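(* Consider the plant, the optimal control problem with $B=B_p$, the feedback $\kappa$, and the singularly perturbed plant–optimizer system $$\dot x_p(t)=f_p(x_p(t))+B_p\Pi_{[\underline u,\overline u]}\bigl(\tfrac1\alpha B_p^\top\lambda_0(t)\bigr),\qquad \varepsilon\dot w(t)=\mathcal S(w(t))-\iota_3x_p(t),\qquad w=(x,(\lambda,\lambda_0)),\qquad (\mathrm{SP}_\varepsilon)$$ on $\mathbb R^n\times\mathcal W$, all as described in the context. Suppose that the stabilizing-controller assumption (SC) of the context holds for some $\delta>0$. Then there is $\varepsilon^\star>0$ such that for all $0<\varepsilon<\varepsilon^\star$ there exists $\delta'>0$ such that for every initial condition $z_0=(x_p^0,w_0)\in\mathbb R^n\times\mathcal W$ with $\|z_0\|_{\mathbb R^n\times\mathcal W}<\delta'$, the system $(\mathrm{SP}_\varepsilon)$ admits a unique bounded mild solution on $[0,\infty)$, and this solution converges to zero in $\mathbb R^n\times\mathcal W$ as $t\to\infty$. Consequently, the origin is locally asymptotically stable for $(\mathrm{SP}_\varepsilon)$. If, in addition, $f_p$ is globally Lipschitz and (SC) holds with $\delta=\infty$ and $r_1\in\mathcal K_\infty$, then the asymptotic stability holds globally, i.e. for all $0<\varepsilon<\varepsilon^\star$ the origin is globally asymptotically stable for $(\mathrm{SP}_\varepsilon)$.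
   Context: Spaces. Fix $t_f>0$, $n,m\in\mathbb N$. Let $\mathcal X=L^2([0,t_f];\mathbb R^n)$, $\mathcal Y=H^1([0,t_f];\mathbb R^n)$, $\mathcal U=L^2([0,t_f];\mathbb R^m)$, $\mathcal Z=\mathcal X\times\mathbb R^n$, $\mathcal W=\mathcal X\times\mathcal Z$, with the product Hilbert space structures (all spaces real). Plant. $\dot x_p=f_p(x_p)+B_pu_p$ with $f_p(x_p)=J_p(\nabla H_p(x_p))-R_p(\nabla H_p(x_p))$, $B_p\in\mathbb R^{n\times m}$, where $H_p:\mathbb R^n\to\mathbb R$ is differentiable and strongly convex, $J_p:\mathbb R^n\to\mathbb R^n$ satisfies $\langle J_p(z),z\rangle=0$ for all $z$, $R_p:\mathbb R^n\to\mathbb R^n$ is continuous with $\langle R_p(z),z\rangle\ge0$ for all $z$. The maps $J_p,R_p,\nabla H_p$ and the feedback $\kappa$ below are locally Lipschitz. The input is box-constrained, $u_p(t)\in[\underline u,\overline u]$. Optimal control problem. Let $A\in\mathbb R^{n\times n}$, $B=B_p$, $\alpha>0$, $\underline u,\overline u\in\mathbb R^m$ with $\underline u_i<0<\overline u_i$ for all $i$, and $F=\{u\in\mathcal U:\underline u_i\le u_i(t)\le\overline u_i\ \forall i,\text{ a.e. }t\in[0,t_f]\}$. Let $\ell:\mathbb R^n\to[0,\infty)$ be continuous and convex with $\ell(0)=0$, and let $J:\mathcal X\to\mathbb R$, $J(x)=\int_0^{t_f}\ell(x(\tau))\,d\tau$, be Fréchet differentiable with gradient $\nabla J(x)\in\mathcal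 X$ satisfying, for some $\mu,L>0$, $\mu\|x-y\|_{\mathcal X}^2\le\langle\nabla J(x)-\nabla J(y),x-y\rangle_{\mathcal X}\le L\|x-y\|_{\mathcal X}^2$ for all $x,y\in\mathcal X$. For $x_0\in\mathbb R^n$ the problem is to minimize $J(x)+\frac\alpha2\|u\|_{\mathcal U}^2$ over $(x,u)\in\mathcal Y\times\mathcal U$ subject to $\dot x=Ax+Bu$, $x(0)=x_0$, $u\in F$. It has a unique solution $(x^\star,u^\star)$, depending on $x_0$. Operators. $\mathcal A:\mathcal X\supset D(\mathcal A)=\mathcal Y\to\mathcal Z$, $\mathcal Ax=(\frac{d}{d\tau}x-Ax,\ x(0))$. Its Hilbert space adjoint has domain $D(\mathcal A^* )=\{(\lambda,\lambda_0)\in\mathcal Y\times\mathbb R^n:\lambda(0)=\lambda_0,\ \lambda(t_f)=0\}$ and $\mathcal A^*(\lambda,\lambda_0)=-\frac{d}{d\tau}\lambda-A^\top\lambda$. $\mathcal B:\mathcal U\to\mathcal Z$, $\mathcal Bu=(Bu,0)$, with $\mathcal B^*(\lambda,\lambda_0)=B^\top\lambda$. $P_F:\mathcal U\to F$ is the orthogonal projection onto $F$ and $\Pi_{[\underline u,\overline u]}:\mathbb R^m\to\mathbb R^m$ the Euclidean projection onto the box $\prod_i[\underline u_i,\overline u_i]$. For $(x,p)\in D(\mathcal A)\times D(\mathcal A^* )$, $$\mathcal S(x,p)=\mathcal J(x,p)-\mathcal R(x,p),\quad \mathcal J(x,p)=(-\mathcal A^*p,\ \mathcal Ax),\quad \mathcal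 R(x,p)=\bigl(\nabla J(x),\ \mathcal BP_F(\tfrac1\alpha\mathcal B^*p)\bigr);$$ $\mathcal J$ (domain $D(\mathcal A)\times D(\mathcal A^* )$) is skew-adjoint on $\mathcal W$ and $\mathcal R$ is defined on all of $\mathcal W$. The embedding $\iota_3:\mathbb R^n\to\mathcal W$ is $\iota_3x_p=(0,(0,x_p))$. Feedback. $\kappa:\mathbb R^n\to\mathbb R^m$, $\kappa(x_0)=u^\star(x_0)(0)$, the value at time $0$ of (the continuous representative of) the optimal control for initial value $x_0$. Equivalently, $\kappa(x_0)=\Pi_{[\underline u,\overline u]}(\frac1\alpha B_p^\top\lambda_0^\star(x_0))$, where $(x^\star,(\lambda^\star,\lambda_0^\star))$ is the unique solution of $\mathcal S(x^\star,(\lambda^\star,\lambda_0^\star))=\iota_3x_0$. Class $\mathcal K$. A continuous $r:[0,a)\to[0,\infty)$ is of class $\mathcal K$ if it is strictly increasing with $r(0)=0$; it is of class $\mathcal K_\infty$ if moreover $a=\infty$ and $r(s)\to\infty$ as $s\to\infty$. Assumption (SC) with $\delta\in(0,\infty]$. Let $\mathcal B_\delta=\{x_p\in\mathbb R^n:\|x_p\|<\delta\}$ (so $\mathcal B_\infty=\mathbb R^n$). The origin of the closed-loop system $\dot x_p=f_p(x_p)+B_p\kappa(x_p)$ is an asymptotically stable equilibrium with $\mathcal B_\delta$ contained in its region of attraction; precisely, there are a continuously differentiable $\vartheta:\mathcal B_\delta\to[0,\infty)$ with $\vartheta(0)=0$, class-$\mathcal K$ functions $r_1,r_p$ defined on $[0,\delta)$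 with $r_p(s)\ge\underline c\,s^2$ on $[0,\delta)$ for some $\underline c>0$, and $\zeta_1>0$ such that, with $\psi_p(x_p)=r_p(\|x_p\|)$, for all $x_p\in\mathcal B_\delta$: (i) $\vartheta(x_p)\ge r_1(\|x_p\|)$; (ii) $\nabla\vartheta(x_p)^\top(f_p(x_p)+B_p\kappa(x_p))\le-\psi_p(x_p)$; (iii) $\|B_p^\top\nabla\vartheta(x_p)\|^2\le\zeta_1\psi_p(x_p)$. Mild solutions of $(\mathrm{SP}_\varepsilon)$ are continuous functions $z=(x_p,w)$ with values in $\mathbb R^n\times\mathcal W$ satisfying the variation-of-constants formula for the semilinear equation $\dot z=\mathfrak A_\varepsilon z+f_\varepsilon(z)$, with $\mathfrak A_\varepsilon=\operatorname{diag}(0,\frac1\varepsilon\mathcal J)$ (generator of a $C_0$-semigroup) and $f_\varepsilon(x_p,w)=\bigl(f_p(x_p)+B_p\Pi_{[\underline u,\overline u]}(\frac1\alpha B_p^\top\lambda_0),\ -\frac1\varepsilon(\mathcal R(w)+\iota_3x_p)\bigr)$. Local asymptotic stability of the origin means Lyapunov stability together with convergence to $0$ of all mild solutions starting sufficiently close to $0$; global asymptotic stability means Lyapunov stability together with existence on $[0,\infty)$ and convergence to $0$ of the mild solution for every initial value. *)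

theory Defs
  imports "HOL-Analysis.Analysis"
begin

section \<open>Square-integrable functions\<close>

definition square_integrable :: "(real \<Rightarrow> 'a::euclidean_space) \<Rightarrow> bool" where
  "square_integrable f \<longleftrightarrow>
     f \<in> borel_measurable lborel \<and> integrable lborel (\<lambda>t. (norm (f t))\<^sup>2)"

lemma square_integrable_inner:
  assumes "square_integrable f" "square_integrable g"
  shows "integrable lborel (\<lambda>t. f t \<bullet> g t)"
proof (rule Bochner_Integration.integrable_bound)
  show "integrable lborel (\<lambda>t. (norm (f t))\<^sup>2 + (norm (g t))\<^sup>2)"
    using assms by (auto simp: square_integrable_def)
  have [measurable]: "f \<in> borel_measurable lborel" "g \<in> borel_measurable lborel"
    using assms by (auto simp: square_integrable_def)
  show "(\<lambda>t. f t \<bullet> g t) \<in> borel_measurable lborel"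
    by measurable
  have "\<bar>f t \<bullet> g t\<bar> \<le> (norm (f t))\<^sup>2 + (norm (g t))\<^sup>2" for t
  proof -
    have "\<bar>f t \<bullet> g t\<bar> \<le> norm (f t) * norm (g t)"
      by (rule Cauchy_Schwarz_ineq2)
    also have "\<dots> \<le> (norm (f t))\<^sup>2 + (norm (g t))\<^sup>2"
    proof -
      have "2 * (norm (f t) * norm (g t)) \<le> (norm (f t))\<^sup>2 + (norm (g t))\<^sup>2"
        using zero_le_power2[of "norm (f t) - norm (g t)"] by (simp add: power2_diff)
      moreover have "0 \<le> norm (f t) * norm (g t)" by simp
      ultimately show ?thesis by linarith
    qed
    finally show ?thesis .
  qed
  then show "AE t in lborel. norm (f t \<bullet> g t) \<le> norm ((norm (f t))\<^sup>2 + (norm (g t))\<^sup>2)"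
    by simp
qed

lemma square_integrable_add:
  assumes "square_integrable f" "square_integrable g"
  shows "square_integrable (\<lambda>t. f t + g t)"
proof -
  have "integrable lborel (\<lambda>t. (norm (f t))\<^sup>2 + (norm (g t))\<^sup>2 + 2 * (f t \<bullet> g t))"
    using assms square_integrable_inner[OF assms] by (auto simp: square_integrable_def)
  moreover have "(norm (f t + g t))\<^sup>2 = (norm (f t))\<^sup>2 + (norm (g t))\<^sup>2 + 2 * (f t \<bullet> g t)" for t
    by (simp add: power2_norm_eq_inner inner_add inner_commute)
  ultimately show ?thesis
    using assms by (auto simp: square_integrable_def)
qed

lemma square_integrable_linear:
  assumes "bounded_linear L" "square_integrable f"
  shows "square_integrable (\<lambda>t. L (f t))"
proof -
  obtain K where K: "\<And>x. norm (L x) \<le> norm x * K"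
    using bounded_linear.bounded[OF assms(1)] by blast
  have [measurable]: "f \<in> borel_measurable lborel"
    using assms by (auto simp: square_integrable_def)
  have L [measurable]: "L \<in> borel_measurable borel"
    by (intro borel_measurable_continuous_onI linear_continuous_on assms)
  have "integrable lborel (\<lambda>t. (norm (L (f t)))\<^sup>2)"
  proof (rule Bochner_Integration.integrable_bound)
    show "integrable lborel (\<lambda>t. K\<^sup>2 * (norm (f t))\<^sup>2)"
      using assms by (auto simp: square_integrable_def)
    have "(norm (L x))\<^sup>2 \<le> K\<^sup>2 * (norm x)\<^sup>2" for x
      using power_mono[OF K, of x 2] by (simp add: power_mult_distrib mult.commute)
    then show "AE t in lborel. norm ((norm (L (f t)))\<^sup>2) \<le> norm (K\<^sup>2 * (norm (f t))\<^sup>2)"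
      by simp
  qed measurable
  then show ?thesis
    by (simp add: square_integrable_def)
qed

lemma square_integrable_scaleR:
  "square_integrable f \<Longrightarrow> square_integrable (\<lambda>t. c *\<^sub>R f t)"
  by (rule square_integrable_linear[OF bounded_linear_scaleR_right])

lemma square_integrable_uminus:
  "square_integrable f \<Longrightarrow> square_integrable (\<lambda>t. - f t)"
  using square_integrable_scaleR[of f "-1"] by simp

lemma square_integrable_zero: "square_integrable (\<lambda>t. 0)"
  by (simp add: square_integrable_def)

definition L2_rel :: "(real \<Rightarrow> 'a::euclidean_space) \<Rightarrow> (real \<Rightarrow> 'a) \<Rightarrow> bool" where
  "L2_rel f g \<longleftrightarrow>
     square_integrable f \<and> square_integrable g \<and> (AE t in lborel. f t = g t)"

quotient_type (overloaded) 'a L2 = "real \<Rightarrow> 'a::euclidean_space" / partial: L2_rel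
proof (rule part_equivpI)
  show "\<exists>f. L2_rel f (f :: real \<Rightarrow> 'a)"
    by (rule exI[of _ "\<lambda>t. 0"]) (simp add: L2_rel_def square_integrable_zero)
  show "symp (L2_rel :: (real \<Rightarrow> 'a) \<Rightarrow> _)"
    by (rule sympI) (auto simp: L2_rel_def)
  show "transp (L2_rel :: (real \<Rightarrow> 'a) \<Rightarrow> _)"
    by (rule transpI) (auto simp: L2_rel_def)
qed

text \<open>The class itself is not a function; \<open>L2_fun\<close> picks some Borel representative, determined
  only up to null sets.\<close>

definition L2_fun :: "'a::euclidean_space L2 \<Rightarrow> real \<Rightarrow> 'a" where
  "L2_fun = rep_L2"

instantiation L2 :: (euclidean_space) real_vector
begin

lift_definition zero_L2 :: "'a L2" is "\<lambda>t. 0"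
  by (simp add: L2_rel_def square_integrable_zero)

lift_definition plus_L2 :: "'a L2 \<Rightarrow> 'a L2 \<Rightarrow> 'a L2" is "\<lambda>f g t. f t + g t"
  by (auto simp: L2_rel_def square_integrable_add)

lift_definition uminus_L2 :: "'a L2 \<Rightarrow> 'a L2" is "\<lambda>f t. - f t"
  by (auto simp: L2_rel_def square_integrable_uminus)

lift_definition scaleR_L2 :: "real \<Rightarrow> 'a L2 \<Rightarrow> 'a L2" is "\<lambda>c f t. c *\<^sub>R f t"
  by (auto simp: L2_rel_def square_integrable_scaleR)

definition minus_L2 :: "'a L2 \<Rightarrow> 'a L2 \<Rightarrow> 'a L2" where
  "minus_L2 f g = f + - g"

instance
proof
  fix f g h :: "'a L2" and a b :: real
  show "f + g + h = f + (g + h)"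
    by transfer (auto simp: L2_rel_def square_integrable_add add.assoc)
  show "f + g = g + f"
    by transfer (auto simp: L2_rel_def square_integrable_add add.commute)
  show "0 + f = f"
    by transfer (auto simp: L2_rel_def)
  show "- f + f = 0"
    by transfer (auto simp: L2_rel_def square_integrable_zero)
  show "f - g = f + - g"
    by (rule minus_L2_def)
  show "a *\<^sub>R (f + g) = a *\<^sub>R f + a *\<^sub>R g"
    by transfer
      (auto simp: L2_rel_def square_integrable_add square_integrable_scaleR scaleR_add_right)
  show "(a + b) *\<^sub>R f = a *\<^sub>R f + b *\<^sub>R f"
    by transfer
      (auto simp: L2_rel_def square_integrable_add square_integrable_scaleR scaleR_add_left)
  show "a *\<^sub>R b *\<^sub>R f = (a * b) *\<^sub>R f"
    by transfer (auto simp: L2_rel_def square_integrable_scaleR)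
  show "1 *\<^sub>R f = f"
    by transfer (auto simp: L2_rel_def)
qed

end

instantiation L2 :: (euclidean_space) real_inner
begin

lift_definition inner_L2 :: "'a L2 \<Rightarrow> 'a L2 \<Rightarrow> real" is
  "\<lambda>f g. integral\<^sup>L lborel (\<lambda>t. f t \<bullet> g t)"
proof -
  fix f f' g g' :: "real \<Rightarrow> 'a"
  assume "L2_rel f f'" "L2_rel g g'"
  then have [measurable]: "f \<in> borel_measurable lborel" "f' \<in> borel_measurable lborel"
    "g \<in> borel_measurable lborel" "g' \<in> borel_measurable lborel"
    and ae: "AE t in lborel. f t = f' t" "AE t in lborel. g t = g' t"
    by (auto simp: L2_rel_def square_integrable_def)
  from ae have "AE t in lborel. f t \<bullet> g t = f' t \<bullet> g' t" by eventually_elim simp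
  then show "integral\<^sup>L lborel (\<lambda>t. f t \<bullet> g t) = integral\<^sup>L lborel (\<lambda>t. f' t \<bullet> g' t)"
    by (intro integral_cong_AE) measurable
qed

definition norm_L2 :: "'a L2 \<Rightarrow> real" where "norm_L2 f = sqrt (f \<bullet> f)"
definition sgn_L2 :: "'a L2 \<Rightarrow> 'a L2" where "sgn_L2 f = f /\<^sub>R norm f"
definition dist_L2 :: "'a L2 \<Rightarrow> 'a L2 \<Rightarrow> real" where "dist_L2 f g = norm (f - g)"
definition uniformity_L2 :: "('a L2 \<times> 'a L2) filter" where
  "uniformity_L2 = (INF e\<in>{0<..}. principal {(f, g). dist f g < e})"
definition open_L2 :: "'a L2 set \<Rightarrow> bool" where
  "open_L2 S = (\<forall>f\<in>S. \<forall>\<^sub>F (f', g) in uniformity. f' = f \<longrightarrow> g \<in> S)"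

instance
proof
  fix f g h :: "'a L2" and a :: real and S :: "'a L2 set"
  show "f \<bullet> g = g \<bullet> f"
    by transfer (simp add: inner_commute)
  show "(f + g) \<bullet> h = f \<bullet> h + g \<bullet> h"
    by transfer
      (simp add: L2_rel_def inner_add_left Bochner_Integration.integral_add square_integrable_inner)
  show "(a *\<^sub>R f) \<bullet> g = a * (f \<bullet> g)"
    by transfer simp
  show "0 \<le> f \<bullet> f"
    by transfer simp
  show "f \<bullet> f = 0 \<longleftrightarrow> f = 0"
  proof transfer
    fix f :: "real \<Rightarrow> 'a"
    assume "L2_rel f f"
    then have f: "square_integrable f" by (simp add: L2_rel_def)
    have "integral\<^sup>L lborel (\<lambda>t. f t \<bullet> f t) = 0 \<longleftrightarrow> (AE t in lborel. f t \<bullet> f t = 0)"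
      by (rule integral_nonneg_eq_0_iff_AE) (auto simp: square_integrable_inner f)
    then show "integral\<^sup>L lborel (\<lambda>t. f t \<bullet> f t) = 0 \<longleftrightarrow> L2_rel f (\<lambda>t. 0)"
      using f by (simp add: L2_rel_def square_integrable_zero)
  qed
  show "norm f = sqrt (f \<bullet> f)" by (rule norm_L2_def)
  show "sgn f = f /\<^sub>R norm f" by (rule sgn_L2_def)
  show "dist f g = norm (f - g)" by (rule dist_L2_def)
  show "(uniformity :: ('a L2 \<times> 'a L2) filter) = (INF e\<in>{0<..}. principal {(f, g). dist f g < e})"
    by (rule uniformity_L2_def)
  show "open S = (\<forall>f\<in>S. \<forall>\<^sub>F (f', g) in uniformity. f' = f \<longrightarrow> g \<in> S)"
    by (rule open_L2_def)
qed

end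

lift_definition L2_mat :: "real^'n^'k \<Rightarrow> (real^'n) L2 \<Rightarrow> (real^'k) L2" is
  "\<lambda>M f t. M *v f t"
  by (auto simp: L2_rel_def square_integrable_linear matrix_vector_mul_bounded_linear)

text \<open>\<open>L\<^sup>2([0,t\<^sub>f])\<close> is identified, by extension with zero, with a closed subspace of \<open>L\<^sup>2(\<real>)\<close>; this
  keeps the horizon \<open>t\<^sub>f\<close> an ordinary variable.\<close>

definition L2_on :: "real \<Rightarrow> 'a::euclidean_space L2 set" where
  "L2_on tf = {f. AE t in lborel. t \<notin> {0..tf} \<longrightarrow> L2_fun f t = 0}"

definition is_rep_on :: "real \<Rightarrow> 'a::euclidean_space L2 \<Rightarrow> (real \<Rightarrow> 'a) \<Rightarrow> bool" where
  "is_rep_on tf f v \<longleftrightarrow> (AE t in lborel. t \<in> {0..tf} \<longrightarrow> L2_fun f t = v t)"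

text \<open>Value at \<open>t \<in> [0,t\<^sub>f]\<close> of the continuous representative (unique for \<open>t\<^sub>f > 0\<close> if there is one).\<close>

definition L2_at :: "real \<Rightarrow> 'a::euclidean_space L2 \<Rightarrow> real \<Rightarrow> 'a" where
  "L2_at tf f t = (THE y. \<exists>v. continuous_on {0..tf} v \<and> is_rep_on tf f v \<and> y = v t)"

text \<open>\<open>H\<^sup>1([0,t\<^sub>f])\<close>: classes of absolutely continuous functions (indefinite Lebesgue integrals)
  whose derivative \<open>g\<close> lies in \<open>L\<^sup>2([0,t\<^sub>f])\<close>.\<close>

definition has_H1_deriv :: "real \<Rightarrow> 'a::euclidean_space L2 \<Rightarrow> 'a L2 \<Rightarrow> bool" where
  "has_H1_deriv tf f g \<longleftrightarrow> f \<in> L2_on tf \<and> g \<in> L2_on tf \<and>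
     (\<exists>v. is_rep_on tf f v \<and> (\<forall>t\<in>{0..tf}. v t = v 0 + (LINT s:{0..t}|lborel. L2_fun g s)))"

definition H1_on :: "real \<Rightarrow> 'a::euclidean_space L2 set" where
  "H1_on tf = {f. \<exists>g. has_H1_deriv tf f g}"

definition H1_deriv :: "real \<Rightarrow> 'a::euclidean_space L2 \<Rightarrow> 'a L2" where
  "H1_deriv tf f = (THE g. has_H1_deriv tf f g)"


section \<open>Semigroups and mild solutions on a closed subspace\<close>

definition c0_semigroup_on :: "'w::real_normed_vector set \<Rightarrow> (real \<Rightarrow> 'w \<Rightarrow> 'w) \<Rightarrow> bool" where
  "c0_semigroup_on V T \<longleftrightarrow>
     (\<forall>t\<ge>0. (\<forall>x\<in>V. T t x \<in> V) \<and>
        (\<forall>x\<in>V. \<forall>y\<in>V. \<forall>a b. T t (a *\<^sub>R x + b *\<^sub>R y) = a *\<^sub>R T t x + b *\<^sub>R T t y) \<and>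
        (\<exists>K. \<forall>x\<in>V. norm (T t x) \<le> K * norm x)) \<and>
     (\<forall>x\<in>V. T 0 x = x) \<and>
     (\<forall>s\<ge>0. \<forall>t\<ge>0. \<forall>x\<in>V. T (s + t) x = T s (T t x)) \<and>
     (\<forall>x\<in>V. ((\<lambda>t. T t x) \<longlongrightarrow> x) (at_right 0))"

text \<open>Unbounded operators are represented by their graphs.\<close>

definition generator_on :: "'w::real_normed_vector set \<Rightarrow> (real \<Rightarrow> 'w \<Rightarrow> 'w) \<Rightarrow> ('w \<times> 'w) set" where
  "generator_on V T =
     {(x, y). x \<in> V \<and> y \<in> V \<and> ((\<lambda>h. (T h x - x) /\<^sub>R h) \<longlongrightarrow> y) (at_right 0)}"

text \<open>Mild solution of \<open>z' = G z + f z\<close>, \<open>z(0) = z0\<close>, on a time interval \<open>I\<close> with left end point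
  \<open>0 \<in> I\<close>.  The integrand is continuous in all uses, so the Henstock-Kurzweil integral is the
  Riemann (hence Bochner) integral.\<close>

definition mild_solution ::
  "'w::real_normed_vector set \<Rightarrow> ('w \<times> 'w) set \<Rightarrow> ('w \<Rightarrow> 'w) \<Rightarrow> real set \<Rightarrow> 'w \<Rightarrow> (real \<Rightarrow> 'w) \<Rightarrow> bool"
where
  "mild_solution V G f I z0 z \<longleftrightarrow>
     continuous_on I z \<and> (\<forall>t\<in>I. z t \<in> V) \<and>
     (\<exists>T. c0_semigroup_on V T \<and> generator_on V T = G \<and>
        (\<forall>t\<in>I. ((\<lambda>s. T (t - s) (f (z s))) has_integral (z t - T t z0)) {0..t}))"

definition lyapunov_stable ::
  "'w::real_normed_vector set \<Rightarrow> ('w \<times> 'w) set \<Rightarrow> ('w \<Rightarrow> 'w) \<Rightarrow> bool" where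
  "lyapunov_stable V G f \<longleftrightarrow>
     (\<forall>\<eta>>0. \<exists>d>0. \<forall>z0\<in>V. norm z0 < d \<longrightarrow>
        (\<forall>\<tau>>0. \<forall>z. mild_solution V G f {0..<\<tau>} z0 z \<longrightarrow> (\<forall>t\<in>{0..<\<tau>}. norm (z t) < \<eta>)))"

definition locally_asymptotically_stable ::
  "'w::real_normed_vector set \<Rightarrow> ('w \<times> 'w) set \<Rightarrow> ('w \<Rightarrow> 'w) \<Rightarrow> bool" where
  "locally_asymptotically_stable V G f \<longleftrightarrow> lyapunov_stable V G f \<and>
     (\<exists>d>0. \<forall>z0\<in>V. norm z0 < d \<longrightarrow>
        (\<forall>z. mild_solution V G f {0..} z0 z \<longrightarrow> (z \<longlongrightarrow> 0) at_top))"

definition globally_asymptotically_stable ::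
  "'w::real_normed_vector set \<Rightarrow> ('w \<times> 'w) set \<Rightarrow> ('w \<Rightarrow> 'w) \<Rightarrow> bool" where
  "globally_asymptotically_stable V G f \<longleftrightarrow> lyapunov_stable V G f \<and>
     (\<forall>z0\<in>V. (\<exists>z. mild_solution V G f {0..} z0 z) \<and>
        (\<forall>z. mild_solution V G f {0..} z0 z \<longrightarrow> (z \<longlongrightarrow> 0) at_top))"


section \<open>Plant, comparison functions and the stabilizing-controller assumption\<close>

definition locally_lipschitz :: "('a::metric_space \<Rightarrow> 'b::metric_space) \<Rightarrow> bool" where
  "locally_lipschitz f \<longleftrightarrow> (\<forall>x. \<exists>r>0. \<exists>K. K-lipschitz_on (cball x r) f)"

definition strongly_convex :: "('a::real_normed_vector \<Rightarrow> real) \<Rightarrow> bool" where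
  "strongly_convex H \<longleftrightarrow>
     (\<exists>m>0. \<forall>x y. \<forall>s\<in>{0..1}. H (s *\<^sub>R x + (1 - s) *\<^sub>R y) \<le>
        s * H x + (1 - s) * H y - m / 2 * s * (1 - s) * (norm (x - y))\<^sup>2)"

text \<open>Class K functions on \<open>[0,a)\<close>; nonnegativity follows from monotonicity and \<open>r 0 = 0\<close>.\<close>

definition class_K :: "ereal \<Rightarrow> (real \<Rightarrow> real) \<Rightarrow> bool" where
  "class_K a r \<longleftrightarrow>
     continuous_on {s. 0 \<le> s \<and> ereal s < a} r \<and>
     strict_mono_on {s. 0 \<le> s \<and> ereal s < a} r \<and> r 0 = 0"

definition class_K_inf :: "(real \<Rightarrow> real) \<Rightarrow> bool" where
  "class_K_inf r \<longleftrightarrow> class_K \<infinity> r \<and> filterlim r at_top at_top"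

definition eball0 :: "ereal \<Rightarrow> 'a::real_normed_vector set" where
  "eball0 \<delta> = {x. ereal (norm x) < \<delta>}"

text \<open>The assumption (SC), with the class K lower bound \<open>r1\<close> of the Lyapunov function exposed.\<close>

definition stabilizing_controller ::
  "(real^'n \<Rightarrow> real^'n) \<Rightarrow> real^'m^'n \<Rightarrow> (real^'n \<Rightarrow> real^'m) \<Rightarrow> ereal \<Rightarrow> (real \<Rightarrow> real) \<Rightarrow> bool"
where
  "stabilizing_controller fp Bp \<kappa> \<delta> r1 \<longleftrightarrow> class_K \<delta> r1 \<and>
     (\<exists>(V :: real^'n \<Rightarrow> real) gradV rp c \<zeta>1.
        class_K \<delta> rp \<and> c > 0 \<and> (\<forall>s\<ge>0. ereal s < \<delta> \<longrightarrow> rp s \<ge> c * s\<^sup>2) \<and> \<zeta>1 > 0 \<and>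
        V 0 = 0 \<and> (\<forall>x\<in>eball0 \<delta>. V x \<ge> 0) \<and>
        (\<forall>x\<in>eball0 \<delta>. GDERIV V x :> gradV x) \<and> continuous_on (eball0 \<delta>) gradV \<and>
        (\<forall>x\<in>eball0 \<delta>.
           V x \<ge> r1 (norm x) \<and>
           gradV x \<bullet> (fp x + Bp *v \<kappa> x) \<le> - rp (norm x) \<and>
           (norm (transpose Bp *v gradV x))\<^sup>2 \<le> \<zeta>1 * rp (norm x)))"


section \<open>Optimal control problem and feedback\<close>

definition running_cost :: "real \<Rightarrow> (real^'n \<Rightarrow> real) \<Rightarrow> (real^'n) L2 \<Rightarrow> real" where
  "running_cost tf l x = (LINT t:{0..tf}|lborel. l (L2_fun x t))"

definition admissible_controls :: "real \<Rightarrow> real^'m \<Rightarrow> real^'m \<Rightarrow> (real^'m) L2 set" where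
  "admissible_controls tf lo hi =
     {u \<in> L2_on tf. AE t in lborel. t \<in> {0..tf} \<longrightarrow> (\<forall>i. lo $ i \<le> L2_fun u t $ i \<and> L2_fun u t $ i \<le> hi $ i)}"

definition ocp_feasible ::
  "real \<Rightarrow> real^'n^'n \<Rightarrow> real^'m^'n \<Rightarrow> real^'m \<Rightarrow> real^'m \<Rightarrow> real^'n \<Rightarrow>
   ((real^'n) L2 \<times> (real^'m) L2) set" where
  "ocp_feasible tf A B lo hi x0 =
     {(x, u). x \<in> H1_on tf \<and> u \<in> admissible_controls tf lo hi \<and>
        H1_deriv tf x = L2_mat A x + L2_mat B u \<and> L2_at tf x 0 = x0}"

definition ocp_cost ::
  "real \<Rightarrow> (real^'n \<Rightarrow> real) \<Rightarrow> real \<Rightarrow> (real^'n) L2 \<times> (real^'m) L2 \<Rightarrow> real" where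
  "ocp_cost tf l \<alpha> = (\<lambda>(x, u). running_cost tf l x + \<alpha> / 2 * (norm u)\<^sup>2)"

definition ocp_solution ::
  "real \<Rightarrow> real^'n^'n \<Rightarrow> real^'m^'n \<Rightarrow> (real^'n \<Rightarrow> real) \<Rightarrow> real \<Rightarrow> real^'m \<Rightarrow> real^'m \<Rightarrow> real^'n \<Rightarrow>
   (real^'n) L2 \<times> (real^'m) L2" where
  "ocp_solution tf A B l \<alpha> lo hi x0 =
     (THE s. is_arg_min (ocp_cost tf l \<alpha>) (\<lambda>s. s \<in> ocp_feasible tf A B lo hi x0) s)"

definition ocp_feedback ::
  "real \<Rightarrow> real^'n^'n \<Rightarrow> real^'m^'n \<Rightarrow> (real^'n \<Rightarrow> real) \<Rightarrow> real \<Rightarrow> real^'m \<Rightarrow> real^'m \<Rightarrow> real^'n \<Rightarrow>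
   real^'m" where
  "ocp_feedback tf A B l \<alpha> lo hi x0 = L2_at tf (snd (ocp_solution tf A B l \<alpha> lo hi x0)) 0"


section \<open>Optimizer dynamics and the singularly perturbed system\<close>

type_synonym 'n adjoint_space = "(real^'n) L2 \<times> (real^'n)"
type_synonym 'n optimizer_space = "(real^'n) L2 \<times> 'n adjoint_space"
type_synonym 'n sp_space = "(real^'n) \<times> 'n optimizer_space"

text \<open>The carrier of \<open>\<real>\<^sup>n \<times> \<W>\<close>; the ambient product types carry the product Hilbert norm.\<close>

definition sp_carrier :: "real \<Rightarrow> 'n::finite sp_space set" where
  "sp_carrier tf = UNIV \<times> (L2_on tf \<times> (L2_on tf \<times> UNIV))"

definition opA :: "real \<Rightarrow> real^'n^'n \<Rightarrow> (real^'n) L2 \<Rightarrow> 'n::finite adjoint_space" where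
  "opA tf A x = (H1_deriv tf x - L2_mat A x, L2_at tf x 0)"

text \<open>Explicit form of the Hilbert space adjoint of \<open>opA\<close> (with domain \<open>H\<^sup>1\<close>), obtained by
  integration by parts.\<close>

definition dom_opA_adj :: "real \<Rightarrow> 'n::finite adjoint_space set" where
  "dom_opA_adj tf = {(lam, lam0). lam \<in> H1_on tf \<and> L2_at tf lam 0 = lam0 \<and> L2_at tf lam tf = 0}"

definition opA_adj :: "real \<Rightarrow> real^'n^'n \<Rightarrow> 'n::finite adjoint_space \<Rightarrow> (real^'n) L2" where
  "opA_adj tf A = (\<lambda>(lam, lam0). - H1_deriv tf lam - L2_mat (transpose A) lam)"

definition opB :: "real^'m^'n \<Rightarrow> (real^'m) L2 \<Rightarrow> 'n::finite adjoint_space" where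
  "opB B u = (L2_mat B u, 0)"

definition opB_adj :: "real^'m^'n \<Rightarrow> 'n::finite adjoint_space \<Rightarrow> (real^'m) L2" where
  "opB_adj B = (\<lambda>(lam, lam0). L2_mat (transpose B) lam)"

definition orth_proj :: "'a::real_inner set \<Rightarrow> 'a \<Rightarrow> 'a" where
  "orth_proj S a = (THE x. x \<in> S \<and> (\<forall>y\<in>S. dist a x \<le> dist a y))"

definition dom_opJ :: "real \<Rightarrow> 'n::finite optimizer_space set" where
  "dom_opJ tf = H1_on tf \<times> dom_opA_adj tf"

definition opJ :: "real \<Rightarrow> real^'n^'n \<Rightarrow> 'n::finite optimizer_space \<Rightarrow> 'n optimizer_space" where
  "opJ tf A = (\<lambda>(x, p). (- opA_adj tf A p, opA tf A x))"

definition opR ::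
  "real \<Rightarrow> real^'m^'n \<Rightarrow> real \<Rightarrow> real^'m \<Rightarrow> real^'m \<Rightarrow> ((real^'n) L2 \<Rightarrow> (real^'n) L2) \<Rightarrow>
   'n::finite optimizer_space \<Rightarrow> 'n optimizer_space" where
  "opR tf B \<alpha> lo hi gradJ =
     (\<lambda>(x, p). (gradJ x, opB B (orth_proj (admissible_controls tf lo hi) ((1 / \<alpha>) *\<^sub>R opB_adj B p))))"

definition iota3 :: "real^'n \<Rightarrow> 'n::finite optimizer_space" where
  "iota3 xp = (0, (0, xp))"

text \<open>\<open>\<epsilon> w' = \<S> w - \<iota>\<^sub>3 x\<^sub>p\<close> with \<open>\<S> = \<J> - \<R>\<close> is treated as a semilinear equation: the unbounded
  linear part \<open>\<J> / \<epsilon>\<close> goes into the generator, \<open>- (\<R> w + \<iota>\<^sub>3 x\<^sub>p) / \<epsilon>\<close> into the nonlinearity.\<close>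

definition sp_generator :: "real \<Rightarrow> real^'n^'n \<Rightarrow> real \<Rightarrow> ('n::finite sp_space \<times> 'n sp_space) set" where
  "sp_generator tf A \<epsilon> = {((xp, w), (0, (1 / \<epsilon>) *\<^sub>R opJ tf A w)) | xp w. w \<in> dom_opJ tf}"

definition sp_nonlinearity ::
  "real \<Rightarrow> (real^'n \<Rightarrow> real^'n) \<Rightarrow> real^'m^'n \<Rightarrow> real \<Rightarrow> real^'m \<Rightarrow> real^'m \<Rightarrow>
   ((real^'n) L2 \<Rightarrow> (real^'n) L2) \<Rightarrow> real \<Rightarrow> 'n::finite sp_space \<Rightarrow> 'n sp_space" where
  "sp_nonlinearity tf fp Bp \<alpha> lo hi gradJ \<epsilon> =
     (\<lambda>(xp, (x, (lam, lam0))).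
        (fp xp + Bp *v closest_point (cbox lo hi) ((1 / \<alpha>) *\<^sub>R (transpose Bp *v lam0)),
         - (1 / \<epsilon>) *\<^sub>R (opR tf Bp \<alpha> lo hi gradJ (x, (lam, lam0)) + iota3 xp)))"

end

theory Submission
  imports Defs
begin

text \<open>Write \<open>w\<^sup>*(x\<^sub>p)\<close> for the stationary point of the optimizer at the plant state \<open>x\<^sub>p\<close> and \<open>e = w - w\<^sup>*(x\<^sub>p)\<close>.
  The operator \<open>\<R>\<close> is only cocoercive in the costate, but with \<open>b(e, e) = \<parallel>e\<parallel>\<^sup>2 / 2 + \<eta> \<langle>e\<^sub>x, K e\<^sub>p\<rangle>\<close>, where \<open>K = \<A>\<inverse>\<close>
  and \<open>\<eta>\<close> is small, the fast dynamics decrease \<open>b\<close> at the rate \<open>c\<^sub>0 \<parallel>e\<parallel>\<^sup>2 / \<epsilon>\<close>; in particular \<open>w\<^sup>*\<close> is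
  Lipschitz.  Hence \<open>W = \<vartheta>(x\<^sub>p) + b(e, e)\<close> has upper right derivative at most
  \<open>- c \<parallel>x\<^sub>p\<parallel>\<^sup>2 / 2 - \<parallel>e\<parallel>\<^sup>2\<close> along mild solutions for small \<open>\<epsilon>\<close>, since the cross terms are bounded by
  (SC) (iii) and by the Lipschitz constants.  Trapping in sublevel sets of \<open>W\<close> gives stability, the
  integrated dissipation gives convergence.  Solutions need not be differentiable: \<open>W\<close> is
  differentiated from the right, using \<open>(z(t + h) - S(h) z(t)) / h \<rightarrow> f(z(t))\<close> for the semigroup \<open>S\<close> and that the
  quadratic form \<open>b\<close> is differentiable along \<open>S\<close> for every initial value because \<open>2 b(\<J> w, w)\<close> extends
  to the bounded form \<open>\<eta> (\<parallel>x\<parallel>\<^sup>2 - \<parallel>p\<parallel>\<^sup>2)\<close>.\<close>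

section \<open>Dini derivatives, Gronwall's inequality and Volterra equations\<close>

text \<open>\<open>mild_solution\<close> leaves the semigroup existentially quantified, so a
  concrete semigroup has to be built and every other one with the same generator shown to agree with
  it. The construction uses only the bounded skew inverse \<open>M\<close> of the generator:
  \<open>M u - h u = v\<close> is solvable for \<open>h > 0\<close>, which gives contractive
  implicit Euler steps, and dyadic step sizes make their iterates converge on the dense range of
  \<open>M\<close> composed with itself. Absorbing this motion requires a closed-loop field bounded
  linearly in the plant state, hence zero at the origin; \<open>stabilizing_controller\<close>
  consists of inequalities, and the equilibrium is derived from them. Since \<open>fp\<close> is
  only locally Lipschitz, local existence is proved for a truncated field, and trapped solutions
  never reach the truncation.\<close>

lemma right_dini_le:
  fixes f :: "real \<Rightarrow> real"
  assumes ab: "a \<le> b" and cont: "continuous_on {a..b} f"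
    and dini: "\<And>t e. t \<in> {a..<b} \<Longrightarrow> e > 0 \<Longrightarrow> \<forall>\<^sub>F h in at_right 0. f (t + h) \<le> f t + e * h"
  shows "f b \<le> f a"
proof (rule field_le_epsilon)
  fix e' :: real assume "e' > 0"
  define e where "e = e' / (b - a + 1)"
  have e: "e > 0" using \<open>e' > 0\<close> ab by (simp add: e_def)
  \<comment> \<open>Continuous induction: the supremum of the times up to which the bound with slope
    \<open>e\<close> holds belongs to the set by left continuity of \<open>f\<close>, and the Dini
    hypothesis pushes beyond any point of the set below \<open>b\<close>.\<close>
  define S where "S = {t \<in> {a..b}. \<forall>s\<in>{a..t}. f s \<le> f a + e * (s - a)}"
  have aS: "a \<in> S" using ab by (auto simp: S_def)
  have bdd: "bdd_above S" by (rule bdd_aboveI[of _ b]) (auto simp: S_def)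
  define c where "c = Sup S"
  have ac: "a \<le> c" using aS bdd by (auto simp: c_def intro: cSup_upper)
  have cb: "c \<le> b" unfolding c_def using aS by (intro cSup_least) (auto simp: S_def)
  have below: "f s \<le> f a + e * (s - a)" if "s \<in> {a..<c}" for s
  proof -
    from that obtain t where "t \<in> S" "s < t"
      unfolding c_def using aS bdd less_cSup_iff[of S s] by auto
    then show ?thesis using that by (auto simp: S_def)
  qed
  have at_c: "f c \<le> f a + e * (c - a)"
  proof (cases "c = a")
    case False
    then have "a < c" using ac by simp
    let ?g = "\<lambda>s. f a + e * (s - a) - f s"
    have "continuous_on {a..c} ?g"
      using cb by (intro continuous_intros continuous_on_subset[OF cont]) auto
    then have "(?g \<longlongrightarrow> ?g c) (at_left c)"
      using \<open>a < c\<close> by (rule continuous_on_Icc_at_leftD)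
    moreover have "\<forall>\<^sub>F s in at_left c. 0 \<le> ?g s"
      using eventually_at_left_real[OF \<open>a < c\<close>]
      by eventually_elim (use below in auto)
    ultimately have "0 \<le> ?g c"
      by (rule tendsto_lowerbound) simp
    then show ?thesis by simp
  qed simp
  have cS: "c \<in> S"
  proof -
    have "f s \<le> f a + e * (s - a)" if "s \<in> {a..c}" for s
      using that below[of s] at_c by (cases "s = c") auto
    then show ?thesis using ac cb by (simp add: S_def)
  qed
  have "c = b"
  proof (rule ccontr)
    assume "c \<noteq> b"
    then have cb': "c < b" using cb by simp
    then have "\<forall>\<^sub>F h in at_right 0. f (c + h) \<le> f c + e * h"
      using ac e by (intro dini) auto
    then obtain d where d: "d > 0" "\<And>h. 0 < h \<Longrightarrow> h < d \<Longrightarrow> f (c + h) \<le> f c + e * h"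
      unfolding eventually_at_right_field by auto
    define t where "t = min b (c + d / 2)"
    have "t \<in> S"
      unfolding S_def
    proof (intro CollectI conjI ballI)
      show "t \<in> {a..b}" using ac cb' d by (auto simp: t_def)
      fix s assume s: "s \<in> {a..t}"
      show "f s \<le> f a + e * (s - a)"
      proof (cases "s \<le> c")
        case True then show ?thesis using below at_c s by (cases "s = c") auto
      next
        case False
        then have "f (c + (s - c)) \<le> f c + e * (s - c)"
          using s d(1) by (intro d(2)) (auto simp: t_def)
        then show ?thesis using at_c by (simp add: algebra_simps)
      qed
    qed
    then have "t \<le> c" unfolding c_def using bdd by (rule cSup_upper)
    then show False using d(1) cb' by (auto simp: t_def min_def split: if_splits)
  qed
  then have "f b \<le> f a + e * (b - a)" using at_c by simp
  also have "e * (b - a) \<le> e'"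
    using ab \<open>e' > 0\<close> by (simp add: e_def field_simps)
  finally show "f b \<le> f a + e'" by simp
qed

text \<open>The primitive of the continuous \<open>g\<close> has right derivative
  \<open>g t\<close>, so subtracting it reduces the claim to rate zero. The slack \<open>e\<close>
  is shared equally between \<open>f\<close> and the primitive.\<close>

lemma right_dini_le_integral:
  fixes f g :: "real \<Rightarrow> real"
  assumes ab: "a \<le> b" and cont: "continuous_on {a..b} f" and g: "continuous_on {a..b} g"
    and dini: "\<And>t e. t \<in> {a..<b} \<Longrightarrow> e > 0 \<Longrightarrow>
        \<forall>\<^sub>F h in at_right 0. f (t + h) \<le> f t + (g t + e) * h"
  shows "f b \<le> f a + integral {a..b} g"
proof -
  let ?G = "\<lambda>t. integral {a..t} g"
  have gi: "g integrable_on {a..b}" using g by (rule integrable_continuous_interval)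
  have "f b - ?G b \<le> f a - ?G a"
  proof (rule right_dini_le[OF ab])
    show "continuous_on {a..b} (\<lambda>t. f t - ?G t)"
      by (intro continuous_intros cont indefinite_integral_continuous_1 gi)
    fix t e :: real assume t: "t \<in> {a..<b}" and e: "e > 0"
    have "(?G has_vector_derivative g t) (at t within {a..b})"
      using t by (intro integral_has_vector_derivative g) auto
    then have "(?G has_real_derivative g t) (at t within {t..b})"
      unfolding has_real_derivative_iff_has_vector_derivative
      by (rule has_vector_derivative_within_subset) (use t in auto)
    then have "((\<lambda>s. (?G s - ?G t) / (s - t)) \<longlongrightarrow> g t) (at_right t)"
      using t by (simp add: has_field_derivative_iff at_within_Icc_at_right)
    then have "\<forall>\<^sub>F s in at_right t. g t - e / 2 < (?G s - ?G t) / (s - t)"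
      using e by (intro order_tendstoD) auto
    then have "\<forall>\<^sub>F h in at_right 0. g t - e / 2 < (?G (t + h) - ?G t) / h"
      by (simp add: eventually_at_right_to_0[of _ t] add.commute)
    moreover have "\<forall>\<^sub>F h in at_right 0. f (t + h) \<le> f t + (g t + e / 2) * h"
      using t e by (intro dini) auto
    moreover have "\<forall>\<^sub>F h :: real in at_right 0. h > 0"
      by (simp add: eventually_at_right_less)
    ultimately show "\<forall>\<^sub>F h in at_right 0. f (t + h) - ?G (t + h) \<le> f t - ?G t + e * h"
      by eventually_elim (simp add: field_simps)
  qed
  then show ?thesis by simp
qed

lemma gronwall_integral:
  fixes \<phi> :: "real \<Rightarrow> real"
  assumes cont: "continuous_on {0..b} \<phi>" and C: "C \<ge> 0" and t: "t \<in> {0..b}"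
    and le: "\<And>t. t \<in> {0..b} \<Longrightarrow> \<phi> t \<le> a + C * integral {0..t} \<phi>"
  shows "\<phi> t \<le> a * exp (C * t)"
proof -
  define I where "I = (\<lambda>t. a + C * integral {0..t} \<phi>)"
  have pi: "\<phi> integrable_on {0..b}" using cont by (rule integrable_continuous_interval)
  have dI: "(I has_real_derivative C * \<phi> s) (at s)" if "s \<in> {0<..<b}" for s
  proof -
    have "((\<lambda>t. integral {0..t} \<phi>) has_vector_derivative \<phi> s) (at s within {0..b})"
      using that by (intro integral_has_vector_derivative cont) auto
    then have "((\<lambda>t. integral {0..t} \<phi>) has_real_derivative \<phi> s) (at s)"
      using that at_within_interior[of s "{0..b}"]
      by (simp add: has_real_derivative_iff_has_vector_derivative)
    then show ?thesis unfolding I_def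
      by (auto intro!: derivative_eq_intros)
  qed
  \<comment> \<open>The right-hand side \<open>I\<close> of the hypothesis satisfies
    \<open>I' = C \<phi> \<le> C I\<close>, so the integrating factor makes it decrease.\<close>
  have "exp (- C * t) * I t \<le> exp (- C * 0) * I 0"
  proof (cases "t = 0")
    case False
    then have "0 < t" using t by simp
    show ?thesis
    proof (rule DERIV_nonpos_imp_decreasing_open[OF less_imp_le[OF \<open>0 < t\<close>]])
      fix s assume s: "0 < s" "s < t"
      have "((\<lambda>t. exp (- C * t) * I t) has_real_derivative
          (exp (- C * s) * (C * \<phi> s) + (- C * exp (- C * s)) * I s)) (at s)"
        using s t by (auto intro!: derivative_eq_intros dI)
      moreover have "exp (- C * s) * (C * \<phi> s) + (- C * exp (- C * s)) * I s
          = C * exp (- C * s) * (\<phi> s - I s)"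
        by (simp add: algebra_simps)
      moreover have "\<phi> s - I s \<le> 0" using le[of s] s t by (simp add: I_def)
      ultimately show "\<exists>y. ((\<lambda>t. exp (- C * t) * I t) has_real_derivative y) (at s) \<and> y \<le> 0"
        using C by (metis mult_nonneg_nonpos exp_ge_zero mult_nonneg_nonneg)
    next
      have "continuous_on {0..b} (\<lambda>t. exp (- C * t) * I t)"
        unfolding I_def by (intro continuous_intros indefinite_integral_continuous_1 pi)
      then show "continuous_on {0..t} (\<lambda>t. exp (- C * t) * I t)"
        by (rule continuous_on_subset) (use t in auto)
    qed
  qed simp
  then have "exp (- C * t) * I t \<le> a" by (simp add: I_def)
  then have "exp (C * t) * (exp (- C * t) * I t) \<le> exp (C * t) * a"
    by (rule mult_left_mono) simp
  then have "I t \<le> exp (C * t) * a"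
    by (simp add: mult.assoc[symmetric] exp_add[symmetric])
  then show ?thesis using le[OF t] by (simp add: I_def mult.commute)
qed

text \<open>One Picard step turns the bound with index \<open>n\<close> into the bound with index
  \<open>Suc n\<close>.\<close>

lemma integral_power_fact:
  fixes C :: real
  assumes "t \<ge> 0"
  shows "integral {0..t} (\<lambda>s. m * ((C * s) ^ n / fact n)) * C = m * ((C * t) ^ Suc n / fact (Suc n))"
proof -
  have "((\<lambda>s. m * ((C * s) ^ n / fact n) * C) has_integral
      (m * ((C * t) ^ Suc n / fact (Suc n)) - m * ((C * 0) ^ Suc n / fact (Suc n)))) {0..t}"
    using assms
  proof (rule fundamental_theorem_of_calculus)
    fix s
    have "((\<lambda>s. (C * s) ^ Suc n) has_real_derivative real (Suc n) * (C * s) ^ n * C) (at s within {0..t})"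
      using DERIV_power[OF DERIV_cmult_Id[of C s "{0..t}"], of "Suc n"]
      by (simp add: mult_ac)
    then have "((\<lambda>s. m * ((C * s) ^ Suc n / fact (Suc n))) has_real_derivative
       m * ((real (Suc n) * (C * s) ^ n * C) / fact (Suc n))) (at s within {0..t})"
      by (intro DERIV_cmult DERIV_cdivide)
    also have "m * ((real (Suc n) * (C * s) ^ n * C) / fact (Suc n)) = m * ((C * s) ^ n / fact n) * C"
      by (simp add: field_simps del: of_nat_Suc)
    finally show "((\<lambda>s. m * ((C * s) ^ Suc n / fact (Suc n))) has_vector_derivative
       m * ((C * s) ^ n / fact n) * C) (at s within {0..t})"
      by (simp add: has_real_derivative_iff_has_vector_derivative)
  qed
  from integral_unique[OF this] show ?thesis
    by (simp only: integral_mult_left) simp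
qed

lemma continuous_on_atLeast:
  fixes f :: "real \<Rightarrow> 'a::topological_space"
  assumes "\<And>\<tau>. continuous_on {0..\<tau>} f"
  shows "continuous_on {0..} f"
  unfolding continuous_on_def
proof
  fix t :: real assume t: "t \<in> {0..}"
  have "(f \<longlongrightarrow> f t) (at t within {0..t+1})"
    using assms[of "t+1"] t by (auto simp: continuous_on_def)
  moreover have "at t within {0..t+1} = at t within {0..}"
    using t by (intro at_within_nhd[of t "{..<t+1}"]) auto
  ultimately show "(f \<longlongrightarrow> f t) (at t within {0..})" by simp
qed

text \<open>Successive Picard iterates differ by at most \<open>m (C t)^n / n!\<close>, which is
  summable for every \<open>t\<close>; the solution is thus obtained on the whole half line at once.
  The lemma serves the semilinear mild equation, the linear state equation and the truncated plant
  field.\<close>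

lemma volterra_fixed_point:
  fixes \<Phi> :: "(real \<Rightarrow> 'a::banach) \<Rightarrow> real \<Rightarrow> 'a"
  assumes cont: "\<And>u. continuous_on {0..} u \<Longrightarrow> continuous_on {0..} (\<Phi> u)"
    and lip: "\<And>u v t. continuous_on {0..} u \<Longrightarrow> continuous_on {0..} v \<Longrightarrow> t \<ge> 0 \<Longrightarrow>
        norm (\<Phi> u t - \<Phi> v t) \<le> C * integral {0..t} (\<lambda>s. norm (u s - v s))"
    and C: "C \<ge> 0"
  obtains u where "continuous_on {0..} u" "\<And>t. t \<ge> 0 \<Longrightarrow> \<Phi> u t = u t"
proof -
  define U where "U n = (\<Phi> ^^ n) (\<lambda>_. 0)" for n
  have U_Suc: "U (Suc n) = \<Phi> (U n)" for n by (simp add: U_def)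
  have Uc: "continuous_on {0..} (U n)" for n
    by (induction n) (auto simp: U_Suc cont, simp add: U_def)
  have Uc': "continuous_on {0..\<tau>} (U n)" for n \<tau>
    by (rule continuous_on_subset[OF Uc]) auto
  have bnd: "\<exists>m\<ge>0. \<forall>n. \<forall>t\<in>{0..\<tau>}. norm (U (Suc n) t - U n t) \<le> m * ((C * t) ^ n / fact n)" for \<tau>
  proof -
    have "bounded ((\<lambda>t. U (Suc 0) t - U 0 t) ` {0..\<tau>})"
      by (intro compact_imp_bounded compact_continuous_image continuous_intros Uc') simp
    then obtain m where m: "m > 0" "\<forall>t\<in>{0..\<tau>}. norm (U (Suc 0) t - U 0 t) \<le> m"
      unfolding bounded_pos by auto
    have "\<forall>t\<in>{0..\<tau>}. norm (U (Suc n) t - U n t) \<le> m * ((C * t) ^ n / fact n)" for n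
    proof (induction n)
      case (Suc n)
      show ?case
      proof
        fix t assume t: "t \<in> {0..\<tau>}"
        have "norm (U (Suc (Suc n)) t - U (Suc n) t) \<le> C * integral {0..t} (\<lambda>s. norm (U (Suc n) s - U n s))"
          using lip[OF Uc Uc, of t "Suc n" n] t by (simp add: U_Suc)
        also have "\<dots> \<le> C * integral {0..t} (\<lambda>s. m * ((C * s) ^ n / fact n))"
          using Suc t C
          by (intro mult_left_mono integral_le integrable_continuous_interval continuous_intros Uc') auto
        also have "\<dots> = m * ((C * t) ^ Suc n / fact (Suc n))"
          using integral_power_fact[of t m C n] t by (simp add: mult.commute)
        finally show "norm (U (Suc (Suc n)) t - U (Suc n) t) \<le> m * ((C * t) ^ Suc n / fact (Suc n))" .
      qed
    qed (use m in auto)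
    then show ?thesis using m(1) by (intro exI[of _ m]) auto
  qed
  have uc: "uniformly_convergent_on {0..\<tau>} U" for \<tau>
  proof -
    obtain m where m: "m \<ge> 0" "\<And>n t. t\<in>{0..\<tau>} \<Longrightarrow> norm (U (Suc n) t - U n t) \<le> m * ((C * t) ^ n / fact n)"
      using bnd[of \<tau>] by auto
    \<comment> \<open>The iterates are the partial sums of their increments because
      \<open>U 0 = 0\<close>, and the increments have a summable majorant on the interval.\<close>
    have "uniformly_convergent_on {0..\<tau>} (\<lambda>n t. \<Sum>i<n. U (Suc i) t - U i t)"
    proof (rule Weierstrass_m_test'[of _ _ "\<lambda>n. m * ((C * \<tau>) ^ n / fact n)"])
      fix n t assume t: "t \<in> {0..\<tau>}"
      have "norm (U (Suc n) t - U n t) \<le> m * ((C * t) ^ n / fact n)" using m(2) t by auto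
      also have "\<dots> \<le> m * ((C * \<tau>) ^ n / fact n)"
        using t m C by (intro mult_left_mono divide_right_mono power_mono mult_left_mono) auto
      finally show "norm (U (Suc n) t - U n t) \<le> m * ((C * \<tau>) ^ n / fact n)" .
    next
      show "summable (\<lambda>n. m * ((C * \<tau>) ^ n / fact n))"
        by (intro summable_mult)
          (use summable_exp[of "C * \<tau>"] in \<open>simp add: divide_inverse mult.commute\<close>)
    qed
    moreover have "(\<lambda>n t. \<Sum>i<n. U (Suc i) t - U i t) = U"
      by (intro ext) (use sum_lessThan_telescope[of "\<lambda>i. U i _"] in \<open>simp add: U_def[of 0]\<close>)
    ultimately show ?thesis by simp
  qed
  define u where "u t = lim (\<lambda>n. U n t)" for t
  have ul: "uniform_limit {0..\<tau>} U u sequentially" for \<tau>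
    using uc[of \<tau>] unfolding u_def by (simp add: uniformly_convergent_uniform_limit_iff)
  have uc': "continuous_on {0..\<tau>} u" for \<tau>
    by (rule uniform_limit_theorem[OF _ ul]) (auto intro: Uc' always_eventually)
  have ucont: "continuous_on {0..} u"
    using uc' by (rule continuous_on_atLeast)
  have fixed: "\<Phi> u t = u t" if t: "t \<ge> 0" for t
  proof -
    have "(\<lambda>n. integral {0..t} (\<lambda>s. norm (u s - U n s))) \<longlonglongrightarrow> 0"
    proof -
      have ul0: "uniform_limit {0..t} (\<lambda>n s. norm (u s - U n s)) (\<lambda>s. norm (u s - u s)) sequentially"
        by (intro uniform_limit_intros ul)
      have c: "continuous_on {0..t} (\<lambda>s. norm (u s - U n s))" for n
        by (intro continuous_intros uc' Uc')
      obtain I J where IJ: "\<And>n. ((\<lambda>s. norm (u s - U n s)) has_integral I n) {0..t}"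
          "((\<lambda>s. norm (u s - u s)) has_integral J) {0..t}" "I \<longlonglongrightarrow> J"
        by (rule uniform_limit_integral[OF ul0 c sequentially_bot]) (rule that)
      have "J = 0" using integral_unique[OF IJ(2)] by simp
      moreover have "integral {0..t} (\<lambda>s. norm (u s - U n s)) = I n" for n
        using IJ(1) by (rule integral_unique)
      ultimately show ?thesis using IJ(3) by simp
    qed
    then have "(\<lambda>n. C * integral {0..t} (\<lambda>s. norm (u s - U n s))) \<longlonglongrightarrow> C * 0"
      by (intro tendsto_intros) simp
    moreover have "\<forall>\<^sub>F n in sequentially. norm (\<Phi> u t - U (Suc n) t)
        \<le> C * integral {0..t} (\<lambda>s. norm (u s - U n s))"
      using lip[OF ucont Uc t] by (simp add: U_Suc)
    ultimately have "(\<lambda>n. \<Phi> u t - U (Suc n) t) \<longlonglongrightarrow> 0"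
      using Lim_null_comparison by fastforce
    moreover have "(\<lambda>n. U (Suc n) t) \<longlonglongrightarrow> u t"
      using LIMSEQ_Suc[OF tendsto_uniform_limitI[OF ul[of t], of t]] t by simp
    ultimately have "(\<lambda>n. (\<Phi> u t - U (Suc n) t) + U (Suc n) t) \<longlonglongrightarrow> 0 + u t"
      by (rule tendsto_add)
    then show ?thesis by (simp add: LIMSEQ_const_iff)
  qed
  from ucont fixed show thesis by (rule that)
qed

section \<open>Contraction semigroups on a complemented subspace\<close>

text \<open>The subspace is the range of the projection \<open>P\<close>; the semigroup is extended to the whole space by
  \<open>T t = T t \<circ> P\<close>, so that \<open>T 0 = P\<close>.\<close>

locale contraction_semigroup = bounded_linear P for P :: "'w::banach \<Rightarrow> 'w" +
  fixes T :: "real \<Rightarrow> 'w \<Rightarrow> 'w"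
  assumes idem: "P (P x) = P x"
    and T_linear: "t \<ge> 0 \<Longrightarrow> bounded_linear (T t)"
    and T_contr: "t \<ge> 0 \<Longrightarrow> norm (T t x) \<le> norm x"
    and T_range: "t \<ge> 0 \<Longrightarrow> P (T t x) = T t x"
    and T_zero: "T 0 x = P x"
    and T_add: "s \<ge> 0 \<Longrightarrow> t \<ge> 0 \<Longrightarrow> T (s + t) x = T s (T t x)"
    and T_lim: "((\<lambda>t. T t x) \<longlongrightarrow> P x) (at_right 0)"
begin

lemma range_iff: "x \<in> range P \<longleftrightarrow> P x = x"
  using idem by (metis rangeE rangeI)

lemma T_P: "t \<ge> 0 \<Longrightarrow> T t (P x) = T t x"
  using T_add[of t 0 x] by (simp add: T_zero)

lemma T_diff: "t \<ge> 0 \<Longrightarrow> T t (x - y) = T t x - T t y"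
  using T_linear by (simp add: bounded_linear.linear linear_diff)

lemma c0_semigroup_T: "c0_semigroup_on (range P) T"
proof -
  have lim: "((\<lambda>t. T t x) \<longlongrightarrow> x) (at_right 0)" if "x \<in> range P" for x
    using T_lim[of x] that by (simp add: range_iff)
  show ?thesis
  unfolding c0_semigroup_on_def
proof (intro conjI allI impI ballI)
  fix t :: real and x assume t: "t \<ge> 0"
  show "T t x \<in> range P" using T_range[OF t] by (simp add: range_iff)
  show "T t (a *\<^sub>R x + b *\<^sub>R y) = a *\<^sub>R T t x + b *\<^sub>R T t y" for a b y
    using T_linear[OF t] by (simp add: bounded_linear.linear linear_add linear_scale)
  show "\<exists>K. \<forall>x\<in>range P. norm (T t x) \<le> K * norm x"
    using T_contr[OF t] by (intro exI[of _ 1]) simp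
qed (use lim in \<open>auto simp: T_add T_zero idem\<close>)
qed

text \<open>For \<open>s \<le> t\<close> one has
  \<open>T t y - T s y = T s (T (t - s) y - P y)\<close>, and \<open>T s\<close> is a contraction.
  Joint continuity in time and state is thereby reduced to continuity at time 0.\<close>

lemma T_dist:
  assumes "s \<ge> 0" "t \<ge> 0"
  shows "norm (T t x - T s y) \<le> norm (x - y) + norm (T \<bar>t - s\<bar> y - P y)"
proof -
  have le: "norm (T t y - T s y) \<le> norm (T (t - s) y - P y)" if "0 \<le> s" "s \<le> t" for s t
  proof -
    have "T t y - T s y = T s (T (t - s) y - P y)"
      using T_add[of s "t - s" y] that by (simp add: T_diff T_P)
    then show ?thesis using T_contr that(1) by simp
  qed
  have "norm (T t y - T s y) \<le> norm (T \<bar>t - s\<bar> y - P y)"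
    using le[of s t] le[of t s] assms by (cases "s \<le> t") (auto simp: norm_minus_commute)
  moreover have "norm (T t x - T t y) \<le> norm (x - y)"
    using T_contr[of t "x - y"] assms by (simp add: T_diff)
  ultimately show ?thesis
    using norm_triangle_ineq[of "T t x - T t y" "T t y - T s y"] by simp
qed

text \<open>Reflecting time turns the one-sided limit of the semigroup into ordinary continuity at
  0, which composes freely with time differences of either sign.\<close>

lemma T_isCont0: "isCont (\<lambda>r. T \<bar>r\<bar> y) 0"
proof -
  have *: "((\<lambda>r. T \<bar>r\<bar> y) \<longlongrightarrow> P y) (at_right 0)"
    using T_lim[of y]
    by (rule Lim_transform_eventually)
      (auto simp: eventually_at_right_less intro: eventually_mono[OF eventually_at_right_less])
  moreover have "((\<lambda>r. T \<bar>r\<bar> y) \<longlongrightarrow> P y) (at_left 0)"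
    using * by (subst filterlim_at_left_to_right) simp
  ultimately show ?thesis
    unfolding isCont_def by (simp add: filterlim_split_at T_zero)
qed

lemma T_continuous: "continuous_on ({0..} \<times> UNIV) (\<lambda>(t, x). T t x)"
  unfolding continuous_on_def
proof
  fix p :: "real \<times> 'w" assume p: "p \<in> {0..} \<times> UNIV"
  let ?F = "at p within {0..} \<times> UNIV"
  let ?g = "\<lambda>q. norm (snd q - snd p) + norm (T \<bar>fst q - fst p\<bar> (snd p) - P (snd p))"
  have "((\<lambda>q. fst q - fst p) \<longlongrightarrow> 0) ?F" and snd: "((\<lambda>q. snd q - snd p) \<longlongrightarrow> 0) ?F"
    by (auto intro!: tendsto_eq_intros)
  from isCont_tendsto_compose[OF T_isCont0 this(1), of "snd p"]
  have "((\<lambda>q. T \<bar>fst q - fst p\<bar> (snd p)) \<longlongrightarrow> P (snd p)) ?F" by (simp add: T_zero)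
  then have "(?g \<longlongrightarrow> norm (0::'w) + norm (P (snd p) - P (snd p))) ?F"
    using snd by (intro tendsto_intros)
  then have "(?g \<longlongrightarrow> 0) ?F" by simp
  moreover have "\<forall>\<^sub>F q in ?F. norm ((\<lambda>(t, x). T t x) q - (\<lambda>(t, x). T t x) p) \<le> ?g q"
    using p T_dist[of "fst p" _ _ "snd p"] by (auto simp: eventually_at_filter split: prod.splits)
  ultimately have "((\<lambda>q. (\<lambda>(t, x). T t x) q - (\<lambda>(t, x). T t x) p) \<longlongrightarrow> 0) ?F"
    by (rule Lim_null_comparison[rotated])
  then show "((\<lambda>(t, x). T t x) \<longlongrightarrow> (\<lambda>(t, x). T t x) p) ?F"
    by (rule LIM_zero_cancel)
qed

lemma continuous_on_T:
  assumes "continuous_on S a" "continuous_on S g" "\<And>s. s \<in> S \<Longrightarrow> a s \<ge> 0"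
  shows "continuous_on S (\<lambda>s. T (a s) (g s))"
  using continuous_on_compose2[OF T_continuous, of S "\<lambda>s. (a s, g s)"] assms
  by (auto intro!: continuous_intros)

lemma continuous_on_convolution:
  assumes g: "continuous_on {0..} g"
  shows "continuous_on {0..} (\<lambda>t. integral {0..t} (\<lambda>s. T (t - s) (g s)))"
proof (rule continuous_on_atLeast)
  fix \<tau> :: real
  have g': "continuous_on {a..b} g" if "0 \<le> a" for a b
    by (rule continuous_on_subset[OF g]) (use that in auto)
  \<comment> \<open>Freezing the semigroup at time 0 for \<open>s > t\<close> gives a jointly
    continuous kernel on a fixed interval. The surplus over \<open>{t..\<tau>}\<close> is the
    integral of \<open>P (g s)\<close> and is subtracted afterwards.\<close>
  let ?k = "\<lambda>t s. T (max 0 (t - s)) (g s)"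
  have "continuous_on ({0..\<tau>} \<times> cbox 0 \<tau>) (\<lambda>p. T (max 0 (fst p - snd p)) (g (snd p)))"
    by (intro continuous_on_T continuous_intros continuous_on_compose2[OF g]) auto
  then have "continuous_on {0..\<tau>} (\<lambda>t. integral (cbox 0 \<tau>) (?k t))"
    by (intro integral_continuous_on_param) (simp add: case_prod_beta)
  moreover have "continuous_on {0..\<tau>} (\<lambda>t. integral {0..t} (\<lambda>s. P (g s)))"
    by (intro indefinite_integral_continuous_1 integrable_continuous_interval g' continuous_on) auto
  ultimately have "continuous_on {0..\<tau>} (\<lambda>t. integral (cbox 0 \<tau>) (?k t)
      - (integral {0..\<tau>} (\<lambda>s. P (g s)) - integral {0..t} (\<lambda>s. P (g s))))"
    by (intro continuous_intros)
  then show "continuous_on {0..\<tau>} (\<lambda>t. integral {0..t} (\<lambda>s. T (t - s) (g s)))"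
  proof (rule continuous_on_eq)
    fix t assume t: "t \<in> {0..\<tau>}"
    have ki: "?k t integrable_on {0..\<tau>}"
      by (intro integrable_continuous_interval continuous_on_T continuous_intros g') auto
    have Pi: "(\<lambda>s. P (g s)) integrable_on {0..\<tau>}"
      by (intro integrable_continuous_interval continuous_on g') auto
    have "integral {0..\<tau>} (?k t) = integral {0..t} (?k t) + integral {t..\<tau>} (?k t)"
      using t ki by (simp add: Henstock_Kurzweil_Integration.integral_combine)
    also have "integral {0..t} (?k t) = integral {0..t} (\<lambda>s. T (t - s) (g s))"
      by (intro integral_cong) auto
    also have "integral {t..\<tau>} (?k t) = integral {t..\<tau>} (\<lambda>s. P (g s))"
      by (intro integral_cong) (auto simp: T_zero max_def)
    also have "integral {t..\<tau>} (\<lambda>s. P (g s)) = integral {0..\<tau>} (\<lambda>s. P (g s)) - integral {0..t} (\<lambda>s. P (g s))"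
      using t Pi Henstock_Kurzweil_Integration.integral_combine[of 0 t \<tau> "\<lambda>s. P (g s)"] by (simp add: algebra_simps)
    finally show "integral (cbox 0 \<tau>) (?k t) - (integral {0..\<tau>} (\<lambda>s. P (g s)) - integral {0..t} (\<lambda>s. P (g s)))
        = integral {0..t} (\<lambda>s. T (t - s) (g s))"
      by simp
  qed
qed

text \<open>The variation-of-constants formula with the semigroup fixed to \<open>T\<close>, whereas
  \<open>mild_solution\<close> quantifies it existentially; \<open>mild_solution_iff_mild_on\<close>
  connects the two.\<close>

definition mild_on :: "('w \<Rightarrow> 'w) \<Rightarrow> real set \<Rightarrow> 'w \<Rightarrow> (real \<Rightarrow> 'w) \<Rightarrow> bool" where
  "mild_on f I z0 z \<longleftrightarrow> continuous_on I z \<and> (\<forall>t\<in>I. P (z t) = z t) \<and>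
     (\<forall>t\<in>I. ((\<lambda>s. T (t - s) (f (z s))) has_integral (z t - T t z0)) {0..t})"

lemma mild_on_subset: "mild_on f I z0 z \<Longrightarrow> I' \<subseteq> I \<Longrightarrow> mild_on f I' z0 z"
  unfolding mild_on_def by (auto intro: continuous_on_subset)

lemma mild_on_start: "mild_on f I z0 z \<Longrightarrow> 0 \<in> I \<Longrightarrow> z 0 = P z0"
proof -
  assume "mild_on f I z0 z" "0 \<in> I"
  then have "((\<lambda>s. T (0 - s) (f (z s))) has_integral (z 0 - P z0)) {0..0}"
    unfolding mild_on_def by (metis T_zero)
  then have "z 0 - P z0 = 0"
    by (rule has_integral_unique) (rule has_integral_null_real, simp)
  then show ?thesis by simp
qed

text \<open>As \<open>T\<close> is a contraction, the variation-of-constants map is a Volterra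
  operator with the Lipschitz constant of \<open>f\<close>. Its fixed point stays in the range of
  \<open>P\<close> since \<open>P\<close> commutes with the integral and fixes the
  integrand.\<close>

lemma mild_on_exists:
  assumes lip: "\<And>x y. norm (f x - f y) \<le> K * norm (x - y)"
  obtains z where "mild_on f {0..} z0 z"
proof -
  have K: "K \<ge> 0 \<or> (\<forall>x y :: 'w. x = y)"
  proof (rule disjCI)
    assume "\<not> (\<forall>x y :: 'w. x = y)"
    then obtain x y :: 'w where "x \<noteq> y" by blast
    have "0 \<le> K * norm (x - y)" using lip[of x y] norm_ge_zero order_trans by blast
    then show "K \<ge> 0" using \<open>x \<noteq> y\<close> by (simp add: zero_le_mult_iff)
  qed
  have lip': "norm (f x - f y) \<le> \<bar>K\<bar> * norm (x - y)" for x y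
    using lip[of x y] by (rule order_trans) (intro mult_right_mono, auto)
  have fc: "continuous_on S f" for S
    by (rule lipschitz_on_continuous_on[of "\<bar>K\<bar>"]) (auto intro!: lipschitz_onI lip' simp: dist_norm)
  define \<Phi> where "\<Phi> u t = T t z0 + integral {0..t} (\<lambda>s. T (t - s) (f (u s)))" for u t
  have fu: "continuous_on {0..} (\<lambda>s. f (u s))" if "continuous_on {0..} u" for u
    by (rule continuous_on_compose2[OF fc that]) auto
  have conv: "(\<lambda>s. T (t - s) (f (u s))) integrable_on {0..t}" if "continuous_on {0..} u" for u t
    by (intro integrable_continuous_interval continuous_on_T continuous_intros continuous_on_subset[OF fu[OF that]]) auto
  obtain u where u: "continuous_on {0..} u" "\<And>t. t \<ge> 0 \<Longrightarrow> \<Phi> u t = u t"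
  proof (rule volterra_fixed_point[of \<Phi> "\<bar>K\<bar>"])
    fix u :: "real \<Rightarrow> 'w" assume u: "continuous_on {0..} u"
    show "continuous_on {0..} (\<Phi> u)" unfolding \<Phi>_def
      by (intro continuous_on_add continuous_on_convolution fu u continuous_on_T) (auto intro: continuous_intros)
  next
    fix u v :: "real \<Rightarrow> 'w" and t :: real
    assume u: "continuous_on {0..} u" and v: "continuous_on {0..} v" and t: "t \<ge> 0"
    have sub: "continuous_on {0..t} u" "continuous_on {0..t} v"
      using u v by (auto intro: continuous_on_subset)
    have "norm (\<Phi> u t - \<Phi> v t) = norm (integral {0..t} (\<lambda>s. T (t - s) (f (u s)) - T (t - s) (f (v s))))"
      by (simp add: \<Phi>_def integral_diff conv u v)
    also have "\<dots> \<le> integral {0..t} (\<lambda>s. \<bar>K\<bar> * norm (u s - v s))"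
    proof (rule integral_norm_bound_integral)
      show "(\<lambda>s. T (t - s) (f (u s)) - T (t - s) (f (v s))) integrable_on {0..t}"
        by (intro integrable_diff conv u v)
      show "(\<lambda>s. \<bar>K\<bar> * norm (u s - v s)) integrable_on {0..t}"
        by (intro integrable_continuous_interval continuous_intros sub)
      fix s assume s: "s \<in> {0..t}"
      have "norm (T (t - s) (f (u s)) - T (t - s) (f (v s))) = norm (T (t - s) (f (u s) - f (v s)))"
        using s by (simp add: T_diff)
      also have "\<dots> \<le> norm (f (u s) - f (v s))" using s by (intro T_contr) auto
      finally show "norm (T (t - s) (f (u s)) - T (t - s) (f (v s))) \<le> \<bar>K\<bar> * norm (u s - v s)"
        using lip' order_trans by blast
    qed
    finally show "norm (\<Phi> u t - \<Phi> v t) \<le> \<bar>K\<bar> * integral {0..t} (\<lambda>s. norm (u s - v s))" by simp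
  qed auto
  have hi: "((\<lambda>s. T (t - s) (f (u s))) has_integral (u t - T t z0)) {0..t}" if "t \<ge> 0" for t
    using integrable_integral[OF conv[OF u(1)], of t] unfolding u(2)[OF that, symmetric] \<Phi>_def by simp
  have "P (u t) = u t" if t: "t \<ge> 0" for t
  proof -
    have "(P \<circ> (\<lambda>s. T (t - s) (f (u s))) has_integral P (u t - T t z0)) {0..t}"
      using hi[OF t] bounded_linear_axioms by (rule has_integral_linear)
    moreover have "(P \<circ> (\<lambda>s. T (t - s) (f (u s)))) s = T (t - s) (f (u s))" if "s \<in> {0..t}" for s
      using that by (simp add: T_range)
    ultimately have "((\<lambda>s. T (t - s) (f (u s))) has_integral P (u t - T t z0)) {0..t}"
      by (subst (asm) has_integral_cong) auto
    then have "P (u t - T t z0) = u t - T t z0" using hi[OF t] has_integral_unique by blast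
    then show ?thesis using t by (simp add: diff T_range)
  qed
  then show thesis using u hi by (intro that[of u]) (auto simp: mild_on_def)
qed

text \<open>Gronwall's inequality for the distance of the two solutions. The Lipschitz estimate is
  asked for only along these solutions, so that a locally Lipschitz nonlinearity is covered.\<close>

lemma mild_on_unique:
  assumes z: "mild_on f {0..\<tau>} z0 z" and y: "mild_on f {0..\<tau>} z0 y"
    and lip: "\<And>s. s \<in> {0..\<tau>} \<Longrightarrow> norm (f (z s) - f (y s)) \<le> K * norm (z s - y s)"
    and K: "K \<ge> 0" and t: "t \<in> {0..\<tau>}"
  shows "z t = y t"
proof -
  have c: "continuous_on {0..\<tau>} (\<lambda>s. norm (z s - y s))"
    using z y by (auto simp: mild_on_def intro!: continuous_intros)
  have "norm (z t - y t) \<le> 0 * exp (K * t)"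
  proof (rule gronwall_integral[OF c K t])
    fix t assume t: "t \<in> {0..\<tau>}"
    have hi: "((\<lambda>s. T (t - s) (f (z s)) - T (t - s) (f (y s))) has_integral (z t - y t)) {0..t}"
      using z y t has_integral_diff[of "\<lambda>s. T (t - s) (f (z s))" "z t - T t z0" "{0..t}" "\<lambda>s. T (t - s) (f (y s))" "y t - T t z0"]
      by (auto simp: mild_on_def)
    have "norm (z t - y t) \<le> integral {0..t} (\<lambda>s. K * norm (z s - y s))"
      unfolding integral_unique[OF hi, symmetric]
    proof (rule integral_norm_bound_integral)
      show "(\<lambda>s. T (t - s) (f (z s)) - T (t - s) (f (y s))) integrable_on {0..t}"
        using hi by (rule has_integral_integrable)
      show "(\<lambda>s. K * norm (z s - y s)) integrable_on {0..t}"
        using t by (intro integrable_continuous_interval continuous_on_mult_left continuous_on_subset[OF c]) auto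
      fix s assume s: "s \<in> {0..t}"
      have "norm (T (t - s) (f (z s)) - T (t - s) (f (y s))) = norm (T (t - s) (f (z s) - f (y s)))"
        using s by (simp add: T_diff)
      also have "\<dots> \<le> norm (f (z s) - f (y s))" using s by (intro T_contr) auto
      also have "\<dots> \<le> K * norm (z s - y s)" using s t by (intro lip) auto
      finally show "norm (T (t - s) (f (z s)) - T (t - s) (f (y s))) \<le> K * norm (z s - y s)" .
    qed
    then show "norm (z t - y t) \<le> 0 + K * integral {0..t} (\<lambda>s. norm (z s - y s))" by simp
  qed
  then show ?thesis by simp
qed

text \<open>Restarting the formula at time \<open>t\<close> gives
  \<open>z (t + h) - T h (z t)\<close> as the integral of \<open>T (t + h - s) (f (z s))\<close>
  over \<open>{t..t + h}\<close>. There the integrand is uniformly close to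
  \<open>P (f (z t))\<close>, by continuity of \<open>f\<close> along \<open>z\<close> and of the
  semigroup at 0.\<close>

lemma mild_on_right_expansion:
  assumes z: "mild_on f {0..<\<tau>} z0 z" and t: "t \<in> {0..<\<tau>}"
    and f: "continuous_on {0..<\<tau>} (\<lambda>s. f (z s))"
  shows "((\<lambda>h. (z (t + h) - T h (z t)) /\<^sub>R h) \<longlongrightarrow> P (f (z t))) (at_right 0)"
proof (rule tendstoI)
  fix e :: real assume e: "e > 0"
  let ?g = "\<lambda>s. f (z s)"
  have "isCont (\<lambda>r. norm (T \<bar>r\<bar> (?g t) - P (?g t))) 0"
    by (intro continuous_intros T_isCont0)
  then have "((\<lambda>r. norm (T \<bar>r\<bar> (?g t) - P (?g t))) \<longlongrightarrow> 0) (at 0)"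
    by (simp add: isCont_def T_zero)
  then have "\<forall>\<^sub>F r in at 0. norm (T \<bar>r\<bar> (?g t) - P (?g t)) < e / 4"
    using e by (intro order_tendstoD) auto
  then obtain d1 where d1: "d1 > 0" "\<And>r. r \<noteq> 0 \<Longrightarrow> dist r 0 < d1 \<Longrightarrow> norm (T \<bar>r\<bar> (?g t) - P (?g t)) < e / 4"
    by (auto simp: eventually_at)
  have "\<exists>d>0. \<forall>s\<in>{0..<\<tau>}. dist s t < d \<longrightarrow> dist (?g s) (?g t) < e / 4"
    using f[unfolded continuous_on_iff, rule_format, of t "e / 4"] t e by simp
  then obtain d2 where d2: "d2 > 0" "\<And>s. s \<in> {0..<\<tau>} \<Longrightarrow> dist s t < d2 \<Longrightarrow> dist (?g s) (?g t) < e / 4"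
    by blast
  have key: "norm ((z (t + h) - T h (z t)) /\<^sub>R h - P (?g t)) < e" if h: "0 < h" "h < min d1 (min d2 (\<tau> - t))" for h
  proof -
    let ?F = "\<lambda>s. T (t + h - s) (?g s)"
    have i1: "(?F has_integral (z (t + h) - T (t + h) z0)) {0..t + h}"
      using z t h by (auto simp: mild_on_def)
    have "((\<lambda>s. T (t - s) (?g s)) has_integral (z t - T t z0)) {0..t}"
      using z t by (auto simp: mild_on_def)
    \<comment> \<open>Applying \<open>T h\<close> to the formula at time \<open>t\<close> reproduces
      the part of the formula at time \<open>t + h\<close> that lies over
      \<open>{0..t}\<close>.\<close>
    then have "(T h \<circ> (\<lambda>s. T (t - s) (?g s)) has_integral T h (z t - T t z0)) {0..t}"
      using h by (intro has_integral_linear T_linear) auto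
    moreover have "(T h \<circ> (\<lambda>s. T (t - s) (?g s))) s = ?F s" if "s \<in> {0..t}" for s
      using that h T_add[of h "t - s"] by (simp add: algebra_simps)
    ultimately have i2: "(?F has_integral (T h (z t) - T (t + h) z0)) {0..t}"
      using h t T_add[of h t z0] by (subst (asm) has_integral_cong) (auto simp: T_diff add.commute)
    have "?F integrable_on {t..t + h}"
      by (rule integrable_subinterval_real[OF has_integral_integrable[OF i1]]) (use t in auto)
    moreover have "integral {0..t} ?F + integral {t..t + h} ?F = integral {0..t + h} ?F"
      using t h by (intro Henstock_Kurzweil_Integration.integral_combine has_integral_integrable[OF i1]) auto
    ultimately have i3: "(?F has_integral (z (t + h) - T h (z t))) {t..t + h}"
      unfolding integral_unique[OF i1] integral_unique[OF i2]
      by (simp add: has_integral_iff algebra_simps)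
    have "((\<lambda>s. P (?g t)) has_integral (h *\<^sub>R P (?g t))) {t..t + h}"
      using has_integral_const_real[of "P (?g t)" t "t + h"] h by simp
    with i3 have i4: "((\<lambda>s. ?F s - P (?g t)) has_integral (z (t + h) - T h (z t) - h *\<^sub>R P (?g t))) {t..t + h}"
      by (rule has_integral_diff)
    have "norm (z (t + h) - T h (z t) - h *\<^sub>R P (?g t)) \<le> (e / 2) * measure lborel {t..t + h}"
    proof (rule has_integral_bound_real[OF _ finite.emptyI i4])
      fix s assume "s \<in> {t..t + h} - {}"
      then have s: "s \<in> {t..t + h}" by simp
      have "norm (T (t + h - s) (?g s) - P (?g t)) \<le> norm (?g s - ?g t) + norm (T (t + h - s) (?g t) - P (?g t))"
      proof -
        have "norm (T (t + h - s) (?g s) - T (t + h - s) (?g t)) \<le> norm (?g s - ?g t)"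
          using T_contr[of "t + h - s" "?g s - ?g t"] s by (simp add: T_diff)
        then show ?thesis
          using norm_triangle_ineq[of "T (t + h - s) (?g s) - T (t + h - s) (?g t)" "T (t + h - s) (?g t) - P (?g t)"] by simp
      qed
      moreover have "norm (?g s - ?g t) < e / 4"
        using d2(2)[of s] s h t by (simp add: dist_norm)
      moreover have "norm (T (t + h - s) (?g t) - P (?g t)) < e / 4"
        using d1(2)[of "t + h - s"] s h e T_zero[of "?g t"] by (cases "s = t + h") auto
      ultimately show "norm (?F s - P (?g t)) \<le> e / 2" by simp
    qed (use e in simp)
    then have "norm (z (t + h) - T h (z t) - h *\<^sub>R P (?g t)) / h \<le> e / 2"
      using h by (simp add: pos_divide_le_eq)
    moreover have eq: "(z (t + h) - T h (z t)) /\<^sub>R h - P (?g t) = (z (t + h) - T h (z t) - h *\<^sub>R P (?g t)) /\<^sub>R h"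
      using h by (simp add: algebra_simps)
    have "norm ((z (t + h) - T h (z t)) /\<^sub>R h - P (?g t)) = norm (z (t + h) - T h (z t) - h *\<^sub>R P (?g t)) / h"
      unfolding eq using h by (simp add: divide_inverse mult.commute)
    ultimately have "norm ((z (t + h) - T h (z t)) /\<^sub>R h - P (?g t)) \<le> e / 2"
      by simp
    then show ?thesis using e by simp
  qed
  have "\<forall>\<^sub>F h in at_right 0. 0 < h \<and> h < min d1 (min d2 (\<tau> - t))"
    unfolding eventually_at_right_field using d1(1) d2(1) t by (intro exI[of _ "min d1 (min d2 (\<tau> - t))"]) auto
  then show "\<forall>\<^sub>F h in at_right 0. dist ((z (t + h) - T h (z t)) /\<^sub>R h) (P (?g t)) < e"
    by eventually_elim (use key in \<open>auto simp: dist_norm\<close>)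
qed

section \<open>Uniqueness of the semigroup with a given generator\<close>

context
  fixes S :: "real \<Rightarrow> 'w \<Rightarrow> 'w"
  assumes S: "c0_semigroup_on (range P) S"
begin

text \<open>Nothing is known about \<open>S\<close> off the range of \<open>P\<close>; composition
  with \<open>P\<close> yields bounded operators on the whole Banach space, to which category and
  closure arguments apply.\<close>

lemma S_linear: "t \<ge> 0 \<Longrightarrow> bounded_linear (\<lambda>x. S t (P x))"
proof -
  assume t: "t \<ge> 0"
  have lin: "S t (a *\<^sub>R P x + b *\<^sub>R P y) = a *\<^sub>R S t (P x) + b *\<^sub>R S t (P y)" for a b x y
    using S t unfolding c0_semigroup_on_def by auto
  obtain K where K: "\<And>x. norm (S t (P x)) \<le> K * norm (P x)"
    using S t unfolding c0_semigroup_on_def by (metis rangeI)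
  obtain K' where K': "\<And>x. norm (P x) \<le> norm x * K'" "K' \<ge> 0" using nonneg_bounded by blast
  show ?thesis
  proof
    fix x y and r :: real
    show "S t (P (x + y)) = S t (P x) + S t (P y)" using lin[of 1 x 1 y] by (simp add: add)
    show "S t (P (r *\<^sub>R x)) = r *\<^sub>R S t (P x)" using lin[of r x 0 x] by (simp add: scaleR)
    have "norm (S t (P x)) \<le> norm x * (\<bar>K\<bar> * K')" for x
    proof -
      have "norm (S t (P x)) \<le> \<bar>K\<bar> * norm (P x)"
        using K[of x] by (rule order_trans) (intro mult_right_mono, auto)
      also have "\<dots> \<le> \<bar>K\<bar> * (norm x * K')" using K' by (intro mult_left_mono) auto
      finally show ?thesis by (simp add: mult_ac)
    qed
    then show "\<exists>K. \<forall>x. norm (S t (P x)) \<le> norm x * K" by blast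
  qed
qed

lemma S_add: "s \<ge> 0 \<Longrightarrow> t \<ge> 0 \<Longrightarrow> P x = x \<Longrightarrow> S (s + t) x = S s (S t x)"
  and S_range: "t \<ge> 0 \<Longrightarrow> P x = x \<Longrightarrow> P (S t x) = S t x"
  and S_zero: "P x = x \<Longrightarrow> S 0 x = x"
  and S_lim: "P x = x \<Longrightarrow> ((\<lambda>t. S t x) \<longlongrightarrow> x) (at_right 0)"
  using S unfolding c0_semigroup_on_def by (metis range_iff)+

lemma S_diff: "t \<ge> 0 \<Longrightarrow> P x = x \<Longrightarrow> P y = y \<Longrightarrow> S t (x - y) = S t x - S t y"
  using linear_diff[OF bounded_linear.linear[OF S_linear], of t x y] by (simp add: diff)

text \<open>The time interval is not given in advance, so the uniform boundedness principle does not apply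
  directly; Baire's theorem is applied to both bounds at once.\<close>

lemma S_bounded_near_0: "\<exists>d>0. \<exists>K. \<forall>t\<in>{0..d}. \<forall>x. norm (S t (P x)) \<le> K * norm x"
proof -
  \<comment> \<open>The index \<open>n\<close> bounds the operators from above and, through its
    inverse, the time interval; strong continuity at 0 then places every \<open>x\<close> in some
    \<open>F n\<close>.\<close>
  define F where "F n = {x. \<forall>t\<in>{0..1 / real (Suc n)}. norm (S t (P x)) \<le> real n}" for n
  have cl: "closed (F n)" for n
  proof -
    have "F n = (\<Inter>t\<in>{0..1 / real (Suc n)}. {x. norm (S t (P x)) \<le> real n})" by (auto simp: F_def)
    moreover have "closed {x. norm (S t (P x)) \<le> real n}" if "t \<in> {0..1 / real (Suc n)}" for t
      using that by (intro closed_Collect_le continuous_intros linear_continuous_on S_linear) auto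
    ultimately show ?thesis by auto
  qed
  have un: "\<Union>(range F) = UNIV"
  proof -
    have "\<exists>n. x \<in> F n" for x
    proof -
      have "((\<lambda>t. norm (S t (P x))) \<longlongrightarrow> norm (P x)) (at_right 0)"
        by (intro tendsto_norm S_lim idem)
      then have "\<forall>\<^sub>F t in at_right 0. norm (S t (P x)) < norm (P x) + 1"
        by (intro order_tendstoD) auto
      then obtain d where d: "d > 0" "\<And>t. 0 < t \<Longrightarrow> t < d \<Longrightarrow> norm (S t (P x)) < norm (P x) + 1"
        unfolding eventually_at_right_field by auto
      obtain n where n: "max (1 / d) (norm (P x) + 1) < real n" using reals_Archimedean2 by blast
      have "1 / real (Suc n) < d"
      proof -
        have "1 / d < real (Suc n)" using n by auto
        then show ?thesis using d(1) by (simp add: field_simps)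
      qed
      moreover have "norm (S t (P x)) \<le> real n" if "0 \<le> t" "t < d" for t
      proof (cases "t = 0")
        case True then show ?thesis using n by (simp add: S_zero idem)
      next
        case False then show ?thesis using d(2)[of t] that n by auto
      qed
      ultimately have "x \<in> F n" by (auto simp: F_def)
      then show ?thesis ..
    qed
    then show ?thesis by auto
  qed
  have "\<exists>n. interior (F n) \<noteq> {}"
  proof (rule ccontr)
    assume "\<not> ?thesis"
    then have "(euclidean :: 'w topology) interior_of \<Union>(range F) = {}"
      by (intro Baire_category_alt) (auto simp: completely_metrizable_space_euclidean cl)
    then show False using un by simp
  qed
  then obtain n x0 where "x0 \<in> interior (F n)" by auto
  then obtain r where r: "r > 0" "cball x0 r \<subseteq> F n" by (auto simp: mem_interior_cball)
  have "norm (S t (P x)) \<le> (2 * real n / r) * norm x" if t: "t \<in> {0..1 / real (Suc n)}" for t x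
  proof (cases "x = 0")
    case True then show ?thesis using bounded_linear.linear[OF S_linear] t linear_0 by fastforce
  next
    case False
    \<comment> \<open>Rescaled to length \<open>r\<close> and attached to the centre
      \<open>x0\<close>, the vector stays in the ball inside \<open>F n\<close>; the two bounds by
      \<open>n\<close> at \<open>y\<close> and \<open>x0\<close> give the factor
      \<open>2 n / r\<close>.\<close>
    define y where "y = x0 + (r / norm x) *\<^sub>R x"
    have "y \<in> F n" "x0 \<in> F n" using r False by (auto simp: y_def dist_norm intro!: subsetD[OF r(2)])
    then have le: "norm (S t (P y)) \<le> real n" "norm (S t (P x0)) \<le> real n" using t by (auto simp: F_def)
    have lin: "linear (\<lambda>x. S t (P x))" using S_linear t by (auto intro: bounded_linear.linear)
    have "S t (P y) = S t (P x0) + (r / norm x) *\<^sub>R S t (P x)"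
      unfolding y_def using linear_add[OF lin] linear_scale[OF lin] by simp
    then have "norm ((r / norm x) *\<^sub>R S t (P x)) = norm (S t (P y) - S t (P x0))" by simp
    also have "\<dots> \<le> 2 * real n" using le norm_triangle_ineq4[of "S t (P y)" "S t (P x0)"] by simp
    finally have "(r / norm x) * norm (S t (P x)) \<le> 2 * real n" using r by simp
    then show ?thesis using r False by (simp add: field_simps)
  qed
  then show ?thesis by (intro exI[of _ "1 / real (Suc n)"] conjI exI[of _ "2 * real n / r"]) auto
qed

text \<open>Splitting off one step of length at most \<open>d\<close> by the semigroup law costs one
  factor \<open>K\<close>, so \<open>K ^ n\<close> is a bound up to time \<open>n d\<close>.\<close>

lemma S_bounded: "\<exists>K\<ge>0. \<forall>t\<in>{0..\<tau>}. \<forall>x. P x = x \<longrightarrow> norm (S t x) \<le> K * norm x"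
proof -
  obtain d K0 where d: "d > 0" and K0: "\<And>t x. t \<in> {0..d} \<Longrightarrow> norm (S t (P x)) \<le> K0 * norm x"
    using S_bounded_near_0 by blast
  define K where "K = max 1 K0"
  have K: "norm (S t x) \<le> K * norm x" if "t \<in> {0..d}" "P x = x" for t x
  proof -
    have "norm (S t x) \<le> K0 * norm x" using K0[OF that(1), of x] that(2) by simp
    also have "\<dots> \<le> K * norm x" by (intro mult_right_mono) (auto simp: K_def)
    finally show ?thesis .
  qed
  have K1: "K \<ge> 1" by (simp add: K_def)
  have step: "\<forall>t\<in>{0..real n * d}. \<forall>x. P x = x \<longrightarrow> norm (S t x) \<le> K ^ n * norm x" for n
  proof (induction n)
    case 0 then show ?case by (simp add: S_zero)
  next
    case (Suc n)
    show ?case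
    proof (intro ballI allI impI)
      fix t x assume t: "t \<in> {0..real (Suc n) * d}" and x: "P x = x"
      define s where "s = min t d"
      have s: "s \<in> {0..d}" "t - s \<in> {0..real n * d}" "0 \<le> t - s" "0 \<le> s"
        using t d by (auto simp: s_def min_def algebra_simps)
      have "norm (S t x) = norm (S s (S (t - s) x))"
        using S_add[of s "t - s" x] s x by simp
      also have "\<dots> \<le> K * norm (S (t - s) x)" using s x by (intro K S_range) auto
      also have "\<dots> \<le> K * (K ^ n * norm x)" using Suc s x K1 by (intro mult_left_mono) auto
      finally show "norm (S t x) \<le> K ^ Suc n * norm x" by simp
    qed
  qed
  obtain n where "\<tau> / d < real n" using reals_Archimedean2 by blast
  then have "\<tau> \<le> real n * d" using d by (simp add: field_simps)
  then show ?thesis using step[of n] K1 by (intro exI[of _ "K ^ n"]) auto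
qed

text \<open>A difference of values at two times is \<open>S a\<close> applied to a short-time
  difference at 0. The bound on \<open>S a\<close>, uniform on the interval, therefore gives
  continuity from the left as well as from the right.\<close>

lemma S_continuous:
  assumes x: "P x = x"
  shows "continuous_on {0..\<tau>} (\<lambda>t. S t x)"
  unfolding continuous_on_iff
proof (intro ballI allI impI)
  fix t and e :: real assume t: "t \<in> {0..\<tau>}" and e: "e > 0"
  obtain K where K: "K \<ge> 0" "\<And>t x. t \<in> {0..\<tau>} \<Longrightarrow> P x = x \<Longrightarrow> norm (S t x) \<le> K * norm x"
    using S_bounded[of \<tau>] by blast
  have "\<forall>\<^sub>F h in at_right 0. dist (S h x) x < e / (K + 1)"
    using S_lim[OF x] e K by (intro tendstoD) auto
  then obtain d where d: "d > 0" "\<And>h. 0 < h \<Longrightarrow> h < d \<Longrightarrow> dist (S h x) x < e / (K + 1)"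
    unfolding eventually_at_right_field by auto
  have le: "norm (S b x - S a x) < e" if "a \<in> {0..\<tau>}" "b \<in> {0..\<tau>}" "a < b" "b - a < d" for a b
  proof -
    have "S b x - S a x = S a (S (b - a) x - x)"
      using S_add[of a "b - a" x] that x by (simp add: S_diff S_range)
    then have "norm (S b x - S a x) \<le> K * norm (S (b - a) x - x)"
      using K(2)[of a "S (b - a) x - x"] that x by (simp add: diff S_range)
    also have "\<dots> \<le> K * (e / (K + 1))"
      using d(2)[of "b - a"] that K(1) by (intro mult_left_mono) (auto simp: dist_norm)
    also have "\<dots> < e" using K(1) e by (simp add: field_simps)
    finally show ?thesis .
  qed
  show "\<exists>d>0. \<forall>s\<in>{0..\<tau>}. dist s t < d \<longrightarrow> dist (S s x) (S t x) < e"
  proof (intro exI conjI ballI impI)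
    fix s assume s: "s \<in> {0..\<tau>}" "dist s t < d"
    show "dist (S s x) (S t x) < e"
      using le[of s t] le[of t s] s t e
      by (cases s t rule: linorder_cases) (auto simp: dist_norm norm_minus_commute)
  qed (rule d)
qed

text \<open>For \<open>x\<close> in the domain, \<open>S s x\<close> stays in the domain and both
  semigroups have the same right derivative there. Since \<open>T\<close> is a contraction, the norm
  of \<open>S s x - T s x\<close> has right Dini derivative at most 0 and starts at 0; density of
  the domain and boundedness of both operators finish the argument.\<close>

lemma semigroup_eq_of_generator_eq:
  assumes gen: "generator_on (range P) S = generator_on (range P) T"
    and dense: "range P \<subseteq> closure (Domain (generator_on (range P) T))"
    and t: "t \<ge> 0" and x: "P x = x"
  shows "S t x = T t x"
proof -
  have on_dom: "S t x = T t x" if xy: "(x, y) \<in> generator_on (range P) T" for x y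
  proof -
    have x: "P x = x" "P y = y" using xy by (auto simp: generator_on_def range_iff)
    have dS: "((\<lambda>h. (S h x - x) /\<^sub>R h) \<longlongrightarrow> y) (at_right 0)"
      using xy unfolding gen[symmetric] by (auto simp: generator_on_def)
    have "norm (S t x - T t x) \<le> norm (S 0 x - T 0 x)"
    proof (rule right_dini_le[OF t])
      show "continuous_on {0..t} (\<lambda>t. norm (S t x - T t x))"
        by (intro continuous_intros S_continuous continuous_on_T x) auto
      fix s e :: real assume s: "s \<in> {0..<t}" and e: "e > 0"
      let ?y = "S s x"
      have Py: "P ?y = ?y" using s x by (intro S_range) auto
      have bl: "bounded_linear (\<lambda>x. S s (P x))" using s by (intro S_linear) auto
      have ev: "\<forall>\<^sub>F h :: real in at_right 0. h > 0" by (simp add: eventually_at_right_less)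
      \<comment> \<open>Applying \<open>S s\<close> to the difference quotient at \<open>x\<close>
        and commuting gives the difference quotient at \<open>S s x\<close>, which is thereby in the
        common domain.\<close>
      have "((\<lambda>h. S s (P ((S h x - x) /\<^sub>R h))) \<longlongrightarrow> S s (P y)) (at_right 0)"
        by (rule bounded_linear.tendsto[OF bl dS])
      moreover have "\<forall>\<^sub>F h in at_right 0. S s (P ((S h x - x) /\<^sub>R h)) = (S h ?y - ?y) /\<^sub>R h"
        using ev
      proof eventually_elim
        case (elim h)
        have "S s (P ((S h x - x) /\<^sub>R h)) = S s (P (S h x - x)) /\<^sub>R h"
          using linear_scale[OF bounded_linear.linear[OF bl]] by simp
        also have "S s (P (S h x - x)) = S s (S h x) - S s x"
          using x elim s by (simp add: diff S_range S_diff)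
        also have "S s (S h x) = S h (S s x)"
          using S_add[of s h x] S_add[of h s x] elim s x by (simp add: add.commute)
        finally show ?case .
      qed
      ultimately have dSy: "((\<lambda>h. (S h ?y - ?y) /\<^sub>R h) \<longlongrightarrow> S s y) (at_right 0)"
        using x by (simp add: tendsto_cong)
      then have "(?y, S s y) \<in> generator_on (range P) S"
        using s x by (auto simp: generator_on_def range_iff S_range)
      then have dTy: "((\<lambda>h. (T h ?y - ?y) /\<^sub>R h) \<longlongrightarrow> S s y) (at_right 0)"
        unfolding gen by (simp add: generator_on_def)
      have "((\<lambda>h. norm ((S h ?y - ?y) /\<^sub>R h - (T h ?y - ?y) /\<^sub>R h)) \<longlongrightarrow> norm (S s y - S s y)) (at_right 0)"
        by (intro tendsto_intros dSy dTy)
      then have "\<forall>\<^sub>F h in at_right 0. norm ((S h ?y - ?y) /\<^sub>R h - (T h ?y - ?y) /\<^sub>R h) < e"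
        using e by (intro order_tendstoD) auto
      with ev show "\<forall>\<^sub>F h in at_right 0. norm (S (s + h) x - T (s + h) x) \<le> norm (S s x - T s x) + e * h"
      proof eventually_elim
        case (elim h)
        have eq: "(S h ?y - ?y) /\<^sub>R h - (T h ?y - ?y) /\<^sub>R h = (S h ?y - T h ?y) /\<^sub>R h"
          by (simp add: algebra_simps)
        have "norm ((S h ?y - T h ?y) /\<^sub>R h) < e" using elim(2) unfolding eq .
        then have "norm (S h ?y - T h ?y) / h < e" using elim(1) by (simp add: divide_inverse mult.commute)
        then have "norm (S h ?y - T h ?y) \<le> e * h" using elim(1) by (simp add: pos_divide_less_eq)
        moreover have "norm (T h (?y - T s x)) \<le> norm (?y - T s x)" using elim by (intro T_contr) auto
        \<comment> \<open>The first summand is \<open>o(h)\<close> by equality of the generators;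
          the second is no longer than the current distance by contractivity.\<close>
        moreover have "S (s + h) x - T (s + h) x = (S h ?y - T h ?y) + T h (?y - T s x)"
          using S_add[of h s x] T_add[of h s x] elim s x by (simp add: T_diff add.commute)
        ultimately show ?case using norm_triangle_ineq[of "S h ?y - T h ?y" "T h (?y - T s x)"] by simp
      qed
    qed
    then show ?thesis using x by (simp add: S_zero T_zero)
  qed
  have "closed {x. S t (P x) - T t x = 0}"
    using S_linear[OF t] T_linear[OF t]
    by (intro closed_Collect_eq continuous_intros linear_continuous_on)
  moreover have "Domain (generator_on (range P) T) \<subseteq> {x. S t (P x) - T t x = 0}"
    using on_dom by (auto simp: generator_on_def range_iff)
  ultimately have "closure (Domain (generator_on (range P) T)) \<subseteq> {x. S t (P x) - T t x = 0}"
    by (rule closure_minimal[rotated])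
  then have "x \<in> {x. S t (P x) - T t x = 0}" using dense x range_iff[of x] by blast
  then show ?thesis using x by simp
qed

end

text \<open>Whatever semigroup witnesses \<open>mild_solution\<close>, it has the generator of
  \<open>T\<close> and so agrees with \<open>T\<close> on the range of \<open>P\<close>, where the
  initial value and the values of \<open>f\<close> along the solution lie.\<close>

lemma mild_solution_iff_mild_on:
  assumes gen: "generator_on (range P) T = G" and dense: "range P \<subseteq> closure (Domain G)"
    and f: "\<And>x. P x = x \<Longrightarrow> P (f x) = f x" and z0: "P z0 = z0"
    and I: "\<And>t. t \<in> I \<Longrightarrow> t \<ge> 0 \<and> {0..t} \<subseteq> I"
  shows "mild_solution (range P) G f I z0 z \<longleftrightarrow> mild_on f I z0 z"
proof
  assume "mild_solution (range P) G f I z0 z"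
  then obtain S where z: "continuous_on I z" "\<forall>t\<in>I. P (z t) = z t"
    and S: "c0_semigroup_on (range P) S" "generator_on (range P) S = G"
    and hi: "\<And>t. t \<in> I \<Longrightarrow> ((\<lambda>s. S (t - s) (f (z s))) has_integral (z t - S t z0)) {0..t}"
    unfolding mild_solution_def range_iff by blast
  have eq: "S t x = T t x" if "t \<ge> 0" "P x = x" for t x
    using semigroup_eq_of_generator_eq[OF S(1), of t x] S(2) gen dense that by simp
  have "((\<lambda>s. T (t - s) (f (z s))) has_integral (z t - T t z0)) {0..t}" if t: "t \<in> I" for t
  proof -
    have "S (t - s) (f (z s)) = T (t - s) (f (z s))" if "s \<in> {0..t}" for s
      using that I[OF t] z(2) by (intro eq f) auto
    with hi[OF t] show ?thesis using eq[of t z0] z0 I[OF t]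
      by (subst has_integral_cong[where g = "\<lambda>s. S (t - s) (f (z s))"]) auto
  qed
  then show "mild_on f I z0 z" using z by (auto simp: mild_on_def)
next
  assume "mild_on f I z0 z"
  then show "mild_solution (range P) G f I z0 z"
    using c0_semigroup_T gen unfolding mild_solution_def mild_on_def range_iff by blast
qed

end

lemma norm_triangle_3:
  fixes a b c :: "'a::real_normed_vector"
  shows "norm (a + b + c) \<le> norm a + norm b + norm c"
    and "norm (a - b + c) \<le> norm a + norm b + norm c"
    and "norm (a + b - c) \<le> norm a + norm b + norm c"
    and "norm (a - b - c) \<le> norm a + norm b + norm c"
  by norm+

section \<open>Semigroups generated by skew-adjoint operators with bounded inverse\<close>

text \<open>\<open>M\<close> is the inverse of the generator, extended by \<open>0\<close> to the kernel of \<open>P\<close>.\<close>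

locale skew_operator = P: bounded_linear P + M: bounded_linear M
  for P M :: "'w::{real_inner,banach} \<Rightarrow> 'w" +
  assumes P_idem: "P (P x) = P x"
    and P_contr: "norm (P x) \<le> norm x"
    and M_P: "M (P x) = M x"
    and P_M: "P (M x) = M x"
    and skew: "M x \<bullet> x = 0"
    and M_inj: "P x = x \<Longrightarrow> M x = 0 \<Longrightarrow> x = 0"
begin

text \<open>Skewness makes \<open>M d\<close> orthogonal to \<open>d\<close>, so the squared norm of
  \<open>(1 - s h) d + s M d\<close> is a sum of two squares. For a suitable \<open>s\<close> the
  relaxed iteration \<open>u + s (M u - h u - v)\<close> is therefore a strict contraction.\<close>

lemma resolvent_ex1:
  assumes h: "h > 0"
  shows "\<exists>!u. M u - h *\<^sub>R u = v"
proof -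
  obtain m where m: "m > 0" "\<And>x. norm (M x) \<le> norm x * m" using M.pos_bounded by blast
  \<comment> \<open>This value minimises \<open>(1 - s h)^2 + s^2 m^2\<close>; the minimum is
    \<open>m^2 / (h^2 + m^2)\<close>, the square of the contraction constant
    \<open>c\<close>.\<close>
  define s where "s = h / (h\<^sup>2 + m\<^sup>2)"
  have pos: "h\<^sup>2 + m\<^sup>2 > 0" using h m by (simp add: add_pos_pos)
  have s: "s > 0" using h pos by (simp add: s_def)
  define c where "c = sqrt (m\<^sup>2 / (h\<^sup>2 + m\<^sup>2))"
  have c: "0 \<le> c" "c < 1" using h pos by (auto simp: c_def field_simps)
  have c2: "c\<^sup>2 = m\<^sup>2 / (h\<^sup>2 + m\<^sup>2)" using pos by (simp add: c_def)
  have sh: "(1 - s * h)\<^sup>2 + s\<^sup>2 * m\<^sup>2 = c\<^sup>2"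
  proof -
    define D where "D = h\<^sup>2 + m\<^sup>2"
    have D: "D > 0" "s = h / D" "c\<^sup>2 = m\<^sup>2 / D" "h\<^sup>2 = D - m\<^sup>2"
      using pos by (simp_all add: D_def s_def c2)
    have "s\<^sup>2 * D = s * h"
      using D by (simp add: power2_eq_square)
    then have "s\<^sup>2 * h\<^sup>2 + s\<^sup>2 * m\<^sup>2 = s * h" by (simp add: D_def algebra_simps)
    then have "(1 - s * h)\<^sup>2 + s\<^sup>2 * m\<^sup>2 = 1 - s * h"
      by (simp add: power2_eq_square algebra_simps)
    moreover have "s * h = h\<^sup>2 / D" using D(2) by (simp add: power2_eq_square)
    moreover have "1 - h\<^sup>2 / D = c\<^sup>2" unfolding D(3,4) using D(1) by (simp add: diff_divide_distrib)
    ultimately show ?thesis by argo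
  qed
  have contr: "norm ((1 - s * h) *\<^sub>R d + s *\<^sub>R M d) \<le> c * norm d" for d
  proof (rule power2_le_imp_le)
    have "(norm ((1 - s * h) *\<^sub>R d + s *\<^sub>R M d))\<^sup>2 = (1 - s * h)\<^sup>2 * (norm d)\<^sup>2 + s\<^sup>2 * (norm (M d))\<^sup>2"
      using skew[of d] unfolding power2_norm_eq_inner
      by (simp add: inner_add_left inner_add_right inner_commute[of d "M d"] power2_eq_square)
    also have "\<dots> \<le> (1 - s * h)\<^sup>2 * (norm d)\<^sup>2 + s\<^sup>2 * (norm d * m)\<^sup>2"
      using m by (intro add_left_mono mult_left_mono power_mono) auto
    also have "\<dots> = ((1 - s * h)\<^sup>2 + s\<^sup>2 * m\<^sup>2) * (norm d)\<^sup>2" by (simp add: algebra_simps power_mult_distrib)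
    finally show "(norm ((1 - s * h) *\<^sub>R d + s *\<^sub>R M d))\<^sup>2 \<le> (c * norm d)\<^sup>2"
      by (simp add: sh power_mult_distrib)
  qed (use c in simp)
  define \<Phi> where "\<Phi> u = u + s *\<^sub>R (M u - h *\<^sub>R u - v)" for u
  have "\<forall>x y. dist (\<Phi> x) (\<Phi> y) \<le> c * dist x y"
  proof (intro allI)
    fix x y
    have "\<Phi> x - \<Phi> y = (1 - s * h) *\<^sub>R (x - y) + s *\<^sub>R M (x - y)"
      by (simp add: \<Phi>_def algebra_simps M.diff)
    then show "dist (\<Phi> x) (\<Phi> y) \<le> c * dist x y" using contr[of "x - y"] by (simp add: dist_norm)
  qed
  then have "\<exists>!u. \<Phi> u = u" by (intro banach_fix_type[OF c])
  moreover have "\<Phi> u = u \<longleftrightarrow> M u - h *\<^sub>R u = v" for u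
  proof -
    have "\<Phi> u = u \<longleftrightarrow> s *\<^sub>R (M u - h *\<^sub>R u - v) = 0" by (simp add: \<Phi>_def)
    also have "\<dots> \<longleftrightarrow> M u - h *\<^sub>R u = v" using s by simp
    finally show ?thesis .
  qed
  ultimately show ?thesis by simp
qed

text \<open>\<open>R h = (1 - h G)\<inverse>\<close> for the generator \<open>G = M\<inverse>\<close>, the implicit Euler step, and \<open>U h = G R h\<close>.\<close>

definition U :: "real \<Rightarrow> 'w \<Rightarrow> 'w" where "U h v = (THE u. M u - h *\<^sub>R u = v)"

definition R :: "real \<Rightarrow> 'w \<Rightarrow> 'w" where "R h v = M (U h v)"

lemma U_eq: "h > 0 \<Longrightarrow> M (U h v) - h *\<^sub>R U h v = v"
  unfolding U_def by (rule theI'[OF resolvent_ex1])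

lemma U_unique: "h > 0 \<Longrightarrow> M u - h *\<^sub>R u = v \<Longrightarrow> U h v = u"
  unfolding U_def using resolvent_ex1 by (intro the1_equality)

lemma R_eq: "h > 0 \<Longrightarrow> R h v = v + h *\<^sub>R U h v"
  using U_eq[of h v] by (simp add: R_def algebra_simps)

lemma U_linear: "h > 0 \<Longrightarrow> linear (U h)"
proof
  fix x y and c :: real assume h: "h > 0"
  show "U h (x + y) = U h x + U h y"
    using h U_eq[OF h, of x] U_eq[OF h, of y] by (intro U_unique) (auto simp: M.add algebra_simps)
  have "M (c *\<^sub>R U h x) - h *\<^sub>R (c *\<^sub>R U h x) = c *\<^sub>R (M (U h x) - h *\<^sub>R U h x)"
    by (simp add: M.scaleR algebra_simps)
  then show "U h (c *\<^sub>R x) = c *\<^sub>R U h x"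
    using h U_eq[OF h, of x] by (intro U_unique) auto
qed

lemma U_M: "h > 0 \<Longrightarrow> U h (M x) = M (U h x)"
  using arg_cong[OF U_eq[of h x], of M] by (intro U_unique) (auto simp: M.diff M.scaleR)

lemma R_linear: "h > 0 \<Longrightarrow> linear (R h)"
  using linear_compose[OF U_linear M.linear] by (simp add: R_def[abs_def] o_def)

lemma R_M: "h > 0 \<Longrightarrow> R h (M x) = M (R h x)"
  by (simp add: R_def U_M)

text \<open>For \<open>y = M x\<close> this is \<open>R h y - y = h R h (G y)\<close> with
  \<open>G\<close> the inverse of \<open>M\<close>; all consistency estimates of the Euler scheme
  come from it.\<close>

lemma R_M_diff: "h > 0 \<Longrightarrow> R h (M x) - M x = h *\<^sub>R R h x"
  by (simp add: R_eq[of h "M x"] U_M) (simp add: R_def)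

text \<open>\<open>R h v = M (U h v)\<close> is orthogonal to \<open>U h v\<close>, while
  \<open>v\<close> and \<open>R h v\<close> differ by a multiple of \<open>U h v\<close>. The
  resulting identity for the squared norm gives contractivity by Cauchy-Schwarz.\<close>

lemma R_norm:
  assumes h: "h > 0"
  shows "norm (R h v) \<le> norm v" and norm_R_sq: "(norm (R h v))\<^sup>2 = v \<bullet> R h v"
proof -
  have "v \<bullet> R h v = (R h v - h *\<^sub>R U h v) \<bullet> R h v" using R_eq[OF h, of v] by simp
  also have "\<dots> = (norm (R h v))\<^sup>2"
    using skew[of "U h v"]
    by (simp add: inner_diff_left power2_norm_eq_inner R_def inner_commute[of "U h v" "M (U h v)"])
  finally show eq: "(norm (R h v))\<^sup>2 = v \<bullet> R h v" ..
  show "norm (R h v) \<le> norm v"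
  proof (cases "R h v = 0")
    case False
    have "norm (R h v) * norm (R h v) \<le> norm v * norm (R h v)"
      using eq norm_cauchy_schwarz[of v "R h v"] by (simp add: power2_eq_square)
    then show ?thesis using False by simp
  qed simp
qed

lemma Rn_linear: "h > 0 \<Longrightarrow> linear (R h ^^ k)"
proof (induction k)
  case 0 then show ?case by (simp add: linear_id[unfolded id_def])
next
  case (Suc k)
  show ?case
    using linear_compose[OF Suc.IH[OF Suc.prems] R_linear[OF Suc.prems]] by (simp add: o_def)
qed

lemma Rn_diff: "h > 0 \<Longrightarrow> (R h ^^ k) (x - y) = (R h ^^ k) x - (R h ^^ k) y"
  by (rule linear_diff[OF Rn_linear])

lemma Rn_norm: "h > 0 \<Longrightarrow> norm ((R h ^^ k) x) \<le> norm x"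
  by (induction k) (auto intro: order_trans[OF R_norm(1)])

lemma Rn_M: "h > 0 \<Longrightarrow> (R h ^^ k) (M x) = M ((R h ^^ k) x)"
  by (induction k) (auto simp: R_M)

lemma Rn_P: "h > 0 \<Longrightarrow> P ((R h ^^ k) (P x)) = (R h ^^ k) (P x)"
  by (induction k) (auto simp: P_idem R_def P_M)

lemma Rn_M_diff: "h > 0 \<Longrightarrow> norm ((R h ^^ k) (M x) - M x) \<le> real k * h * norm x"
proof (induction k)
  case (Suc k)
  have "(R h ^^ Suc k) (M x) - M x = R h ((R h ^^ k) (M x) - M x) + (R h (M x) - M x)"
    using Suc.prems by (simp add: linear_diff[OF R_linear])
  also have "norm \<dots> \<le> norm ((R h ^^ k) (M x) - M x) + norm (h *\<^sub>R R h x)"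
    unfolding R_M_diff[OF Suc.prems] using R_norm(1)[OF Suc.prems]
    by (intro order_trans[OF norm_triangle_ineq add_mono]) auto
  also have "\<dots> \<le> real k * h * norm x + h * norm x"
    using Suc R_norm(1)[OF Suc.prems, of x] by (intro add_mono) auto
  finally show ?case by (simp add: algebra_simps)
qed simp

text \<open>\<open>M (M y)\<close> lies in the domain of the squared generator, where
  \<open>k\<close> Euler steps agree with the linear Taylor polynomial up to the square of the
  elapsed time \<open>k h\<close>. The induction adds one step, whose own error is again controlled
  by \<open>Rn_M_diff\<close>.\<close>

lemma Rn_MM_diff:
  "h > 0 \<Longrightarrow> norm ((R h ^^ k) (M (M y)) - M (M y) - (real k * h) *\<^sub>R M y) \<le> (real k * h)\<^sup>2 * norm y"
proof (induction k)
  case (Suc k)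
  let ?x = "M y"
  have Rx: "norm (R h ?x - ?x) \<le> h * norm y" using Rn_M_diff[OF Suc.prems, of 1 y] by simp
  have "(R h ^^ Suc k) (M ?x) - M ?x - (real (Suc k) * h) *\<^sub>R ?x
     = R h ((R h ^^ k) (M ?x) - M ?x - (real k * h) *\<^sub>R ?x) + (real k * h) *\<^sub>R (R h ?x - ?x)
       + (R h (M ?x) - M ?x - h *\<^sub>R ?x)"
    using Suc.prems by (simp add: linear_diff[OF R_linear] linear_scale[OF R_linear] linear_add[OF R_linear] algebra_simps)
  also have "R h (M ?x) - M ?x - h *\<^sub>R ?x = h *\<^sub>R (R h ?x - ?x)"
    using R_M_diff[OF Suc.prems, of ?x] by (simp add: algebra_simps)
  also have "norm (R h ((R h ^^ k) (M ?x) - M ?x - (real k * h) *\<^sub>R ?x) + (real k * h) *\<^sub>R (R h ?x - ?x)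
       + h *\<^sub>R (R h ?x - ?x)) \<le> (real k * h)\<^sup>2 * norm y + (real k * h) * (h * norm y) + h * (h * norm y)"
    using Suc.prems Rx
    by (intro order_trans[OF norm_triangle_3(1)] add_mono order_trans[OF R_norm(1) Suc.IH])
      (auto intro!: mult_left_mono)
  also have "\<dots> \<le> (real (Suc k) * h)\<^sup>2 * norm y"
    using Suc.prems by (simp add: power2_eq_square algebra_simps)
  finally show ?case .
qed simp

text \<open>The first-order terms of one step and of two half steps cancel. What remains is
  \<open>h / 2\<close> times differences \<open>R y - y\<close>, each of order \<open>h\<close>
  because \<open>y = M u\<close> is in the domain of the generator.\<close>

lemma resolvent_doubling:
  assumes h: "h > 0"
  shows "norm (R h (M (M u)) - R (h / 2) (R (h / 2) (M (M u)))) \<le> 2 * h\<^sup>2 * norm u"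
proof -
  define g y where "g = h / 2" and "y = M u"
  have g: "g > 0" "h = g + g" using h by (simp_all add: g_def)
  have 1: "norm (R h y - y) \<le> h * norm u" using Rn_M_diff[OF h, of 1 u] by (simp add: y_def)
  have 2: "norm (R g y - y) \<le> g * norm u" using Rn_M_diff[OF g(1), of 1 u] by (simp add: y_def)
  have 3: "norm (R g (R g y) - y) \<le> h * norm u"
    using Rn_M_diff[OF g(1), of 2 u] g by (simp add: eval_nat_numeral y_def)
  have "R g (R g (M y)) = R g (M y) + g *\<^sub>R R g (R g y)"
    using R_M_diff[OF g(1), of "R g y"] R_M[OF g(1)] by (simp add: algebra_simps)
  moreover have "R g (M y) = M y + g *\<^sub>R R g y" using R_M_diff[OF g(1), of y] by (simp add: algebra_simps)
  moreover have "R h (M y) = M y + (g *\<^sub>R R h y + g *\<^sub>R R h y)"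
    using R_M_diff[OF h, of y] scaleR_add_left[of g g "R h y"] unfolding g(2)[symmetric] by (simp add: algebra_simps)
  ultimately have "R h (M y) - R g (R g (M y))
      = g *\<^sub>R ((R h y - y) - (R g y - y) + (R h y - y) - (R g (R g y) - y))"
    by (simp add: scaleR_diff_right scaleR_add_right)
  also have "norm \<dots> = g * norm ((R h y - y) - (R g y - y) + (R h y - y) - (R g (R g y) - y))"
    using g by simp
  also have "\<dots> \<le> g * (h * norm u + g * norm u + h * norm u + h * norm u)"
  proof (rule mult_left_mono)
    have "norm (p - q + r - s) \<le> norm p + norm q + norm r + norm s" for p q r s :: 'w by norm
    then show "norm ((R h y - y) - (R g y - y) + (R h y - y) - (R g (R g y) - y))
        \<le> h * norm u + g * norm u + h * norm u + h * norm u"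
      using 1 2 3 by (meson add_mono order_trans)
  qed (use g in simp)
  also have "\<dots> \<le> 2 * h\<^sup>2 * norm u"
    using g by (simp add: power2_eq_square algebra_simps)
  finally show ?thesis by (simp add: g_def y_def)
qed

text \<open>Local errors add up since the steps are contractions and commute with \<open>M\<close>.
  The total is of order \<open>k h\<close> times \<open>h\<close>, hence summable along dyadic step
  sizes at a fixed time; \<open>u\<close> must vary in the induction because the first step replaces
  it by \<open>R h u\<close>.\<close>

lemma resolvent_doubling_power:
  assumes h: "h > 0"
  shows "norm ((R h ^^ k) (M (M u)) - (R (h / 2) ^^ (2 * k)) (M (M u))) \<le> real k * (2 * h\<^sup>2 * norm u)"
proof (induction k arbitrary: u)
  case (Suc k)
  have g: "h / 2 > 0" using h by simp
  let ?x = "M (M u)" and ?A = "R (h / 2) ^^ (2 * k)"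
  have "(R (h / 2) ^^ (2 * Suc k)) ?x = ?A (R (h / 2) (R (h / 2) ?x))"
    using funpow_add[of "2 * k" 2 "R (h / 2)"] by (simp add: eval_nat_numeral)
  moreover have "(R h ^^ Suc k) ?x = (R h ^^ k) (R h ?x)" by (simp only: funpow_Suc_right o_apply)
  ultimately have eq: "(R h ^^ Suc k) ?x - (R (h / 2) ^^ (2 * Suc k)) ?x
      = ((R h ^^ k) (M (M (R h u))) - ?A (M (M (R h u)))) + ?A (R h ?x - R (h / 2) (R (h / 2) ?x))"
    by (simp add: Rn_diff[OF g] R_M[OF h])
  have "norm ((R h ^^ Suc k) ?x - (R (h / 2) ^^ (2 * Suc k)) ?x)
      \<le> real k * (2 * h\<^sup>2 * norm (R h u)) + norm (R h ?x - R (h / 2) (R (h / 2) ?x))"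
    unfolding eq by (rule order_trans[OF norm_triangle_ineq add_mono[OF Suc[of "R h u"] Rn_norm[OF g, of "2 * k"]]])
  also have "\<dots> \<le> real k * (2 * h\<^sup>2 * norm u) + 2 * h\<^sup>2 * norm u"
  proof (rule add_mono[OF _ resolvent_doubling[OF h]])
    have "2 * h\<^sup>2 * norm (R h u) \<le> 2 * h\<^sup>2 * norm u"
      by (rule mult_left_mono[OF R_norm(1)[OF h]]) simp
    then show "real k * (2 * h\<^sup>2 * norm (R h u)) \<le> real k * (2 * h\<^sup>2 * norm u)"
      by (rule mult_left_mono) simp
  qed
  also have "\<dots> = real (Suc k) * (2 * h\<^sup>2 * norm u)"
    by (simp only: of_nat_Suc distrib_right mult_1_left add.commute)
  finally show ?case .
qed simp

text \<open>The resolvents converge strongly: \<open>\<parallel>R\<^sub>h y - R\<^sub>k y\<parallel>\<^sup>2\<close> is a multiple of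
  \<open>\<parallel>R\<^sub>k y\<parallel>\<^sup>2 - \<parallel>R\<^sub>h y\<parallel>\<^sup>2\<close>, so the bounded monotone norms force a Cauchy sequence.\<close>

lemma R_dist_sq:
  assumes h: "h > 0" and k: "k > 0"
  shows "(h + k) * (norm (R h y - R k y))\<^sup>2 = (h - k) * ((norm (R k y))\<^sup>2 - (norm (R h y))\<^sup>2)"
proof -
  let ?a = "R h y" and ?b = "R k y"
  have anti: "M x \<bullet> z = - (M z \<bullet> x)" for x z
    using skew[of "x + z"] by (simp add: M.add inner_add skew)
  define g where "g = U k y \<bullet> ?a"
  have g': "U h y \<bullet> ?b = - g"
    using anti[of "U k y" "U h y"] by (simp add: g_def R_def inner_commute)
  have 0: "U k y \<bullet> ?b = 0" "U h y \<bullet> ?a = 0" using skew by (auto simp: R_def inner_commute)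
  have d: "?a - ?b = h *\<^sub>R U h y - k *\<^sub>R U k y" using R_eq[OF h, of y] R_eq[OF k, of y] by simp
  have A: "?a \<bullet> ?a - ?b \<bullet> ?a = - k * g"
    using arg_cong[OF d, of "\<lambda>x. x \<bullet> ?a"] by (simp add: inner_diff_left 0 g_def)
  have B: "?a \<bullet> ?b - ?b \<bullet> ?b = - h * g"
    using arg_cong[OF d, of "\<lambda>x. x \<bullet> ?b"] by (simp add: inner_diff_left 0 g')
  have "(norm (?a - ?b))\<^sup>2 = (h - k) * g"
    using A B by (simp add: power2_norm_eq_inner inner_diff inner_commute[of ?b ?a] algebra_simps)
  moreover have "(norm ?b)\<^sup>2 - (norm ?a)\<^sup>2 = (h + k) * g"
    using A B by (simp add: power2_norm_eq_inner inner_commute[of ?b ?a] algebra_simps)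
  ultimately show ?thesis by simp
qed

lemma P_in_closure: "P y = y \<Longrightarrow> y \<in> closure (range M)"
proof -
  assume Py: "P y = y"
  define h where "h n = 1 / real (Suc n)" for n
  have h: "h n > 0" for n by (simp add: h_def)
  have hle: "h n \<le> h m" if "m \<le> n" for m n using that by (simp add: h_def frac_le)
  define r where "r n = (norm (R (h n) y))\<^sup>2" for n
  have bound: "(norm (R (h m) y - R (h n) y))\<^sup>2 \<le> r n - r m" and mono: "r m \<le> r n" if mn: "m \<le> n" for m n
  proof -
    have eq: "(h m + h n) * (norm (R (h m) y - R (h n) y))\<^sup>2 = (h m - h n) * (r n - r m)"
      unfolding r_def by (rule R_dist_sq[OF h h])
    have nn: "0 \<le> (h m + h n) * (norm (R (h m) y - R (h n) y))\<^sup>2" using h[of m] h[of n] by simp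
    show mono: "r m \<le> r n"
    proof (cases "h m = h n")
      case True
      show ?thesis unfolding r_def True by (rule order_refl)
    next
      case False
      then have "h m - h n > 0" using hle[OF mn] by simp
      have "0 \<le> (h m - h n) * (r n - r m)" using nn unfolding eq .
      then show ?thesis using \<open>h m - h n > 0\<close> mult_pos_neg[of "h m - h n" "r n - r m"] by linarith
    qed
    have "(h m + h n) * (norm (R (h m) y - R (h n) y))\<^sup>2 \<le> (h m + h n) * (r n - r m)"
      unfolding eq using mono h[of n] by (intro mult_right_mono) auto
    then show "(norm (R (h m) y - R (h n) y))\<^sup>2 \<le> r n - r m"
      using h[of m] h[of n] by (simp add: mult_le_cancel_left_pos)
  qed
  have "convergent r"
  proof (rule Bseq_monoseq_convergent)
    show "monoseq r" using mono by (auto simp: monoseq_def)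
    show "Bseq r"
      by (rule BseqI'[of _ "(norm y)\<^sup>2"]) (auto simp: r_def intro!: power_mono R_norm(1) h)
  qed
  then have cr: "Cauchy r" by (simp add: Cauchy_convergent_iff)
  have "Cauchy (\<lambda>n. R (h n) y)"
  proof (rule CauchyI')
    fix e :: real assume e: "e > 0"
    then obtain N where N: "\<And>m n. m \<ge> N \<Longrightarrow> n \<ge> N \<Longrightarrow> norm (r m - r n) < e\<^sup>2"
      using CauchyD[OF cr, of "e\<^sup>2"] by auto
    have "dist (R (h m) y) (R (h n) y) < e" if "m \<ge> N" "m < n" for m n
    proof -
      have "(norm (R (h m) y - R (h n) y))\<^sup>2 < e\<^sup>2" using bound[of m n] N[of m n] that by auto
      then show ?thesis using e by (simp add: dist_norm power2_less_imp_less)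
    qed
    then show "\<exists>N. \<forall>m\<ge>N. \<forall>n>m. dist (R (h m) y) (R (h n) y) < e" by blast
  qed
  then obtain z where z: "(\<lambda>n. R (h n) y) \<longlonglongrightarrow> z" by (auto simp: Cauchy_convergent_iff convergent_def)
  have "P z = z"
    using P.tendsto[OF z] z LIMSEQ_unique by (fastforce simp: R_def P_M)
  \<comment> \<open>The limit \<open>z\<close> is identified with \<open>y\<close> through
    \<open>M\<close>: \<open>M (R h y - y) = h R h y\<close> tends to 0, and \<open>M\<close> is
    injective on the range of \<open>P\<close>.\<close>
  have "(\<lambda>n. h n *\<^sub>R R (h n) y) \<longlonglongrightarrow> 0 *\<^sub>R z"
    unfolding h_def by (intro tendsto_intros z[unfolded h_def] LIMSEQ_Suc[OF lim_1_over_n])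
  moreover have "h n *\<^sub>R R (h n) y = M (R (h n) y - y)" for n
    using R_M_diff[OF h, of n y] by (simp add: M.diff R_M[OF h])
  moreover have "(\<lambda>n. M (R (h n) y - y)) \<longlonglongrightarrow> M (z - y)"
    by (intro M.tendsto tendsto_intros z)
  ultimately have "M (z - y) = 0" using LIMSEQ_unique by fastforce
  then have "z - y = 0" using \<open>P z = z\<close> Py by (intro M_inj[of "z - y", rotated]) (simp_all only: P.diff)
  then have "(\<lambda>n. R (h n) y) \<longlonglongrightarrow> y" using z by simp
  then show ?thesis
    unfolding closure_sequential by (intro exI[of _ "\<lambda>n. R (h n) y"]) (simp add: R_def)
qed

text \<open>Continuity of \<open>M\<close> carries the density of its range over to the domain of
  the squared generator, where the doubling estimate is available.\<close>

lemma P_in_closure2: "P y = y \<Longrightarrow> y \<in> closure (range (\<lambda>x. M (M x)))"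
proof -
  have "M ` closure (range M) \<subseteq> closure (range (\<lambda>x. M (M x)))"
    by (rule image_closure_subset) (auto intro: linear_continuous_on M.bounded_linear_axioms closure_subset[THEN subsetD])
  moreover have "range M = M ` range P" using M_P by (auto simp: image_iff)
  moreover have "range P \<subseteq> closure (range M)" using P_in_closure P_idem by auto
  ultimately have "range M \<subseteq> closure (range (\<lambda>x. M (M x)))" by blast
  then have "closure (range M) \<subseteq> closure (range (\<lambda>x. M (M x)))" by (rule closure_minimal) simp
  then show "P y = y \<Longrightarrow> y \<in> closure (range (\<lambda>x. M (M x)))" using P_in_closure by blast
qed

section \<open>The semigroup as a limit of dyadic implicit Euler schemes\<close>

definition Tn :: "nat \<Rightarrow> real \<Rightarrow> 'w \<Rightarrow> 'w" where
  "Tn n t = (R ((1 / 2) ^ n) ^^ nat \<lfloor>t * 2 ^ n\<rfloor>)"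

text \<open>The prior projection by \<open>P\<close> makes the limit exist for every
  \<open>x\<close> and produces the convention \<open>T 0 = P\<close>.\<close>

definition T :: "real \<Rightarrow> 'w \<Rightarrow> 'w" where "T t x = lim (\<lambda>n. Tn n t (P x))"

lemma Tn_norm: "norm (Tn n t x) \<le> norm x" and Tn_diff: "Tn n t (x - y) = Tn n t x - Tn n t y"
  and Tn_M: "Tn n t (M x) = M (Tn n t x)" and Tn_P: "P (Tn n t (P x)) = Tn n t (P x)"
  and Tn_linear: "linear (Tn n t)"
  by (simp_all add: Tn_def Rn_norm Rn_diff Rn_M Rn_P Rn_linear)

lemma floor_le_time: "t \<ge> 0 \<Longrightarrow> real (nat \<lfloor>t * 2 ^ n\<rfloor>) * (1 / 2) ^ n \<le> t"
proof -
  assume t: "t \<ge> 0"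
  then have "real (nat \<lfloor>t * 2 ^ n\<rfloor>) \<le> t * 2 ^ n" by simp
  then have "real (nat \<lfloor>t * 2 ^ n\<rfloor>) * (1 / 2) ^ n \<le> t * 2 ^ n * (1 / 2) ^ n" by (rule mult_right_mono) simp
  then show ?thesis by (simp add: power_one_over)
qed

lemma floor_time_tendsto: "t \<ge> 0 \<Longrightarrow> (\<lambda>n. real (nat \<lfloor>t * 2 ^ n\<rfloor>) * (1 / 2) ^ n) \<longlonglongrightarrow> t"
proof (rule tendsto_sandwich[of "\<lambda>n. t - (1 / 2) ^ n" _ _ "\<lambda>_. t"])
  assume t: "t \<ge> 0"
  show "\<forall>\<^sub>F n in sequentially. t - (1 / 2) ^ n \<le> real (nat \<lfloor>t * 2 ^ n\<rfloor>) * (1 / 2) ^ n"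
  proof (intro always_eventually allI)
    fix n
    have "t * 2 ^ n - 1 \<le> real (nat \<lfloor>t * 2 ^ n\<rfloor>)" using t by simp
    then have "(t * 2 ^ n - 1) * (1 / 2) ^ n \<le> real (nat \<lfloor>t * 2 ^ n\<rfloor>) * (1 / 2) ^ n" by (rule mult_right_mono) simp
    then show "t - (1 / 2) ^ n \<le> real (nat \<lfloor>t * 2 ^ n\<rfloor>) * (1 / 2) ^ n"
      by (simp add: algebra_simps power_one_over)
  qed
  have "(\<lambda>n. t - (1 / 2 :: real) ^ n) \<longlonglongrightarrow> t - 0" by (intro tendsto_intros LIMSEQ_power_zero) auto
  then show "(\<lambda>n. t - (1 / 2 :: real) ^ n) \<longlonglongrightarrow> t" by simp
  show "\<forall>\<^sub>F n in sequentially. real (nat \<lfloor>t * 2 ^ n\<rfloor>) * (1 / 2) ^ n \<le> t"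
    by (intro always_eventually allI floor_le_time t)
qed simp

lemma Rn_step: "h > 0 \<Longrightarrow> norm ((R h ^^ Suc k) (M x) - (R h ^^ k) (M x)) \<le> h * norm x"
proof -
  assume h: "h > 0"
  have "(R h ^^ Suc k) (M x) - (R h ^^ k) (M x) = (R h ^^ k) (R h (M x) - M x)"
    by (simp only: funpow_Suc_right o_apply Rn_diff[OF h])
  also have "norm \<dots> \<le> norm (R h (M x) - M x)" by (rule Rn_norm[OF h])
  also have "\<dots> \<le> h * norm x" using Rn_M_diff[OF h, of 1 x] by simp
  finally show ?thesis .
qed

text \<open>Halving the step turns \<open>k\<close> steps into \<open>2 k\<close> or
  \<open>2 k + 1\<close> of them. Doubling accounts for \<open>2 t\<close> times the norm of
  \<open>u\<close>, a possible extra half-size step for the norm of \<open>M u\<close>; both come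
  with the factor \<open>(1 / 2) ^ n\<close>.\<close>

lemma Tn_step:
  assumes t: "t \<ge> 0"
  shows "norm (Tn (Suc n) t (M (M u)) - Tn n t (M (M u))) \<le> (1 / 2) ^ n * (2 * t * norm u + norm (M u))"
proof -
  define h :: real where "h = (1 / 2) ^ n"
  define k where "k = nat \<lfloor>t * 2 ^ n\<rfloor>"
  let ?x = "M (M u)"
  have h: "h > 0" "h / 2 > 0" by (auto simp: h_def)
  have kh: "real k * h \<le> t" unfolding k_def h_def by (rule floor_le_time[OF t])
  have "\<lfloor>t * 2 ^ Suc n\<rfloor> = 2 * \<lfloor>t * 2 ^ n\<rfloor> \<or> \<lfloor>t * 2 ^ Suc n\<rfloor> = 2 * \<lfloor>t * 2 ^ n\<rfloor> + 1"
  proof -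
    have "t * 2 ^ Suc n = 2 * (t * 2 ^ n)" by simp
    then show ?thesis by linarith
  qed
  then have k': "nat \<lfloor>t * 2 ^ Suc n\<rfloor> = 2 * k \<or> nat \<lfloor>t * 2 ^ Suc n\<rfloor> = Suc (2 * k)"
  proof
    assume a: "\<lfloor>t * 2 ^ Suc n\<rfloor> = 2 * \<lfloor>t * 2 ^ n\<rfloor>"
    show ?thesis unfolding a k_def by (simp add: nat_mult_distrib)
  next
    assume a: "\<lfloor>t * 2 ^ Suc n\<rfloor> = 2 * \<lfloor>t * 2 ^ n\<rfloor> + 1"
    have "0 \<le> \<lfloor>t * 2 ^ n\<rfloor>" using t by simp
    then show ?thesis unfolding a k_def by (simp add: nat_add_distrib nat_mult_distrib)
  qed
  have 1: "norm ((R h ^^ k) ?x - (R (h / 2) ^^ (2 * k)) ?x) \<le> 2 * t * norm u * h"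
  proof -
    have "norm ((R h ^^ k) ?x - (R (h / 2) ^^ (2 * k)) ?x) \<le> real k * (2 * h\<^sup>2 * norm u)"
      by (rule resolvent_doubling_power[OF h(1)])
    also have "\<dots> = (real k * h) * (2 * h * norm u)" by (simp add: power2_eq_square)
    also have "\<dots> \<le> t * (2 * h * norm u)" using kh h by (intro mult_right_mono) auto
    finally show ?thesis by (simp add: mult_ac)
  qed
  have 2: "norm ((R (h / 2) ^^ nat \<lfloor>t * 2 ^ Suc n\<rfloor>) ?x - (R (h / 2) ^^ (2 * k)) ?x) \<le> h / 2 * norm (M u)"
    using k' Rn_step[OF h(2), of "2 * k" "M u"] h by auto
  have "Tn (Suc n) t ?x - Tn n t ?x = ((R (h / 2) ^^ nat \<lfloor>t * 2 ^ Suc n\<rfloor>) ?x - (R (h / 2) ^^ (2 * k)) ?x)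
     - ((R h ^^ k) ?x - (R (h / 2) ^^ (2 * k)) ?x)"
    by (simp add: Tn_def h_def k_def)
  also have "norm \<dots> \<le> h / 2 * norm (M u) + 2 * t * norm u * h"
    by (rule order_trans[OF norm_triangle_ineq4 add_mono[OF 2 1]])
  also have "\<dots> \<le> h * (2 * t * norm u + norm (M u))"
    using h by (simp add: algebra_simps)
  finally show ?thesis by (simp add: h_def)
qed

text \<open>On the range of \<open>M\<close> composed with itself the increments are summable; the
  uniform contraction bound and density transfer the Cauchy property to the whole range of
  \<open>P\<close>.\<close>

lemma Tn_convergent:
  assumes t: "t \<ge> 0" and x: "P x = x"
  shows "convergent (\<lambda>n. Tn n t x)"
proof -
  have c: "convergent (\<lambda>n. Tn n t (M (M u)))" for u
  proof -
    have "summable (\<lambda>n. Tn (Suc n) t (M (M u)) - Tn n t (M (M u)))"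
    proof (rule summable_comparison_test')
      show "summable (\<lambda>n. (1 / 2 :: real) ^ n * (2 * t * norm u + norm (M u)))"
        by (intro summable_mult2 summable_geometric) simp
    qed (use Tn_step[OF t] in auto)
    then have "convergent (\<lambda>n. Tn n t (M (M u)) - Tn 0 t (M (M u)))"
      unfolding summable_iff_convergent using sum_lessThan_telescope[of "\<lambda>n. Tn n t (M (M u))"] by simp
    then obtain l where "(\<lambda>n. Tn n t (M (M u)) - Tn 0 t (M (M u))) \<longlonglongrightarrow> l" by (auto simp: convergent_def)
    from tendsto_add[OF this tendsto_const, of "Tn 0 t (M (M u))"]
    show ?thesis by (auto simp: convergent_def)
  qed
  have "Cauchy (\<lambda>n. Tn n t x)"
  proof (rule CauchyI)
    fix e :: real assume e: "e > 0"
    obtain u where u: "norm (M (M u) - x) < e / 3"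
      using P_in_closure2[OF x] e unfolding closure_approachable by (force simp: dist_norm dest: spec[of _ "e / 3"])
    obtain N where N: "\<And>m n. m \<ge> N \<Longrightarrow> n \<ge> N \<Longrightarrow> norm (Tn m t (M (M u)) - Tn n t (M (M u))) < e / 3"
      using c[of u] e CauchyD[of "\<lambda>n. Tn n t (M (M u))" "e / 3"] by (auto simp: Cauchy_convergent_iff)
    have "norm (Tn m t x - Tn n t x) < e" if "m \<ge> N" "n \<ge> N" for m n
    proof -
      have "Tn m t x - Tn n t x = (Tn m t (M (M u)) - Tn n t (M (M u))) - Tn m t (M (M u) - x) + Tn n t (M (M u) - x)"
        by (simp add: Tn_diff)
      also have "norm \<dots> \<le> norm (Tn m t (M (M u)) - Tn n t (M (M u))) + norm (Tn m t (M (M u) - x)) + norm (Tn n t (M (M u) - x))"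
        by (rule norm_triangle_3)
      also have "\<dots> < e / 3 + e / 3 + e / 3"
        using N[OF that] Tn_norm[of m t "M (M u) - x"] Tn_norm[of n t "M (M u) - x"] u by linarith
      finally show ?thesis by simp
    qed
    then show "\<exists>N. \<forall>m\<ge>N. \<forall>n\<ge>N. norm (Tn m t x - Tn n t x) < e" by blast
  qed
  then show ?thesis by (simp add: Cauchy_convergent_iff)
qed

lemma T_LIMSEQ: "t \<ge> 0 \<Longrightarrow> (\<lambda>n. Tn n t (P x)) \<longlonglongrightarrow> T t x"
  unfolding T_def using Tn_convergent[of t "P x"] by (simp add: P_idem convergent_LIMSEQ_iff)

lemma T_contraction: "t \<ge> 0 \<Longrightarrow> norm (T t x) \<le> norm x"
proof -
  assume t: "t \<ge> 0"
  have "norm (Tn n t (P x)) \<le> norm x" for n using Tn_norm P_contr order_trans by blast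
  then show ?thesis
    by (intro LIMSEQ_le_const2[OF tendsto_norm[OF T_LIMSEQ[OF t, of x]]]) auto
qed

lemma T_bounded_linear: "t \<ge> 0 \<Longrightarrow> bounded_linear (T t)"
proof -
  assume t: "t \<ge> 0"
  show ?thesis
  proof
    fix x y and c :: real
    have "(\<lambda>n. Tn n t (P x) + Tn n t (P y)) \<longlonglongrightarrow> T t x + T t y" by (intro tendsto_intros T_LIMSEQ t)
    moreover have "Tn n t (P x) + Tn n t (P y) = Tn n t (P (x + y))" for n
      by (simp add: P.add linear_add[OF Tn_linear])
    ultimately show "T t (x + y) = T t x + T t y" using T_LIMSEQ[OF t, of "x + y"] LIMSEQ_unique by fastforce
    have "(\<lambda>n. c *\<^sub>R Tn n t (P x)) \<longlonglongrightarrow> c *\<^sub>R T t x" by (intro tendsto_intros T_LIMSEQ t)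
    moreover have "c *\<^sub>R Tn n t (P x) = Tn n t (P (c *\<^sub>R x))" for n
      by (simp add: P.scaleR linear_scale[OF Tn_linear])
    ultimately show "T t (c *\<^sub>R x) = c *\<^sub>R T t x" using T_LIMSEQ[OF t, of "c *\<^sub>R x"] LIMSEQ_unique by fastforce
    show "\<exists>K. \<forall>x. norm (T t x) \<le> norm x * K" using T_contraction[OF t] by (intro exI[of _ 1]) simp
  qed
qed

lemma T_in_range:
  assumes t: "t \<ge> 0"
  shows "P (T t x) = T t x"
proof (rule LIMSEQ_unique)
  show "(\<lambda>n. Tn n t (P x)) \<longlonglongrightarrow> T t x" by (rule T_LIMSEQ[OF t])
  show "(\<lambda>n. Tn n t (P x)) \<longlonglongrightarrow> P (T t x)"
    using P.tendsto[OF T_LIMSEQ[OF t, of x]] by (simp add: Tn_P)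
qed

lemma T_0: "T 0 x = P x"
proof -
  have "(\<lambda>n. Tn n 0 (P x)) \<longlonglongrightarrow> T 0 x" by (rule T_LIMSEQ) simp
  then have "(\<lambda>n. P x) \<longlonglongrightarrow> T 0 x" by (simp add: Tn_def)
  then show ?thesis by (simp add: LIMSEQ_const_iff)
qed

lemma T_P': "t \<ge> 0 \<Longrightarrow> T t (P x) = T t x"
  by (simp add: T_def P_idem)

lemma T_M: "t \<ge> 0 \<Longrightarrow> T t (M x) = M (T t x)"
proof -
  assume t: "t \<ge> 0"
  have "(\<lambda>n. M (Tn n t (P x))) \<longlonglongrightarrow> M (T t x)" by (intro M.tendsto T_LIMSEQ t)
  moreover have "M (Tn n t (P x)) = Tn n t (P (M x))" for n
    using Tn_M[of n t "P x"] by (simp add: M_P P_M)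
  ultimately show ?thesis using T_LIMSEQ[OF t, of "M x"] LIMSEQ_unique by fastforce
qed

lemma T_diff': "t \<ge> 0 \<Longrightarrow> T t (x - y) = T t x - T t y"
  by (rule linear_diff[OF bounded_linear.linear[OF T_bounded_linear]])

lemma eq_on_P_if_eq_on_range:
  assumes "bounded_linear A" "bounded_linear B" "\<And>u. A (M u) = B (M u)" "P x = x"
  shows "A x = B x"
proof -
  have "closed {x. A x = B x}"
    using assms by (intro closed_Collect_eq linear_continuous_on)
  then have "closure (range M) \<subseteq> {x. A x = B x}" by (intro closure_minimal) (auto simp: assms(3))
  then show ?thesis using P_in_closure[OF assms(4)] by auto
qed

text \<open>The step counts for \<open>s\<close> and \<open>t\<close> add up to the one for
  \<open>s + t\<close>, or fall short of it by one. On the range of \<open>M\<close> one additional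
  Euler step is of size \<open>(1 / 2) ^ n\<close>, so the defect vanishes in the limit; density
  does the rest.\<close>

lemma T_add':
  assumes s: "s \<ge> 0" and t: "t \<ge> 0"
  shows "T (s + t) x = T s (T t x)"
proof -
  have on_M: "T (s + t) (M u) = T s (T t (M u))" for u
  proof -
    have 1: "(\<lambda>n. Tn n (s + t) (M u)) \<longlonglongrightarrow> T (s + t) (M u)"
      using T_LIMSEQ[of "s + t" "M u"] s t by (simp add: P_M)
    have "(\<lambda>n. Tn n s (P (T t (M u))) + Tn n s (Tn n t (M u) - T t (M u))) \<longlonglongrightarrow> T s (T t (M u)) + 0"
    proof (intro tendsto_add T_LIMSEQ s)
      have "(\<lambda>n. norm (Tn n t (M u) - T t (M u))) \<longlonglongrightarrow> 0"
        using T_LIMSEQ[OF t, of "M u"] by (simp add: P_M tendsto_norm_zero_iff LIM_zero_iff)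
      then show "(\<lambda>n. Tn n s (Tn n t (M u) - T t (M u))) \<longlonglongrightarrow> 0"
        by (rule Lim_null_comparison[rotated]) (auto intro: always_eventually Tn_norm)
    qed
    then have 2: "(\<lambda>n. Tn n s (Tn n t (M u))) \<longlonglongrightarrow> T s (T t (M u))"
      by (simp add: Tn_diff T_in_range[OF t])
    have "(\<lambda>n. Tn n (s + t) (M u) - Tn n s (Tn n t (M u))) \<longlonglongrightarrow> 0"
    proof (rule Lim_null_comparison)
      show "\<forall>\<^sub>F n in sequentially. norm (Tn n (s + t) (M u) - Tn n s (Tn n t (M u))) \<le> (1 / 2) ^ n * norm u"
      proof (intro always_eventually allI)
        fix n
        let ?a = "s * 2 ^ n" and ?b = "t * 2 ^ n"
        have ab: "0 \<le> \<lfloor>?a\<rfloor>" "0 \<le> \<lfloor>?b\<rfloor>" using s t by auto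
        have "\<lfloor>(s + t) * 2 ^ n\<rfloor> = \<lfloor>?a\<rfloor> + \<lfloor>?b\<rfloor> \<or> \<lfloor>(s + t) * 2 ^ n\<rfloor> = \<lfloor>?a\<rfloor> + \<lfloor>?b\<rfloor> + 1"
        proof -
          have "(s + t) * 2 ^ n = ?a + ?b" by (simp add: algebra_simps)
          then show ?thesis by linarith
        qed
        then have "nat \<lfloor>(s + t) * 2 ^ n\<rfloor> = nat \<lfloor>?a\<rfloor> + nat \<lfloor>?b\<rfloor> \<or> nat \<lfloor>(s + t) * 2 ^ n\<rfloor> = Suc (nat \<lfloor>?a\<rfloor> + nat \<lfloor>?b\<rfloor>)"
          using ab by linarith
        then show "norm (Tn n (s + t) (M u) - Tn n s (Tn n t (M u))) \<le> (1 / 2) ^ n * norm u"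
        proof
          assume "nat \<lfloor>(s + t) * 2 ^ n\<rfloor> = nat \<lfloor>?a\<rfloor> + nat \<lfloor>?b\<rfloor>"
          then show ?thesis by (simp add: Tn_def funpow_add)
        next
          assume a: "nat \<lfloor>(s + t) * 2 ^ n\<rfloor> = Suc (nat \<lfloor>?a\<rfloor> + nat \<lfloor>?b\<rfloor>)"
          show ?thesis
            using Rn_step[of "(1 / 2) ^ n" "nat \<lfloor>?a\<rfloor> + nat \<lfloor>?b\<rfloor>" u]
            unfolding Tn_def a by (simp add: funpow_add)
        qed
      qed
      have "(\<lambda>n. (1 / 2 :: real) ^ n * norm u) \<longlonglongrightarrow> 0 * norm u"
        by (intro tendsto_intros LIMSEQ_power_zero) auto
      then show "(\<lambda>n. (1 / 2 :: real) ^ n * norm u) \<longlonglongrightarrow> 0" by simp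
    qed
    from tendsto_add[OF this 2] have "(\<lambda>n. Tn n (s + t) (M u)) \<longlonglongrightarrow> T s (T t (M u))" by simp
    then show ?thesis using 1 LIMSEQ_unique by blast
  qed
  have "T (s + t) (P x) = T s (T t (P x))"
  proof (rule eq_on_P_if_eq_on_range[where A = "T (s + t)" and B = "\<lambda>x. T s (T t x)"])
    show "bounded_linear (\<lambda>x. T s (T t x))"
      by (rule bounded_linear_compose[OF T_bounded_linear[OF s] T_bounded_linear[OF t]])
  qed (use s t in \<open>simp_all add: T_bounded_linear on_M P_idem\<close>)
  then show ?thesis using s t by (simp add: T_P')
qed

lemma T_M_diff: "t \<ge> 0 \<Longrightarrow> norm (T t (M u) - M u) \<le> t * norm u"
proof -
  assume t: "t \<ge> 0"
  have "(\<lambda>n. norm (Tn n t (M u) - M u)) \<longlonglongrightarrow> norm (T t (M u) - M u)"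
    using T_LIMSEQ[OF t, of "M u"] by (intro tendsto_intros) (simp add: P_M)
  moreover have "norm (Tn n t (M u) - M u) \<le> t * norm u" for n
  proof -
    have "norm (Tn n t (M u) - M u) \<le> real (nat \<lfloor>t * 2 ^ n\<rfloor>) * (1 / 2) ^ n * norm u"
      unfolding Tn_def by (rule Rn_M_diff) simp
    also have "\<dots> \<le> t * norm u" by (intro mult_right_mono floor_le_time t) simp
    finally show ?thesis .
  qed
  ultimately show ?thesis by (intro LIMSEQ_le_const2) auto
qed

lemma T_MM_diff: "t \<ge> 0 \<Longrightarrow> norm (T t (M (M y)) - M (M y) - t *\<^sub>R M y) \<le> t\<^sup>2 * norm y"
proof -
  assume t: "t \<ge> 0"
  let ?k = "\<lambda>n. real (nat \<lfloor>t * 2 ^ n\<rfloor>) * (1 / 2) ^ n"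
  have "(\<lambda>n. norm (Tn n t (M (M y)) - M (M y) - ?k n *\<^sub>R M y)) \<longlonglongrightarrow> norm (T t (M (M y)) - M (M y) - t *\<^sub>R M y)"
    using T_LIMSEQ[OF t, of "M (M y)"] by (intro tendsto_intros floor_time_tendsto t) (simp add: P_M)
  moreover have "norm (Tn n t (M (M y)) - M (M y) - ?k n *\<^sub>R M y) \<le> t\<^sup>2 * norm y" for n
  proof -
    have "norm (Tn n t (M (M y)) - M (M y) - ?k n *\<^sub>R M y) \<le> (?k n)\<^sup>2 * norm y"
      unfolding Tn_def by (rule Rn_MM_diff) simp
    also have "\<dots> \<le> t\<^sup>2 * norm y" by (intro mult_right_mono power_mono floor_le_time t) auto
    finally show ?thesis .
  qed
  ultimately show ?thesis by (intro LIMSEQ_le_const2) auto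
qed

lemma T_lim': "((\<lambda>t. T t x) \<longlongrightarrow> P x) (at_right 0)"
proof (rule tendstoI)
  fix e :: real assume e: "e > 0"
  obtain u where u: "norm (M u - P x) < e / 4"
    using P_in_closure[OF P_idem[of x]] e unfolding closure_approachable by (force simp: dist_norm dest: spec[of _ "e / 4"])
  have "((\<lambda>t. t * norm u) \<longlongrightarrow> 0 * norm u) (at_right 0)" by (intro tendsto_intros)
  then have "\<forall>\<^sub>F t in at_right 0. t * norm u < e / 4" using e by (intro order_tendstoD) auto
  moreover have "\<forall>\<^sub>F t :: real in at_right 0. t > 0" by (simp add: eventually_at_right_less)
  ultimately show "\<forall>\<^sub>F t in at_right 0. dist (T t x) (P x) < e"
  proof eventually_elim
    case (elim t)
    have "T t x - P x = (T t (M u) - M u) - T t (M u - P x) + (M u - P x)"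
      using elim by (simp add: T_diff' T_P')
    also have "norm \<dots> \<le> norm (T t (M u) - M u) + norm (T t (M u - P x)) + norm (M u - P x)"
      by (rule norm_triangle_3)
    also have "\<dots> < e"
      using elim u e T_M_diff[of t u] T_contraction[of t "M u - P x"] by linarith
    finally show ?case by (simp add: dist_norm)
  qed
qed

sublocale S: contraction_semigroup P T
  by (rule contraction_semigroup.intro[OF P.bounded_linear_axioms contraction_semigroup_axioms.intro])
    (rule P_idem T_bounded_linear T_contraction T_in_range T_0 T_add' T_lim'; assumption)+

text \<open>\<open>u\<close> is approximated by some \<open>M y\<close>, for which the Taylor
  estimate \<open>T_MM_diff\<close> is quadratic in time. The remainder \<open>u - M y\<close>
  contributes at most \<open>2 t\<close> times its norm, which is small after division by
  \<open>t\<close>.\<close>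

lemma T_M_right_derivative:
  assumes u: "P u = u"
  shows "((\<lambda>h. (T h (M u) - M u) /\<^sub>R h) \<longlongrightarrow> u) (at_right 0)"
proof (rule tendstoI)
  fix e :: real assume e: "e > 0"
  obtain y where y: "norm (M y - u) < e / 4"
    using P_in_closure[OF u] e unfolding closure_approachable by (force simp: dist_norm dest: spec[of _ "e / 4"])
  have "((\<lambda>t. t * norm y) \<longlongrightarrow> 0 * norm y) (at_right 0)" by (intro tendsto_intros)
  then have "\<forall>\<^sub>F t in at_right 0. t * norm y < e / 4" using e by (intro order_tendstoD) auto
  moreover have "\<forall>\<^sub>F t :: real in at_right 0. t > 0" by (simp add: eventually_at_right_less)
  ultimately show "\<forall>\<^sub>F h in at_right 0. dist ((T h (M u) - M u) /\<^sub>R h) u < e"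
  proof eventually_elim
    case (elim t)
    let ?v = "u - M y"
    have "T t (M u) - M u - t *\<^sub>R u = (T t (M (M y)) - M (M y) - t *\<^sub>R M y) + (T t (M ?v) - M ?v) - t *\<^sub>R ?v"
      using elim by (simp add: M.diff T_diff' algebra_simps)
    also have "norm \<dots> \<le> t\<^sup>2 * norm y + t * norm ?v + t * norm ?v"
      using elim T_MM_diff[of t y] T_M_diff[of t ?v]
      by (intro order_trans[OF norm_triangle_3(3)] add_mono) auto
    also have "\<dots> = t * (t * norm y + 2 * norm ?v)" by (simp add: power2_eq_square algebra_simps)
    also have "\<dots> \<le> t * (e / 4 + 2 * (e / 4))"
      using elim y by (intro mult_left_mono add_mono) (auto simp: norm_minus_commute)
    finally have le: "norm (T t (M u) - M u - t *\<^sub>R u) \<le> t * (3 / 4 * e)" by simp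
    have eq: "(T t (M u) - M u) /\<^sub>R t - u = (T t (M u) - M u - t *\<^sub>R u) /\<^sub>R t"
      using elim by (simp add: scaleR_diff_right)
    have "norm ((T t (M u) - M u) /\<^sub>R t - u) = norm (T t (M u) - M u - t *\<^sub>R u) / t"
      unfolding eq norm_scaleR using elim(2) by (simp only: abs_of_pos positive_imp_inverse_positive divide_inverse mult.commute)
    moreover have "norm (T t (M u) - M u - t *\<^sub>R u) / t \<le> 3 / 4 * e"
      unfolding pos_divide_le_eq[OF elim(2)] using le by (simp only: mult.commute)
    ultimately show ?case using e unfolding dist_norm by linarith
  qed
qed

lemma generator_T: "generator_on (range P) T = {(M u, u) | u. P u = u}"
proof (intro equalityI subsetI)
  fix p assume "p \<in> {(M u, u) | u. P u = u}"
  then obtain u where "p = (M u, u)" "P u = u" by blast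
  then show "p \<in> generator_on (range P) T"
    using T_M_right_derivative[of u] by (auto simp: generator_on_def S.range_iff P_M)
next
  fix p assume p: "p \<in> generator_on (range P) T"
  obtain x y where xy: "p = (x, y)" by (cases p)
  then have x: "P x = x" "P y = y" and d: "((\<lambda>h. (T h x - x) /\<^sub>R h) \<longlongrightarrow> y) (at_right 0)"
    using p by (auto simp: generator_on_def S.range_iff)
  \<comment> \<open>Since \<open>M\<close> commutes with the semigroup, these quotients are those of
    the orbit of \<open>M x\<close>, whose right derivative is already known to be \<open>x\<close>;
    hence \<open>x = M y\<close>.\<close>
  have "((\<lambda>h. M ((T h x - x) /\<^sub>R h)) \<longlongrightarrow> M y) (at_right 0)" by (intro M.tendsto d)
  moreover have "\<forall>\<^sub>F h in at_right 0. M ((T h x - x) /\<^sub>R h) = (T h (M x) - M x) /\<^sub>R h"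
    using eventually_at_right_less[of 0] by eventually_elim (simp add: M.scaleR M.diff T_M)
  ultimately have "((\<lambda>h. (T h (M x) - M x) /\<^sub>R h) \<longlongrightarrow> M y) (at_right 0)"
    by (simp add: tendsto_cong)
  then have "x = M y" using T_M_right_derivative[OF x(1)] tendsto_unique trivial_limit_at_right_real by blast
  then show "p \<in> {(M u, u) | u. P u = u}" using xy x by auto
qed

text \<open>On the range of \<open>M\<close> the product rule gives the derivative
  \<open>2 b u (M u)\<close>. For general \<open>w\<close> the orbit need not be differentiable, so
  the derivative is put into a mean value estimate that mentions only \<open>q\<close>; this
  survives the limit along points of the range of \<open>M\<close>.\<close>

lemma quadratic_form_right_derivative:
  assumes b: "bounded_bilinear b" and sym: "\<And>x y. b x y = b y x"
    and bM: "\<And>u. P u = u \<Longrightarrow> 2 * b u (M u) = q (M u)"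
    and q: "\<And>x y. \<bar>q x - q y\<bar> \<le> C * norm (x - y) * (norm x + norm y)"
    and w: "P w = w"
  shows "((\<lambda>h. (b (T h w) (T h w) - b w w) / h) \<longlongrightarrow> (q w :: real)) (at_right 0)"
proof -
  interpret b: bounded_bilinear b by (rule b)
  have rd: "((\<lambda>h. (b (T h (M u)) (T h (M u)) - b (M u) (M u)) / h) \<longlongrightarrow> q (M u)) (at_right 0)"
    if u: "P u = u" for u
  proof -
    let ?x = "M u"
    have "((\<lambda>h. b ((T h ?x - ?x) /\<^sub>R h) (T h ?x) + b ?x ((T h ?x - ?x) /\<^sub>R h)) \<longlongrightarrow> b u (P ?x) + b ?x u) (at_right 0)"
      by (intro tendsto_add b.tendsto tendsto_const T_M_right_derivative u T_lim')
    also have "b u (P ?x) + b ?x u = q ?x" using bM[OF u] sym by (simp add: P_M)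
    finally show ?thesis
    proof (rule Lim_transform_eventually)
      show "\<forall>\<^sub>F h in at_right 0. b ((T h ?x - ?x) /\<^sub>R h) (T h ?x) + b ?x ((T h ?x - ?x) /\<^sub>R h)
          = (b (T h ?x) (T h ?x) - b ?x ?x) / h"
        using eventually_at_right_less[of 0]
        by eventually_elim (simp add: b.scaleR_left b.scaleR_right b.diff_left b.diff_right field_simps)
    qed
  qed
  \<comment> \<open>The mean value estimate: a tolerance for \<open>q\<close> along the orbit
    becomes the same tolerance for the difference quotient, by the Dini comparison from above and
    from below.\<close>
  have est: "\<bar>b (T t (M u)) (T t (M u)) - b (M u) (M u) - t * q0\<bar> \<le> t * e"
    if u: "P u = u" and t: "t \<ge> 0" and e: "\<And>s. s \<in> {0..t} \<Longrightarrow> \<bar>q (T s (M u)) - q0\<bar> \<le> e" for u t e q0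
  proof -
    let ?f = "\<lambda>s. b (T s (M u)) (T s (M u))"
    have cf: "continuous_on {0..t} ?f"
      by (intro b.continuous_on S.continuous_on_T continuous_intros) auto
    have ev: "\<forall>\<^sub>F h in at_right 0. \<bar>?f (s + h) - ?f s - h * q (T s (M u))\<bar> \<le> e' * h" if s: "s \<in> {0..<t}" and e': "e' > 0" for s e'
    proof -
      have Ps: "P (T s u) = T s u" using s by (simp add: T_in_range)
      have eq: "M (T s u) = T s (M u)" using s by (simp add: T_M)
      have "\<forall>\<^sub>F h in at_right 0. dist ((b (T h (T s (M u))) (T h (T s (M u))) - ?f s) / h) (q (T s (M u))) < e'"
        using rd[OF Ps] e' unfolding eq by (rule tendstoD)
      then show ?thesis using eventually_at_right_less[of 0]
      proof eventually_elim
        case (elim h)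
        have T: "T (s + h) (M u) = T h (T s (M u))" using elim s T_add'[of h s "M u"] by (simp add: add.commute)
        have "\<bar>?f (s + h) - ?f s - h * q (T s (M u))\<bar> = h * \<bar>(?f (s + h) - ?f s) / h - q (T s (M u))\<bar>"
          using elim by (simp add: abs_mult_pos[symmetric] field_simps flip: abs_mult)
        also have "\<dots> \<le> h * e'" using elim unfolding T by (intro mult_left_mono) (auto simp: dist_real_def)
        finally show ?case by (simp add: mult.commute)
      qed
    qed
    have up: "?f t - t * (q0 + e) \<le> ?f 0 - 0 * (q0 + e)"
    proof (rule right_dini_le[OF t])
      show "continuous_on {0..t} (\<lambda>s. ?f s - s * (q0 + e))" by (intro continuous_intros cf)
      fix s e' :: real assume s: "s \<in> {0..<t}" and e': "e' > 0"
      show "\<forall>\<^sub>F h in at_right 0. ?f (s + h) - (s + h) * (q0 + e) \<le> ?f s - s * (q0 + e) + e' * h"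
        using ev[OF s e'] eventually_at_right_less[of 0]
      proof eventually_elim
        case (elim h)
        have "h * q (T s (M u)) \<le> h * (q0 + e)" using e[of s] s elim by (intro mult_left_mono) auto
        then show ?case using elim by (simp add: algebra_simps)
      qed
    qed
    have dn: "t * (q0 - e) - ?f t \<le> 0 * (q0 - e) - ?f 0"
    proof (rule right_dini_le[OF t])
      show "continuous_on {0..t} (\<lambda>s. s * (q0 - e) - ?f s)" by (intro continuous_intros cf)
      fix s e' :: real assume s: "s \<in> {0..<t}" and e': "e' > 0"
      show "\<forall>\<^sub>F h in at_right 0. (s + h) * (q0 - e) - ?f (s + h) \<le> s * (q0 - e) - ?f s + e' * h"
        using ev[OF s e'] eventually_at_right_less[of 0]
      proof eventually_elim
        case (elim h)
        have "h * (q0 - e) \<le> h * q (T s (M u))" using e[of s] s elim by (intro mult_left_mono) auto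
        then show ?case using elim by (simp add: algebra_simps)
      qed
    qed
    show ?thesis using up dn by (simp add: T_0 P_M algebra_simps)
  qed
  show ?thesis
  proof (rule tendstoI)
    fix e :: real assume e: "e > 0"
    have "((\<lambda>t. q (T t w) - q w) \<longlongrightarrow> 0) (at_right 0)"
    proof (rule Lim_null_comparison)
      have "((\<lambda>t. C * norm (T t w - w) * (norm (T t w) + norm w)) \<longlongrightarrow> C * norm (P w - w) * (norm (P w) + norm w)) (at_right 0)"
        by (intro tendsto_intros T_lim')
      then show "((\<lambda>t. C * norm (T t w - w) * (norm (T t w) + norm w)) \<longlongrightarrow> 0) (at_right 0)" using w by simp
    qed (use q in simp)
    then have "\<forall>\<^sub>F t in at_right 0. \<bar>q (T t w) - q w\<bar> < e / 4"
      using e tendstoD[of "\<lambda>t. q (T t w) - q w" 0 "at_right 0" "e / 4"] by (simp add: dist_real_def)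
    then obtain d where d: "d > 0" "\<And>s. 0 < s \<Longrightarrow> s < d \<Longrightarrow> \<bar>q (T s w) - q w\<bar> < e / 4"
      unfolding eventually_at_right_field by auto
    have key: "\<bar>(b (T t w) (T t w) - b w w) / t - q w\<bar> < e" if t: "0 < t" "t < d" for t
    proof -
      have d': "\<bar>q (T s w) - q w\<bar> \<le> e / 4" if "s \<in> {0..t}" for s
        using d(2)[of s] that t e w by (cases "s = 0") (auto simp: T_0)
      obtain x where x: "\<And>n. x n \<in> range M" "x \<longlonglongrightarrow> w"
        using P_in_closure[OF w] unfolding closure_sequential by blast
      have "(\<lambda>n. C * norm (x n - w) * (norm (x n) + norm w)) \<longlonglongrightarrow> C * norm (w - w) * (norm w + norm w)"
        by (intro tendsto_intros x)
      then have "\<forall>\<^sub>F n in sequentially. C * norm (x n - w) * (norm (x n) + norm w) < e / 4"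
        using e by (intro order_tendstoD) auto
      then have ev: "\<forall>\<^sub>F n in sequentially. \<bar>b (T t (x n)) (T t (x n)) - b (x n) (x n) - t * q w\<bar> \<le> t * (e / 2)"
      proof eventually_elim
        case (elim n)
        obtain u0 where "x n = M u0" using x(1) by blast
        then have u: "x n = M (P u0)" "P (P u0) = P u0" by (auto simp: M_P P_idem)
        have C: "C \<ge> 0 \<or> x n = w"
        proof (rule disjCI)
          assume "x n \<noteq> w"
          have "0 \<le> C * (norm (x n - w) * (norm (x n) + norm w))" using q[of "x n" w] by (simp add: mult.assoc)
          moreover have "norm (x n - w) * (norm (x n) + norm w) > 0"
          proof (rule mult_pos_pos)
            show "norm (x n) + norm w > 0"
              using \<open>x n \<noteq> w\<close> by (cases "x n = 0") (auto simp: add_pos_nonneg)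
          qed (use \<open>x n \<noteq> w\<close> in simp)
          ultimately show "C \<ge> 0" by (simp add: zero_le_mult_iff)
        qed
        show ?case
          unfolding u(1)
        proof (rule est[OF u(2)])
          show "0 \<le> t" using t by simp
          fix s assume s: "s \<in> {0..t}"
          have "\<bar>q (T s (x n)) - q (T s w)\<bar> \<le> e / 4"
          proof (cases "x n = w")
            case False
            then have C0: "C \<ge> 0" using C by simp
            have "\<bar>q (T s (x n)) - q (T s w)\<bar> \<le> C * norm (T s (x n) - T s w) * (norm (T s (x n)) + norm (T s w))"
              by (rule q)
            also have "\<dots> \<le> C * norm (x n - w) * (norm (x n) + norm w)"
              using s C0 T_contraction[of s "x n - w"] T_contraction[of s "x n"] T_contraction[of s w]
              by (intro mult_mono add_mono) (auto simp: T_diff')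
            finally show ?thesis using elim by simp
          qed (use e in simp)
          then show "\<bar>q (T s (M (P u0))) - q w\<bar> \<le> e / 2"
            using d'[OF s] unfolding u(1)[symmetric] by linarith
        qed
      qed
      have lim: "(\<lambda>n. \<bar>b (T t (x n)) (T t (x n)) - b (x n) (x n) - t * q w\<bar>)
          \<longlonglongrightarrow> \<bar>b (T t w) (T t w) - b w w - t * q w\<bar>"
        using t by (intro tendsto_intros b.tendsto bounded_linear.tendsto[OF T_bounded_linear] x) auto
      have le: "\<bar>b (T t w) (T t w) - b w w - t * q w\<bar> \<le> t * (e / 2)"
        by (rule tendsto_upperbound[OF lim ev sequentially_bot])
      have "\<bar>(b (T t w) (T t w) - b w w) / t - q w\<bar> = \<bar>b (T t w) (T t w) - b w w - t * q w\<bar> / t"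
      proof -
        have "(b (T t w) (T t w) - b w w) / t - q w = (b (T t w) (T t w) - b w w - t * q w) / t"
          using t by (simp add: diff_divide_distrib)
        then show ?thesis using t by (simp add: abs_divide)
      qed
      also have "\<dots> \<le> e / 2" using le t by (simp add: pos_divide_le_eq mult.commute)
      finally show ?thesis using e by simp
    qed
    show "\<forall>\<^sub>F h in at_right 0. dist ((b (T h w) (T h w) - b w w) / h) (q w) < e"
      unfolding eventually_at_right_field dist_real_def using d(1) key by blast
  qed
qed

end

section \<open>The Hilbert space L2\<close>

lemma L2_rel_L2_fun: "L2_rel (L2_fun f) (L2_fun f)"
  unfolding L2_fun_def using Quotient3_rel_rep[OF Quotient3_L2] by blast

lemma square_integrable_L2_fun: "square_integrable (L2_fun f)"
  using L2_rel_L2_fun[of f] by (simp add: L2_rel_def)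

lemma measurable_L2_fun [measurable]: "L2_fun f \<in> borel_measurable borel"
  using square_integrable_L2_fun[of f] by (simp add: square_integrable_def)

lemma integrable_norm_L2_fun: "integrable lborel (\<lambda>t. (norm (L2_fun f t))\<^sup>2)"
  using square_integrable_L2_fun[of f] by (simp add: square_integrable_def)

lemma L2_fun_abs:
  assumes "square_integrable f"
  shows "AE t in lborel. L2_fun (abs_L2 f) t = f t"
proof -
  have "L2_rel f f" using assms by (simp add: L2_rel_def)
  then have "L2_rel (rep_L2 (abs_L2 f)) f" by (rule Quotient3_rep_abs[OF Quotient3_L2])
  then show ?thesis by (simp add: L2_rel_def L2_fun_def)
qed

lemma abs_L2_fun: "abs_L2 (L2_fun f) = f"
  unfolding L2_fun_def by (rule Quotient3_abs_rep[OF Quotient3_L2])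

lemma L2_eqI:
  assumes "AE t in lborel. L2_fun f t = L2_fun g t"
  shows "f = g"
proof -
  have "L2_rel (rep_L2 f) (rep_L2 g)"
    using assms square_integrable_L2_fun[of f] square_integrable_L2_fun[of g]
    by (simp add: L2_rel_def L2_fun_def)
  then show ?thesis using Quotient3_rel_rep[OF Quotient3_L2] by blast
qed

lemma L2_fun_zero: "AE t in lborel. L2_fun 0 t = 0"
  using L2_fun_abs[OF square_integrable_zero] by (simp add: zero_L2_def)

lemma L2_fun_add: "AE t in lborel. L2_fun (f + g) t = L2_fun f t + L2_fun g t"
proof -
  have "f + g = abs_L2 (\<lambda>t. L2_fun f t + L2_fun g t)"
    using plus_L2.abs_eq[OF L2_rel_L2_fun L2_rel_L2_fun, of f g] by (simp add: abs_L2_fun)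
  then show ?thesis
    using L2_fun_abs[OF square_integrable_add[OF square_integrable_L2_fun square_integrable_L2_fun], of f g] by simp
qed

lemma L2_fun_scaleR: "AE t in lborel. L2_fun (c *\<^sub>R f) t = c *\<^sub>R L2_fun f t"
proof -
  have "c *\<^sub>R f = abs_L2 (\<lambda>t. c *\<^sub>R L2_fun f t)"
    using scaleR_L2.abs_eq[OF L2_rel_L2_fun, of c f] by (simp add: abs_L2_fun)
  then show ?thesis
    using L2_fun_abs[OF square_integrable_scaleR[OF square_integrable_L2_fun], of c f] by simp
qed

lemma L2_fun_uminus: "AE t in lborel. L2_fun (- f) t = - L2_fun f t"
  using L2_fun_scaleR[of "-1" f] by simp

lemma L2_fun_diff: "AE t in lborel. L2_fun (f - g) t = L2_fun f t - L2_fun g t"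
  using L2_fun_add[of f "- g"] L2_fun_uminus[of g] by eventually_elim simp

lemma L2_fun_mat: "AE t in lborel. L2_fun (L2_mat A f) t = A *v L2_fun f t"
proof -
  have "L2_mat A f = abs_L2 (\<lambda>t. A *v L2_fun f t)"
    using L2_mat.abs_eq[OF L2_rel_L2_fun, of A f] by (simp add: abs_L2_fun)
  then show ?thesis
    using L2_fun_abs[OF square_integrable_linear[OF matrix_vector_mul_bounded_linear square_integrable_L2_fun], of A f] by simp
qed

lemma inner_L2_eq: "f \<bullet> g = (\<integral>t. L2_fun f t \<bullet> L2_fun g t \<partial>lborel)"
  using inner_L2.abs_eq[OF L2_rel_L2_fun L2_rel_L2_fun, of f g] by (simp add: abs_L2_fun)

lemma norm_L2_sq: "(norm f)\<^sup>2 = (\<integral>t. (norm (L2_fun f t))\<^sup>2 \<partial>lborel)"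
  unfolding power2_norm_eq_inner by (rule inner_L2_eq)

lemma nn_integral_norm_L2_diff:
  "(\<integral>\<^sup>+t. ennreal ((norm (L2_fun f t - L2_fun g t))\<^sup>2) \<partial>lborel) = ennreal ((norm (f - g))\<^sup>2)"
proof -
  have "(\<integral>\<^sup>+t. ennreal ((norm (L2_fun f t - L2_fun g t))\<^sup>2) \<partial>lborel)
      = (\<integral>\<^sup>+t. ennreal ((norm (L2_fun (f - g) t))\<^sup>2) \<partial>lborel)"
    using L2_fun_diff[of f g] by (intro nn_integral_cong_AE) (auto elim!: eventually_mono)
  also have "\<dots> = ennreal ((norm (f - g))\<^sup>2)"
    unfolding norm_L2_sq by (intro nn_integral_eq_integral integrable_norm_L2_fun) simp
  finally show ?thesis .
qed

section \<open>Completeness of \<open>L2\<close>\<close>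

lemma Cauchy_fast_subsequence:
  fixes X :: "nat \<Rightarrow> 'a::metric_space" and e :: "nat \<Rightarrow> real"
  assumes "Cauchy X" and e: "\<And>n. e n > 0"
  obtains r where "strict_mono r" "\<And>n m. m \<ge> r n \<Longrightarrow> dist (X m) (X (r n)) < e n"
proof -
  have "\<forall>n. \<exists>N. \<forall>m\<ge>N. \<forall>k\<ge>N. dist (X m) (X k) < e n"
    using assms(1) e unfolding Cauchy_def by blast
  then obtain N where N: "\<And>n m k. m \<ge> N n \<Longrightarrow> k \<ge> N n \<Longrightarrow> dist (X m) (X k) < e n" by metis
  \<comment> \<open>The partial sum dominates every threshold up to \<open>n\<close>, and the added
    \<open>n\<close> makes the sequence strictly increasing.\<close>
  define r where "r n = (\<Sum>k\<le>n. N k) + n" for n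
  have "strict_mono r" by (rule strict_monoI_Suc) (simp add: r_def)
  moreover have "dist (X m) (X (r n)) < e n" if m: "m \<ge> r n" for n m
  proof -
    have "N n \<le> r n" by (simp add: r_def trans_le_add1 member_le_sum)
    with m show ?thesis by (intro N) auto
  qed
  ultimately show thesis by (rule that)
qed

text \<open>The argument of Riesz and Fischer: for a rapidly converging subsequence, Markov's
  inequality and the Borel-Cantelli lemma make the pointwise increments summable almost
  everywhere.\<close>

lemma L2_Cauchy_AE_subsequence:
  fixes X :: "nat \<Rightarrow> 'a::euclidean_space L2"
  assumes "Cauchy X"
  obtains r where "strict_mono r" "AE t in lborel. convergent (\<lambda>n. L2_fun (X (r n)) t)"
proof -
  obtain r where r: "strict_mono r" "\<And>n m. m \<ge> r n \<Longrightarrow> dist (X m) (X (r n)) < (1 / 3) ^ n"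
    using Cauchy_fast_subsequence[OF assms, of "\<lambda>n. (1 / 3) ^ n"] by auto
  let ?F = "\<lambda>n. L2_fun (X (r n))"
  let ?D = "\<lambda>n. X (r (Suc n)) - X (r n)"
  \<comment> \<open>The bases fit together: increments of norm below \<open>(1 / 3) ^ n\<close> give
    \<open>A n\<close> measure at most \<open>(4 / 9) ^ n\<close>, which is summable, while off
    \<open>A n\<close> the pointwise increment is below \<open>(1 / 2) ^ n\<close>, also
    summable.\<close>
  define A where "A n = {t \<in> space lborel. (norm (L2_fun (?D n) t))\<^sup>2 \<ge> (1 / 4) ^ n}" for n
  have em: "emeasure lborel (A n) \<le> ennreal ((4 / 9) ^ n)" for n
  proof -
    have "emeasure lborel (A n) \<le> ennreal ((1 / (1 / 4) ^ n) * (\<integral>t. (norm (L2_fun (?D n) t))\<^sup>2 \<partial>lborel))"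
      unfolding A_def by (intro integral_Markov_inequality integrable_norm_L2_fun) auto
    also have "(1 / (1 / 4) ^ n) * (\<integral>t. (norm (L2_fun (?D n) t))\<^sup>2 \<partial>lborel) = 4 ^ n * (norm (?D n))\<^sup>2"
      by (simp add: norm_L2_sq power_one_over)
    also have "\<dots> \<le> 4 ^ n * ((1 / 3) ^ n)\<^sup>2"
    proof (intro mult_left_mono power_mono)
      show "norm (?D n) \<le> (1 / 3) ^ n"
        using r(2)[of n "r (Suc n)"] strict_mono_mono[OF r(1)] by (simp add: mono_def dist_norm less_imp_le)
    qed auto
    also have "\<dots> = (4 / 9) ^ n"
      by (simp add: power2_eq_square flip: power_mult_distrib)
    finally show ?thesis by (simp add: ennreal_leI)
  qed
  have sets: "A n \<in> sets lborel" for n unfolding A_def by measurable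
  have fin: "emeasure lborel (A n) < \<infinity>" for n
    using em[of n] by (rule le_less_trans) simp
  have "summable (\<lambda>n. measure lborel (A n))"
  proof (rule summable_comparison_test')
    show "summable (\<lambda>n. (4 / 9 :: real) ^ n)" by (rule summable_geometric) simp
    show "norm (measure lborel (A n)) \<le> (4 / 9) ^ n" for n
      using em[of n] by (simp add: measure_def enn2real_leI)
  qed
  then have "AE t in lborel. eventually (\<lambda>n. t \<in> space lborel - A n) sequentially"
    by (intro borel_cantelli_AE1 sets fin)
  moreover have "AE t in lborel. \<forall>n. L2_fun (?D n) t = ?F (Suc n) t - ?F n t"
    by (simp add: AE_all_countable L2_fun_diff)
  ultimately have "AE t in lborel. convergent (\<lambda>n. ?F n t)"
  proof eventually_elim
    case (elim t)
    from elim(1) have "\<forall>\<^sub>F n in sequentially. norm (?F (Suc n) t - ?F n t) \<le> (1 / 2) ^ n"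
    proof eventually_elim
      case (elim n)
      then have "(norm (?F (Suc n) t - ?F n t))\<^sup>2 < (1 / 4) ^ n"
        using \<open>\<forall>n. L2_fun (?D n) t = ?F (Suc n) t - ?F n t\<close> by (simp add: A_def)
      also have "(1 / 4 :: real) ^ n = ((1 / 2) ^ n)\<^sup>2" by (simp add: power2_eq_square flip: power_mult_distrib)
      finally have "norm (?F (Suc n) t - ?F n t) < (1 / 2) ^ n" by (rule power2_less_imp_less) simp
      then show ?case by (rule less_imp_le)
    qed
    moreover have "summable (\<lambda>n. (1 / 2 :: real) ^ n)" by (rule summable_geometric) simp
    ultimately have "summable (\<lambda>n. ?F (Suc n) t - ?F n t)"
      by (rule summable_comparison_test_ev[of "\<lambda>n. ?F (Suc n) t - ?F n t"])
    then have "convergent (\<lambda>n. ?F n t - ?F 0 t)"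
      unfolding summable_iff_convergent using sum_lessThan_telescope[of "\<lambda>n. ?F n t"] by simp
    then obtain l where "(\<lambda>n. ?F n t - ?F 0 t) \<longlonglongrightarrow> l" by (auto simp: convergent_def)
    from tendsto_add[OF this tendsto_const, of "?F 0 t"] show ?case by (auto simp: convergent_def)
  qed
  then show thesis by (rule that[OF r(1)])
qed

instance L2 :: (euclidean_space) complete_space
proof
  fix X :: "nat \<Rightarrow> 'a L2" assume X: "Cauchy X"
  obtain r where r: "strict_mono r" and conv: "AE t in lborel. convergent (\<lambda>n. L2_fun (X (r n)) t)"
    using L2_Cauchy_AE_subsequence[OF X] .
  let ?F = "\<lambda>n. L2_fun (X (r n))"
  define g where "g t = lim (\<lambda>n. ?F n t)" for t
  have lim: "AE t in lborel. (\<lambda>n. ?F n t) \<longlonglongrightarrow> g t"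
    using conv by eventually_elim (simp add: g_def convergent_LIMSEQ_iff)
  have gm [measurable]: "g \<in> borel_measurable borel" unfolding g_def by measurable
  \<comment> \<open>Fatou's lemma bounds the distance to the pointwise limit by the Cauchy bound; in
    particular \<open>g\<close> differs from one member of the sequence by a square integrable
    function.\<close>
  have est: "(\<integral>\<^sup>+t. ennreal ((norm (?F n t - g t))\<^sup>2) \<partial>lborel) \<le> ennreal (e\<^sup>2)"
    if "\<And>m. m \<ge> n \<Longrightarrow> norm (X (r n) - X (r m)) \<le> e" for n e
  proof -
    have "(\<integral>\<^sup>+t. ennreal ((norm (?F n t - g t))\<^sup>2) \<partial>lborel)
        = (\<integral>\<^sup>+t. liminf (\<lambda>m. ennreal ((norm (?F n t - ?F m t))\<^sup>2)) \<partial>lborel)"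
    proof (rule nn_integral_cong_AE)
      show "AE t in lborel. ennreal ((norm (?F n t - g t))\<^sup>2) = liminf (\<lambda>m. ennreal ((norm (?F n t - ?F m t))\<^sup>2))"
        using lim
      proof eventually_elim
        case (elim t)
        then have "(\<lambda>m. ennreal ((norm (?F n t - ?F m t))\<^sup>2)) \<longlonglongrightarrow> ennreal ((norm (?F n t - g t))\<^sup>2)"
          by (intro tendsto_ennrealI tendsto_intros)
        then show ?case by (rule lim_imp_Liminf[OF sequentially_bot, symmetric])
      qed
    qed
    also have "\<dots> \<le> liminf (\<lambda>m. \<integral>\<^sup>+t. ennreal ((norm (?F n t - ?F m t))\<^sup>2) \<partial>lborel)"
      by (rule nn_integral_liminf) measurable
    also have "\<dots> = liminf (\<lambda>m. ennreal ((norm (X (r n) - X (r m)))\<^sup>2))"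
      by (simp add: nn_integral_norm_L2_diff)
    also have "\<dots> \<le> ennreal (e\<^sup>2)"
    proof (rule Liminf_le)
      show "\<forall>\<^sub>F m in sequentially. ennreal ((norm (X (r n) - X (r m)))\<^sup>2) \<le> ennreal (e\<^sup>2)"
        using eventually_ge_at_top[of n] by eventually_elim (intro ennreal_leI power_mono that, auto)
    qed simp
    finally show ?thesis .
  qed
  have tail: "\<exists>n0. \<forall>n\<ge>n0. \<forall>m\<ge>n. norm (X (r n) - X (r m)) \<le> e" if e: "e > 0" for e
  proof -
    obtain N where N: "\<And>m n. m \<ge> N \<Longrightarrow> n \<ge> N \<Longrightarrow> norm (X m - X n) < e"
      using CauchyD[OF X e] by auto
    have "r n \<ge> N" if "n \<ge> N" for n using seq_suble[OF r, of n] that by simp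
    then show ?thesis using N by (meson less_imp_le order_trans)
  qed
  have sq: "square_integrable (\<lambda>t. ?F n t - g t) \<and> (\<integral>t. (norm (?F n t - g t))\<^sup>2 \<partial>lborel) \<le> e\<^sup>2"
    if "\<And>m. m \<ge> n \<Longrightarrow> norm (X (r n) - X (r m)) \<le> e" for n e
  proof -
    have i: "integrable lborel (\<lambda>t. (norm (?F n t - g t))\<^sup>2)"
    proof (rule integrableI_bounded)
      have "(\<integral>\<^sup>+t. ennreal (norm ((norm (?F n t - g t))\<^sup>2)) \<partial>lborel) \<le> ennreal (e\<^sup>2)"
        using est[OF that] by simp
      then show "(\<integral>\<^sup>+t. ennreal (norm ((norm (?F n t - g t))\<^sup>2)) \<partial>lborel) < \<infinity>"
        by (rule le_less_trans) simp
    qed measurable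
    then have "ennreal (\<integral>t. (norm (?F n t - g t))\<^sup>2 \<partial>lborel) \<le> ennreal (e\<^sup>2)"
      using est[OF that] by (subst nn_integral_eq_integral[symmetric]) auto
    then have "(\<integral>t. (norm (?F n t - g t))\<^sup>2 \<partial>lborel) \<le> e\<^sup>2" by (simp add: ennreal_le_iff)
    then show ?thesis using i by (simp add: square_integrable_def)
  qed
  obtain n1 where "\<And>m. m \<ge> n1 \<Longrightarrow> norm (X (r n1) - X (r m)) \<le> 1" using tail[of 1] by auto
  then have "square_integrable (\<lambda>t. ?F n1 t - g t)" using sq by blast
  from square_integrable_add[OF square_integrable_L2_fun[of "X (r n1)"] square_integrable_uminus[OF this]]
  have g: "square_integrable g" by simp
  let ?G = "abs_L2 g"
  have sub: "\<exists>n0. \<forall>n\<ge>n0. norm (X (r n) - ?G) \<le> e" if e: "e > 0" for e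
  proof -
    obtain n0 where n0: "\<And>n m. n \<ge> n0 \<Longrightarrow> m \<ge> n \<Longrightarrow> norm (X (r n) - X (r m)) \<le> e" using tail[OF e] by auto
    have "norm (X (r n) - ?G) \<le> e" if "n \<ge> n0" for n
    proof (rule power2_le_imp_le)
      have "(norm (X (r n) - ?G))\<^sup>2 = (\<integral>t. (norm (?F n t - g t))\<^sup>2 \<partial>lborel)"
        unfolding norm_L2_sq
      proof (rule integral_cong_AE)
        show "AE t in lborel. (norm (L2_fun (X (r n) - ?G) t))\<^sup>2 = (norm (?F n t - g t))\<^sup>2"
          using L2_fun_diff[of "X (r n)" ?G] L2_fun_abs[OF g] by eventually_elim simp
      qed measurable
      then show "(norm (X (r n) - ?G))\<^sup>2 \<le> e\<^sup>2" using sq[of n e] n0 that by auto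
    qed (use e in simp)
    then show ?thesis by blast
  qed
  have "X \<longlonglongrightarrow> ?G"
  proof (rule LIMSEQ_I)
    fix e :: real assume e: "e > 0"
    obtain N where N: "\<And>m n. m \<ge> N \<Longrightarrow> n \<ge> N \<Longrightarrow> norm (X m - X n) < e / 2"
      using CauchyD[OF X, of "e / 2"] e by auto
    obtain n0 where n0: "\<And>n. n \<ge> n0 \<Longrightarrow> norm (X (r n) - ?G) \<le> e / 2" using sub[of "e / 2"] e by auto
    have "norm (X m - ?G) < e" if m: "m \<ge> N" for m
    proof -
      let ?n = "max N n0"
      have "r ?n \<ge> N" using seq_suble[OF r, of ?n] by simp
      then have "norm (X m - X (r ?n)) < e / 2" using N m by blast
      moreover have "norm (X (r ?n) - ?G) \<le> e / 2" by (rule n0) simp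
      moreover have "norm (X m - ?G) \<le> norm (X m - X (r ?n)) + norm (X (r ?n) - ?G)" by norm
      ultimately show ?thesis by linarith
    qed
    then show "\<exists>N. \<forall>m\<ge>N. norm (X m - ?G) < e" by blast
  qed
  then show "convergent X" by (auto simp: convergent_def)
qed

instance L2 :: (euclidean_space) banach ..

section \<open>The orthogonal projection onto functions on the horizon, and matrix
  multipliers\<close>

lemma square_integrable_indicator:
  assumes "square_integrable f"
  shows "square_integrable (\<lambda>t. indicator {0..tf::real} t *\<^sub>R f t)"
proof -
  have [measurable]: "f \<in> borel_measurable borel" using assms by (simp add: square_integrable_def)
  have "integrable lborel (\<lambda>t. (norm (indicator {0..tf} t *\<^sub>R f t))\<^sup>2)"
  proof (rule Bochner_Integration.integrable_bound)
    show "integrable lborel (\<lambda>t. (norm (f t))\<^sup>2)" using assms by (simp add: square_integrable_def)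
  qed (auto simp: indicator_def)
  then show ?thesis by (simp add: square_integrable_def)
qed

text \<open>The orthogonal projection with range \<open>L2_on tf\<close>; it supplies the abstract
  projection \<open>P\<close> in both function components of the optimizer space.\<close>

lift_definition L2_restrict :: "real \<Rightarrow> 'a::euclidean_space L2 \<Rightarrow> 'a L2" is
  "\<lambda>tf f t. indicator {0..tf} t *\<^sub>R f t"
  by (auto simp: L2_rel_def square_integrable_indicator)

lemma L2_fun_restrict: "AE t in lborel. L2_fun (L2_restrict tf f) t = indicator {0..tf} t *\<^sub>R L2_fun f t"
proof -
  have "L2_restrict tf f = abs_L2 (\<lambda>t. indicator {0..tf} t *\<^sub>R L2_fun f t)"
    using L2_restrict.abs_eq[OF L2_rel_L2_fun, of tf f] by (simp add: abs_L2_fun)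
  then show ?thesis
    using L2_fun_abs[OF square_integrable_indicator[OF square_integrable_L2_fun], of tf f] by simp
qed

lemma L2_restrict_in: "L2_restrict tf f \<in> L2_on tf"
  unfolding L2_on_def using L2_fun_restrict[of tf f] by (auto elim!: eventually_mono)

lemma L2_on_iff: "f \<in> L2_on tf \<longleftrightarrow> L2_restrict tf f = f"
proof
  assume "f \<in> L2_on tf"
  then have "AE t in lborel. t \<notin> {0..tf} \<longrightarrow> L2_fun f t = 0" by (simp add: L2_on_def)
  then have "AE t in lborel. L2_fun (L2_restrict tf f) t = L2_fun f t"
    using L2_fun_restrict[of tf f] by eventually_elim (auto simp: indicator_def)
  then show "L2_restrict tf f = f" by (rule L2_eqI)
qed (metis L2_restrict_in)

lemma L2_restrict_idem: "L2_restrict tf (L2_restrict tf f) = L2_restrict tf f"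
  using L2_restrict_in L2_on_iff by blast

lemma L2_restrict_inner: "L2_restrict tf f \<bullet> g = f \<bullet> L2_restrict tf g"
  unfolding inner_L2_eq
proof (rule integral_cong_AE)
  show "AE t in lborel. L2_fun (L2_restrict tf f) t \<bullet> L2_fun g t = L2_fun f t \<bullet> L2_fun (L2_restrict tf g) t"
    using L2_fun_restrict[of tf f] L2_fun_restrict[of tf g] by eventually_elim simp
qed measurable

lemma L2_restrict_norm: "norm (L2_restrict tf f) \<le> norm f"
proof (rule power2_le_imp_le)
  show "(norm (L2_restrict tf f))\<^sup>2 \<le> (norm f)\<^sup>2"
    unfolding norm_L2_sq
  proof (rule integral_mono_AE[OF integrable_norm_L2_fun integrable_norm_L2_fun])
    show "AE t in lborel. (norm (L2_fun (L2_restrict tf f) t))\<^sup>2 \<le> (norm (L2_fun f t))\<^sup>2"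
      using L2_fun_restrict[of tf f] by eventually_elim (auto simp: indicator_def)
  qed
qed simp

lemma bounded_linear_L2_restrict: "bounded_linear (L2_restrict tf)"
proof (rule bounded_linear_intro[where K = 1])
  fix f g :: "'a L2" and c :: real
  show "L2_restrict tf (f + g) = L2_restrict tf f + L2_restrict tf g"
    by (rule L2_eqI)
      (use L2_fun_restrict[of tf "f + g"] L2_fun_add[of f g] L2_fun_restrict[of tf f] L2_fun_restrict[of tf g]
          L2_fun_add[of "L2_restrict tf f" "L2_restrict tf g"] in \<open>eventually_elim, simp add: scaleR_add_right\<close>)
  show "L2_restrict tf (c *\<^sub>R f) = c *\<^sub>R L2_restrict tf f"
    by (rule L2_eqI)
      (use L2_fun_restrict[of tf "c *\<^sub>R f"] L2_fun_scaleR[of c f] L2_fun_restrict[of tf f]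
          L2_fun_scaleR[of c "L2_restrict tf f"] in \<open>eventually_elim, simp\<close>)
  show "norm (L2_restrict tf f) \<le> norm f * 1" by (simp add: L2_restrict_norm)
qed

lemma L2_on_subspace: "subspace (L2_on tf)"
proof -
  interpret bounded_linear "L2_restrict tf" by (rule bounded_linear_L2_restrict)
  show ?thesis by (auto simp: subspace_def L2_on_iff zero add scaleR)
qed

lemma L2_mat_linear:
  fixes A :: "real^'n^'k"
  shows "linear (L2_mat A)"
proof
  fix f g :: "(real^'n) L2" and c :: real
  show "L2_mat A (f + g) = L2_mat A f + L2_mat A g"
    by (rule L2_eqI)
      (use L2_fun_mat[of A "f + g"] L2_fun_add[of f g] L2_fun_mat[of A f] L2_fun_mat[of A g]
          L2_fun_add[of "L2_mat A f" "L2_mat A g"] in \<open>eventually_elim, simp add: matrix_vector_right_distrib\<close>)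
  show "L2_mat A (c *\<^sub>R f) = c *\<^sub>R L2_mat A f"
    by (rule L2_eqI)
      (use L2_fun_mat[of A "c *\<^sub>R f"] L2_fun_scaleR[of c f] L2_fun_mat[of A f]
          L2_fun_scaleR[of c "L2_mat A f"] in \<open>eventually_elim, simp add: matrix_vector_mult_scaleR\<close>)
qed

lemma bounded_linear_L2_mat: "bounded_linear (L2_mat A)"
proof -
  obtain K where K: "\<And>x. norm (A *v x) \<le> norm x * K" "K \<ge> 0"
    using bounded_linear.nonneg_bounded[OF matrix_vector_mul_bounded_linear[of A]] by blast
  have "norm (L2_mat A f) \<le> norm f * K" for f
  proof (rule power2_le_imp_le)
    have "(norm (L2_mat A f))\<^sup>2 \<le> (\<integral>t. K\<^sup>2 * (norm (L2_fun f t))\<^sup>2 \<partial>lborel)"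
      unfolding norm_L2_sq[of "L2_mat A f"]
    proof (rule integral_mono_AE[OF integrable_norm_L2_fun])
      show "AE t in lborel. (norm (L2_fun (L2_mat A f) t))\<^sup>2 \<le> K\<^sup>2 * (norm (L2_fun f t))\<^sup>2"
        using L2_fun_mat[of A f]
      proof eventually_elim
        case (elim t)
        then show ?case
          using power_mono[OF K(1)[of "L2_fun f t"], of 2] by (simp add: power_mult_distrib mult.commute)
      qed
    qed (intro integrable_mult_right integrable_norm_L2_fun)
    then show "(norm (L2_mat A f))\<^sup>2 \<le> (norm f * K)\<^sup>2"
      by (simp add: norm_L2_sq[of f] power_mult_distrib mult.commute)
  qed (use K in simp)
  then show ?thesis
    by (intro bounded_linear_intro[where K = K] linear_add[OF L2_mat_linear] linear_scale[OF L2_mat_linear])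
qed

lemma L2_mat_in: "f \<in> L2_on tf \<Longrightarrow> L2_mat A f \<in> L2_on tf"
  unfolding L2_on_def using L2_fun_mat[of A f] by (auto elim!: eventually_elim2)

lemma matrix_vector_inner_transpose: "(A *v x) \<bullet> y = x \<bullet> (transpose A *v y)" for A :: "real^'n^'k"
  by (metis dot_lmul_matrix inner_commute transpose_matrix_vector)

lemma L2_mat_adjoint: "L2_mat A f \<bullet> g = f \<bullet> L2_mat (transpose A) g"
  unfolding inner_L2_eq
proof (rule integral_cong_AE)
  show "AE t in lborel. L2_fun (L2_mat A f) t \<bullet> L2_fun g t = L2_fun f t \<bullet> L2_fun (L2_mat (transpose A) g) t"
    using L2_fun_mat[of A f] L2_fun_mat[of "transpose A" g]
    by eventually_elim (simp only: matrix_vector_inner_transpose)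
qed measurable

section \<open>Sobolev functions on an interval\<close>

lemma norm_le_1_plus_sq: "norm x \<le> 1 + (norm x)\<^sup>2"
proof -
  have "2 * norm x \<le> (norm x)\<^sup>2 + 1" using zero_le_power2[of "norm x - 1"] by (simp add: power2_diff)
  then show ?thesis using norm_ge_zero[of x] by linarith
qed

lemma set_integrable_L2_fun: "set_integrable lborel {a..b} (L2_fun f)"
  unfolding set_integrable_def
proof (rule Bochner_Integration.integrable_bound)
  show "integrable lborel (\<lambda>t. indicator {a..b} t + (norm (L2_fun f t))\<^sup>2 :: real)"
    by (intro Bochner_Integration.integrable_add integrable_norm_L2_fun integrable_real_indicator)
      (auto simp: emeasure_lborel_Icc_eq)
  show "AE t in lborel. norm (indicator {a..b} t *\<^sub>R L2_fun f t)
      \<le> norm (indicator {a..b} t + (norm (L2_fun f t))\<^sup>2 :: real)"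
    by (auto simp: indicator_def norm_le_1_plus_sq)
qed measurable

definition indef :: "'a::euclidean_space L2 \<Rightarrow> real \<Rightarrow> 'a" where
  "indef f t = (LINT s:{0..t}|lborel. L2_fun f s)"

lemma indef_eq_integral: "indef f t = integral {0..t} (L2_fun f)"
  and L2_fun_integrable_on: "L2_fun f integrable_on {a..b}"
  unfolding indef_def using set_borel_integral_eq_integral[OF set_integrable_L2_fun] by auto

lemma indef_add: "indef (f + g) t = indef f t + indef g t"
proof -
  have "indef (f + g) t = (\<integral>s. indicator {0..t} s *\<^sub>R L2_fun f s + indicator {0..t} s *\<^sub>R L2_fun g s \<partial>lborel)"
    unfolding indef_def set_lebesgue_integral_def
  proof (rule integral_cong_AE)
    show "AE s in lborel. indicator {0..t} s *\<^sub>R L2_fun (f + g) s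
        = indicator {0..t} s *\<^sub>R L2_fun f s + indicator {0..t} s *\<^sub>R L2_fun g s"
      using L2_fun_add[of f g] by eventually_elim (simp add: scaleR_add_right)
  qed measurable
  also have "\<dots> = indef f t + indef g t"
    unfolding indef_def set_lebesgue_integral_def
    by (intro Bochner_Integration.integral_add set_integrable_L2_fun[unfolded set_integrable_def])
  finally show ?thesis .
qed

lemma indef_scaleR: "indef (c *\<^sub>R f) t = c *\<^sub>R indef f t"
proof -
  have "indef (c *\<^sub>R f) t = (\<integral>s. c *\<^sub>R (indicator {0..t} s *\<^sub>R L2_fun f s) \<partial>lborel)"
    unfolding indef_def set_lebesgue_integral_def
  proof (rule integral_cong_AE)
    show "AE s in lborel. indicator {0..t} s *\<^sub>R L2_fun (c *\<^sub>R f) s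
        = c *\<^sub>R (indicator {0..t} s *\<^sub>R L2_fun f s)"
      using L2_fun_scaleR[of c f] by eventually_elim simp
  qed measurable
  also have "\<dots> = c *\<^sub>R (\<integral>s. indicator {0..t} s *\<^sub>R L2_fun f s \<partial>lborel)"
    by (rule Bochner_Integration.integral_scaleR_right)
  finally show ?thesis unfolding indef_def set_lebesgue_integral_def .
qed

lemma continuous_on_indef: "continuous_on {0..b} (indef f)"
  unfolding indef_eq_integral[abs_def]
  by (rule indefinite_integral_continuous_1[OF L2_fun_integrable_on])

lemma indef_0: "indef f 0 = 0"
  by (simp add: indef_eq_integral)

text \<open>A crude substitute for Cauchy-Schwarz, from \<open>a \<le> 1 + a^2\<close> under the
  integral. It is not homogeneous in \<open>f\<close>, but it is applied on the unit ball
  only.\<close>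

lemma norm_indef_le:
  assumes "t \<ge> 0"
  shows "norm (indef f t) \<le> t + (norm f)\<^sup>2"
proof -
  have le: "norm (indicator {0..t} s *\<^sub>R L2_fun f s) \<le> indicator {0..t} s + (norm (L2_fun f s))\<^sup>2" for s
    by (auto simp: indicator_def norm_le_1_plus_sq)
  have "norm (indef f t) \<le> (\<integral>s. norm (indicator {0..t} s *\<^sub>R L2_fun f s) \<partial>lborel)"
    unfolding indef_def set_lebesgue_integral_def by (rule integral_norm_bound)
  also have "\<dots> \<le> (\<integral>s. indicator {0..t} s + (norm (L2_fun f s))\<^sup>2 \<partial>lborel)"
    using le by (intro integral_mono integrable_norm Bochner_Integration.integrable_add integrable_norm_L2_fun
        set_integrable_L2_fun[unfolded set_integrable_def] integrable_real_indicator)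
      (auto simp: emeasure_lborel_Icc_eq)
  also have "\<dots> = t + (norm f)\<^sup>2"
    using assms by (subst Bochner_Integration.integral_add) (auto simp: integrable_norm_L2_fun norm_L2_sq)
  finally show ?thesis .
qed

lemma is_rep_on_unique:
  assumes tf: "tf > 0" and v: "continuous_on {0..tf} v" "is_rep_on tf f v"
    and w: "continuous_on {0..tf} w" "is_rep_on tf f w" and t: "t \<in> {0..tf}"
  shows "v t = w t"
proof (rule ccontr)
  assume ne: "v t \<noteq> w t"
  let ?c = "\<lambda>s. v s - w s"
  have "continuous_on {0..tf} ?c" by (intro continuous_intros v w)
  then obtain d where d: "d > 0" "\<And>s. s \<in> {0..tf} \<Longrightarrow> dist s t < d \<Longrightarrow> dist (?c s) (?c t) < norm (?c t)"
    using t ne unfolding continuous_on_iff by (metis norm_eq_zero right_minus_eq zero_less_norm_iff)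
  \<comment> \<open>Clipping the neighbourhood of \<open>t\<close> to the horizon leaves an interval
    of positive length even if \<open>t\<close> is an end point, because
    \<open>tf > 0\<close>.\<close>
  define a b where "a = max 0 (t - d)" and "b = min tf (t + d)"
  have ab: "a < b" using tf t d(1) by (auto simp: a_def b_def)
  have "AE s in lborel. s \<in> {0..tf} \<longrightarrow> v s = w s"
    using v(2) w(2) unfolding is_rep_on_def by eventually_elim auto
  then have "AE s in lborel. \<not> s \<in> {a<..<b}"
  proof eventually_elim
    case (elim s)
    show ?case
    proof
      assume s: "s \<in> {a<..<b}"
      then have "s \<in> {0..tf}" "dist s t < d" by (auto simp: a_def b_def dist_real_def)
      with d(2)[of s] elim show False by simp
    qed
  qed
  then have "emeasure lborel {s \<in> space lborel. s \<in> {a<..<b}} = 0" by (rule emeasure_eq_0_AE)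
  moreover have "{s \<in> space lborel. s \<in> {a<..<b}} = {a<..<b}" by auto
  ultimately show False using ab by (simp only: emeasure_lborel_Ioo[OF less_imp_le]) simp
qed

text \<open>\<open>has_H1_deriv\<close> with its absolutely continuous representative exposed, so
  that boundary values can be named and computed with.\<close>

definition H1_rep :: "real \<Rightarrow> 'a::euclidean_space L2 \<Rightarrow> 'a L2 \<Rightarrow> (real \<Rightarrow> 'a) \<Rightarrow> bool" where
  "H1_rep tf f g v \<longleftrightarrow> f \<in> L2_on tf \<and> g \<in> L2_on tf \<and> is_rep_on tf f v \<and>
     (\<forall>t\<in>{0..tf}. v t = v 0 + indef g t)"

lemma has_H1_deriv_iff: "has_H1_deriv tf f g \<longleftrightarrow> (\<exists>v. H1_rep tf f g v)"
  by (auto simp: has_H1_deriv_def H1_rep_def indef_def)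

lemma H1_repD:
  assumes "H1_rep tf f g v"
  shows "f \<in> L2_on tf" "g \<in> L2_on tf" "is_rep_on tf f v" "t \<in> {0..tf} \<Longrightarrow> v t = v 0 + indef g t"
  using assms unfolding H1_rep_def by blast+

lemma H1_rep_continuous:
  assumes "H1_rep tf f g v"
  shows "continuous_on {0..tf} v"
proof -
  have "continuous_on {0..tf} (\<lambda>t. v 0 + indef g t)" by (intro continuous_intros continuous_on_indef)
  then show ?thesis by (rule continuous_on_eq) (rule H1_repD(4)[OF assms, symmetric])
qed

lemma L2_at_eq:
  assumes tf: "tf > 0" and v: "continuous_on {0..tf} v" "is_rep_on tf f v" and t: "t \<in> {0..tf}"
  shows "L2_at tf f t = v t"
  unfolding L2_at_def using v is_rep_on_unique[OF tf _ _ _ _ t] by (intro the_equality) auto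

lemma H1_rep_at: "tf > 0 \<Longrightarrow> H1_rep tf f g v \<Longrightarrow> t \<in> {0..tf} \<Longrightarrow> L2_at tf f t = v t"
  by (rule L2_at_eq[OF _ H1_rep_continuous H1_repD(3)])

lemma is_rep_on_add:
  assumes "is_rep_on tf f v" "is_rep_on tf f' v'"
  shows "is_rep_on tf (f + f') (\<lambda>t. v t + v' t)"
  using assms L2_fun_add[of f f'] unfolding is_rep_on_def by eventually_elim simp

lemma is_rep_on_scaleR:
  assumes "is_rep_on tf f v"
  shows "is_rep_on tf (c *\<^sub>R f) (\<lambda>t. c *\<^sub>R v t)"
  using assms L2_fun_scaleR[of c f] unfolding is_rep_on_def by eventually_elim simp

lemma H1_rep_add:
  assumes "H1_rep tf f g v" "H1_rep tf f' g' v'"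
  shows "H1_rep tf (f + f') (g + g') (\<lambda>t. v t + v' t)"
  unfolding H1_rep_def
proof (intro conjI ballI is_rep_on_add)
  fix t assume t: "t \<in> {0..tf}"
  show "v t + v' t = v 0 + v' 0 + indef (g + g') t"
    unfolding H1_repD(4)[OF assms(1) t] H1_repD(4)[OF assms(2) t] indef_add by (simp only: add_ac)
qed (use assms L2_on_subspace in \<open>auto dest: H1_repD intro: subspace_add\<close>)

lemma H1_rep_scaleR:
  assumes "H1_rep tf f g v"
  shows "H1_rep tf (c *\<^sub>R f) (c *\<^sub>R g) (\<lambda>t. c *\<^sub>R v t)"
  unfolding H1_rep_def
proof (intro conjI ballI is_rep_on_scaleR)
  fix t assume t: "t \<in> {0..tf}"
  show "c *\<^sub>R v t = c *\<^sub>R v 0 + indef (c *\<^sub>R g) t"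
    unfolding H1_repD(4)[OF assms t] indef_scaleR by (simp only: scaleR_add_right)
qed (use assms L2_on_subspace in \<open>auto dest: H1_repD intro: subspace_scale\<close>)

lemma H1_rep_diff:
  assumes "H1_rep tf f g v" "H1_rep tf f' g' v'"
  shows "H1_rep tf (f - f') (g - g') (\<lambda>t. v t - v' t)"
  using H1_rep_add[OF assms(1) H1_rep_scaleR[OF assms(2), of "-1"]] by simp

text \<open>Lebesgue differentiation: at almost every point the averages over
  \<open>{x..x + h}\<close> tend to the value of \<open>f\<close>, and all of them vanish inside the
  horizon.\<close>

lemma L2_eq_0_if_indef_0:
  assumes f: "f \<in> L2_on tf" and 0: "\<And>t. t \<in> {0..tf} \<Longrightarrow> indef f t = 0"
  shows "f = 0"
proof -
  have "L2_fun f integrable_on cbox a b" for a b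
    using L2_fun_integrable_on by simp
  then obtain N where N: "negligible N" "\<And>x e. x \<notin> N \<Longrightarrow> e > 0 \<Longrightarrow>
      \<exists>d>0. \<forall>h. 0 < h \<and> h < d \<longrightarrow> norm (integral (cbox x (x + h *\<^sub>R One)) (L2_fun f) /\<^sub>R h ^ DIM(real) - L2_fun f x) < e"
    using integrable_ccontinuous_explicit[of "L2_fun f"] by blast
  have zero: "L2_fun f x = 0" if x: "x \<notin> N" "0 < x" "x < tf" for x
  proof (rule ccontr)
    assume "L2_fun f x \<noteq> 0"
    then obtain d where d: "d > 0" "\<And>h. 0 < h \<Longrightarrow> h < d \<Longrightarrow>
        norm (integral (cbox x (x + h *\<^sub>R One)) (L2_fun f) /\<^sub>R h ^ DIM(real) - L2_fun f x) < norm (L2_fun f x)"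
      using N(2)[OF x(1), of "norm (L2_fun f x)"] by auto
    define h where "h = min (d / 2) (tf - x)"
    have h: "0 < h" "h < d" "x + h \<le> tf" using d(1) x by (auto simp: h_def)
    have "integral {0..x} (L2_fun f) + integral {x..x + h} (L2_fun f) = integral {0..x + h} (L2_fun f)"
      using x h by (intro Henstock_Kurzweil_Integration.integral_combine L2_fun_integrable_on) auto
    then have "integral {x..x + h} (L2_fun f) = 0"
      using 0[of x] 0[of "x + h"] x h by (simp add: indef_eq_integral)
    then show False using d(2)[OF h(1,2)] by simp
  qed
  have "AE x in lebesgue. x \<notin> N"
    using N(1) by (simp add: negligible_iff_null_sets AE_not_in)
  then have "AE x in lborel. x \<notin> N" by (simp add: AE_completion_iff)
  moreover have "AE x in lborel. x \<notin> {0..tf} \<longrightarrow> L2_fun f x = 0" using f by (simp add: L2_on_def)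
  ultimately have "AE x in lborel. L2_fun f x = 0"
    using AE_lborel_singleton[of 0] AE_lborel_singleton[of tf]
  proof eventually_elim
    case (elim x)
    then show ?case using zero[of x] by (cases "x \<in> {0..tf}") auto
  qed
  then have "AE x in lborel. L2_fun f x = L2_fun 0 x"
    using L2_fun_zero by eventually_elim simp
  then show ?thesis by (rule L2_eqI)
qed

lemma H1_rep_deriv_unique:
  assumes tf: "tf > 0" and f: "H1_rep tf f g v" and f': "H1_rep tf f g' v'"
  shows "g = g'"
proof -
  have vv: "v t = v' t" if "t \<in> {0..tf}" for t
    by (rule is_rep_on_unique[OF tf H1_rep_continuous[OF f] H1_repD(3)[OF f]
          H1_rep_continuous[OF f'] H1_repD(3)[OF f'] that])
  have "indef g t = indef g' t" if t: "t \<in> {0..tf}" for t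
    using H1_repD(4)[OF f t] H1_repD(4)[OF f' t] vv[OF t] vv[of 0] tf by simp
  then have "indef (g - g') t = 0" if "t \<in> {0..tf}" for t
    using that indef_add[of g "(-1) *\<^sub>R g'" t] indef_scaleR[of "-1" g' t] by simp
  moreover have "g - g' \<in> L2_on tf" using H1_repD(2)[OF f] H1_repD(2)[OF f'] by (rule subspace_diff[OF L2_on_subspace])
  ultimately have "g - g' = 0" by (intro L2_eq_0_if_indef_0)
  then show ?thesis by simp
qed

lemma H1_deriv_eq: "tf > 0 \<Longrightarrow> H1_rep tf f g v \<Longrightarrow> H1_deriv tf f = g"
  unfolding H1_deriv_def has_H1_deriv_iff using H1_rep_deriv_unique by (intro the_equality) blast+

lemma H1_onE:
  assumes "tf > 0" "f \<in> H1_on tf"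
  obtains v where "H1_rep tf f (H1_deriv tf f) v"
proof -
  obtain g v where v: "H1_rep tf f g v" using assms(2) by (auto simp: H1_on_def has_H1_deriv_iff)
  then have "H1_rep tf f (H1_deriv tf f) v" using H1_deriv_eq[OF assms(1) v] by simp
  then show thesis by (rule that)
qed

text \<open>Integration by parts for indefinite integrals, by Fubini: the two terms integrate
  \<open>a x \<bullet> b y\<close> over the two triangles of the plane that meet in the diagonal,
  and each vertical section meets the diagonal in a null set.\<close>

lemma integral_triangle:
  fixes a b :: "real \<Rightarrow> 'a::euclidean_space"
  assumes a: "integrable lborel a" and b: "integrable lborel b"
  shows "(\<integral>t. a t \<bullet> (\<integral>s. indicator {..t} s *\<^sub>R b s \<partial>lborel) \<partial>lborel)
      + (\<integral>t. (\<integral>s. indicator {..t} s *\<^sub>R a s \<partial>lborel) \<bullet> b t \<partial>lborel)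
      = (\<integral>t. a t \<partial>lborel) \<bullet> (\<integral>t. b t \<partial>lborel)"
proof -
  have [measurable]: "a \<in> borel_measurable borel" "b \<in> borel_measurable borel"
    using borel_measurable_integrable[OF a] borel_measurable_integrable[OF b] by simp_all
  let ?F = "\<lambda>x y. a x \<bullet> b y" and ?L = "\<lambda>x y. (if y \<le> x then 1 else 0) * (a x \<bullet> b y) :: real"
    and ?G = "\<lambda>x y. (if x \<le> y then 1 else 0) * (a x \<bullet> b y) :: real"
  have ib: "integrable lborel (\<lambda>y. c \<bullet> b y)" for c using b by simp
  have bound: "integrable (lborel \<Otimes>\<^sub>M lborel) (\<lambda>p. k p * (a (fst p) \<bullet> b (snd p)))"
    if [measurable]: "k \<in> borel_measurable (borel \<Otimes>\<^sub>M borel)" and k: "\<And>p. \<bar>k p\<bar> \<le> 1" for k :: "real \<times> real \<Rightarrow> real"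
  proof (rule Bochner_Integration.integrable_bound)
    show "integrable (lborel \<Otimes>\<^sub>M lborel) (\<lambda>p. norm (a (fst p)) * norm (b (snd p)))"
    proof (rule lborel_pair.Fubini_integrable)
      show "integrable lborel (\<lambda>x. \<integral>y. norm (norm (a (fst (x, y))) * norm (b (snd (x, y)))) \<partial>lborel)"
        using integrable_norm[OF a] by (simp add: abs_mult)
      show "AE x in lborel. integrable lborel (\<lambda>y. norm (a (fst (x, y))) * norm (b (snd (x, y))))"
        using integrable_norm[OF b] by simp
    qed measurable
    show "AE p in lborel \<Otimes>\<^sub>M lborel. norm (k p * (a (fst p) \<bullet> b (snd p))) \<le> norm (norm (a (fst p)) * norm (b (snd p)))"
    proof (intro always_eventually allI)
      fix p
      have "\<bar>k p\<bar> * \<bar>a (fst p) \<bullet> b (snd p)\<bar> \<le> 1 * (norm (a (fst p)) * norm (b (snd p)))"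
        by (intro mult_mono k Cauchy_Schwarz_ineq2) auto
      then show "norm (k p * (a (fst p) \<bullet> b (snd p))) \<le> norm (norm (a (fst p)) * norm (b (snd p)))"
        by (simp add: abs_mult)
    qed
  qed measurable
  have iL: "integrable (lborel \<Otimes>\<^sub>M lborel) (\<lambda>(x, y). ?L x y)"
  proof -
    have "{p :: real \<times> real. snd p \<le> fst p} \<in> sets borel"
      by (intro borel_closed closed_Collect_le continuous_intros)
    then have "(\<lambda>p :: real \<times> real. indicator {p. snd p \<le> fst p} p :: real) \<in> borel_measurable (borel \<Otimes>\<^sub>M borel)"
      unfolding borel_prod by (rule borel_measurable_indicator)
    also have "(\<lambda>p :: real \<times> real. indicator {p. snd p \<le> fst p} p :: real) = (\<lambda>p. if snd p \<le> fst p then 1 else 0)"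
      by (auto simp: indicator_def)
    finally have "integrable (lborel \<Otimes>\<^sub>M lborel) (\<lambda>p. (if snd p \<le> fst p then 1 else 0) * (a (fst p) \<bullet> b (snd p)))"
      by (rule bound) simp
    then show ?thesis by (simp only: case_prod_unfold)
  qed
  have iG: "integrable (lborel \<Otimes>\<^sub>M lborel) (\<lambda>(x, y). ?G x y)"
  proof -
    have "{p :: real \<times> real. fst p \<le> snd p} \<in> sets borel"
      by (intro borel_closed closed_Collect_le continuous_intros)
    then have "(\<lambda>p :: real \<times> real. indicator {p. fst p \<le> snd p} p :: real) \<in> borel_measurable (borel \<Otimes>\<^sub>M borel)"
      unfolding borel_prod by (rule borel_measurable_indicator)
    also have "(\<lambda>p :: real \<times> real. indicator {p. fst p \<le> snd p} p :: real) = (\<lambda>p. if fst p \<le> snd p then 1 else 0)"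
      by (auto simp: indicator_def)
    finally have "integrable (lborel \<Otimes>\<^sub>M lborel) (\<lambda>p. (if fst p \<le> snd p then 1 else 0) * (a (fst p) \<bullet> b (snd p)))"
      by (rule bound) simp
    then show ?thesis by (simp only: case_prod_unfold)
  qed
  have 1: "(\<integral>t. a t \<bullet> (\<integral>s. indicator {..t} s *\<^sub>R b s \<partial>lborel) \<partial>lborel) = (\<integral>x. (\<integral>y. ?L x y \<partial>lborel) \<partial>lborel)"
  proof (rule Bochner_Integration.integral_cong[OF refl])
    fix t
    have "integrable lborel (\<lambda>s. indicator {..t} s *\<^sub>R b s)" by (rule integrable_mult_indicator) (use b in auto)
    then have "a t \<bullet> (\<integral>s. indicator {..t} s *\<^sub>R b s \<partial>lborel) = (\<integral>s. a t \<bullet> (indicator {..t} s *\<^sub>R b s) \<partial>lborel)"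
      by (intro integral_inner_right[symmetric])
    also have "\<dots> = (\<integral>y. ?L t y \<partial>lborel)"
      by (rule Bochner_Integration.integral_cong) (auto simp: indicator_def)
    finally show "a t \<bullet> (\<integral>s. indicator {..t} s *\<^sub>R b s \<partial>lborel) = (\<integral>y. ?L t y \<partial>lborel)" .
  qed
  have "(\<integral>t. (\<integral>s. indicator {..t} s *\<^sub>R a s \<partial>lborel) \<bullet> b t \<partial>lborel) = (\<integral>y. (\<integral>x. ?G x y \<partial>lborel) \<partial>lborel)"
  proof (rule Bochner_Integration.integral_cong[OF refl])
    fix t
    have "integrable lborel (\<lambda>s. indicator {..t} s *\<^sub>R a s)" by (rule integrable_mult_indicator) (use a in auto)
    then have "(\<integral>s. indicator {..t} s *\<^sub>R a s \<partial>lborel) \<bullet> b t = (\<integral>s. (indicator {..t} s *\<^sub>R a s) \<bullet> b t \<partial>lborel)"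
      by (intro integral_inner_left[symmetric])
    also have "\<dots> = (\<integral>x. ?G x t \<partial>lborel)"
      by (rule Bochner_Integration.integral_cong) (auto simp: indicator_def)
    finally show "(\<integral>s. indicator {..t} s *\<^sub>R a s \<partial>lborel) \<bullet> b t = (\<integral>x. ?G x t \<partial>lborel)" .
  qed
  also have "\<dots> = (\<integral>x. (\<integral>y. ?G x y \<partial>lborel) \<partial>lborel)"
    by (rule lborel_pair.Fubini_integral[OF iG])
  finally have 2: "(\<integral>t. (\<integral>s. indicator {..t} s *\<^sub>R a s \<partial>lborel) \<bullet> b t \<partial>lborel) = (\<integral>x. (\<integral>y. ?G x y \<partial>lborel) \<partial>lborel)" .
  have "(\<integral>x. (\<integral>y. ?L x y \<partial>lborel) \<partial>lborel) + (\<integral>x. (\<integral>y. ?G x y \<partial>lborel) \<partial>lborel)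
      = (\<integral>x. (\<integral>y. ?L x y \<partial>lborel) + (\<integral>y. ?G x y \<partial>lborel) \<partial>lborel)"
    using lborel_pair.integrable_fst'[OF iL] lborel_pair.integrable_fst'[OF iG] by simp
  also have "\<dots> = (\<integral>x. a x \<bullet> (\<integral>y. b y \<partial>lborel) \<partial>lborel)"
  proof (rule Bochner_Integration.integral_cong[OF refl])
    fix x
    have iL': "integrable lborel (?L x)"
    proof -
      have "?L x = (\<lambda>y. indicator {..x} y *\<^sub>R (a x \<bullet> b y))" by (auto simp: indicator_def)
      then show ?thesis using integrable_mult_indicator[of "{..x}" lborel "\<lambda>y. a x \<bullet> b y"] ib by simp
    qed
    have iG': "integrable lborel (?G x)"
    proof -
      have "?G x = (\<lambda>y. indicator {x..} y *\<^sub>R (a x \<bullet> b y))" by (auto simp: indicator_def)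
      then show ?thesis using integrable_mult_indicator[of "{x..}" lborel "\<lambda>y. a x \<bullet> b y"] ib by simp
    qed
    have "(\<integral>y. ?L x y \<partial>lborel) + (\<integral>y. ?G x y \<partial>lborel) = (\<integral>y. ?L x y + ?G x y \<partial>lborel)"
      using iL' iG' by simp
    also have "\<dots> = (\<integral>y. a x \<bullet> b y \<partial>lborel)"
    proof (rule integral_cong_AE)
      show "AE y in lborel. ?L x y + ?G x y = a x \<bullet> b y"
        using AE_lborel_singleton[of x] by eventually_elim (auto simp: indicator_def)
    qed (use iL' iG' ib in auto)
    also have "\<dots> = a x \<bullet> (\<integral>y. b y \<partial>lborel)" using b by simp
    finally show "(\<integral>y. ?L x y \<partial>lborel) + (\<integral>y. ?G x y \<partial>lborel) = a x \<bullet> (\<integral>y. b y \<partial>lborel)" .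
  qed
  also have "\<dots> = (\<integral>t. a t \<partial>lborel) \<bullet> (\<integral>t. b t \<partial>lborel)" using a by simp
  finally show ?thesis unfolding 1 2 .
qed

text \<open>Each representative is its initial value plus an indefinite integral. The initial values
  pair with the total integrals, the indefinite integrals pair by \<open>integral_triangle\<close>,
  and together they form the boundary terms.\<close>

lemma H1_integration_by_parts:
  assumes tf: "tf > 0" and f: "H1_rep tf f g v" and f': "H1_rep tf f' g' v'"
  shows "g \<bullet> f' + f \<bullet> g' = v tf \<bullet> v' tf - v 0 \<bullet> v' 0"
proof -
  define a b where "a t = indicator {0..tf} t *\<^sub>R L2_fun g t" and "b t = indicator {0..tf} t *\<^sub>R L2_fun g' t" for t
  have a: "integrable lborel a" and b: "integrable lborel b"
    unfolding a_def b_def by (rule set_integrable_L2_fun[unfolded set_integrable_def])+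
  have ind: "(\<integral>s. indicator {..t} s *\<^sub>R (indicator {0..tf} s *\<^sub>R L2_fun h s) \<partial>lborel) = indef h t"
    if "t \<in> {0..tf}" for t and h :: "'a L2"
    unfolding indef_def set_lebesgue_integral_def
    by (rule Bochner_Integration.integral_cong) (use that in \<open>auto simp: indicator_def\<close>)
  have Ga: "(\<integral>t. a t \<partial>lborel) = indef g tf" and Gb: "(\<integral>t. b t \<partial>lborel) = indef g' tf"
    by (simp_all add: a_def b_def indef_def set_lebesgue_integral_def)
  have int: "integrable lborel (\<lambda>t. a t \<bullet> indef g' t)" "integrable lborel (\<lambda>t. indef g t \<bullet> b t)"
    if True
  proof -
    have bd: "integrable lborel (\<lambda>t. indicator {0..tf} t *\<^sub>R (L2_fun h t \<bullet> indef k t))" for h k :: "'a L2"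
    proof -
      have m: "(\<lambda>t. indicator {0..tf} t *\<^sub>R indef k t) \<in> borel_measurable borel"
        by (rule borel_measurable_continuous_on_indicator) (auto intro: continuous_on_indef)
      have "bounded (indef k ` {0..tf})"
        by (intro compact_imp_bounded compact_continuous_image continuous_on_indef) simp
      then obtain B where "\<forall>x\<in>indef k ` {0..tf}. norm x \<le> B" unfolding bounded_iff by blast
      then have B: "norm (indef k t) \<le> B" if "t \<in> {0..tf}" for t using that by blast
      have "integrable lborel (\<lambda>t. (indicator {0..tf} t *\<^sub>R L2_fun h t) \<bullet> (indicator {0..tf} t *\<^sub>R indef k t))"
      proof (rule Bochner_Integration.integrable_bound)
        show "integrable lborel (\<lambda>t. norm (indicator {0..tf} t *\<^sub>R L2_fun h t) * B)"
          by (intro integrable_mult_left integrable_norm set_integrable_L2_fun[unfolded set_integrable_def])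
        show "AE t in lborel. norm ((indicator {0..tf} t *\<^sub>R L2_fun h t) \<bullet> (indicator {0..tf} t *\<^sub>R indef k t))
            \<le> norm (norm (indicator {0..tf} t *\<^sub>R L2_fun h t) * B)"
        proof (intro always_eventually allI)
          fix t
          show "norm ((indicator {0..tf} t *\<^sub>R L2_fun h t) \<bullet> (indicator {0..tf} t *\<^sub>R indef k t))
            \<le> norm (norm (indicator {0..tf} t *\<^sub>R L2_fun h t) * B)"
          proof (cases "t \<in> {0..tf}")
            case True
            have "\<bar>L2_fun h t \<bullet> indef k t\<bar> \<le> norm (L2_fun h t) * B"
              using Cauchy_Schwarz_ineq2[of "L2_fun h t" "indef k t"] mult_left_mono[OF B[OF True] norm_ge_zero[of "L2_fun h t"]]
              by linarith
            then show ?thesis using True by simp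
          qed simp
        qed
      qed (use m in measurable)
      then show ?thesis by (rule Bochner_Integration.integrable_cong[THEN iffD1, rotated -1]) (auto simp: indicator_def)
    qed
    show "integrable lborel (\<lambda>t. a t \<bullet> indef g' t)"
      using bd[of g g'] by (simp add: a_def)
    show "integrable lborel (\<lambda>t. indef g t \<bullet> b t)"
      using bd[of g' g] by (simp add: b_def inner_commute)
  qed
  have v: "v t = v 0 + indef g t" "v' t = v' 0 + indef g' t" if "t \<in> {0..tf}" for t
    using H1_repD(4)[OF f that] H1_repD(4)[OF f' that] by simp_all
  have A: "g \<bullet> f' = indef g tf \<bullet> v' 0 + (\<integral>t. a t \<bullet> indef g' t \<partial>lborel)"
  proof -
    have "g \<bullet> f' = (\<integral>t. a t \<bullet> v' 0 + a t \<bullet> indef g' t \<partial>lborel)"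
      unfolding inner_L2_eq
    proof (rule integral_cong_AE)
      have "AE t in lborel. t \<notin> {0..tf} \<longrightarrow> L2_fun g t = 0" "AE t in lborel. t \<in> {0..tf} \<longrightarrow> L2_fun f' t = v' t"
        using H1_repD(2)[OF f] H1_repD(3)[OF f'] by (simp_all add: L2_on_def is_rep_on_def)
      then show "AE t in lborel. L2_fun g t \<bullet> L2_fun f' t = a t \<bullet> v' 0 + a t \<bullet> indef g' t"
      proof eventually_elim
        case (elim t) then show ?case using v(2)[of t] by (cases "t \<in> {0..tf}") (auto simp: a_def inner_add_right)
      qed
    qed (use int a in auto)
    then show ?thesis using int a Ga by simp
  qed
  have B: "f \<bullet> g' = v 0 \<bullet> indef g' tf + (\<integral>t. indef g t \<bullet> b t \<partial>lborel)"
  proof -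
    have "f \<bullet> g' = (\<integral>t. v 0 \<bullet> b t + indef g t \<bullet> b t \<partial>lborel)"
      unfolding inner_L2_eq
    proof (rule integral_cong_AE)
      have "AE t in lborel. t \<notin> {0..tf} \<longrightarrow> L2_fun g' t = 0" "AE t in lborel. t \<in> {0..tf} \<longrightarrow> L2_fun f t = v t"
        using H1_repD(2)[OF f'] H1_repD(3)[OF f] by (simp_all add: L2_on_def is_rep_on_def)
      then show "AE t in lborel. L2_fun f t \<bullet> L2_fun g' t = v 0 \<bullet> b t + indef g t \<bullet> b t"
      proof eventually_elim
        case (elim t) then show ?case using v(1)[of t] by (cases "t \<in> {0..tf}") (auto simp: b_def inner_add_left)
      qed
    qed (use int b in auto)
    then show ?thesis using int b Gb by simp
  qed
  have "(\<integral>t. a t \<bullet> indef g' t \<partial>lborel) = (\<integral>t. a t \<bullet> (\<integral>s. indicator {..t} s *\<^sub>R b s \<partial>lborel) \<partial>lborel)"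
    by (rule Bochner_Integration.integral_cong[OF refl]) (use ind[of _ g'] in \<open>auto simp: a_def b_def indicator_def\<close>)
  moreover have "(\<integral>t. indef g t \<bullet> b t \<partial>lborel) = (\<integral>t. (\<integral>s. indicator {..t} s *\<^sub>R a s \<partial>lborel) \<bullet> b t \<partial>lborel)"
    by (rule Bochner_Integration.integral_cong[OF refl]) (use ind[of _ g] in \<open>auto simp: a_def b_def indicator_def\<close>)
  ultimately have "(\<integral>t. a t \<bullet> indef g' t \<partial>lborel) + (\<integral>t. indef g t \<bullet> b t \<partial>lborel) = indef g tf \<bullet> indef g' tf"
    using integral_triangle[OF a b] Ga Gb by simp
  then show ?thesis
    using A B v[of tf] tf by (simp add: inner_add_left inner_add_right)
qed

section \<open>State and adjoint equations\<close>

lemma matrix_vector_bound: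
  fixes A :: "real^'n^'k"
  obtains a where "a \<ge> 0" "\<And>x. norm (A *v x) \<le> a * norm x"
  using bounded_linear.nonneg_bounded[OF matrix_vector_mul_bounded_linear[of A]] by (auto simp: mult.commute)

lemma continuous_on_matrix_vector [continuous_intros]:
  fixes A :: "real^'n^'k"
  shows "continuous_on S u \<Longrightarrow> continuous_on S (\<lambda>s. A *v u s)"
  by (rule bounded_linear.continuous_on[OF matrix_vector_mul_bounded_linear])

text \<open>The integrated form admits a forcing that is merely square integrable, since only its
  continuous primitive enters; the remaining term is a Volterra operator.\<close>

lemma linear_ode_exists:
  fixes A :: "real^'n^'n"
  obtains u where "continuous_on {0..} u"
    "\<And>t. t \<ge> 0 \<Longrightarrow> u t = x0 + indef f t + integral {0..t} (\<lambda>s. A *v u s)"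
proof -
  obtain a where a: "a \<ge> 0" "\<And>x. norm (A *v x) \<le> a * norm x" by (rule matrix_vector_bound[of A]) (rule that)
  define \<Phi> where "\<Phi> u t = x0 + indef f t + integral {0..t} (\<lambda>s. A *v u s)" for u t
  have sub: "continuous_on {0..\<tau>} u" if "continuous_on {0..} u" for u :: "real \<Rightarrow> real^'n" and \<tau>
    using that by (rule continuous_on_subset) auto
  have int: "(\<lambda>s. A *v u s) integrable_on {0..\<tau>}" if "continuous_on {0..} u" for u :: "real \<Rightarrow> real^'n" and \<tau>
    by (intro integrable_continuous_interval continuous_intros sub that)
  obtain u where "continuous_on {0..} u" "\<And>t. t \<ge> 0 \<Longrightarrow> \<Phi> u t = u t"
  proof (rule volterra_fixed_point[of \<Phi> a])
    fix u :: "real \<Rightarrow> real^'n" assume u: "continuous_on {0..} u"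
    show "continuous_on {0..} (\<Phi> u)"
      unfolding \<Phi>_def
      by (rule continuous_on_atLeast)
        (intro continuous_intros continuous_on_indef indefinite_integral_continuous_1 int u)
  next
    fix u v :: "real \<Rightarrow> real^'n" and t :: real
    assume u: "continuous_on {0..} u" and v: "continuous_on {0..} v" and t: "t \<ge> 0"
    have "\<Phi> u t - \<Phi> v t = integral {0..t} (\<lambda>s. A *v u s - A *v v s)"
      by (simp add: \<Phi>_def Henstock_Kurzweil_Integration.integral_diff int u v)
    also have "norm \<dots> \<le> integral {0..t} (\<lambda>s. a * norm (u s - v s))"
    proof (rule integral_norm_bound_integral)
      show "(\<lambda>s. A *v u s - A *v v s) integrable_on {0..t}" by (intro integrable_diff int u v)
      show "(\<lambda>s. a * norm (u s - v s)) integrable_on {0..t}"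
        by (intro integrable_continuous_interval continuous_intros sub u v)
      show "norm (A *v u s - A *v v s) \<le> a * norm (u s - v s)" for s
        using a(2)[of "u s - v s"] by (simp add: matrix_vector_mult_diff_distrib)
    qed
    finally show "norm (\<Phi> u t - \<Phi> v t) \<le> a * integral {0..t} (\<lambda>s. norm (u s - v s))" by simp
  qed (use a in auto)
  then show thesis by (intro that[of u]) (auto simp: \<Phi>_def)
qed

lemma square_integrable_continuous_on:
  fixes u :: "real \<Rightarrow> 'a::euclidean_space"
  assumes u: "continuous_on {0..tf} u"
  shows "square_integrable (\<lambda>t. indicator {0..tf} t *\<^sub>R u t)"
proof -
  have m [measurable]: "(\<lambda>t. indicator {0..tf} t *\<^sub>R u t) \<in> borel_measurable borel"
    by (rule borel_measurable_continuous_on_indicator) (auto intro: u)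
  have "bounded (u ` {0..tf})" by (intro compact_imp_bounded compact_continuous_image u) simp
  then obtain B where "\<forall>x\<in>u ` {0..tf}. norm x \<le> B" unfolding bounded_iff by blast
  then have B: "norm (u t) \<le> B" if "t \<in> {0..tf}" for t using that by blast
  have "integrable lborel (\<lambda>t. (norm (indicator {0..tf} t *\<^sub>R u t))\<^sup>2)"
  proof (rule Bochner_Integration.integrable_bound)
    show "integrable lborel (\<lambda>t. B\<^sup>2 * indicator {0..tf} t :: real)"
      by (intro integrable_mult_right integrable_real_indicator) (auto simp: emeasure_lborel_Icc_eq)
    show "AE t in lborel. norm ((norm (indicator {0..tf} t *\<^sub>R u t))\<^sup>2) \<le> norm (B\<^sup>2 * indicator {0..tf} t :: real)"
      using B by (intro always_eventually allI) (auto simp: indicator_def intro!: power_mono)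
  qed measurable
  then show ?thesis by (simp add: square_integrable_def)
qed

lemma L2_of_continuous:
  fixes u :: "real \<Rightarrow> 'a::euclidean_space"
  assumes u: "continuous_on {0..tf} u"
  obtains x where "x \<in> L2_on tf" "is_rep_on tf x u"
proof -
  define x where "x = abs_L2 (\<lambda>t. indicator {0..tf} t *\<^sub>R u t)"
  have ae: "AE t in lborel. L2_fun x t = indicator {0..tf} t *\<^sub>R u t"
    unfolding x_def by (rule L2_fun_abs[OF square_integrable_continuous_on[OF u]])
  have "x \<in> L2_on tf" unfolding L2_on_def using ae by (auto elim!: eventually_mono)
  moreover have "is_rep_on tf x u" unfolding is_rep_on_def using ae by (auto elim!: eventually_mono)
  ultimately show thesis by (rule that)
qed

lemma indef_L2_mat:
  fixes A :: "real^'n^'k"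
  assumes x: "is_rep_on tf x v" and v: "continuous_on {0..tf} v" and t: "t \<in> {0..tf}"
  shows "indef (L2_mat A x) t = integral {0..t} (\<lambda>s. A *v v s)"
proof -
  have c: "continuous_on {0..t} (\<lambda>s. A *v v s)"
    by (rule continuous_on_subset[of "{0..tf}"]) (use v t in \<open>auto intro: continuous_intros\<close>)
  have [measurable]: "(\<lambda>s. indicator {0..t} s *\<^sub>R (A *v v s)) \<in> borel_measurable borel"
    by (rule borel_measurable_continuous_on_indicator) (auto intro: c)
  have "indef (L2_mat A x) t = (LINT s:{0..t}|lborel. A *v v s)"
    unfolding indef_def set_lebesgue_integral_def
  proof (rule integral_cong_AE)
    show "AE s in lborel. indicator {0..t} s *\<^sub>R L2_fun (L2_mat A x) s = indicator {0..t} s *\<^sub>R (A *v v s)"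
      using L2_fun_mat[of A x] x[unfolded is_rep_on_def]
      by eventually_elim (use t in \<open>auto simp: indicator_def\<close>)
  qed measurable
  also have "\<dots> = integral {0..t} (\<lambda>s. A *v v s)"
    by (rule set_borel_integral_eq_integral(2)[OF borel_integrable_atLeastAtMost'[OF c]])
  finally show ?thesis .
qed

lemma L2_eq_0_if_rep_0:
  assumes "f \<in> L2_on tf" "is_rep_on tf f v" "\<And>t. t \<in> {0..tf} \<Longrightarrow> v t = 0"
  shows "f = 0"
proof (rule L2_eqI)
  show "AE t in lborel. L2_fun f t = L2_fun 0 t"
    using assms(1,2) L2_fun_zero unfolding L2_on_def is_rep_on_def mem_Collect_eq
    by eventually_elim (use assms(3) in auto)
qed

lemma state_exists:
  fixes A :: "real^'n^'n"
  assumes f: "f \<in> L2_on tf"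
  obtains x v where "H1_rep tf x (L2_mat A x + f) v" "v 0 = x0"
proof -
  obtain u where u: "continuous_on {0..} u"
    "\<And>t. t \<ge> 0 \<Longrightarrow> u t = x0 + indef f t + integral {0..t} (\<lambda>s. A *v u s)"
    using linear_ode_exists[of x0 f A] by blast
  have uc: "continuous_on {0..tf} u" by (rule continuous_on_subset[OF u(1)]) auto
  obtain x where x: "x \<in> L2_on tf" "is_rep_on tf x u" using L2_of_continuous[OF uc] .
  have u0: "u 0 = x0" using u(2)[of 0] by (simp add: indef_0)
  have "H1_rep tf x (L2_mat A x + f) u"
    unfolding H1_rep_def
  proof (intro conjI ballI)
    show "L2_mat A x + f \<in> L2_on tf" by (intro subspace_add[OF L2_on_subspace] L2_mat_in x f)
    fix t assume t: "t \<in> {0..tf}"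
    have "u t = x0 + indef f t + integral {0..t} (\<lambda>s. A *v u s)" using t by (intro u(2)) simp
    then show "u t = u 0 + indef (L2_mat A x + f) t"
      unfolding u0 indef_add indef_L2_mat[OF x(2) uc t] by simp
  qed (use x in auto)
  with u0 show thesis by (rule that[rotated])
qed

lemma state_bound:
  fixes A :: "real^'n^'n"
  assumes rep: "H1_rep tf x (L2_mat A x + f) v" and a: "a \<ge> 0" "\<And>x. norm (A *v x) \<le> a * norm x"
    and c: "\<And>t. t \<in> {0..tf} \<Longrightarrow> norm (v 0 + indef f t) \<le> c" and t: "t \<in> {0..tf}"
  shows "norm (v t) \<le> c * exp (a * t)"
proof -
  have vc: "continuous_on {0..tf} v" by (rule H1_rep_continuous[OF rep])
  show ?thesis
  proof (rule gronwall_integral[OF _ a(1) t])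
    show "continuous_on {0..tf} (\<lambda>t. norm (v t))" by (intro continuous_intros vc)
    fix t assume t: "t \<in> {0..tf}"
    have vct: "continuous_on {0..t} v" by (rule continuous_on_subset[OF vc]) (use t in auto)
    have "v t = (v 0 + indef f t) + integral {0..t} (\<lambda>s. A *v v s)"
      using H1_repD(4)[OF rep t] unfolding indef_add indef_L2_mat[OF H1_repD(3)[OF rep] vc t] by simp
    then have "norm (v t) \<le> norm (v 0 + indef f t) + norm (integral {0..t} (\<lambda>s. A *v v s))"
      using norm_triangle_ineq by metis
    also have "norm (integral {0..t} (\<lambda>s. A *v v s)) \<le> integral {0..t} (\<lambda>s. a * norm (v s))"
      by (rule integral_norm_bound_integral)
        (intro integrable_continuous_interval continuous_intros vct a(2))+
    finally show "norm (v t) \<le> c + a * integral {0..t} (\<lambda>s. norm (v s))" using c[OF t] by simp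
  qed
qed

lemma state_unique:
  fixes A :: "real^'n^'n"
  assumes 1: "H1_rep tf x (L2_mat A x + f) v" and 2: "H1_rep tf x' (L2_mat A x' + f) v'"
    and eq: "v 0 = v' 0"
  shows "x = x'"
proof -
  interpret m: bounded_linear "L2_mat A" by (rule bounded_linear_L2_mat)
  obtain a where a: "a \<ge> 0" "\<And>x. norm (A *v x) \<le> a * norm x" by (rule matrix_vector_bound[of A]) (rule that)
  have d: "H1_rep tf (x - x') (L2_mat A (x - x') + 0) (\<lambda>t. v t - v' t)"
    using H1_rep_diff[OF 1 2] by (simp add: m.diff)
  have "indef (0 :: (real^'n) L2) t = 0" for t using indef_scaleR[of 0 "0 :: (real^'n) L2" t] by simp
  then have "norm (v t - v' t) \<le> 0 * exp (a * t)" if "t \<in> {0..tf}" for t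
    using that eq by (intro state_bound[OF d a]) auto
  then have "x - x' = 0"
    using H1_repD(1,3)[OF d] by (intro L2_eq_0_if_rep_0[of "x - x'" tf "\<lambda>t. v t - v' t"]) auto
  then show ?thesis by simp
qed

text \<open>The operator \<open>K\<close> of the overview: it solves \<open>x' = A x + g\<close>,
  \<open>x(0) = x0\<close>, and so inverts \<open>opA\<close>. Restricting the forcing makes it a
  total function on the ambient space.\<close>

definition state_map :: "real \<Rightarrow> real^'n^'n \<Rightarrow> 'n::finite adjoint_space \<Rightarrow> (real^'n) L2" where
  "state_map tf A z = (SOME x. \<exists>v. H1_rep tf x (L2_mat A x + L2_restrict tf (fst z)) v \<and> v 0 = snd z)"

lemma state_map_rep:
  obtains v where "H1_rep tf (state_map tf A z) (L2_mat A (state_map tf A z) + L2_restrict tf (fst z)) v"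
    "v 0 = snd z"
proof -
  have "\<exists>x v. H1_rep tf x (L2_mat A x + L2_restrict tf (fst z)) v \<and> v 0 = snd z"
    using state_exists[OF L2_restrict_in] by metis
  from someI_ex[OF this] show thesis using that unfolding state_map_def by blast
qed

lemma state_map_eqI:
  assumes "H1_rep tf x (L2_mat A x + L2_restrict tf (fst z)) v" "v 0 = snd z"
  shows "state_map tf A z = x"
proof -
  obtain w where "H1_rep tf (state_map tf A z) (L2_mat A (state_map tf A z) + L2_restrict tf (fst z)) w"
    "w 0 = snd z" by (rule state_map_rep)
  then show ?thesis using state_unique assms by metis
qed

lemma state_map_in:
  fixes A :: "real^'n^'n"
  shows "state_map tf A z \<in> L2_on tf"
  using state_map_rep H1_repD(1) by metis

lemma state_map_linear:
  fixes A :: "real^'n^'n"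
  shows "linear (state_map tf A)"
proof
  interpret m: bounded_linear "L2_mat A" by (rule bounded_linear_L2_mat)
  interpret r: bounded_linear "L2_restrict tf" by (rule bounded_linear_L2_restrict)
  fix z z' :: "'n adjoint_space" and c :: real
  obtain v where v: "H1_rep tf (state_map tf A z) (L2_mat A (state_map tf A z) + L2_restrict tf (fst z)) v"
    "v 0 = snd z" by (rule state_map_rep)
  obtain v' where v': "H1_rep tf (state_map tf A z') (L2_mat A (state_map tf A z') + L2_restrict tf (fst z')) v'"
    "v' 0 = snd z'" by (rule state_map_rep)
  show "state_map tf A (z + z') = state_map tf A z + state_map tf A z'"
  proof (rule state_map_eqI)
    show "H1_rep tf (state_map tf A z + state_map tf A z')
        (L2_mat A (state_map tf A z + state_map tf A z') + L2_restrict tf (fst (z + z'))) (\<lambda>t. v t + v' t)"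
      using H1_rep_add[OF v(1) v'(1)] by (simp add: m.add r.add algebra_simps)
  qed (use v v' in simp)
  show "state_map tf A (c *\<^sub>R z) = c *\<^sub>R state_map tf A z"
  proof (rule state_map_eqI)
    show "H1_rep tf (c *\<^sub>R state_map tf A z)
        (L2_mat A (c *\<^sub>R state_map tf A z) + L2_restrict tf (fst (c *\<^sub>R z))) (\<lambda>t. c *\<^sub>R v t)"
      using H1_rep_scaleR[OF v(1), of c] by (simp add: m.scaleR r.scaleR scaleR_add_right)
  qed (use v in simp)
qed

lemma bounded_linear_of_unit_bound:
  fixes K :: "'a::real_normed_vector \<Rightarrow> 'b::real_normed_vector"
  assumes K: "linear K" and C: "\<And>z. norm z \<le> 1 \<Longrightarrow> norm (K z) \<le> C"
  shows "bounded_linear K"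
proof (rule bounded_linear_intro[where K = C])
  show "norm (K z) \<le> norm z * C" for z
  proof (cases "z = 0")
    case True then show ?thesis by (simp add: linear_0[OF K])
  next
    case False
    have "K z = norm z *\<^sub>R K (z /\<^sub>R norm z)" using False by (simp add: linear_scale[OF K])
    then have "norm (K z) = norm z * norm (K (z /\<^sub>R norm z))" by (metis abs_norm_cancel norm_scaleR)
    also have "\<dots> \<le> norm z * C" by (intro mult_left_mono C) (use False in auto)
    finally show ?thesis .
  qed
qed (use K in \<open>auto simp: linear_add linear_scale\<close>)

lemma norm_L2_on_le:
  assumes tf: "tf \<ge> 0" and x: "x \<in> L2_on tf" "is_rep_on tf x v" and B: "\<And>t. t \<in> {0..tf} \<Longrightarrow> norm (v t) \<le> B"
  shows "(norm x)\<^sup>2 \<le> tf * B\<^sup>2"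
proof -
  have "(norm x)\<^sup>2 \<le> (\<integral>t. B\<^sup>2 * indicator {0..tf} t \<partial>lborel)"
    unfolding norm_L2_sq
  proof (rule integral_mono_AE[OF integrable_norm_L2_fun])
    show "integrable lborel (\<lambda>t. B\<^sup>2 * indicator {0..tf} t :: real)"
      by (intro integrable_mult_right integrable_real_indicator) (auto simp: emeasure_lborel_Icc_eq)
    show "AE t in lborel. (norm (L2_fun x t))\<^sup>2 \<le> B\<^sup>2 * indicator {0..tf} t"
      using x unfolding L2_on_def is_rep_on_def mem_Collect_eq
      by eventually_elim (use B in \<open>auto simp: indicator_def intro!: power_mono\<close>)
  qed
  also have "\<dots> = tf * B\<^sup>2" using tf by simp
  finally show ?thesis .
qed

lemma bounded_linear_state_map:
  fixes A :: "real^'n^'n"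
  assumes tf: "tf > 0"
  shows "bounded_linear (state_map tf A)"
proof -
  obtain a where a: "a \<ge> 0" "\<And>x. norm (A *v x) \<le> a * norm x" by (rule matrix_vector_bound[of A]) (rule that)
  \<comment> \<open>For \<open>norm z \<le> 1\<close> the initial value contributes at most 1 and
    the primitive of the forcing at most \<open>tf + 1\<close>; Gronwall's inequality contributes
    the exponential.\<close>
  define B where "B = (tf + 2) * exp (a * tf)"
  have B: "B \<ge> 0" using tf by (simp add: B_def)
  show ?thesis
  proof (rule bounded_linear_of_unit_bound[OF state_map_linear, of _ _ "sqrt tf * B"])
    fix z :: "'n adjoint_space" assume z: "norm z \<le> 1"
    obtain v where v: "H1_rep tf (state_map tf A z) (L2_mat A (state_map tf A z) + L2_restrict tf (fst z)) v"
      "v 0 = snd z" by (rule state_map_rep)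
    have z1: "norm (fst z) \<le> 1" "norm (snd z) \<le> 1"
      using z norm_fst_le[of "fst z" "snd z"] norm_snd_le[of "snd z" "fst z"] by simp_all
    have r: "(norm (L2_restrict tf (fst z)))\<^sup>2 \<le> 1"
      using power_mono[of "norm (L2_restrict tf (fst z))" 1 2] L2_restrict_norm[of tf "fst z"] z1 by simp
    have le: "norm (v 0 + indef (L2_restrict tf (fst z)) t) \<le> tf + 2" if t: "t \<in> {0..tf}" for t
      using norm_triangle_ineq[of "v 0" "indef (L2_restrict tf (fst z)) t"]
        norm_indef_le[of t "L2_restrict tf (fst z)"] r t z1 v(2) by simp
    have "norm (v t) \<le> B" if t: "t \<in> {0..tf}" for t
    proof -
      have "norm (v t) \<le> (tf + 2) * exp (a * t)" by (rule state_bound[OF v(1) a le t])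
      also have "\<dots> \<le> B" unfolding B_def using t tf a by (intro mult_left_mono) (auto intro!: mult_left_mono)
      finally show ?thesis .
    qed
    then have "(norm (state_map tf A z))\<^sup>2 \<le> tf * B\<^sup>2"
      by (intro norm_L2_on_le[OF less_imp_le[OF tf] state_map_in H1_repD(3)[OF v(1)]])
    then have "(norm (state_map tf A z))\<^sup>2 \<le> (sqrt tf * B)\<^sup>2" using tf by (simp add: power_mult_distrib)
    then show "norm (state_map tf A z) \<le> sqrt tf * B" by (rule power2_le_imp_le) (use tf B in simp)
  qed
qed

lemma L2_mat_uminus: "L2_mat (- A) f = - L2_mat A f" for A :: "real^'n^'k"
proof (rule L2_eqI)
  have neg: "(- A) *v x = - (A *v x)" for x
    by (simp add: vec_eq_iff matrix_vector_mult_def sum_negf)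
  show "AE t in lborel. L2_fun (L2_mat (- A) f) t = L2_fun (- L2_mat A f) t"
    using L2_fun_mat[of "- A" f] L2_fun_mat[of A f] L2_fun_uminus[of "L2_mat A f"] by eventually_elim (simp add: neg)
qed

lemma homogeneous_pairing:
  fixes C :: "real^'n^'n"
  assumes tf: "tf > 0" and x: "H1_rep tf x (L2_mat C x) v" and y: "H1_rep tf y (- L2_mat (transpose C) y) w"
  shows "v tf \<bullet> w tf = v 0 \<bullet> w 0"
  using H1_integration_by_parts[OF tf x y] by (simp add: L2_mat_adjoint)

text \<open>The map from initial to terminal values is linear on a finite-dimensional space, so
  injectivity suffices. Terminal conditions can thus be imposed although only initial value problems
  have been solved.\<close>

lemma endpoint_surj:
  fixes C :: "real^'n^'n"
  assumes tf: "tf > 0"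
  obtains x v where "H1_rep tf x (L2_mat C x) v" "v tf = y"
proof -
  let ?S = "\<lambda>\<xi>. state_map tf C (0, \<xi>)"
  define N where "N \<xi> = L2_at tf (?S \<xi>) tf" for \<xi>
  have zero: "L2_restrict tf (0 :: (real^'n) L2) = 0"
    using bounded_linear.linear[OF bounded_linear_L2_restrict] by (rule linear_0)
  have rep: "\<exists>v. H1_rep tf (?S \<xi>) (L2_mat C (?S \<xi>)) v \<and> v 0 = \<xi> \<and> N \<xi> = v tf" for \<xi>
  proof -
    obtain v where "H1_rep tf (?S \<xi>) (L2_mat C (?S \<xi>) + L2_restrict tf (fst (0 :: (real^'n) L2, \<xi>))) v"
      "v 0 = snd (0 :: (real^'n) L2, \<xi>)" by (rule state_map_rep)
    then have "H1_rep tf (?S \<xi>) (L2_mat C (?S \<xi>)) v" "v 0 = \<xi>" by (simp_all add: zero)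
    then show ?thesis using H1_rep_at[OF tf, of "?S \<xi>" _ v tf] tf by (auto simp: N_def)
  qed
  have lin: "linear N"
  proof
    fix \<xi> \<eta> :: "real^'n" and c :: real
    obtain v where v: "H1_rep tf (?S \<xi>) (L2_mat C (?S \<xi>)) v" "N \<xi> = v tf" using rep by blast
    obtain w where w: "H1_rep tf (?S \<eta>) (L2_mat C (?S \<eta>)) w" "N \<eta> = w tf" using rep by blast
    have "?S (\<xi> + \<eta>) = ?S \<xi> + ?S \<eta>" using linear_add[OF state_map_linear, of tf C "(0, \<xi>)" "(0, \<eta>)"] by simp
    then show "N (\<xi> + \<eta>) = N \<xi> + N \<eta>"
      using H1_rep_at[OF tf H1_rep_add[OF v(1) w(1)], of tf] tf v w by (simp add: N_def)
    have "?S (c *\<^sub>R \<xi>) = c *\<^sub>R ?S \<xi>" using linear_scale[OF state_map_linear, of tf C c "(0, \<xi>)"] by simp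
    then show "N (c *\<^sub>R \<xi>) = c *\<^sub>R N \<xi>"
      using H1_rep_at[OF tf H1_rep_scaleR[OF v(1), of c], of tf] tf v by (simp add: N_def)
  qed
  have "inj N"
    unfolding linear_injective_0[OF lin]
  proof (intro allI impI)
    fix \<xi> assume N: "N \<xi> = 0"
    obtain v where v: "H1_rep tf (?S \<xi>) (L2_mat C (?S \<xi>)) v" "v 0 = \<xi>" "N \<xi> = v tf" using rep by blast
    \<comment> \<open>Pairing with the adjoint solution that also starts in \<open>\<xi>\<close> is
      constant in its end values: it is \<open>\<xi> \<bullet> \<xi>\<close> at time 0 and zero at
      \<open>tf\<close>.\<close>
    obtain y w where w: "H1_rep tf y (L2_mat (- transpose C) y + 0) w" "w 0 = \<xi>"
      using state_exists[OF subspace_0[OF L2_on_subspace]] by blast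
    have "v tf \<bullet> w tf = v 0 \<bullet> w 0"
      using w(1) by (intro homogeneous_pairing[OF tf v(1)]) (simp add: L2_mat_uminus)
    then show "\<xi> = 0" using N v w by simp
  qed
  then have "surj N" by (rule linear_inj_imp_surj[OF lin])
  then obtain \<xi> where "y = N \<xi>" by (rule surjE)
  then show thesis using rep[of \<xi>] that by auto
qed

text \<open>A solution with arbitrary initial value is corrected by the homogeneous solution that
  has the same terminal value.\<close>

lemma adjoint_exists:
  fixes A :: "real^'n^'n"
  assumes tf: "tf > 0" and f: "f \<in> L2_on tf"
  obtains lam v where "H1_rep tf lam (- L2_mat (transpose A) lam - f) v" "v tf = 0"
proof -
  interpret m: bounded_linear "L2_mat (- transpose A)" by (rule bounded_linear_L2_mat)
  have f': "- f \<in> L2_on tf" by (rule subspace_neg[OF L2_on_subspace f])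
  obtain lam v where v: "H1_rep tf lam (L2_mat (- transpose A) lam + (- f)) v" "v 0 = 0"
    using state_exists[OF f'] by blast
  obtain y w where w: "H1_rep tf y (L2_mat (- transpose A) y) w" "w tf = v tf"
    using endpoint_surj[OF tf] by blast
  have "H1_rep tf (lam - y) (- L2_mat (transpose A) (lam - y) - f) (\<lambda>t. v t - w t)"
    using H1_rep_diff[OF v(1) w(1)] by (simp add: m.diff algebra_simps flip: L2_mat_uminus)
  then show thesis by (rule that) (simp add: w)
qed

text \<open>Sign and boundary condition say \<open>opA_adj p = f\<close> for \<open>p\<close> in
  \<open>dom_opA_adj\<close>, so this is the inverse of the adjoint; the second component records
  the initial value that the domain prescribes.\<close>

definition adjoint_map :: "real \<Rightarrow> real^'n^'n \<Rightarrow> (real^'n) L2 \<Rightarrow> 'n::finite adjoint_space" where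
  "adjoint_map tf A f = (SOME p. \<exists>v. H1_rep tf (fst p) (- L2_mat (transpose A) (fst p) - L2_restrict tf f) v
     \<and> v tf = 0 \<and> v 0 = snd p)"

lemma adjoint_map_rep:
  fixes A :: "real^'n^'n"
  assumes tf: "tf > 0"
  obtains v where "H1_rep tf (fst (adjoint_map tf A f))
      (- L2_mat (transpose A) (fst (adjoint_map tf A f)) - L2_restrict tf f) v"
    "v tf = 0" "v 0 = snd (adjoint_map tf A f)"
proof -
  obtain lam v where "H1_rep tf lam (- L2_mat (transpose A) lam - L2_restrict tf f) v" "v tf = 0"
    using adjoint_exists[OF tf L2_restrict_in] by blast
  then have "\<exists>p v. H1_rep tf (fst p) (- L2_mat (transpose A) (fst p) - L2_restrict tf f) v
     \<and> v tf = 0 \<and> v 0 = snd p" by (intro exI[of _ "(lam, v 0)"] exI[of _ v]) simp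
  from someI_ex[OF this] show thesis using that unfolding adjoint_map_def by blast
qed

lemma adjoint_pairing:
  fixes A :: "real^'n^'n"
  assumes tf: "tf > 0" and rep: "H1_rep tf lam (- L2_mat (transpose A) lam - L2_restrict tf f) v" and "v tf = 0"
  shows "(lam, v 0) \<bullet> z = f \<bullet> state_map tf A z"
proof -
  let ?x = "state_map tf A z"
  obtain w where w: "H1_rep tf ?x (L2_mat A ?x + L2_restrict tf (fst z)) w" "w 0 = snd z" by (rule state_map_rep)
  have "lam \<bullet> L2_mat A ?x = L2_mat (transpose A) lam \<bullet> ?x"
    using L2_mat_adjoint[of A ?x lam] by (simp add: inner_commute)
  moreover have "L2_restrict tf f \<bullet> ?x = f \<bullet> ?x"
    using state_map_in[of tf A z] by (simp add: L2_restrict_inner L2_on_iff)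
  moreover have "lam \<bullet> L2_restrict tf (fst z) = lam \<bullet> fst z"
    using H1_repD(1)[OF rep] by (simp add: L2_on_iff flip: L2_restrict_inner)
  ultimately show ?thesis
    using H1_integration_by_parts[OF tf rep w(1)] w(2) assms(3)
    by (simp add: inner_diff_left inner_add_right inner_prod_def)
qed

text \<open>Integration by parts exhibits \<open>adjoint_map\<close> as the Hilbert adjoint of
  \<open>state_map\<close>. Its uniqueness, linearity and norm bound follow from this relation, and
  so does the skewness of \<open>opJ_inv\<close>.\<close>

lemma adjoint_map_inner:
  fixes A :: "real^'n^'n"
  shows "tf > 0 \<Longrightarrow> adjoint_map tf A f \<bullet> z = f \<bullet> state_map tf A z"
proof -
  assume tf: "tf > 0"
  obtain v where v: "H1_rep tf (fst (adjoint_map tf A f))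
      (- L2_mat (transpose A) (fst (adjoint_map tf A f)) - L2_restrict tf f) v"
    "v tf = 0" "v 0 = snd (adjoint_map tf A f)" by (rule adjoint_map_rep[OF tf])
  show ?thesis using adjoint_pairing[OF tf v(1,2), of z] unfolding v(3) by simp
qed

lemma adjoint_map_eqI:
  fixes A :: "real^'n^'n"
  assumes tf: "tf > 0" and "H1_rep tf lam (- L2_mat (transpose A) lam - L2_restrict tf f) v" and "v tf = 0"
  shows "adjoint_map tf A f = (lam, v 0)"
proof -
  let ?d = "adjoint_map tf A f - (lam, v 0)"
  have "?d \<bullet> ?d = 0"
    unfolding inner_diff_left[of _ _ ?d] using adjoint_map_inner[OF tf] adjoint_pairing[OF assms] by simp
  then show ?thesis by simp
qed

lemma bounded_linear_adjoint_map:
  fixes A :: "real^'n^'n"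
  assumes tf: "tf > 0"
  shows "bounded_linear (adjoint_map tf A)"
proof -
  interpret K: bounded_linear "state_map tf A" by (rule bounded_linear_state_map[OF tf])
  obtain k where k: "\<And>z. norm (state_map tf A z) \<le> norm z * k" "k \<ge> 0" using K.nonneg_bounded by blast
  have ext: "p = q" if "\<And>z. p \<bullet> z = q \<bullet> z" for p q :: "'n adjoint_space"
  proof -
    have "(p - q) \<bullet> (p - q) = 0" using that[of "p - q"] by (simp only: inner_diff_left diff_self)
    then show ?thesis by simp
  qed
  show ?thesis
  proof (rule bounded_linear_intro[where K = k])
    fix f g :: "(real^'n) L2" and c :: real
    show "adjoint_map tf A (f + g) = adjoint_map tf A f + adjoint_map tf A g"
      by (rule ext) (simp add: inner_add_left adjoint_map_inner[OF tf])
    show "adjoint_map tf A (c *\<^sub>R f) = c *\<^sub>R adjoint_map tf A f"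
      by (rule ext) (simp add: adjoint_map_inner[OF tf])
    let ?p = "adjoint_map tf A f"
    have "norm ?p * norm ?p = f \<bullet> state_map tf A ?p"
      using adjoint_map_inner[OF tf, of A f ?p] by (simp add: dot_square_norm power2_eq_square)
    also have "\<dots> \<le> norm f * norm (state_map tf A ?p)" by (rule norm_cauchy_schwarz)
    also have "\<dots> \<le> norm f * (norm ?p * k)" by (intro mult_left_mono k) auto
    finally have "norm ?p * norm ?p \<le> (norm f * k) * norm ?p" by (simp add: mult_ac)
    then show "norm ?p \<le> norm f * k" using k(2) by (cases "norm ?p = 0") auto
  qed
qed

section \<open>The bounded inverse of the operator \<open>opJ\<close>\<close>

definition restrict_opt :: "real \<Rightarrow> 'n::finite optimizer_space \<Rightarrow> 'n optimizer_space" where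
  "restrict_opt tf = (\<lambda>(x, (lam, lam0)). (L2_restrict tf x, (L2_restrict tf lam, lam0)))"

text \<open>Inverts the off-diagonal blocks of \<open>opJ\<close>: the second component of the datum
  determines the state, the first one the costate, the latter with the sign of the block
  \<open>- opA_adj\<close>.\<close>

definition opJ_inv :: "real \<Rightarrow> real^'n^'n \<Rightarrow> 'n::finite optimizer_space \<Rightarrow> 'n optimizer_space" where
  "opJ_inv tf A = (\<lambda>(f, z). (state_map tf A z, - adjoint_map tf A f))"

lemma restrict_opt_iff: "restrict_opt tf w = w \<longleftrightarrow> fst w \<in> L2_on tf \<and> fst (snd w) \<in> L2_on tf"
  by (cases w rule: prod_cases3) (simp add: restrict_opt_def L2_on_iff)

lemma state_map_restrict: "state_map tf A (L2_restrict tf g, x0) = state_map tf A (g, x0)"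
  by (simp add: state_map_def L2_restrict_idem)

lemma adjoint_map_restrict: "adjoint_map tf A (L2_restrict tf f) = adjoint_map tf A f"
  by (simp add: adjoint_map_def L2_restrict_idem)

lemma adjoint_map_in: "tf > 0 \<Longrightarrow> fst (adjoint_map tf A f) \<in> L2_on tf"
  using adjoint_map_rep H1_repD(1) by metis

lemma state_map_inj:
  fixes A :: "real^'n^'n"
  assumes tf: "tf > 0" and z: "fst z \<in> L2_on tf" and 0: "state_map tf A z = 0"
  shows "z = 0"
proof -
  interpret m: bounded_linear "L2_mat A" by (rule bounded_linear_L2_mat)
  obtain v where v: "H1_rep tf 0 (L2_mat A 0 + L2_restrict tf (fst z)) v" "v 0 = snd z"
    using state_map_rep[of tf A z] unfolding 0 by blast
  have "H1_rep tf (0 :: (real^'n) L2) 0 (\<lambda>_. 0)" using H1_rep_scaleR[OF v(1), of 0] by simp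
  then have "L2_mat A 0 + L2_restrict tf (fst z) = 0" by (rule H1_rep_deriv_unique[OF tf v(1)])
  then have "fst z = 0" using z by (simp add: m.zero L2_on_iff)
  moreover have "v 0 = 0"
    using H1_rep_at[OF tf v(1), of 0] H1_rep_at[OF tf \<open>H1_rep tf 0 0 (\<lambda>_. 0)\<close>, of 0] tf by simp
  ultimately show ?thesis using v(2) by (simp add: prod_eq_iff)
qed

lemma adjoint_map_inj:
  fixes A :: "real^'n^'n"
  assumes tf: "tf > 0" and f: "f \<in> L2_on tf" and 0: "adjoint_map tf A f = 0"
  shows "f = 0"
proof -
  interpret m: bounded_linear "L2_mat (transpose A)" by (rule bounded_linear_L2_mat)
  obtain v where v: "H1_rep tf 0 (- L2_mat (transpose A) 0 - L2_restrict tf f) v"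
    using adjoint_map_rep[OF tf, of A f] unfolding 0 by auto
  have "H1_rep tf (0 :: (real^'n) L2) 0 (\<lambda>_. 0)" using H1_rep_scaleR[OF v, of 0] by simp
  then have "- L2_mat (transpose A) 0 - L2_restrict tf f = 0" by (rule H1_rep_deriv_unique[OF tf v])
  then show ?thesis using f by (simp add: m.zero L2_on_iff)
qed

text \<open>The off-diagonal blocks are \<open>state_map\<close> and the negative of its adjoint,
  whence skewness. Injectivity comes from uniqueness of weak derivatives: a zero solution has zero
  forcing and zero boundary value.\<close>

lemma skew_operator_opJ_inv:
  fixes A :: "real^'n^'n"
  assumes tf: "tf > 0"
  shows "skew_operator (restrict_opt tf) (opJ_inv tf A)"
proof -
  interpret r: bounded_linear "L2_restrict tf" by (rule bounded_linear_L2_restrict)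
  interpret K: bounded_linear "state_map tf A" by (rule bounded_linear_state_map[OF tf])
  interpret E: bounded_linear "adjoint_map tf A" by (rule bounded_linear_adjoint_map[OF tf])
  have P: "bounded_linear (restrict_opt tf :: 'n optimizer_space \<Rightarrow> _)"
    unfolding restrict_opt_def case_prod_beta
    by (intro bounded_linear_Pair bounded_linear_compose[OF bounded_linear_L2_restrict]
        bounded_linear_fst bounded_linear_snd bounded_linear_compose[OF bounded_linear_fst bounded_linear_snd]
        bounded_linear_compose[OF bounded_linear_snd bounded_linear_snd])
  have M: "bounded_linear (opJ_inv tf A)"
    unfolding opJ_inv_def case_prod_beta
    by (intro bounded_linear_Pair bounded_linear_minus bounded_linear_compose[OF K.bounded_linear_axioms]
        bounded_linear_compose[OF E.bounded_linear_axioms] bounded_linear_fst bounded_linear_snd)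
  show ?thesis
  proof (rule skew_operator.intro[OF P M skew_operator_axioms.intro])
    fix w :: "'n optimizer_space"
    obtain x g x0 where w: "w = (x, (g, x0))" by (cases w rule: prod_cases3)
    show "restrict_opt tf (restrict_opt tf w) = restrict_opt tf w"
      by (simp add: w restrict_opt_def L2_restrict_idem)
    show "norm (restrict_opt tf w) \<le> norm w"
      by (auto simp: w restrict_opt_def norm_Pair intro!: add_mono power_mono L2_restrict_norm)
    show "opJ_inv tf A (restrict_opt tf w) = opJ_inv tf A w"
      by (simp add: w restrict_opt_def opJ_inv_def state_map_restrict adjoint_map_restrict)
    show "restrict_opt tf (opJ_inv tf A w) = opJ_inv tf A w"
      unfolding restrict_opt_iff
      by (simp add: w opJ_inv_def state_map_in subspace_neg[OF L2_on_subspace] adjoint_map_in[OF tf])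
    show "opJ_inv tf A w \<bullet> w = 0"
      using adjoint_map_inner[OF tf, of A x "(g, x0)"]
      by (simp add: w opJ_inv_def inner_prod_def inner_commute[of x])
    assume Pw: "restrict_opt tf w = w" and 0: "opJ_inv tf A w = 0"
    show "w = 0"
    proof -
      have "state_map tf A (g, x0) = 0" "adjoint_map tf A x = 0"
        using arg_cong[OF 0, of fst] arg_cong[OF 0, of snd] by (simp_all add: w opJ_inv_def)
      then have "(g, x0) = 0" "x = 0"
        using Pw state_map_inj[OF tf, of "(g, x0)" A] adjoint_map_inj[OF tf, of x A]
        unfolding restrict_opt_iff by (simp_all add: w)
      then show ?thesis by (simp add: w zero_prod_def)
    qed
  qed
qed

text \<open>The boundary conditions in \<open>dom_opJ\<close> are those solved by
  \<open>state_map\<close> and \<open>adjoint_map\<close>. This lets the generator constructed from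
  \<open>opJ_inv\<close> be recognised as the prescribed \<open>sp_generator\<close>.\<close>

lemma opJ_graph:
  fixes A :: "real^'n^'n"
  assumes tf: "tf > 0"
  shows "{(w, opJ tf A w) | w. w \<in> dom_opJ tf} = {(opJ_inv tf A u, u) | u. restrict_opt tf u = u}"
proof (intro equalityI subsetI)
  fix p assume "p \<in> {(w, opJ tf A w) | w. w \<in> dom_opJ tf}"
  then obtain x lam lam0 where p: "p = ((x, (lam, lam0)), opJ tf A (x, (lam, lam0)))"
    and x: "x \<in> H1_on tf" and lam: "lam \<in> H1_on tf" "L2_at tf lam 0 = lam0" "L2_at tf lam tf = 0"
    by (auto simp: dom_opJ_def dom_opA_adj_def)
  obtain v where v: "H1_rep tf x (H1_deriv tf x) v" using H1_onE[OF tf x] .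
  obtain w where w: "H1_rep tf lam (H1_deriv tf lam) w" using H1_onE[OF tf lam(1)] .
  have w0: "w 0 = lam0" "w tf = 0" and v0: "L2_at tf x 0 = v 0"
    using H1_rep_at[OF tf w, of 0] H1_rep_at[OF tf w, of tf] H1_rep_at[OF tf v, of 0] lam tf by auto
  define f where "f = H1_deriv tf lam + L2_mat (transpose A) lam"
  define g where "g = H1_deriv tf x - L2_mat A x"
  have f_in: "f \<in> L2_on tf" and g_in: "g \<in> L2_on tf"
    unfolding f_def g_def using H1_repD(1,2)[OF v] H1_repD(1,2)[OF w]
    by (auto intro!: subspace_add[OF L2_on_subspace] subspace_diff[OF L2_on_subspace] L2_mat_in)
  have u: "opJ tf A (x, (lam, lam0)) = (f, (g, v 0))"
    by (simp add: opJ_def opA_def opA_adj_def f_def g_def v0)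
  have "state_map tf A (g, v 0) = x"
    using v g_in by (intro state_map_eqI) (auto simp: g_def L2_on_iff)
  moreover have "adjoint_map tf A f = - (lam, lam0)"
  proof -
    interpret m: bounded_linear "L2_mat (transpose A)" by (rule bounded_linear_L2_mat)
    have "H1_rep tf (- lam) (- L2_mat (transpose A) (- lam) - L2_restrict tf f) (\<lambda>t. - w t)"
      using H1_rep_scaleR[OF w, of "-1"] f_in by (simp add: L2_on_iff m.neg f_def)
    then have "adjoint_map tf A f = (- lam, - w 0)" by (rule adjoint_map_eqI[OF tf]) (simp add: w0)
    then show ?thesis by (simp add: w0)
  qed
  ultimately have "opJ_inv tf A (f, (g, v 0)) = (x, (lam, lam0))" by (simp add: opJ_inv_def)
  then show "p \<in> {(opJ_inv tf A u, u) | u. restrict_opt tf u = u}"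
    unfolding p u using f_in g_in by (auto intro!: exI[of _ "(f, (g, v 0))"] simp: restrict_opt_iff)
next
  fix p assume "p \<in> {(opJ_inv tf A u, u) | u. restrict_opt tf u = u}"
  then obtain f g x0 where p: "p = (opJ_inv tf A (f, (g, x0)), (f, (g, x0)))" and fg: "f \<in> L2_on tf" "g \<in> L2_on tf"
    by (auto simp: restrict_opt_iff)
  let ?x = "state_map tf A (g, x0)" and ?q = "adjoint_map tf A f"
  interpret m: bounded_linear "L2_mat (transpose A)" by (rule bounded_linear_L2_mat)
  obtain v where "H1_rep tf ?x (L2_mat A ?x + L2_restrict tf (fst (g, x0))) v" "v 0 = snd (g, x0)"
    by (rule state_map_rep)
  then have v: "H1_rep tf ?x (L2_mat A ?x + g) v" "v 0 = x0" using fg by (simp_all add: L2_on_iff)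
  obtain w where "H1_rep tf (fst ?q) (- L2_mat (transpose A) (fst ?q) - L2_restrict tf f) w"
    "w tf = 0" "w 0 = snd ?q" by (rule adjoint_map_rep[OF tf])
  then have w': "H1_rep tf (fst ?q) (- L2_mat (transpose A) (fst ?q) - f) w" "w tf = 0" "w 0 = snd ?q"
    using fg by (simp_all add: L2_on_iff)
  then have w: "H1_rep tf (- fst ?q) (- L2_mat (transpose A) (- fst ?q) + f) (\<lambda>t. - w t)"
    "w tf = 0" "w 0 = snd ?q" using H1_rep_scaleR[OF w'(1), of "-1"] w'(2,3) by (simp_all add: m.neg add.commute)
  have at: "L2_at tf ?x 0 = x0" "L2_at tf (- fst ?q) 0 = - snd ?q" "L2_at tf (- fst ?q) tf = 0"
    using H1_rep_at[OF tf v(1), of 0] H1_rep_at[OF tf w(1), of 0] H1_rep_at[OF tf w(1), of tf] tf v w by auto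
  have d: "H1_deriv tf ?x = L2_mat A ?x + g" "H1_deriv tf (- fst ?q) = - L2_mat (transpose A) (- fst ?q) + f"
    using H1_deriv_eq[OF tf v(1)] H1_deriv_eq[OF tf w(1)] .
  have J: "opJ_inv tf A (f, (g, x0)) = (?x, (- fst ?q, - snd ?q))"
    by (simp add: opJ_inv_def prod_eq_iff)
  have "opJ tf A (?x, (- fst ?q, - snd ?q)) = (f, (g, x0))"
    unfolding opJ_def opA_def opA_adj_def by (simp add: d at)
  moreover have "(?x, (- fst ?q, - snd ?q)) \<in> dom_opJ tf"
    using v(1) w(1) at by (auto simp: dom_opJ_def dom_opA_adj_def H1_on_def has_H1_deriv_iff)
  ultimately show "p \<in> {(w, opJ tf A w) | w. w \<in> dom_opJ tf}"
    unfolding p J by (auto intro!: exI[of _ ?x] exI[of _ "- fst ?q"])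
qed

section \<open>An abstract fast-slow system\<close>

text \<open>The fast equation is \<open>\<epsilon> w' = M\<inverse> w - R0 w - \<iota> x\<close>.  Its stationary point at \<open>x\<close> is \<open>M (js x)\<close>, that is,
  \<open>js x\<close> is the image of the stationary point under the unbounded operator \<open>M\<inverse>\<close>.  The form \<open>q\<close> is
  the bounded extension of \<open>w \<mapsto> 2 b (M\<inverse> w) w\<close>.\<close>

locale fast_slow = skew_operator P M
  for P M :: "'w::{real_inner,banach} \<Rightarrow> 'w" +
  fixes R0 :: "'w \<Rightarrow> 'w" and \<iota> :: "'x::euclidean_space \<Rightarrow> 'w" and b :: "'w \<Rightarrow> 'w \<Rightarrow> real"
    and q :: "'w \<Rightarrow> real" and js :: "'x \<Rightarrow> 'w" and out :: "'w \<Rightarrow> 'm::euclidean_space" and B :: "'m \<Rightarrow> 'x"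
    and c0 LR Cq Lh :: real
  assumes R0_range: "P w = w \<Longrightarrow> P (R0 w) = R0 w"
    and R0_lip: "P v = v \<Longrightarrow> P w = w \<Longrightarrow> norm (R0 v - R0 w) \<le> LR * norm (v - w)"
    and R0_zero: "R0 0 = 0"
    and iota: "bounded_linear \<iota>" and iota_range: "P (\<iota> x) = \<iota> x"
    and b: "bounded_bilinear b" and b_sym: "b v w = b w v"
    and b_lower: "(norm w)\<^sup>2 \<le> 4 * b w w" and b_upper: "b w w \<le> (norm w)\<^sup>2"
    and b_M: "P u = u \<Longrightarrow> 2 * b u (M u) = q (M u)"
    and q_lip: "\<bar>q v - q w\<bar> \<le> Cq * norm (v - w) * (norm v + norm w)"
    and dissip: "P v = v \<Longrightarrow> P w = w \<Longrightarrow>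
        q (v - w) - 2 * b (v - w) (R0 v - R0 w) \<le> - c0 * (norm (v - w))\<^sup>2"
    and c0: "c0 > 0"
    and js_range: "P (js x) = js x" and js_eq: "js x = R0 (M (js x)) + \<iota> x"
    and out_lip: "norm (out v - out w) \<le> Lh * norm (v - w)" and Lh: "Lh \<ge> 0" and LR: "LR \<ge> 0"
    and B: "bounded_linear B"
begin

interpretation b: bounded_bilinear b by (rule b)
interpretation \<iota>: bounded_linear \<iota> by (rule iota)
interpretation B: bounded_linear B by (rule B)

text \<open>Chosen once and for all, as are the next two constants, since \<open>eps_bound\<close>
  is defined in terms of them before any solution is given.\<close>

definition Cb :: real where "Cb = (SOME K. K \<ge> 0 \<and> (\<forall>v w. norm (b v w) \<le> norm v * norm w * K))"

lemma Cb: "Cb \<ge> 0" "\<bar>b v w\<bar> \<le> norm v * norm w * Cb"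
proof -
  have "\<exists>K\<ge>0. \<forall>v w. norm (b v w) \<le> norm v * norm w * K" by (rule b.nonneg_bounded)
  from someI_ex[OF this[unfolded Bex_def]]
  show "Cb \<ge> 0" "\<bar>b v w\<bar> \<le> norm v * norm w * Cb" unfolding Cb_def by auto
qed

definition nB :: real where "nB = (SOME K. K \<ge> 0 \<and> (\<forall>y. norm (B y) \<le> norm y * K))"

lemma nB: "nB \<ge> 0" "norm (B y) \<le> norm y * nB"
proof -
  have "\<exists>K\<ge>0. \<forall>y. norm (B y) \<le> norm y * K" by (rule B.nonneg_bounded)
  from someI_ex[OF this[unfolded Bex_def]] show "nB \<ge> 0" "norm (B y) \<le> norm y * nB" unfolding nB_def by auto
qed

definition n\<iota> :: real where "n\<iota> = (SOME K. K \<ge> 0 \<and> (\<forall>y. norm (\<iota> y) \<le> norm y * K))"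

lemma n\<iota>: "n\<iota> \<ge> 0" "norm (\<iota> y) \<le> norm y * n\<iota>"
proof -
  have "\<exists>K\<ge>0. \<forall>y. norm (\<iota> y) \<le> norm y * K" by (rule \<iota>.nonneg_bounded)
  from someI_ex[OF this[unfolded Bex_def]] show "n\<iota> \<ge> 0" "norm (\<iota> y) \<le> norm y * n\<iota>" unfolding n\<iota>_def by auto
qed

definition ws :: "'x \<Rightarrow> 'w" where "ws x = M (js x)"

text \<open>The Lipschitz constant of the stationary map that the dissipation rate \<open>c0\<close>
  yields.\<close>

definition \<l> :: real where "\<l> = 2 * Cb * n\<iota> / c0"

lemma \<l>_nonneg: "\<l> \<ge> 0" using Cb(1) n\<iota>(1) c0 by (simp add: \<l>_def)

lemma ws_range: "P (ws x) = ws x" by (simp add: ws_def P_M)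

text \<open>The difference of the two stationary equations is tested with the error through
  \<open>b\<close>: the unbounded part becomes \<open>q\<close>, the dissipation inequality bounds
  \<open>c0\<close> times the squared error, and only the forcing \<open>\<iota> (x - y)\<close>
  remains on the other side.\<close>

lemma stationary_lip:
  assumes "P u = u" "u = R0 (M u) + \<iota> x" and "P v = v" "v = R0 (M v) + \<iota> y"
  shows "norm (M u - M v) \<le> \<l> * norm (x - y)"
proof -
  let ?e = "M u - M v"
  have e: "?e = M (u - v)" by (simp add: M.diff)
  have r: "R0 (M u) - R0 (M v) = (u - v) - \<iota> (x - y)"
    using assms(2,4) by (simp add: \<iota>.diff algebra_simps)
  have "q ?e = 2 * b (u - v) ?e"
    unfolding e using b_M[of "u - v"] assms by (simp add: P.diff)
  moreover have "b ?e (R0 (M u) - R0 (M v)) = b (u - v) ?e - b ?e (\<iota> (x - y))"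
    unfolding r b.diff_right[of ?e "u - v" "\<iota> (x - y)"] b_sym[of ?e "u - v"] ..
  ultimately have "q ?e - 2 * b ?e (R0 (M u) - R0 (M v)) = 2 * b ?e (\<iota> (x - y))"
    by (simp only: right_diff_distrib)
  then have "c0 * (norm ?e)\<^sup>2 \<le> - (2 * b ?e (\<iota> (x - y)))"
    using dissip[of "M u" "M v"] by (simp add: P_M)
  also have "\<dots> \<le> 2 * (norm ?e * norm (\<iota> (x - y)) * Cb)" using Cb(2)[of ?e "\<iota> (x - y)"] by linarith
  also have "\<dots> \<le> 2 * (norm ?e * (norm (x - y) * n\<iota>) * Cb)"
    using n\<iota>(2)[of "x - y"] Cb(1) by (intro mult_left_mono mult_right_mono) auto
  finally have le: "norm ?e * (c0 * norm ?e) \<le> norm ?e * (2 * Cb * n\<iota> * norm (x - y))"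
    by (simp add: power2_eq_square mult_ac)
  show ?thesis
  proof (cases "norm ?e = 0")
    case True then show ?thesis using \<l>_nonneg by (simp add: mult_nonneg_nonneg)
  next
    case False
    then have "c0 * norm ?e \<le> 2 * Cb * n\<iota> * norm (x - y)" using le by (simp add: mult_le_cancel_left)
    then show ?thesis using c0 by (simp add: \<l>_def field_simps)
  qed
qed

lemma ws_lip: "norm (ws x - ws y) \<le> \<l> * norm (x - y)"
  unfolding ws_def by (rule stationary_lip[OF js_range js_eq js_range js_eq])

lemma ws_unique: "P u = u \<Longrightarrow> u = R0 (M u) + \<iota> x \<Longrightarrow> M u = ws x"
  using stationary_lip[OF _ _ js_range js_eq, of u x x] by (simp add: ws_def)

lemma ws_zero: "ws 0 = 0"
  using ws_unique[of 0 0] by (simp add: P.zero M.zero \<iota>.zero R0_zero)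

lemma norm_snd_le_ws: "norm w \<le> norm (w - ws x) + \<l> * norm x"
  using norm_triangle_ineq[of "w - ws x" "ws x"] ws_lip[of x 0] by (simp add: ws_zero)

section \<open>The semigroup on plant and optimizer\<close>

definition Psp :: "'x \<times> 'w \<Rightarrow> 'x \<times> 'w" where "Psp = (\<lambda>(x, w). (x, P w))"

text \<open>Dividing the fast generator by \<open>\<epsilon>\<close> is a change of time scale; the
  plant component has generator 0, its whole right-hand side being part of
  \<open>fsp\<close>.\<close>

definition Tsp :: "real \<Rightarrow> real \<Rightarrow> 'x \<times> 'w \<Rightarrow> 'x \<times> 'w" where
  "Tsp \<epsilon> t = (\<lambda>(x, w). (x, T (t / \<epsilon>) w))"

definition fsp :: "('x \<Rightarrow> 'x) \<Rightarrow> real \<Rightarrow> 'x \<times> 'w \<Rightarrow> 'x \<times> 'w" where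
  "fsp f \<epsilon> = (\<lambda>(x, w). (f x + B (out w), - (1 / \<epsilon>) *\<^sub>R (R0 w + \<iota> x)))"

lemma Psp_iff: "Psp z = z \<longleftrightarrow> P (snd z) = snd z"
  by (cases z) (simp add: Psp_def)

lemma fsp_range: "Psp z = z \<Longrightarrow> Psp (fsp f \<epsilon> z) = fsp f \<epsilon> z"
  by (cases z) (simp add: Psp_iff fsp_def P.neg P.scaleR P.add R0_range iota_range)

lemma filterlim_divide_at_right: "\<epsilon> > 0 \<Longrightarrow> filterlim (\<lambda>t::real. t / \<epsilon>) (at_right 0) (at_right 0)"
proof (rule filterlim_at_withinI)
  assume "\<epsilon> > 0"
  have "((\<lambda>t::real. t / \<epsilon>) \<longlongrightarrow> 0 / \<epsilon>) (at_right 0)"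
    by (rule tendsto_divide[OF tendsto_ident_at tendsto_const]) (use \<open>\<epsilon> > 0\<close> in simp)
  then show "((\<lambda>t::real. t / \<epsilon>) \<longlongrightarrow> 0) (at_right 0)" by simp
  show "\<forall>\<^sub>F t in at_right 0. t / \<epsilon> \<in> {0<..} - {0}"
    using eventually_at_right_less[of 0] by eventually_elim (use \<open>\<epsilon> > 0\<close> in simp)
qed

lemma contraction_semigroup_Tsp:
  assumes \<epsilon>: "\<epsilon> > 0"
  shows "contraction_semigroup Psp (Tsp \<epsilon>)"
proof -
  have Psp: "bounded_linear Psp"
    unfolding Psp_def case_prod_beta
    by (intro bounded_linear_Pair bounded_linear_fst bounded_linear_compose[OF P.bounded_linear_axioms bounded_linear_snd])
  show ?thesis
  proof (rule contraction_semigroup.intro[OF Psp contraction_semigroup_axioms.intro])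
    fix z :: "'x \<times> 'w" and s t :: real
    obtain x w where z: "z = (x, w)" by (cases z)
    show "Psp (Psp z) = Psp z" by (simp add: z Psp_def P_idem)
    show "Tsp \<epsilon> 0 z = Psp z" by (simp add: z Psp_def Tsp_def T_0)
    have "((\<lambda>t. T (t / \<epsilon>) w) \<longlongrightarrow> P w) (at_right 0)"
      by (rule filterlim_compose[OF T_lim' filterlim_divide_at_right[OF \<epsilon>]])
    then show "((\<lambda>t. Tsp \<epsilon> t z) \<longlongrightarrow> Psp z) (at_right 0)"
      unfolding z Tsp_def Psp_def prod.case by (intro tendsto_Pair tendsto_const)
    assume t: "t \<ge> 0"
    then have t': "t / \<epsilon> \<ge> 0" using \<epsilon> by simp
    show "bounded_linear (Tsp \<epsilon> t)"
      unfolding Tsp_def case_prod_beta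
      by (intro bounded_linear_Pair bounded_linear_fst bounded_linear_compose[OF T_bounded_linear[OF t'] bounded_linear_snd])
    show "norm (Tsp \<epsilon> t z) \<le> norm z"
      by (auto simp: z Tsp_def norm_Pair intro!: add_mono power_mono T_contraction t')
    show "Psp (Tsp \<epsilon> t z) = Tsp \<epsilon> t z" by (simp add: z Psp_def Tsp_def T_in_range[OF t'])
    assume s: "s \<ge> 0"
    then have s': "s / \<epsilon> \<ge> 0" using \<epsilon> by simp
    show "Tsp \<epsilon> (s + t) z = Tsp \<epsilon> s (Tsp \<epsilon> t z)"
      using T_add'[OF s' t', of w] by (simp add: z Tsp_def add_divide_distrib)
  qed
qed

lemma range_Psp: "range Psp = UNIV \<times> range P"
  by (auto simp: Psp_def image_iff)

lemma generator_Tsp: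
  assumes \<epsilon>: "\<epsilon> > 0"
  shows "generator_on (range Psp) (Tsp \<epsilon>) = {((x, M u), (0, (1 / \<epsilon>) *\<^sub>R u)) | x u. P u = u}"
proof -
  have iff: "((\<lambda>h. (T (h / \<epsilon>) w - w) /\<^sub>R h) \<longlongrightarrow> v) (at_right 0)
      \<longleftrightarrow> ((\<lambda>h. (T h w - w) /\<^sub>R h) \<longlongrightarrow> \<epsilon> *\<^sub>R v) (at_right 0)" for w v
  proof
    assume "((\<lambda>h. (T h w - w) /\<^sub>R h) \<longlongrightarrow> \<epsilon> *\<^sub>R v) (at_right 0)"
    from filterlim_compose[OF this filterlim_divide_at_right[OF \<epsilon>]]
    have "((\<lambda>h. (T (h / \<epsilon>) w - w) /\<^sub>R (h / \<epsilon>)) \<longlongrightarrow> \<epsilon> *\<^sub>R v) (at_right 0)" .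
    then have "((\<lambda>h. (1 / \<epsilon>) *\<^sub>R ((T (h / \<epsilon>) w - w) /\<^sub>R (h / \<epsilon>))) \<longlongrightarrow> (1 / \<epsilon>) *\<^sub>R (\<epsilon> *\<^sub>R v)) (at_right 0)"
      by (rule tendsto_scaleR[OF tendsto_const])
    moreover have "(1 / \<epsilon>) *\<^sub>R ((T (h / \<epsilon>) w - w) /\<^sub>R (h / \<epsilon>)) = (T (h / \<epsilon>) w - w) /\<^sub>R h" for h
      using \<epsilon> by (simp add: divide_inverse)
    moreover have "(1 / \<epsilon>) *\<^sub>R (\<epsilon> *\<^sub>R v) = v" using \<epsilon> by simp
    ultimately show "((\<lambda>h. (T (h / \<epsilon>) w - w) /\<^sub>R h) \<longlongrightarrow> v) (at_right 0)" by (simp only:)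
  next
    assume a: "((\<lambda>h. (T (h / \<epsilon>) w - w) /\<^sub>R h) \<longlongrightarrow> v) (at_right 0)"
    have "filterlim (\<lambda>t. t / (1 / \<epsilon>)) (at_right 0) (at_right 0)"
      by (rule filterlim_divide_at_right) (use \<epsilon> in simp)
    from filterlim_compose[OF a this]
    have "((\<lambda>h. (T h w - w) /\<^sub>R (h * \<epsilon>)) \<longlongrightarrow> v) (at_right 0)" using \<epsilon> by simp
    then have "((\<lambda>h. \<epsilon> *\<^sub>R ((T h w - w) /\<^sub>R (h * \<epsilon>))) \<longlongrightarrow> \<epsilon> *\<^sub>R v) (at_right 0)"
      by (rule tendsto_scaleR[OF tendsto_const])
    moreover have "\<epsilon> *\<^sub>R ((T h w - w) /\<^sub>R (h * \<epsilon>)) = (T h w - w) /\<^sub>R h" for h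
      using \<epsilon> by (simp add: inverse_eq_divide)
    ultimately show "((\<lambda>h. (T h w - w) /\<^sub>R h) \<longlongrightarrow> \<epsilon> *\<^sub>R v) (at_right 0)" by (simp only:)
  qed
  have gen: "P w = w \<and> P v = v \<and> ((\<lambda>h. (T h w - w) /\<^sub>R h) \<longlongrightarrow> v) (at_right 0) \<longleftrightarrow> P v = v \<and> w = M v" for w v
    using generator_T unfolding generator_on_def S.range_iff set_eq_iff by auto
  have "((x, w), (y, v)) \<in> generator_on (range Psp) (Tsp \<epsilon>) \<longleftrightarrow> y = 0 \<and> P v = v \<and> w = M (\<epsilon> *\<^sub>R v)" for x y w v
  proof -
    have "((\<lambda>h. (Tsp \<epsilon> h (x, w) - (x, w)) /\<^sub>R h) \<longlongrightarrow> (y, v)) (at_right 0)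
        \<longleftrightarrow> y = 0 \<and> ((\<lambda>h. (T (h / \<epsilon>) w - w) /\<^sub>R h) \<longlongrightarrow> v) (at_right 0)"
    proof
      assume a: "((\<lambda>h. (Tsp \<epsilon> h (x, w) - (x, w)) /\<^sub>R h) \<longlongrightarrow> (y, v)) (at_right 0)"
      have "((\<lambda>h::real. 0 :: 'x) \<longlongrightarrow> y) (at_right 0)" using tendsto_fst[OF a] by (simp add: Tsp_def)
      then show "y = 0 \<and> ((\<lambda>h. (T (h / \<epsilon>) w - w) /\<^sub>R h) \<longlongrightarrow> v) (at_right 0)"
        using tendsto_snd[OF a] tendsto_const_iff[of "at_right (0::real)" "0::'x" y] by (simp add: Tsp_def)
    next
      assume "y = 0 \<and> ((\<lambda>h. (T (h / \<epsilon>) w - w) /\<^sub>R h) \<longlongrightarrow> v) (at_right 0)"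
      then show "((\<lambda>h. (Tsp \<epsilon> h (x, w) - (x, w)) /\<^sub>R h) \<longlongrightarrow> (y, v)) (at_right 0)"
        using tendsto_Pair[of "\<lambda>h. 0 :: 'x" 0 "at_right (0::real)" "\<lambda>h. (T (h / \<epsilon>) w - w) /\<^sub>R h" v]
        by (simp add: Tsp_def)
    qed
    moreover have "P v = v \<longleftrightarrow> P (\<epsilon> *\<^sub>R v) = \<epsilon> *\<^sub>R v" using \<epsilon> by (simp add: P.scaleR)
    ultimately show ?thesis
      unfolding generator_on_def range_Psp using gen[of w "\<epsilon> *\<^sub>R v"]
      by (auto simp: S.range_iff iff simp del: scaleR_cancel_left)
  qed
  note iff2 = this
  show ?thesis
  proof (intro equalityI subsetI)
    fix p :: "('x \<times> 'w) \<times> 'x \<times> 'w" assume p: "p \<in> generator_on (range Psp) (Tsp \<epsilon>)"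
    obtain x w y v where pp: "p = ((x, w), (y, v))" by (cases p) auto
    have "y = 0" "P v = v" "w = M (\<epsilon> *\<^sub>R v)" using p iff2[of x w y v] unfolding pp by auto
    then show "p \<in> {((x, M u), (0, (1 / \<epsilon>) *\<^sub>R u)) | x u. P u = u}"
      unfolding pp using \<epsilon> by (auto intro!: exI[of _ "\<epsilon> *\<^sub>R v"] simp: P.scaleR)
  next
    fix p :: "('x \<times> 'w) \<times> 'x \<times> 'w" assume "p \<in> {((x, M u), (0, (1 / \<epsilon>) *\<^sub>R u)) | x u. P u = u}"
    then obtain x u where "p = ((x, M u), (0, (1 / \<epsilon>) *\<^sub>R u))" "P u = u" by auto
    then show "p \<in> generator_on (range Psp) (Tsp \<epsilon>)"
      using iff2[of x "M u" 0 "(1 / \<epsilon>) *\<^sub>R u"] \<epsilon> by (simp add: P.scaleR)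
  qed
qed

lemma dense_generator_Tsp:
  assumes \<epsilon>: "\<epsilon> > 0"
  shows "range Psp \<subseteq> closure (Domain (generator_on (range Psp) (Tsp \<epsilon>)))"
proof -
  have "Domain (generator_on (range Psp) (Tsp \<epsilon>)) = UNIV \<times> range M"
  proof (intro equalityI subsetI)
    fix p :: "'x \<times> 'w" assume "p \<in> UNIV \<times> range M"
    then obtain x y where p: "p = (x, M (P y))" by (auto simp: M_P)
    have "((x, M (P y)), (0, (1 / \<epsilon>) *\<^sub>R P y)) \<in> generator_on (range Psp) (Tsp \<epsilon>)"
      unfolding generator_Tsp[OF \<epsilon>] using P_idem by blast
    then show "p \<in> Domain (generator_on (range Psp) (Tsp \<epsilon>))" unfolding p by (rule DomainI)
  qed (auto simp: generator_Tsp[OF \<epsilon>])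
  moreover have "range P \<subseteq> closure (range M)" using P_in_closure P_idem by auto
  ultimately show ?thesis unfolding range_Psp by (auto simp: closure_Times)
qed

end

text \<open>The one-sided limit is a derivative within the half line, for which the chain rule
  holds.\<close>

lemma right_quotient_chain:
  fixes k :: "real \<Rightarrow> 'x::real_normed_vector" and V :: "'x \<Rightarrow> real"
  assumes k: "((\<lambda>h. (k (t + h) - k t) /\<^sub>R h) \<longlongrightarrow> D) (at_right 0)"
    and V: "(V has_derivative V') (at (k t))"
  shows "((\<lambda>h. (V (k (t + h)) - V (k t)) / h) \<longlongrightarrow> V' D) (at_right 0)"
proof -
  define m where "m h = k (t + h)" for h
  have m0: "m 0 = k t" by (simp add: m_def)
  have "(m has_derivative (\<lambda>s. s *\<^sub>R D)) (at 0 within {0..})"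
    unfolding has_derivative_within at_within_Ici_at_right
  proof (intro conjI bounded_linear_scaleR_left)
    have "((\<lambda>h. (m h - m 0) /\<^sub>R h - D) \<longlongrightarrow> D - D) (at_right 0)"
      using k unfolding m_def by (intro tendsto_diff tendsto_const) simp
    then have lim: "((\<lambda>h. (m h - m 0) /\<^sub>R h - D) \<longlongrightarrow> 0) (at_right 0)" by simp
    show "((\<lambda>y. (1 / norm (y - 0)) *\<^sub>R (m y - (m 0 + (y - 0) *\<^sub>R D))) \<longlongrightarrow> 0) (at_right 0)"
    proof (rule Lim_transform_eventually[OF lim])
      show "\<forall>\<^sub>F h in at_right 0. (m h - m 0) /\<^sub>R h - D = (1 / norm (h - 0)) *\<^sub>R (m h - (m 0 + (h - 0) *\<^sub>R D))"
        using eventually_at_right_less[of 0]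
        by eventually_elim (simp add: scaleR_diff_right scaleR_add_right divide_inverse)
    qed
  qed
  then have "((\<lambda>h. V (m h)) has_derivative (\<lambda>s. V' (s *\<^sub>R D))) (at 0 within {0..})"
    using V unfolding m0[symmetric] by (rule has_derivative_compose)
  moreover have "(\<lambda>s. V' (s *\<^sub>R D)) = (*) (V' D)"
    using linear_scale[OF bounded_linear.linear[OF has_derivative_bounded_linear[OF V]]] by (simp add: fun_eq_iff)
  ultimately have "((\<lambda>h. V (m h)) has_field_derivative V' D) (at 0 within {0..})"
    by (simp add: has_field_derivative_def)
  then have "((\<lambda>h. (V (m h) - V (m 0)) / (h - 0)) \<longlongrightarrow> V' D) (at_right 0)"
    unfolding has_field_derivative_iff at_within_Ici_at_right .
  then show ?thesis by (simp add: m_def)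
qed

section \<open>The right derivative of the composite Lyapunov function\<close>

context fast_slow
begin

interpretation b: bounded_bilinear b by (rule b)
interpretation \<iota>: bounded_linear \<iota> by (rule iota)
interpretation B: bounded_linear B by (rule B)

definition W :: "('x \<Rightarrow> real) \<Rightarrow> 'x \<times> 'w \<Rightarrow> real" where
  "W V z = V (fst z) + b (snd z - ws (fst z)) (snd z - ws (fst z))"

abbreviation mild :: "real \<Rightarrow> ('x \<Rightarrow> 'x) \<Rightarrow> real set \<Rightarrow> 'x \<times> 'w \<Rightarrow> (real \<Rightarrow> 'x \<times> 'w) \<Rightarrow> bool" where
  "mild \<epsilon> f \<equiv> contraction_semigroup.mild_on Psp (Tsp \<epsilon>) (fsp f \<epsilon>)"

lemma mildD:
  assumes "\<epsilon> > 0" "mild \<epsilon> f I z0 z"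
  shows "continuous_on I z" "t \<in> I \<Longrightarrow> P (snd (z t)) = snd (z t)"
proof -
  interpret SP: contraction_semigroup Psp "Tsp \<epsilon>" by (rule contraction_semigroup_Tsp[OF assms(1)])
  show "continuous_on I z" "t \<in> I \<Longrightarrow> P (snd (z t)) = snd (z t)"
    using assms(2) unfolding SP.mild_on_def Psp_iff by blast+
qed

lemma continuous_on_R0:
  assumes "continuous_on I w" "\<And>s. s \<in> I \<Longrightarrow> P (w s) = w s"
  shows "continuous_on I (\<lambda>s. R0 (w s))"
proof -
  have "LR-lipschitz_on {w. P w = w} R0"
    by (rule lipschitz_onI) (auto simp: dist_norm R0_lip LR)
  then have "continuous_on {w. P w = w} R0" by (rule lipschitz_on_continuous_on)
  then show ?thesis by (rule continuous_on_compose2[OF _ assms(1)]) (use assms(2) in auto)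
qed

lemma continuous_out: "continuous_on S out"
  by (rule lipschitz_on_continuous_on[of Lh]) (auto intro!: lipschitz_onI simp: dist_norm out_lip Lh)

lemma continuous_ws: "continuous_on S ws"
  by (rule lipschitz_on_continuous_on[of \<l>]) (auto intro!: lipschitz_onI simp: dist_norm ws_lip \<l>_nonneg)

lemma continuous_on_fsp:
  assumes z: "continuous_on I z" and P: "\<And>s. s \<in> I \<Longrightarrow> P (snd (z s)) = snd (z s)" and f: "continuous_on UNIV f"
  shows "continuous_on I (\<lambda>s. fsp f \<epsilon> (z s))"
  unfolding fsp_def case_prod_beta
  by (intro continuous_intros continuous_on_R0 P continuous_on_compose2[OF f] B.continuous_on \<iota>.continuous_on
      continuous_on_compose2[OF continuous_out[of UNIV]] z) auto

text \<open>The stationary point is held fixed at \<open>ws x\<close> while the fast state moves,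
  which has an exact right derivative. Replacing it by the stationary point at time
  \<open>t + h\<close> shifts the error by at most \<open>\<l>\<close> times the plant increment,
  and this gives the last term of the rate.\<close>

lemma W_right_dini:
  assumes \<epsilon>: "\<epsilon> > 0" and z: "mild \<epsilon> f {0..<\<tau>} z0 z" and t: "t \<in> {0..<\<tau>}" and f: "continuous_on UNIV f"
    and V: "(V has_derivative (\<lambda>k. g \<bullet> k)) (at (fst (z t)))" and e': "e' > 0"
  defines "x \<equiv> fst (z t)" and "w \<equiv> snd (z t)"
  defines "xd \<equiv> f x + B (out w)" and "e \<equiv> w - ws x"
  shows "\<forall>\<^sub>F h in at_right 0. W V (z (t + h)) \<le> W V (z t)
      + (g \<bullet> xd + (q e - 2 * b e (R0 w - R0 (ws x))) / \<epsilon> + 2 * Cb * norm e * (\<l> * norm xd) + e') * h"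
proof -
  interpret SP: contraction_semigroup Psp "Tsp \<epsilon>" by (rule contraction_semigroup_Tsp[OF \<epsilon>])
  have ev0: "\<forall>\<^sub>F h :: real in at_right 0. 0 < h" by (simp add: eventually_at_right_less)
  have Pw: "P w = w" unfolding w_def using mildD(2)[OF \<epsilon> z t] .
  have Pe: "P e = e" by (simp add: e_def P.diff Pw ws_range)
  have exp: "((\<lambda>h. (z (t + h) - Tsp \<epsilon> h (z t)) /\<^sub>R h) \<longlongrightarrow> Psp (fsp f \<epsilon> (z t))) (at_right 0)"
    using mildD[OF \<epsilon> z] by (intro SP.mild_on_right_expansion[OF z t] continuous_on_fsp f) auto
  have zt: "z t = (x, w)" by (simp add: x_def w_def)
  have Pf: "Psp (fsp f \<epsilon> (z t)) = (xd, - (1 / \<epsilon>) *\<^sub>R (R0 w + \<iota> x))"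
    using fsp_range[of "z t" f \<epsilon>] Pw by (simp add: zt Psp_iff fsp_def xd_def)
  have dx: "((\<lambda>h. (fst (z (t + h)) - x) /\<^sub>R h) \<longlongrightarrow> xd) (at_right 0)"
    using tendsto_fst[OF exp] unfolding Pf by (simp add: zt Tsp_def)
  have dw: "((\<lambda>h. (snd (z (t + h)) - T (h / \<epsilon>) w) /\<^sub>R h) \<longlongrightarrow> - (1 / \<epsilon>) *\<^sub>R (R0 w + \<iota> x)) (at_right 0)"
    using tendsto_snd[OF exp] unfolding Pf by (simp add: zt Tsp_def)
  have gen: "((x, ws x), (0, (1 / \<epsilon>) *\<^sub>R js x)) \<in> generator_on (range Psp) (Tsp \<epsilon>)"
    unfolding generator_Tsp[OF \<epsilon>] ws_def using js_range by blast
  \<comment> \<open>The stationary point lies in the domain of the generator, so its free orbit is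
    differentiable; \<open>js x\<close> will cancel \<open>R0 (ws x) + \<iota> x\<close>.\<close>
  have dws: "((\<lambda>h. (T (h / \<epsilon>) (ws x) - ws x) /\<^sub>R h) \<longlongrightarrow> (1 / \<epsilon>) *\<^sub>R js x) (at_right 0)"
  proof -
    have "((\<lambda>h. (Tsp \<epsilon> h (x, ws x) - (x, ws x)) /\<^sub>R h) \<longlongrightarrow> (0, (1 / \<epsilon>) *\<^sub>R js x)) (at_right 0)"
      using gen by (simp add: generator_on_def)
    from tendsto_snd[OF this] show ?thesis by (simp add: Tsp_def)
  qed
  define y where "y h = snd (z (t + h)) - ws x" for h
  define r where "r h = y h - T (h / \<epsilon>) e" for h
  define \<rho> where "\<rho> = - (1 / \<epsilon>) *\<^sub>R (R0 w - R0 (ws x))"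
  have dr: "((\<lambda>h. r h /\<^sub>R h) \<longlongrightarrow> \<rho>) (at_right 0)"
  proof -
    have "((\<lambda>h. (snd (z (t + h)) - T (h / \<epsilon>) w) /\<^sub>R h + (T (h / \<epsilon>) (ws x) - ws x) /\<^sub>R h) \<longlongrightarrow>
        - (1 / \<epsilon>) *\<^sub>R (R0 w + \<iota> x) + (1 / \<epsilon>) *\<^sub>R js x) (at_right 0)"
      by (rule tendsto_add[OF dw dws])
    moreover have "- (1 / \<epsilon>) *\<^sub>R (R0 w + \<iota> x) + (1 / \<epsilon>) *\<^sub>R js x = \<rho>"
    proof -
      have "js x = R0 (ws x) + \<iota> x" using js_eq[of x] by (simp add: ws_def)
      then show ?thesis unfolding \<rho>_def by (simp add: algebra_simps)
    qed
    moreover have "\<forall>\<^sub>F h in at_right 0. (snd (z (t + h)) - T (h / \<epsilon>) w) /\<^sub>R h + (T (h / \<epsilon>) (ws x) - ws x) /\<^sub>R h = r h /\<^sub>R h"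
      using ev0
    proof eventually_elim
      case (elim h)
      have "T (h / \<epsilon>) e = T (h / \<epsilon>) w - T (h / \<epsilon>) (ws x)"
        unfolding e_def using elim \<epsilon> by (intro T_diff') simp
      then show ?case unfolding r_def y_def by (simp only: scaleR_add_right[symmetric]) simp
    qed
    ultimately show ?thesis by (simp add: tendsto_cong)
  qed
  have r0: "(r \<longlongrightarrow> 0) (at_right 0)"
  proof -
    have "((\<lambda>h. h *\<^sub>R (r h /\<^sub>R h)) \<longlongrightarrow> 0 *\<^sub>R \<rho>) (at_right 0)" by (intro tendsto_scaleR dr tendsto_ident_at)
    moreover have "\<forall>\<^sub>F h in at_right 0. h *\<^sub>R (r h /\<^sub>R h) = r h" using ev0 by eventually_elim simp
    ultimately show ?thesis by (simp add: tendsto_cong)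
  qed
  have Te: "((\<lambda>h. T (h / \<epsilon>) e) \<longlongrightarrow> e) (at_right 0)"
    using filterlim_compose[OF T_lim'[of e] filterlim_divide_at_right[OF \<epsilon>]] unfolding Pe .
  have y0: "(y \<longlongrightarrow> e) (at_right 0)"
  proof -
    have "((\<lambda>h. r h + T (h / \<epsilon>) e) \<longlongrightarrow> 0 + e) (at_right 0)" by (rule tendsto_add[OF r0 Te])
    then show ?thesis by (simp add: r_def)
  qed
  have dq: "((\<lambda>h. (b (T (h / \<epsilon>) e) (T (h / \<epsilon>) e) - b e e) / h) \<longlongrightarrow> q e / \<epsilon>) (at_right 0)"
  proof -
    have "((\<lambda>h. (b (T (h / \<epsilon>) e) (T (h / \<epsilon>) e) - b e e) / (h / \<epsilon>)) \<longlongrightarrow> q e) (at_right 0)"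
      by (rule filterlim_compose[OF quadratic_form_right_derivative[OF b b_sym b_M q_lip Pe] filterlim_divide_at_right[OF \<epsilon>]])
    then have "((\<lambda>h. (b (T (h / \<epsilon>) e) (T (h / \<epsilon>) e) - b e e) / (h / \<epsilon>) / \<epsilon>) \<longlongrightarrow> q e / \<epsilon>) (at_right 0)"
      by (intro tendsto_divide tendsto_const) (use \<epsilon> in auto)
    moreover have "(b (T (h / \<epsilon>) e) (T (h / \<epsilon>) e) - b e e) / (h / \<epsilon>) / \<epsilon> = (b (T (h / \<epsilon>) e) (T (h / \<epsilon>) e) - b e e) / h" for h
      using \<epsilon> by simp
    ultimately show ?thesis by (simp only:)
  qed
  have dby: "((\<lambda>h. (b (y h) (y h) - b e e) / h) \<longlongrightarrow> q e / \<epsilon> + 2 * b e \<rho> + b 0 \<rho>) (at_right 0)"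
  proof (rule Lim_transform_eventually)
    show "((\<lambda>h. (b (T (h / \<epsilon>) e) (T (h / \<epsilon>) e) - b e e) / h + 2 * b (T (h / \<epsilon>) e) (r h /\<^sub>R h) + b (r h) (r h /\<^sub>R h))
        \<longlongrightarrow> q e / \<epsilon> + 2 * b e \<rho> + b 0 \<rho>) (at_right 0)"
      by (intro tendsto_add dq tendsto_mult tendsto_const b.tendsto Te dr r0)
    show "\<forall>\<^sub>F h in at_right 0. (b (T (h / \<epsilon>) e) (T (h / \<epsilon>) e) - b e e) / h + 2 * b (T (h / \<epsilon>) e) (r h /\<^sub>R h) + b (r h) (r h /\<^sub>R h)
        = (b (y h) (y h) - b e e) / h"
      using ev0
    proof eventually_elim
      case (elim h)
      have "y h = T (h / \<epsilon>) e + r h" by (simp add: r_def)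
      then have "b (y h) (y h) = b (T (h / \<epsilon>) e) (T (h / \<epsilon>) e) + 2 * b (T (h / \<epsilon>) e) (r h) + b (r h) (r h)"
        using b_sym[of "r h" "T (h / \<epsilon>) e"] by (simp add: b.add_left b.add_right)
      then show ?case using elim by (simp add: b.scaleR_right divide_inverse algebra_simps)
    qed
  qed
  have dV: "((\<lambda>h. (V (fst (z (t + h))) - V x) / h) \<longlongrightarrow> g \<bullet> xd) (at_right 0)"
    using right_quotient_chain[of "\<lambda>s. fst (z s)" t xd V] dx V by (simp add: x_def)
  have x0: "((\<lambda>h. fst (z (t + h)) - x) \<longlongrightarrow> 0) (at_right 0)"
  proof -
    have "((\<lambda>h. h *\<^sub>R ((fst (z (t + h)) - x) /\<^sub>R h)) \<longlongrightarrow> 0 *\<^sub>R xd) (at_right 0)" by (intro tendsto_scaleR dx tendsto_ident_at)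
    moreover have "\<forall>\<^sub>F h in at_right 0. h *\<^sub>R ((fst (z (t + h)) - x) /\<^sub>R h) = fst (z (t + h)) - x"
      using ev0 by eventually_elim simp
    ultimately show ?thesis by (simp add: tendsto_cong)
  qed
  define Q where "Q h = (V (fst (z (t + h))) - V x) / h + (b (y h) (y h) - b e e) / h
      + 2 * Cb * norm (y h) * (\<l> * norm ((fst (z (t + h)) - x) /\<^sub>R h))
      + \<l>\<^sup>2 * norm (fst (z (t + h)) - x) * norm ((fst (z (t + h)) - x) /\<^sub>R h)" for h
  let ?D = "g \<bullet> xd + (q e - 2 * b e (R0 w - R0 (ws x))) / \<epsilon> + 2 * Cb * norm e * (\<l> * norm xd)"
  have "(Q \<longlongrightarrow> g \<bullet> xd + (q e / \<epsilon> + 2 * b e \<rho> + b 0 \<rho>) + 2 * Cb * norm e * (\<l> * norm xd)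
      + \<l>\<^sup>2 * norm (0::'x) * norm xd) (at_right 0)"
    unfolding Q_def by (intro tendsto_add tendsto_mult tendsto_const tendsto_norm dV dby y0 dx x0)
  moreover have "b e \<rho> = - b e (R0 w - R0 (ws x)) / \<epsilon>" by (simp add: \<rho>_def b.scaleR_right b.minus_right)
  ultimately have "(Q \<longlongrightarrow> ?D) (at_right 0)"
    by (simp add: b.zero_left diff_divide_distrib algebra_simps)
  then have "\<forall>\<^sub>F h in at_right 0. Q h < ?D + e'" using e' by (intro order_tendstoD) auto
  with ev0 show ?thesis
  proof eventually_elim
    case (elim h)
    let ?dx = "fst (z (t + h)) - x"
    define d where "d = ws (fst (z (t + h))) - ws x"
    have dle: "norm d \<le> \<l> * norm ?dx" unfolding d_def by (rule ws_lip)
    have "snd (z (t + h)) - ws (fst (z (t + h))) = y h - d" by (simp add: y_def d_def)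
    then have "W V (z (t + h)) = V (fst (z (t + h))) + b (y h - d) (y h - d)" by (simp add: W_def)
    also have "b (y h - d) (y h - d) = b (y h) (y h) - 2 * b (y h) d + b d d"
      using b_sym[of d "y h"] by (simp add: b.diff_left b.diff_right)
    also have "\<dots> \<le> b (y h) (y h) + 2 * (norm (y h) * (\<l> * norm ?dx) * Cb) + (\<l> * norm ?dx)\<^sup>2"
    proof -
      have "- b (y h) d \<le> norm (y h) * norm d * Cb" using Cb(2)[of "y h" d] by linarith
      also have "\<dots> \<le> norm (y h) * (\<l> * norm ?dx) * Cb"
        using dle Cb(1) by (intro mult_left_mono mult_right_mono) auto
      finally have 1: "- b (y h) d \<le> norm (y h) * (\<l> * norm ?dx) * Cb" .
      have "b d d \<le> (\<l> * norm ?dx)\<^sup>2" using b_upper[of d] power_mono[OF dle, of 2] by simp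
      with 1 show ?thesis by linarith
    qed
    finally have up: "W V (z (t + h)) \<le> V (fst (z (t + h)))
        + (b (y h) (y h) + 2 * (norm (y h) * (\<l> * norm ?dx) * Cb) + (\<l> * norm ?dx)\<^sup>2)" by simp
    have nd: "norm (?dx /\<^sub>R h) = norm ?dx / h" using elim by (simp add: divide_inverse mult.commute)
    have "Q h * h = V (fst (z (t + h))) - V x + (b (y h) (y h) - b e e)
        + 2 * (norm (y h) * (\<l> * norm ?dx) * Cb) + (\<l> * norm ?dx)\<^sup>2"
      unfolding Q_def nd using elim(1) by (simp add: field_simps power2_eq_square)
    moreover have "Q h * h \<le> (?D + e') * h" using elim by (intro mult_right_mono) auto
    moreover have "W V (z t) = V x + b e e" by (simp add: W_def zt e_def)
    ultimately show ?case using up by linarith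
  qed
qed

end

section \<open>Decay of the Lyapunov function, stability and convergence\<close>

context fast_slow
begin

interpretation b: bounded_bilinear b by (rule b)
interpretation \<iota>: bounded_linear \<iota> by (rule iota)
interpretation B: bounded_linear B by (rule B)

text \<open>(SC) in the form in which the estimates consume it: condition (iii) becomes a bound on
  \<open>g x \<bullet> B y\<close> by Cauchy-Schwarz, the feedback is written as the output at the
  stationary point, and the closed-loop field is bounded linearly by \<open>LF\<close>.\<close>

definition plant_lyapunov ::
  "ereal \<Rightarrow> ('x \<Rightarrow> 'x) \<Rightarrow> ('x \<Rightarrow> real) \<Rightarrow> ('x \<Rightarrow> 'x) \<Rightarrow> (real \<Rightarrow> real) \<Rightarrow> (real \<Rightarrow> real) \<Rightarrow> real \<Rightarrow> real \<Rightarrow> real \<Rightarrow> bool"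
where
  "plant_lyapunov \<delta> f V g r1 rp c \<zeta> LF \<longleftrightarrow>
     continuous_on UNIV f \<and> c > 0 \<and> \<zeta> > 0 \<and> LF \<ge> 0 \<and> V 0 = 0 \<and> r1 0 = 0 \<and>
     strict_mono_on {s. 0 \<le> s \<and> ereal s < \<delta>} r1 \<and>
     (\<forall>x. ereal (norm x) < \<delta> \<longrightarrow>
        (V has_derivative (\<lambda>k. g x \<bullet> k)) (at x) \<and> r1 (norm x) \<le> V x \<and> c * (norm x)\<^sup>2 \<le> rp (norm x) \<and>
        g x \<bullet> (f x + B (out (ws x))) \<le> - rp (norm x) \<and>
        (\<forall>y. \<bar>g x \<bullet> B y\<bar> \<le> sqrt (\<zeta> * rp (norm x)) * norm y) \<and>
        norm (f x + B (out (ws x))) \<le> LF * norm x)"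

lemma plant_lyapunovD:
  assumes "plant_lyapunov \<delta> f V g r1 rp c \<zeta> LF"
  shows "continuous_on UNIV f" "c > 0" "\<zeta> > 0" "LF \<ge> 0" "V 0 = 0" "r1 0 = 0"
    "strict_mono_on {s. 0 \<le> s \<and> ereal s < \<delta>} r1"
    "ereal (norm x) < \<delta> \<Longrightarrow> (V has_derivative (\<lambda>k. g x \<bullet> k)) (at x)"
    "ereal (norm x) < \<delta> \<Longrightarrow> r1 (norm x) \<le> V x"
    "ereal (norm x) < \<delta> \<Longrightarrow> c * (norm x)\<^sup>2 \<le> rp (norm x)"
    "ereal (norm x) < \<delta> \<Longrightarrow> g x \<bullet> (f x + B (out (ws x))) \<le> - rp (norm x)"
    "ereal (norm x) < \<delta> \<Longrightarrow> \<bar>g x \<bullet> B y\<bar> \<le> sqrt (\<zeta> * rp (norm x)) * norm y"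
    "ereal (norm x) < \<delta> \<Longrightarrow> norm (f x + B (out (ws x))) \<le> LF * norm x"
  using assms unfolding plant_lyapunov_def by blast+

text \<open>The coefficient of \<open>sqrt (rp (norm x)) * norm e\<close> in the rate of
  \<open>W\<close>. One part stems from the control error seen by the plant function, the other from
  the motion of the stationary point along the nominal plant field; \<open>self_rate\<close>
  collects what is quadratic in \<open>norm e\<close>.\<close>

definition cross_rate :: "real \<Rightarrow> real \<Rightarrow> real \<Rightarrow> real" where
  "cross_rate c \<zeta> LF = sqrt \<zeta> * Lh + 2 * Cb * \<l> * LF / sqrt c"

definition self_rate :: real where "self_rate = 2 * Cb * \<l> * nB * Lh"

text \<open>For smaller \<open>\<epsilon>\<close> the quotient \<open>c0 / \<epsilon>\<close>
  exceeds the denominator: it pays for the quadratic terms, for the Young share of the cross term,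
  and leaves 1 as decay rate of the squared error.\<close>

definition eps_bound :: "real \<Rightarrow> real \<Rightarrow> real \<Rightarrow> real" where
  "eps_bound c \<zeta> LF = c0 / (self_rate + (cross_rate c \<zeta> LF)\<^sup>2 / 2 + 1)"

lemma eps_bound_pos: "eps_bound c \<zeta> LF > 0"
proof -
  have "self_rate \<ge> 0" using Cb(1) \<l>_nonneg nB(1) Lh by (simp add: self_rate_def)
  then have "self_rate + (cross_rate c \<zeta> LF)\<^sup>2 / 2 + 1 > 0" by (simp add: add_nonneg_pos)
  then show ?thesis using c0 by (simp add: eps_bound_def)
qed

lemma W_rate_bound:
  assumes lyap: "plant_lyapunov \<delta> f V g r1 rp c \<zeta> LF" and \<epsilon>: "0 < \<epsilon>" "\<epsilon> < eps_bound c \<zeta> LF"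
    and x: "ereal (norm x) < \<delta>" and w: "P w = w"
  defines "xd \<equiv> f x + B (out w)" and "e \<equiv> w - ws x"
  shows "g x \<bullet> xd + (q e - 2 * b e (R0 w - R0 (ws x))) / \<epsilon> + 2 * Cb * norm e * (\<l> * norm xd)
     \<le> - (c / 2 * (norm x)\<^sup>2 + (norm e)\<^sup>2)"
proof -
  note D = plant_lyapunovD[OF lyap]
  \<comment> \<open>Every plant quantity is measured by the root of its dissipation, since both the
    gradient bound and \<open>sqrt c * norm x\<close> are controlled by it.\<close>
  define s where "s = sqrt (rp (norm x))"
  have c: "c > 0" by (rule D)
  have rp: "rp (norm x) \<ge> 0" using D(10)[OF x] c by (meson mult_nonneg_nonneg less_imp_le zero_le_power2 order_trans)
  have s: "s \<ge> 0" "s\<^sup>2 = rp (norm x)" using rp by (auto simp: s_def)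
  have nx: "norm x \<le> s / sqrt c"
  proof -
    have "(sqrt c * norm x)\<^sup>2 \<le> s\<^sup>2" using D(10)[OF x] c by (simp add: s power_mult_distrib)
    then have "sqrt c * norm x \<le> s" using s(1) by (rule power2_le_imp_le)
    then show ?thesis using c by (simp add: pos_le_divide_eq mult.commute)
  qed
  let ?dy = "out w - out (ws x)"
  have dy: "norm ?dy \<le> Lh * norm e" unfolding e_def by (rule out_lip)
  have xd: "xd = (f x + B (out (ws x))) + B ?dy" by (simp add: xd_def B.diff)
  have nxd: "norm xd \<le> LF * (s / sqrt c) + nB * (Lh * norm e)"
  proof -
    have "norm xd \<le> norm (f x + B (out (ws x))) + norm (B ?dy)" unfolding xd by (rule norm_triangle_ineq)
    also have "norm (f x + B (out (ws x))) \<le> LF * (s / sqrt c)"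
      using D(13)[OF x] mult_left_mono[OF nx D(4)] by linarith
    also have "norm (B ?dy) \<le> nB * (Lh * norm e)"
      using nB(2)[of ?dy] mult_right_mono[OF dy nB(1)] by (simp add: mult.commute)
    finally show ?thesis by simp
  qed
  have 1: "g x \<bullet> xd \<le> - s\<^sup>2 + sqrt \<zeta> * s * (Lh * norm e)"
  proof -
    have "g x \<bullet> xd = g x \<bullet> (f x + B (out (ws x))) + g x \<bullet> B ?dy" unfolding xd by (rule inner_add_right)
    also have "g x \<bullet> (f x + B (out (ws x))) \<le> - s\<^sup>2" using D(11)[OF x] s by simp
    also have "g x \<bullet> B ?dy \<le> sqrt (\<zeta> * rp (norm x)) * norm ?dy" using D(12)[OF x, of ?dy] by linarith
    also have "\<dots> \<le> sqrt (\<zeta> * rp (norm x)) * (Lh * norm e)" using D(3) rp by (intro mult_left_mono dy) simp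
    finally show ?thesis by (simp add: s_def real_sqrt_mult)
  qed
  have 2: "(q e - 2 * b e (R0 w - R0 (ws x))) / \<epsilon> \<le> - (c0 / \<epsilon>) * (norm e)\<^sup>2"
  proof -
    have "q e - 2 * b e (R0 w - R0 (ws x)) \<le> - c0 * (norm e)\<^sup>2"
      unfolding e_def by (rule dissip[OF w ws_range])
    then have "(q e - 2 * b e (R0 w - R0 (ws x))) / \<epsilon> \<le> (- c0 * (norm e)\<^sup>2) / \<epsilon>"
      using \<epsilon>(1) by (intro divide_right_mono) auto
    then show ?thesis by simp
  qed
  have 3: "2 * Cb * norm e * (\<l> * norm xd)
      \<le> 2 * Cb * norm e * (\<l> * (LF * (s / sqrt c) + nB * (Lh * norm e)))"
    using Cb(1) \<l>_nonneg nxd by (intro mult_left_mono) auto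
  let ?a = "cross_rate c \<zeta> LF"
  have 4: "sqrt \<zeta> * s * (Lh * norm e) + 2 * Cb * norm e * (\<l> * (LF * (s / sqrt c) + nB * (Lh * norm e)))
      = ?a * s * norm e + self_rate * (norm e)\<^sup>2"
    by (simp add: cross_rate_def self_rate_def algebra_simps power2_eq_square)
  \<comment> \<open>Young's inequality spends half of the plant dissipation; the other half still
    dominates \<open>c / 2\<close> times the squared norm of \<open>x\<close>.\<close>
  have 5: "?a * s * norm e \<le> s\<^sup>2 / 2 + ?a\<^sup>2 / 2 * (norm e)\<^sup>2"
    using zero_le_power2[of "s - ?a * norm e"] by (simp add: power2_diff power_mult_distrib mult_ac)
  have 6: "c0 / \<epsilon> \<ge> self_rate + ?a\<^sup>2 / 2 + 1"
  proof -
    have "self_rate \<ge> 0" using Cb(1) \<l>_nonneg nB(1) Lh by (simp add: self_rate_def)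
    then have pos: "self_rate + ?a\<^sup>2 / 2 + 1 > 0" by (simp add: add_nonneg_pos)
    have "\<epsilon> * (self_rate + ?a\<^sup>2 / 2 + 1) < c0"
      using \<epsilon>(2) pos unfolding eps_bound_def by (simp add: pos_less_divide_eq)
    then show ?thesis using \<epsilon>(1) by (simp add: pos_le_divide_eq mult.commute)
  qed
  have 7: "(self_rate + ?a\<^sup>2 / 2 + 1) * (norm e)\<^sup>2 \<le> (c0 / \<epsilon>) * (norm e)\<^sup>2"
    using 6 by (intro mult_right_mono) auto
  have 8: "c / 2 * (norm x)\<^sup>2 \<le> s\<^sup>2 / 2" using D(10)[OF x] s by simp
  show ?thesis using 1 2 3 4 5 7 8 by (simp add: algebra_simps)
qed

lemma W_decay:
  assumes lyap: "plant_lyapunov \<delta> f V g r1 rp c \<zeta> LF" and \<epsilon>: "0 < \<epsilon>" "\<epsilon> < eps_bound c \<zeta> LF"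
    and z: "mild \<epsilon> f {0..<\<tau>} z0 z" and st: "0 \<le> s" "s \<le> t" "t < \<tau>"
    and x: "\<And>r. r \<in> {s..t} \<Longrightarrow> ereal (norm (fst (z r))) < \<delta>"
  shows "W V (z t) \<le> W V (z s) - integral {s..t} (\<lambda>r. c / 2 * (norm (fst (z r)))\<^sup>2 + (norm (snd (z r) - ws (fst (z r))))\<^sup>2)"
proof -
  note D = plant_lyapunovD[OF lyap]
  let ?N = "\<lambda>r. c / 2 * (norm (fst (z r)))\<^sup>2 + (norm (snd (z r) - ws (fst (z r))))\<^sup>2"
  have zc: "continuous_on {s..t} z" by (rule continuous_on_subset[OF mildD(1)[OF \<epsilon>(1) z]]) (use st in auto)
  have ec: "continuous_on {s..t} (\<lambda>r. snd (z r) - ws (fst (z r)))"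
    by (intro continuous_intros zc continuous_on_compose2[OF continuous_ws[of UNIV]]) auto
  have Vc: "continuous_on {s..t} (\<lambda>r. V (fst (z r)))"
  proof (rule continuous_on_compose2[of "(\<lambda>r. fst (z r)) ` {s..t}"])
    show "continuous_on ((\<lambda>r. fst (z r)) ` {s..t}) V"
      by (intro continuous_at_imp_continuous_on ballI) (auto intro!: has_derivative_continuous[OF D(8)] x)
  qed (auto intro!: continuous_intros zc)
  have "W V (z t) \<le> W V (z s) + integral {s..t} (\<lambda>r. - ?N r)"
  proof (rule right_dini_le_integral[OF st(2)])
    show "continuous_on {s..t} (\<lambda>r. W V (z r))"
      unfolding W_def by (intro continuous_on_add Vc b.continuous_on ec)
    show "continuous_on {s..t} (\<lambda>r. - ?N r)" by (intro continuous_intros ec zc)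
    fix r e' :: real assume r: "r \<in> {s..<t}" and e': "e' > 0"
    have r': "r \<in> {0..<\<tau>}" using r st by auto
    have xr: "ereal (norm (fst (z r))) < \<delta>" using r by (intro x) auto
    have Pr: "P (snd (z r)) = snd (z r)" by (rule mildD(2)[OF \<epsilon>(1) z r'])
    note dini = W_right_dini[OF \<epsilon>(1) z r' D(1) D(8)[OF xr] e']
    note rate = W_rate_bound[OF lyap \<epsilon> xr Pr]
    show "\<forall>\<^sub>F h in at_right 0. W V (z (r + h)) \<le> W V (z r) + (- ?N r + e') * h"
      using dini eventually_at_right_less[of 0]
    proof eventually_elim
      case (elim h)
      have "(g (fst (z r)) \<bullet> (f (fst (z r)) + B (out (snd (z r))))
        + (q (snd (z r) - ws (fst (z r))) - 2 * b (snd (z r) - ws (fst (z r))) (R0 (snd (z r)) - R0 (ws (fst (z r))))) / \<epsilon>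
        + 2 * Cb * norm (snd (z r) - ws (fst (z r))) * (\<l> * norm (f (fst (z r)) + B (out (snd (z r))))) + e') * h
        \<le> (- ?N r + e') * h"
        using rate elim(2) by (intro mult_right_mono) auto
      then show ?case using elim(1) by linarith
    qed
  qed
  then show ?thesis unfolding Henstock_Kurzweil_Integration.integral_neg by linarith
qed

lemma W_antimono:
  assumes lyap: "plant_lyapunov \<delta> f V g r1 rp c \<zeta> LF" and \<epsilon>: "0 < \<epsilon>" "\<epsilon> < eps_bound c \<zeta> LF"
    and z: "mild \<epsilon> f {0..<\<tau>} z0 z" and st: "0 \<le> s" "s \<le> t" "t < \<tau>"
    and x: "\<And>r. r \<in> {s..t} \<Longrightarrow> ereal (norm (fst (z r))) < \<delta>"
  shows "W V (z t) \<le> W V (z s)"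
proof -
  \<comment> \<open>A non-integrable integrand has integral 0, so nonnegativity holds in either
    case.\<close>
  have "0 \<le> integral {s..t} (\<lambda>r. c / 2 * (norm (fst (z r)))\<^sup>2 + (norm (snd (z r) - ws (fst (z r))))\<^sup>2)"
    using plant_lyapunovD(2)[OF lyap]
    by (cases "(\<lambda>r. c / 2 * (norm (fst (z r)))\<^sup>2 + (norm (snd (z r) - ws (fst (z r))))\<^sup>2) integrable_on {s..t}")
      (auto intro!: integral_nonneg simp: not_integrable_integral)
  then show ?thesis using W_decay[OF assms] by linarith
qed

lemma r1_pos:
  assumes lyap: "plant_lyapunov \<delta> f V g r1 rp c \<zeta> LF" and "0 < s" "ereal s < \<delta>"
  shows "r1 s > 0"
proof -
  have "ereal 0 < \<delta>" using assms(2,3) by (meson ereal_less_eq(3) less_imp_le order_le_less_trans)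
  then show ?thesis
    using strict_mono_onD[OF plant_lyapunovD(7)[OF lyap], of 0 s] assms plant_lyapunovD(6)[OF lyap] by simp
qed

lemma W_lower:
  assumes lyap: "plant_lyapunov \<delta> f V g r1 rp c \<zeta> LF" and x: "ereal (norm (fst z)) < \<delta>"
  shows "r1 (norm (fst z)) \<le> W V z" "(norm (snd z - ws (fst z)))\<^sup>2 \<le> 4 * W V z" "W V z \<ge> 0"
proof -
  have r0: "r1 (norm (fst z)) \<ge> 0"
    using r1_pos[OF lyap _ x] plant_lyapunovD(6)[OF lyap] by (cases "fst z = 0") (auto intro: less_imp_le)
  define \<beta> where "\<beta> = b (snd z - ws (fst z)) (snd z - ws (fst z))"
  have b0: "(norm (snd z - ws (fst z)))\<^sup>2 \<le> 4 * \<beta>" unfolding \<beta>_def by (rule b_lower)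
  then have b1: "\<beta> \<ge> 0" using zero_le_power2[of "norm (snd z - ws (fst z))"] by linarith
  have W: "W V z = V (fst z) + \<beta>" by (simp add: W_def \<beta>_def)
  show "r1 (norm (fst z)) \<le> W V z" "(norm (snd z - ws (fst z)))\<^sup>2 \<le> 4 * W V z" "W V z \<ge> 0"
    unfolding W using plant_lyapunovD(9)[OF lyap x] r0 b0 b1 by simp_all
qed

text \<open>At the first time with plant norm \<open>\<rho>\<close> the value of \<open>W\<close>
  would be at least \<open>r1 \<rho>\<close>, although \<open>W\<close> has not increased since the
  start, where it was smaller.\<close>

lemma trapped:
  assumes lyap: "plant_lyapunov \<delta> f V g r1 rp c \<zeta> LF" and \<epsilon>: "0 < \<epsilon>" "\<epsilon> < eps_bound c \<zeta> LF"
    and z: "mild \<epsilon> f {0..<\<tau>} z0 z" and \<rho>: "0 < \<rho>" "ereal \<rho> < \<delta>"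
    and init: "norm (fst (z 0)) < \<rho>" "W V (z 0) < r1 \<rho>" and t: "t \<in> {0..<\<tau>}"
  shows "norm (fst (z t)) < \<rho>"
proof (rule ccontr)
  assume bad: "\<not> norm (fst (z t)) < \<rho>"
  have zc: "continuous_on {0..t} (\<lambda>r. norm (fst (z r)))"
    by (intro continuous_intros continuous_on_subset[OF mildD(1)[OF \<epsilon>(1) z]]) (use t in auto)
  \<comment> \<open>The infimum of this closed set is the first exit time. Up to and including it
    the plant state is still in the region where \<open>W\<close> decreases, because
    \<open>\<rho>\<close> lies strictly below \<open>\<delta>\<close>.\<close>
  define S where "S = {r \<in> {0..t}. \<rho> \<le> norm (fst (z r))}"
  have "closed S"
  proof -
    have "S = {0..t} \<inter> (\<lambda>r. norm (fst (z r))) -` {\<rho>..}" by (auto simp: S_def)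
    then show ?thesis by (simp add: continuous_closed_preimage[OF zc])
  qed
  have "t \<in> S" using bad t by (auto simp: S_def)
  have bdd: "bdd_below S" by (rule bdd_belowI[of _ 0]) (auto simp: S_def)
  define s where "s = Inf S"
  have sS: "s \<in> S" unfolding s_def using \<open>t \<in> S\<close> bdd \<open>closed S\<close> by (intro closed_contains_Inf) auto
  have below: "norm (fst (z r)) < \<rho>" if "0 \<le> r" "r < s" for r
  proof (rule ccontr)
    assume "\<not> norm (fst (z r)) < \<rho>"
    then have "r \<in> S" using that sS by (auto simp: S_def)
    then have "s \<le> r" unfolding s_def using bdd by (rule cInf_lower)
    then show False using that by simp
  qed
  have s: "0 \<le> s" "s \<le> t" "\<rho> \<le> norm (fst (z s))" using sS by (auto simp: S_def)
  have "s \<noteq> 0" using s init by auto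
  then have "0 < s" using s by simp
  have at_s: "norm (fst (z s)) \<le> \<rho>"
  proof (rule tendsto_upperbound)
    have "continuous_on {0..s} (\<lambda>r. norm (fst (z r)))" by (rule continuous_on_subset[OF zc]) (use s in auto)
    then show "((\<lambda>r. norm (fst (z r))) \<longlongrightarrow> norm (fst (z s))) (at_left s)"
      using \<open>0 < s\<close> by (rule continuous_on_Icc_at_leftD)
    show "\<forall>\<^sub>F r in at_left s. norm (fst (z r)) \<le> \<rho>"
      using eventually_at_left_real[OF \<open>0 < s\<close>] by eventually_elim (use below in \<open>auto intro: less_imp_le\<close>)
  qed simp
  have in_reg: "ereal (norm (fst (z r))) < \<delta>" if "r \<in> {0..s}" for r
  proof -
    have "norm (fst (z r)) \<le> \<rho>" using below[of r] at_s that by (cases "r = s") auto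
    then show ?thesis using \<rho>(2) by (meson ereal_less_eq(3) order_le_less_trans)
  qed
  have "W V (z s) \<le> W V (z 0)"
    using s t by (intro W_antimono[OF lyap \<epsilon> z] in_reg) auto
  moreover have "r1 \<rho> \<le> W V (z s)"
    using W_lower(1)[OF lyap in_reg[of s]] s at_s by simp
  ultimately show False using init by simp
qed

lemma W_small:
  assumes lyap: "plant_lyapunov \<delta> f V g r1 rp c \<zeta> LF" and \<delta>: "\<delta> > 0" and \<eta>: "\<eta> > 0"
  obtains d where "d > 0" "\<And>z. norm (fst z) < d \<Longrightarrow> norm (snd z - ws (fst z)) < d \<Longrightarrow> W V z < \<eta>"
proof -
  have "(V has_derivative (\<lambda>k. g 0 \<bullet> k)) (at 0)"
    using plant_lyapunovD(8)[OF lyap, of 0] \<delta> by (simp add: zero_ereal_def)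
  then have "isCont V 0" by (rule has_derivative_continuous)
  then have "(V \<longlongrightarrow> 0) (at 0)" using plant_lyapunovD(5)[OF lyap] by (simp add: isCont_def)
  then have "\<forall>\<^sub>F x in at 0. V x < \<eta> / 2" using \<eta> by (intro order_tendstoD) auto
  then obtain d1 where d1: "d1 > 0" "\<And>x. x \<noteq> 0 \<Longrightarrow> norm x < d1 \<Longrightarrow> V x < \<eta> / 2"
    by (auto simp: eventually_at)
  define d where "d = min d1 (sqrt (\<eta> / 2))"
  show thesis
  proof (rule that)
    show "d > 0" using d1 \<eta> by (simp add: d_def)
    fix z assume z: "norm (fst z) < d" "norm (snd z - ws (fst z)) < d"
    have "V (fst z) < \<eta> / 2"
      using d1(2)[of "fst z"] z(1) plant_lyapunovD(5)[OF lyap] \<eta> by (cases "fst z = 0") (auto simp: d_def)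
    moreover have "b (snd z - ws (fst z)) (snd z - ws (fst z)) < \<eta> / 2"
    proof -
      have "norm (snd z - ws (fst z)) < sqrt (\<eta> / 2)" using z(2) by (simp add: d_def)
      then have "(norm (snd z - ws (fst z)))\<^sup>2 < (sqrt (\<eta> / 2))\<^sup>2" by (intro power_strict_mono) auto
      then show ?thesis using b_upper[of "snd z - ws (fst z)"] \<eta> by simp
    qed
    ultimately show "W V z < \<eta>" by (simp add: W_def)
  qed
qed

lemma norm_init_bounds:
  shows "norm (fst z) \<le> norm z" "norm (snd z - ws (fst z)) \<le> (1 + \<l>) * norm z"
proof -
  show 1: "norm (fst z) \<le> norm z" using norm_fst_le[of "fst z" "snd z"] by simp
  have 2: "norm (snd z) \<le> norm z" using norm_snd_le[of "snd z" "fst z"] by simp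
  have "norm (snd z - ws (fst z)) \<le> norm (snd z) + norm (ws (fst z))" by (rule norm_triangle_ineq4)
  also have "\<dots> \<le> norm z + \<l> * norm z"
    using 1 2 ws_lip[of "fst z" 0] mult_left_mono[OF 1 \<l>_nonneg] by (simp add: ws_zero)
  finally show "norm (snd z - ws (fst z)) \<le> (1 + \<l>) * norm z" by (simp add: algebra_simps)
qed

lemma norm_le_error: "norm z \<le> (1 + \<l>) * norm (fst z) + norm (snd z - ws (fst z))"
proof -
  have "norm z \<le> norm (fst z) + norm (snd z)" by (metis norm_Pair_le prod.collapse)
  also have "norm (snd z) \<le> norm (snd z - ws (fst z)) + \<l> * norm (fst z)" by (rule norm_snd_le_ws)
  finally show ?thesis by (simp add: algebra_simps)
qed

lemma mild_start:
  assumes "\<epsilon> > 0" "mild \<epsilon> f I z0 z" "0 \<in> I" "Psp z0 = z0"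
  shows "z 0 = z0"
proof -
  interpret SP: contraction_semigroup Psp "Tsp \<epsilon>" by (rule contraction_semigroup_Tsp[OF assms(1)])
  show ?thesis using SP.mild_on_start[OF assms(2,3)] assms(4) by simp
qed

lemma mild_subset:
  assumes "\<epsilon> > 0" "mild \<epsilon> f I z0 z" "I' \<subseteq> I"
  shows "mild \<epsilon> f I' z0 z"
proof -
  interpret SP: contraction_semigroup Psp "Tsp \<epsilon>" by (rule contraction_semigroup_Tsp[OF assms(1)])
  show ?thesis using SP.mild_on_subset[OF assms(2,3)] .
qed

lemma stable:
  assumes lyap: "plant_lyapunov \<delta> f V g r1 rp c \<zeta> LF" and \<epsilon>: "0 < \<epsilon>" "\<epsilon> < eps_bound c \<zeta> LF"
    and \<delta>: "\<delta> > 0" and \<eta>: "\<eta> > 0"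
  obtains d where "d > 0" "\<And>z0 \<tau> z t. Psp z0 = z0 \<Longrightarrow> norm z0 < d \<Longrightarrow> mild \<epsilon> f {0..<\<tau>} z0 z \<Longrightarrow>
      t \<in> {0..<\<tau>} \<Longrightarrow> norm (z t) < \<eta> \<and> ereal (norm (fst (z t))) < \<delta>"
proof -
  obtain \<rho>0 where \<rho>0: "0 < \<rho>0" "ereal \<rho>0 < \<delta>"
    using ereal_dense2[OF \<delta>] by (metis ereal_less(2) zero_ereal_def)
  \<comment> \<open>The plant part, including the shift of the stationary point with factor
    \<open>\<l>\<close>, may use half of \<open>\<eta>\<close>; the error uses the other
    half.\<close>
  define \<rho> where "\<rho> = min \<rho>0 (\<eta> / (2 * (1 + \<l>)))"
  have \<rho>: "0 < \<rho>" "ereal \<rho> < \<delta>"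
    using \<rho>0 \<eta> \<l>_nonneg by (auto simp: \<rho>_def intro: order_le_less_trans[of _ "ereal \<rho>0"])
  have \<rho>\<eta>: "(1 + \<l>) * \<rho> \<le> \<eta> / 2"
  proof -
    have "(1 + \<l>) * \<rho> \<le> (1 + \<l>) * (\<eta> / (2 * (1 + \<l>)))"
      using \<l>_nonneg by (intro mult_left_mono) (auto simp: \<rho>_def)
    also have "\<dots> = \<eta> / 2" using \<l>_nonneg by (simp add: field_simps)
    finally show ?thesis .
  qed
  \<comment> \<open>The first bound traps the plant state below \<open>\<rho>\<close>; the second
    keeps the error below \<open>\<eta> / 2\<close>, since the squared error is at most
    \<open>4 W\<close>.\<close>
  define m where "m = min (r1 \<rho>) ((\<eta> / 4)\<^sup>2)"
  have m: "m > 0" using r1_pos[OF lyap \<rho>] \<eta> by (simp add: m_def)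
  obtain d where d: "d > 0" "\<And>z. norm (fst z) < d \<Longrightarrow> norm (snd z - ws (fst z)) < d \<Longrightarrow> W V z < m"
    using W_small[OF lyap \<delta> m] by blast
  define d' where "d' = min \<rho> (d / (1 + \<l>))"
  show thesis
  proof (rule that)
    show "d' > 0" using \<rho> d \<l>_nonneg by (simp add: d'_def)
    fix z0 \<tau> z t assume z0: "Psp z0 = z0" "norm z0 < d'" and z: "mild \<epsilon> f {0..<\<tau>} z0 z" and t: "t \<in> {0..<\<tau>}"
    have st: "z 0 = z0" using t by (intro mild_start[OF \<epsilon>(1) z] z0) auto
    have n0: "(1 + \<l>) * norm z0 < d" using z0(2) \<l>_nonneg by (simp add: d'_def field_simps)
    have "norm z0 \<le> (1 + \<l>) * norm z0" using \<l>_nonneg by (simp add: algebra_simps)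
    then have W0: "W V (z 0) < m" unfolding st using norm_init_bounds[of z0] n0 by (intro d(2)) auto
    have x: "norm (fst (z r)) < \<rho>" if "r \<in> {0..<\<tau>}" for r
      by (rule trapped[OF lyap \<epsilon> z \<rho> _ _ that])
        (use W0 z0(2) norm_init_bounds(1)[of z0] in \<open>auto simp: st m_def d'_def\<close>)
    have reg: "ereal (norm (fst (z r))) < \<delta>" if "r \<in> {0..<\<tau>}" for r
      using x[OF that] \<rho>(2) by (meson ereal_less_eq(3) less_imp_le order_le_less_trans)
    have "W V (z t) \<le> W V (z 0)" using t by (intro W_antimono[OF lyap \<epsilon> z] reg) auto
    then have "(norm (snd (z t) - ws (fst (z t))))\<^sup>2 < 4 * (\<eta> / 4)\<^sup>2"
      using W_lower(2)[OF lyap reg[OF t]] W0 by (simp add: m_def)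
    then have "(norm (snd (z t) - ws (fst (z t))))\<^sup>2 < (\<eta> / 2)\<^sup>2" by (simp add: power2_eq_square)
    then have e: "norm (snd (z t) - ws (fst (z t))) < \<eta> / 2" by (rule power2_less_imp_less) (use \<eta> in simp)
    have "norm (z t) \<le> (1 + \<l>) * norm (fst (z t)) + norm (snd (z t) - ws (fst (z t)))" by (rule norm_le_error)
    also have "(1 + \<l>) * norm (fst (z t)) \<le> (1 + \<l>) * \<rho>" using x[OF t] \<l>_nonneg by (intro mult_left_mono) auto
    finally show "norm (z t) < \<eta> \<and> ereal (norm (fst (z t))) < \<delta>" using e \<rho>\<eta> reg[OF t] by simp
  qed
qed

text \<open>\<open>W\<close> is nonincreasing along the solution, so it suffices that it drops below
  every positive level once. Small \<open>W\<close> forces a small plant state through strict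
  monotonicity of \<open>r1\<close>, and a small error through the lower bound on
  \<open>b\<close>.\<close>

lemma convergent:
  assumes lyap: "plant_lyapunov \<delta> f V g r1 rp c \<zeta> LF" and \<epsilon>: "0 < \<epsilon>" "\<epsilon> < eps_bound c \<zeta> LF"
    and \<delta>: "\<delta> > 0" and z: "mild \<epsilon> f {0..} z0 z"
    and reg: "\<And>t. t \<ge> 0 \<Longrightarrow> ereal (norm (fst (z t))) < \<delta>"
  shows "(z \<longlongrightarrow> 0) at_top"
proof -
  let ?e = "\<lambda>r. snd (z r) - ws (fst (z r))"
  let ?N = "\<lambda>r. c / 2 * (norm (fst (z r)))\<^sup>2 + (norm (?e r))\<^sup>2"
  have z': "mild \<epsilon> f {0..<\<tau>} z0 z" for \<tau> by (rule mild_subset[OF \<epsilon>(1) z]) auto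
  have c: "c > 0" by (rule plant_lyapunovD(2)[OF lyap])
  have dec: "W V (z t) \<le> W V (z s)" if "0 \<le> s" "s \<le> t" for s t
    using that by (intro W_antimono[OF lyap \<epsilon> z'[of "t + 1"]] reg) auto
  \<comment> \<open>While \<open>W\<close> stays above \<open>\<eta>\<close> the solution avoids a
    neighbourhood of the origin, where the dissipation is at least some \<open>k > 0\<close>; the
    integrated decay would then push \<open>W\<close> below 0 in finite time.\<close>
  have small: "\<exists>t\<ge>0. W V (z t) < \<eta>" if \<eta>: "\<eta> > 0" for \<eta>
  proof (rule ccontr)
    assume "\<not> ?thesis"
    then have ge: "W V (z t) \<ge> \<eta>" if "t \<ge> 0" for t using that by force
    obtain d where d: "d > 0" "\<And>z. norm (fst z) < d \<Longrightarrow> norm (snd z - ws (fst z)) < d \<Longrightarrow> W V z < \<eta>"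
      using W_small[OF lyap \<delta> \<eta>] by blast
    define k where "k = min (c / 2) 1 * d\<^sup>2"
    have k: "k > 0" using c d by (simp add: k_def)
    have Nk: "k \<le> ?N r" if "r \<ge> 0" for r
    proof -
      have "d \<le> norm (fst (z r)) \<or> d \<le> norm (?e r)" using ge[OF that] d(2)[of "z r"] by force
      then show ?thesis
      proof
        assume "d \<le> norm (fst (z r))"
        then have "d\<^sup>2 \<le> (norm (fst (z r)))\<^sup>2" using d by (intro power_mono) auto
        then have "k \<le> c / 2 * (norm (fst (z r)))\<^sup>2" unfolding k_def using c by (intro mult_mono) auto
        then show ?thesis using zero_le_power2[of "norm (?e r)"] by linarith
      next
        assume "d \<le> norm (?e r)"
        then have "d\<^sup>2 \<le> (norm (?e r))\<^sup>2" using d by (intro power_mono) auto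
        then have "k \<le> 1 * (norm (?e r))\<^sup>2" unfolding k_def using c by (intro mult_mono) auto
        moreover have "0 \<le> c / 2 * (norm (fst (z r)))\<^sup>2" using c by simp
        ultimately show ?thesis by linarith
      qed
    qed
    have bound: "k * t \<le> W V (z 0)" if t: "t \<ge> 0" for t
    proof -
      have zc: "continuous_on {0..t} z" by (rule continuous_on_subset[OF mildD(1)[OF \<epsilon>(1) z]]) auto
      have "integral {0..t} (\<lambda>r. k) \<le> integral {0..t} ?N"
      proof (rule integral_le)
        show "?N integrable_on {0..t}"
          by (intro integrable_continuous_interval continuous_intros zc continuous_on_compose2[OF continuous_ws[of UNIV]]) auto
      qed (use Nk in auto)
      moreover have "W V (z t) \<le> W V (z 0) - integral {0..t} ?N"
        using t by (intro W_decay[OF lyap \<epsilon> z'[of "t + 1"]] reg) auto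
      moreover have "W V (z t) \<ge> 0" by (rule W_lower(3)[OF lyap reg[OF t]])
      ultimately show ?thesis using t by (simp add: mult.commute)
    qed
    have W0: "W V (z 0) \<ge> 0" using bound[of 0] by simp
    have "k * ((W V (z 0) + 1) / k) \<le> W V (z 0)" using k W0 by (intro bound) simp
    then show False using k by simp
  qed
  show ?thesis
  proof (rule tendstoI)
    fix \<eta> :: real assume \<eta>: "\<eta> > 0"
    obtain \<rho>0 where \<rho>0: "0 < \<rho>0" "ereal \<rho>0 < \<delta>"
      using ereal_dense2[OF \<delta>] by (metis ereal_less(2) zero_ereal_def)
    define \<rho> where "\<rho> = min \<rho>0 (\<eta> / (2 * (1 + \<l>)))"
    have \<rho>: "0 < \<rho>" "ereal \<rho> < \<delta>"
      using \<rho>0 \<eta> \<l>_nonneg by (auto simp: \<rho>_def intro: order_le_less_trans[of _ "ereal \<rho>0"])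
    have \<rho>\<eta>: "(1 + \<l>) * \<rho> \<le> \<eta> / 2"
    proof -
      have "(1 + \<l>) * \<rho> \<le> (1 + \<l>) * (\<eta> / (2 * (1 + \<l>)))"
        using \<l>_nonneg by (intro mult_left_mono) (auto simp: \<rho>_def)
      also have "\<dots> = \<eta> / 2" using \<l>_nonneg by (simp add: field_simps)
      finally show ?thesis .
    qed
    define m where "m = min (r1 \<rho>) ((\<eta> / 4)\<^sup>2)"
    have "m > 0" using r1_pos[OF lyap \<rho>] \<eta> by (simp add: m_def)
    then obtain t0 where t0: "t0 \<ge> 0" "W V (z t0) < m" using small by blast
    have "norm (z t) < \<eta>" if t: "t \<ge> t0" for t
    proof -
      have Wt: "W V (z t) < m" using dec[OF t0(1) t] t0(2) by simp
      have rt: "ereal (norm (fst (z t))) < \<delta>" using t t0 by (intro reg) simp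
      have x: "norm (fst (z t)) \<le> \<rho>"
      proof (rule ccontr)
        assume "\<not> norm (fst (z t)) \<le> \<rho>"
        then have "r1 \<rho> < r1 (norm (fst (z t)))"
          using \<rho> rt by (intro strict_mono_onD[OF plant_lyapunovD(7)[OF lyap]]) auto
        then show False using W_lower(1)[OF lyap rt] Wt by (simp add: m_def)
      qed
      have "(norm (?e t))\<^sup>2 < 4 * (\<eta> / 4)\<^sup>2" using W_lower(2)[OF lyap rt] Wt by (simp add: m_def)
      then have "(norm (?e t))\<^sup>2 < (\<eta> / 2)\<^sup>2" by (simp add: power2_eq_square)
      then have e: "norm (?e t) < \<eta> / 2" by (rule power2_less_imp_less) (use \<eta> in simp)
      have "norm (z t) \<le> (1 + \<l>) * norm (fst (z t)) + norm (?e t)" by (rule norm_le_error)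
      also have "(1 + \<l>) * norm (fst (z t)) \<le> (1 + \<l>) * \<rho>" using x \<l>_nonneg by (intro mult_left_mono) auto
      finally show ?thesis using e \<rho>\<eta> by simp
    qed
    then show "\<forall>\<^sub>F t in at_top. dist (z t) 0 < \<eta>"
      by (intro eventually_mono[OF eventually_ge_at_top[of t0]]) simp
  qed
qed

section \<open>Existence and uniqueness of mild solutions of the coupled system\<close>

lemma norm_fsp_diff_le:
  assumes \<epsilon>: "\<epsilon> > 0" and P: "P (snd z) = snd z" "P (snd y) = snd y"
    and f: "norm (f (fst z) - f (fst y)) \<le> K * norm (fst z - fst y)" and K: "K \<ge> 0"
  shows "norm (fsp f \<epsilon> z - fsp f \<epsilon> y) \<le> (K + nB * Lh + (LR + n\<iota>) / \<epsilon>) * norm (z - y)"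
proof -
  let ?n = "norm (z - y)"
  have n1: "norm (fst z - fst y) \<le> ?n" by (metis fst_diff norm_fst_le prod.collapse)
  have n2: "norm (snd z - snd y) \<le> ?n" by (metis snd_diff norm_snd_le prod.collapse)
  have "fsp f \<epsilon> z - fsp f \<epsilon> y = ((f (fst z) - f (fst y)) + B (out (snd z) - out (snd y)),
      - (1 / \<epsilon>) *\<^sub>R ((R0 (snd z) - R0 (snd y)) + \<iota> (fst z - fst y)))"
    by (simp add: fsp_def case_prod_beta B.diff \<iota>.diff algebra_simps)
  then have "norm (fsp f \<epsilon> z - fsp f \<epsilon> y) \<le> norm ((f (fst z) - f (fst y)) + B (out (snd z) - out (snd y)))
      + norm (- (1 / \<epsilon>) *\<^sub>R ((R0 (snd z) - R0 (snd y)) + \<iota> (fst z - fst y)))"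
    by (simp only: norm_Pair_le)
  also have "norm ((f (fst z) - f (fst y)) + B (out (snd z) - out (snd y))) \<le> K * ?n + Lh * ?n * nB"
  proof (intro order_trans[OF norm_triangle_ineq] add_mono)
    show "norm (f (fst z) - f (fst y)) \<le> K * ?n" using f mult_left_mono[OF n1 K] by linarith
    have "norm (out (snd z) - out (snd y)) \<le> Lh * ?n"
      using out_lip[of "snd z" "snd y"] mult_left_mono[OF n2 Lh] by linarith
    from mult_right_mono[OF this nB(1)] nB(2)[of "out (snd z) - out (snd y)"]
    show "norm (B (out (snd z) - out (snd y))) \<le> Lh * ?n * nB" by linarith
  qed
  also have "norm (- (1 / \<epsilon>) *\<^sub>R ((R0 (snd z) - R0 (snd y)) + \<iota> (fst z - fst y)))
      \<le> (1 / \<epsilon>) * (LR * ?n + ?n * n\<iota>)"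
  proof -
    have "norm ((R0 (snd z) - R0 (snd y)) + \<iota> (fst z - fst y)) \<le> LR * ?n + ?n * n\<iota>"
    proof (intro order_trans[OF norm_triangle_ineq] add_mono)
      show "norm (R0 (snd z) - R0 (snd y)) \<le> LR * ?n" using R0_lip[OF P] mult_left_mono[OF n2 LR] by linarith
      show "norm (\<iota> (fst z - fst y)) \<le> ?n * n\<iota>"
        using n\<iota>(2)[of "fst z - fst y"] mult_right_mono[OF n1 n\<iota>(1)] by linarith
    qed
    then have "(1 / \<epsilon>) * norm ((R0 (snd z) - R0 (snd y)) + \<iota> (fst z - fst y)) \<le> (1 / \<epsilon>) * (LR * ?n + ?n * n\<iota>)"
      using \<epsilon> by (intro mult_left_mono) auto
    then show ?thesis using \<epsilon> by simp
  qed
  finally show ?thesis using \<epsilon> by (simp add: algebra_simps add_divide_distrib)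
qed

text \<open>\<open>R0\<close> is Lipschitz on the range of \<open>P\<close> only, so the equation is
  solved with the nonlinearity precomposed with \<open>Psp\<close>; its solution lies in the range
  of \<open>Psp\<close>, where the two nonlinearities agree.\<close>

lemma mild_exists:
  assumes \<epsilon>: "\<epsilon> > 0" and f: "K-lipschitz_on UNIV f"
  obtains z where "mild \<epsilon> f {0..} z0 z"
proof -
  interpret SP: contraction_semigroup Psp "Tsp \<epsilon>" by (rule contraction_semigroup_Tsp[OF \<epsilon>])
  have K: "K \<ge> 0" by (rule lipschitz_on_nonneg[OF f])
  have lip: "norm (fsp f \<epsilon> (Psp x) - fsp f \<epsilon> (Psp y)) \<le> (K + nB * Lh + (LR + n\<iota>) / \<epsilon>) * norm (x - y)" for x y
  proof -
    have P: "P (snd (Psp x)) = snd (Psp x)" for x :: "'x \<times> 'w" using SP.idem[of x] by (simp add: Psp_iff)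
    have "norm (fsp f \<epsilon> (Psp x) - fsp f \<epsilon> (Psp y)) \<le> (K + nB * Lh + (LR + n\<iota>) / \<epsilon>) * norm (Psp x - Psp y)"
      using lipschitz_onD[OF f, of "fst (Psp x)" "fst (Psp y)"]
      by (intro norm_fsp_diff_le \<epsilon> P K) (simp add: dist_norm)
    also have "\<dots> \<le> (K + nB * Lh + (LR + n\<iota>) / \<epsilon>) * norm (x - y)"
    proof (rule mult_left_mono)
      have "norm (Psp (x - y)) \<le> norm (x - y)"
        by (cases "x - y") (auto simp: Psp_def norm_Pair intro!: add_mono power_mono P_contr)
      then show "norm (Psp x - Psp y) \<le> norm (x - y)" by (simp add: SP.diff)
      show "0 \<le> K + nB * Lh + (LR + n\<iota>) / \<epsilon>" using K nB(1) Lh LR n\<iota>(1) \<epsilon> by simp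
    qed
    finally show ?thesis .
  qed
  obtain z where z: "SP.mild_on (\<lambda>z. fsp f \<epsilon> (Psp z)) {0..} z0 z" using SP.mild_on_exists[OF lip] by blast
  have "SP.mild_on (fsp f \<epsilon>) {0..} z0 z"
    unfolding SP.mild_on_def
  proof (intro conjI ballI)
    show "continuous_on {0..} z" using z by (simp add: SP.mild_on_def)
    fix t :: real assume t: "t \<in> {0..}"
    show "Psp (z t) = z t" using z t by (simp add: SP.mild_on_def)
    have "((\<lambda>s. Tsp \<epsilon> (t - s) (fsp f \<epsilon> (Psp (z s)))) has_integral z t - Tsp \<epsilon> t z0) {0..t}"
      using z t by (simp add: SP.mild_on_def)
    moreover have "Psp (z s) = z s" if "s \<in> {0..t}" for s using z that by (simp add: SP.mild_on_def)
    ultimately show "((\<lambda>s. Tsp \<epsilon> (t - s) (fsp f \<epsilon> (z s))) has_integral z t - Tsp \<epsilon> t z0) {0..t}"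
      by (subst has_integral_cong[where g = "\<lambda>s. Tsp \<epsilon> (t - s) (fsp f \<epsilon> (Psp (z s)))"]) auto
  qed
  then show thesis by (rule that)
qed

text \<open>On a compact time interval both plant components are bounded, and a Lipschitz constant
  of \<open>f\<close> on one ball containing them serves along both solutions.\<close>

lemma mild_unique:
  assumes \<epsilon>: "\<epsilon> > 0" and f: "\<And>r. \<exists>K. K-lipschitz_on (cball 0 r) f"
    and z: "mild \<epsilon> f {0..} z0 z" and y: "mild \<epsilon> f {0..} z0 y" and t: "t \<ge> 0"
  shows "z t = y t"
proof -
  interpret SP: contraction_semigroup Psp "Tsp \<epsilon>" by (rule contraction_semigroup_Tsp[OF \<epsilon>])
  have bd: "bounded ((\<lambda>s. fst (u s)) ` {0..t})" if u: "mild \<epsilon> f {0..} z0 u" for u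
    by (intro compact_imp_bounded compact_continuous_image continuous_on_fst
        continuous_on_subset[OF mildD(1)[OF \<epsilon> u]]) auto
  obtain r1 where r1: "\<forall>x\<in>(\<lambda>s. fst (z s)) ` {0..t}. norm x \<le> r1" using bd[OF z] unfolding bounded_iff by blast
  obtain r2 where r2: "\<forall>x\<in>(\<lambda>s. fst (y s)) ` {0..t}. norm x \<le> r2" using bd[OF y] unfolding bounded_iff by blast
  obtain K where K: "K-lipschitz_on (cball 0 (max r1 r2)) f" using f by blast
  have K0: "K \<ge> 0" by (rule lipschitz_on_nonneg[OF K])
  show ?thesis
  proof (rule SP.mild_on_unique[where \<tau> = t and K = "K + nB * Lh + (LR + n\<iota>) / \<epsilon>"])
    show "SP.mild_on (fsp f \<epsilon>) {0..t} z0 z" "SP.mild_on (fsp f \<epsilon>) {0..t} z0 y"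
      using SP.mild_on_subset[OF z, of "{0..t}"] SP.mild_on_subset[OF y, of "{0..t}"] by auto
    show "norm (fsp f \<epsilon> (z s) - fsp f \<epsilon> (y s)) \<le> (K + nB * Lh + (LR + n\<iota>) / \<epsilon>) * norm (z s - y s)"
      if s: "s \<in> {0..t}" for s
    proof (rule norm_fsp_diff_le[OF \<epsilon> _ _ _ K0])
      have "norm (fst (z s)) \<le> max r1 r2" "norm (fst (y s)) \<le> max r1 r2" using r1 r2 s by force+
      then show "norm (f (fst (z s)) - f (fst (y s))) \<le> K * norm (fst (z s) - fst (y s))"
        using lipschitz_onD[OF K, of "fst (z s)" "fst (y s)"] by (simp add: dist_norm)
    qed (use s in \<open>auto intro: mildD(2)[OF \<epsilon> z] mildD(2)[OF \<epsilon> y]\<close>)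
    show "0 \<le> K + nB * Lh + (LR + n\<iota>) / \<epsilon>" using K0 nB(1) Lh LR n\<iota>(1) \<epsilon> by simp
  qed (use t in auto)
qed

end

section \<open>The optimal control problem\<close>

text \<open>The variational inequality makes the squared distance grow by at least the squared norm
  of \<open>y - c\<close>, so \<open>c\<close> is the only minimiser and the definite description in
  \<open>orth_proj\<close> is met.\<close>

lemma orth_proj_eqI:
  fixes a c :: "'a::real_inner"
  assumes c: "c \<in> S" and vi: "\<And>y. y \<in> S \<Longrightarrow> (a - c) \<bullet> (y - c) \<le> 0"
  shows "orth_proj S a = c"
proof -
  have sq: "(dist a y)\<^sup>2 \<ge> (dist a c)\<^sup>2 + (norm (y - c))\<^sup>2" if "y \<in> S" for y
  proof -
    have "(dist a y)\<^sup>2 = (norm ((a - c) - (y - c)))\<^sup>2" by (simp add: dist_norm)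
    also have "\<dots> = (norm (a - c))\<^sup>2 - 2 * ((a - c) \<bullet> (y - c)) + (norm (y - c))\<^sup>2"
      by (simp only: power2_norm_eq_inner inner_diff_left inner_diff_right) (simp add: inner_commute)
    finally show ?thesis using vi[OF that] by (simp add: dist_norm)
  qed
  show ?thesis
    unfolding orth_proj_def
  proof (rule the_equality)
    show "c \<in> S \<and> (\<forall>y\<in>S. dist a c \<le> dist a y)"
    proof (intro conjI ballI c)
      fix y assume "y \<in> S"
      then have "(dist a c)\<^sup>2 \<le> (dist a y)\<^sup>2" using sq[of y] zero_le_power2[of "norm (y - c)"] by linarith
      then show "dist a c \<le> dist a y" by (rule power2_le_imp_le) simp
    qed
    fix x assume x: "x \<in> S \<and> (\<forall>y\<in>S. dist a x \<le> dist a y)"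
    then have "(dist a x)\<^sup>2 \<le> (dist a c)\<^sup>2" using c by (intro power_mono) auto
    then have "(norm (x - c))\<^sup>2 \<le> 0" using sq[of x] x by linarith
    then show "x = c" by simp
  qed
qed

locale ocp_problem =
  fixes tf \<alpha> \<mu> L :: real and A :: "real^'n^'n" and Bp :: "real^'m^'n" and lo hi :: "real^'m"
    and l :: "real^'n \<Rightarrow> real" and gradJ :: "(real^'n) L2 \<Rightarrow> (real^'n) L2"
  assumes tf: "tf > 0" and \<alpha>: "\<alpha> > 0" and box: "\<And>i. lo $ i < 0 \<and> 0 < hi $ i"
    and l_cont: "continuous_on UNIV l" and l_nonneg: "\<And>x. l x \<ge> 0" and l_zero: "l 0 = 0"
    and gradJ_in: "\<And>x. x \<in> L2_on tf \<Longrightarrow> gradJ x \<in> L2_on tf"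
    and J_grad: "\<And>x. x \<in> L2_on tf \<Longrightarrow>
          (running_cost tf l has_derivative (\<lambda>h. gradJ x \<bullet> h)) (at x within L2_on tf)"
    and \<mu>: "\<mu> > 0" and L: "L > 0"
    and J_lower: "\<And>x y. x \<in> L2_on tf \<Longrightarrow> y \<in> L2_on tf \<Longrightarrow>
          \<mu> * (norm (x - y))\<^sup>2 \<le> (gradJ x - gradJ y) \<bullet> (x - y)"
    and J_upper: "\<And>x y. x \<in> L2_on tf \<Longrightarrow> y \<in> L2_on tf \<Longrightarrow>
          (gradJ x - gradJ y) \<bullet> (x - y) \<le> L * (norm (x - y))\<^sup>2"
begin

abbreviation J :: "(real^'n) L2 \<Rightarrow> real" where "J \<equiv> running_cost tf l"

lemma L2_on_line: "x \<in> L2_on tf \<Longrightarrow> d \<in> L2_on tf \<Longrightarrow> x + s *\<^sub>R d \<in> L2_on tf"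
  by (intro subspace_add[OF L2_on_subspace] subspace_scale[OF L2_on_subspace])

lemma J_mean_value:
  assumes x: "x \<in> L2_on tf" and d: "d \<in> L2_on tf"
  obtains s where "0 < s" "s < 1" "J (x + d) - J x = gradJ (x + s *\<^sub>R d) \<bullet> d"
proof -
  have der: "((\<lambda>s. J (x + s *\<^sub>R d)) has_real_derivative gradJ (x + s *\<^sub>R d) \<bullet> d) (at s)" for s
  proof -
    have 1: "((\<lambda>s. x + s *\<^sub>R d) has_derivative (\<lambda>h. h *\<^sub>R d)) (at s)"
      by (auto intro!: derivative_eq_intros)
    have 2: "(J has_derivative (\<lambda>h. gradJ (x + s *\<^sub>R d) \<bullet> h)) (at (x + s *\<^sub>R d) within (\<lambda>s. x + s *\<^sub>R d) ` UNIV)"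
      using J_grad[OF L2_on_line[OF x d, of s]] by (rule has_derivative_subset) (use L2_on_line[OF x d] in auto)
    have "((\<lambda>s. J (x + s *\<^sub>R d)) has_derivative (\<lambda>h. gradJ (x + s *\<^sub>R d) \<bullet> (h *\<^sub>R d))) (at s)"
      by (rule has_derivative_in_compose[OF 1 2])
    moreover have "(\<lambda>h. gradJ (x + s *\<^sub>R d) \<bullet> (h *\<^sub>R d)) = (*) (gradJ (x + s *\<^sub>R d) \<bullet> d)"
      by (simp add: fun_eq_iff mult.commute)
    ultimately show ?thesis by (simp add: has_field_derivative_def)
  qed
  obtain s where "0 < s" "s < 1" "J (x + 1 *\<^sub>R d) - J (x + 0 *\<^sub>R d) = (1 - 0) * (gradJ (x + s *\<^sub>R d) \<bullet> d)"
    using MVT2[of 0 1 "\<lambda>s. J (x + s *\<^sub>R d)" "\<lambda>s. gradJ (x + s *\<^sub>R d) \<bullet> d"] der by auto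
  then show thesis by (intro that[of s]) auto
qed

text \<open>At the intermediate point of the mean value theorem both gradient bounds refer to the
  increment \<open>s *\<^sub>R (y - x)\<close>; the positive factor \<open>s\<close> is cancelled,
  and the one left over in the upper bound is estimated by 1.\<close>

lemma J_bounds:
  assumes x: "x \<in> L2_on tf" and y: "y \<in> L2_on tf"
  shows "J y \<ge> J x + gradJ x \<bullet> (y - x)" "J y \<le> J x + gradJ x \<bullet> (y - x) + L * (norm (y - x))\<^sup>2"
proof -
  let ?d = "y - x"
  have d: "?d \<in> L2_on tf" by (rule subspace_diff[OF L2_on_subspace y x])
  obtain s where s: "0 < s" "s < 1" "J (x + ?d) - J x = gradJ (x + s *\<^sub>R ?d) \<bullet> ?d"
    using J_mean_value[OF x d] .
  have xs: "x + s *\<^sub>R ?d \<in> L2_on tf" by (rule L2_on_line[OF x d])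
  have lo: "0 \<le> s * ((gradJ (x + s *\<^sub>R ?d) - gradJ x) \<bullet> ?d)"
  proof -
    have "0 \<le> \<mu> * (norm (s *\<^sub>R ?d))\<^sup>2" using \<mu> by simp
    then show ?thesis using J_lower[OF xs x] by simp
  qed
  have up: "s * ((gradJ (x + s *\<^sub>R ?d) - gradJ x) \<bullet> ?d) \<le> s * (L * s * (norm ?d)\<^sup>2)"
    using J_upper[OF xs x] by (simp add: power_mult_distrib power2_eq_square mult_ac)
  have "0 \<le> (gradJ (x + s *\<^sub>R ?d) - gradJ x) \<bullet> ?d" using lo s by (simp add: zero_le_mult_iff)
  then show "J y \<ge> J x + gradJ x \<bullet> (y - x)" using s(3) by (simp add: inner_diff_left)
  have "(gradJ (x + s *\<^sub>R ?d) - gradJ x) \<bullet> ?d \<le> L * s * (norm ?d)\<^sup>2"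
    using up s(1) by (simp add: mult_le_cancel_left_pos)
  also have "\<dots> \<le> L * 1 * (norm ?d)\<^sup>2" using s L by (intro mult_right_mono mult_left_mono) auto
  finally show "J y \<le> J x + gradJ x \<bullet> (y - x) + L * (norm (y - x))\<^sup>2" using s(3) by (simp add: inner_diff_left)
qed

text \<open>Baillon--Haddad; the mean value form of the descent inequality costs a factor two.\<close>

lemma gradJ_cocoercive:
  assumes x: "x \<in> L2_on tf" and y: "y \<in> L2_on tf"
  shows "(norm (gradJ y - gradJ x))\<^sup>2 \<le> 2 * L * ((gradJ y - gradJ x) \<bullet> (y - x))"
proof -
  have half: "(norm (gradJ y - gradJ x))\<^sup>2 / (4 * L) \<le> J y - J x - gradJ x \<bullet> (y - x)"
    if x: "x \<in> L2_on tf" and y: "y \<in> L2_on tf" for x y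
  proof -
    let ?h = "gradJ y - gradJ x"
    \<comment> \<open>The step maximises \<open>s - L s^2\<close>, the gain of a gradient step from
      \<open>y\<close> along the gradient difference; the maximum is
      \<open>1 / (4 L)\<close>.\<close>
    define s where "s = 1 / (2 * L)"
    define z where "z = y - s *\<^sub>R ?h"
    have h: "?h \<in> L2_on tf" by (intro subspace_diff[OF L2_on_subspace] gradJ_in x y)
    have z: "z \<in> L2_on tf" unfolding z_def by (intro subspace_diff[OF L2_on_subspace] subspace_scale[OF L2_on_subspace] y h)
    have "J x + gradJ x \<bullet> (z - x) \<le> J z" by (rule J_bounds(1)[OF x z])
    also have "J z \<le> J y + gradJ y \<bullet> (z - y) + L * (norm (z - y))\<^sup>2" by (rule J_bounds(2)[OF y z])
    finally have "J x + gradJ x \<bullet> (z - x) \<le> J y + gradJ y \<bullet> (z - y) + L * (norm (z - y))\<^sup>2" .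
    moreover have "z - y = - (s *\<^sub>R ?h)" by (simp add: z_def)
    moreover have "gradJ x \<bullet> (z - x) = gradJ x \<bullet> (y - x) - s * (gradJ x \<bullet> ?h)"
      by (simp add: z_def inner_diff_right)
    ultimately have "J x + gradJ x \<bullet> (y - x) - s * (gradJ x \<bullet> ?h)
        \<le> J y - s * (gradJ y \<bullet> ?h) + L * (s * norm ?h)\<^sup>2"
      using L by (simp add: s_def)
    moreover have "s * (gradJ y \<bullet> ?h) - s * (gradJ x \<bullet> ?h) = s * (norm ?h)\<^sup>2"
      by (simp add: power2_norm_eq_inner inner_diff_left flip: right_diff_distrib)
    moreover have "L * (s * norm ?h)\<^sup>2 = (norm ?h)\<^sup>2 / (4 * L)"
      using L by (simp add: s_def power2_eq_square field_simps)
    moreover have "s * (norm ?h)\<^sup>2 = 2 * ((norm ?h)\<^sup>2 / (4 * L))" using L by (simp add: s_def)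
    ultimately show ?thesis by linarith
  qed
  have "(norm (gradJ y - gradJ x))\<^sup>2 / (4 * L) + (norm (gradJ x - gradJ y))\<^sup>2 / (4 * L)
      \<le> (gradJ y - gradJ x) \<bullet> (y - x)"
    using half[OF x y] half[OF y x] by (simp add: inner_diff_left inner_diff_right)
  then have "(norm (gradJ y - gradJ x))\<^sup>2 / (2 * L) \<le> (gradJ y - gradJ x) \<bullet> (y - x)"
    by (simp add: norm_minus_commute)
  then show ?thesis using L by (simp add: pos_divide_le_eq mult.commute)
qed

lemma gradJ_lip:
  assumes x: "x \<in> L2_on tf" and y: "y \<in> L2_on tf"
  shows "norm (gradJ y - gradJ x) \<le> 2 * L * norm (y - x)"
proof -
  let ?h = "norm (gradJ y - gradJ x)"
  have "?h * ?h \<le> 2 * L * (?h * norm (y - x))"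
    using gradJ_cocoercive[OF x y] mult_left_mono[OF norm_cauchy_schwarz[of "gradJ y - gradJ x" "y - x"], of "2 * L"] L
    unfolding power2_eq_square by linarith
  then have "?h * ?h \<le> ?h * (2 * L * norm (y - x))" by (simp add: mult_ac)
  then show ?thesis using L by (cases "?h = 0") (auto simp: mult_le_cancel_left)
qed

lemma J_zero: "J 0 = 0"
proof -
  have "J 0 = (\<integral>t. indicator {0..tf} t *\<^sub>R l (L2_fun 0 t) \<partial>lborel)"
    by (simp add: running_cost_def set_lebesgue_integral_def)
  also have "\<dots> = (\<integral>t. 0 \<partial>(lborel :: real measure))"
  proof (rule integral_cong_AE)
    have [measurable]: "l \<in> borel_measurable borel" using l_cont by (rule borel_measurable_continuous_onI)
    show "(\<lambda>t. indicator {0..tf} t *\<^sub>R l (L2_fun 0 t)) \<in> borel_measurable lborel" by measurable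
    show "AE t in lborel. indicator {0..tf} t *\<^sub>R l (L2_fun 0 t) = 0"
      using L2_fun_zero[where 'a="real^'n"] by eventually_elim (simp add: l_zero)
  qed simp
  finally show ?thesis by simp
qed

lemma J_nonneg: "J x \<ge> 0"
  unfolding running_cost_def set_lebesgue_integral_def by (rule Bochner_Integration.integral_nonneg) (simp add: l_nonneg)

text \<open>Since \<open>l\<close> is nonnegative with \<open>l 0 = 0\<close>, the origin minimises
  \<open>J\<close>; a nonzero gradient there would let a short gradient step make \<open>J\<close>
  negative.\<close>

lemma gradJ_zero: "gradJ 0 = 0"
proof -
  have z: "(0 :: (real^'n) L2) \<in> L2_on tf" by (rule subspace_0[OF L2_on_subspace])
  define s where "s = 1 / (2 * L)"
  let ?y = "- s *\<^sub>R gradJ 0"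
  have y: "?y \<in> L2_on tf" by (intro subspace_scale[OF L2_on_subspace] gradJ_in z)
  have "0 \<le> J ?y" by (rule J_nonneg)
  also have "\<dots> \<le> J 0 + gradJ 0 \<bullet> (?y - 0) + L * (norm (?y - 0))\<^sup>2" by (rule J_bounds(2)[OF z y])
  also have "\<dots> = - s * (norm (gradJ 0))\<^sup>2 + L * s\<^sup>2 * (norm (gradJ 0))\<^sup>2"
    by (simp add: J_zero power2_norm_eq_inner[symmetric] power_mult_distrib)
  also have "\<dots> = - ((norm (gradJ 0))\<^sup>2 / (4 * L))"
    using L by (simp add: s_def power2_eq_square field_simps)
  finally have "(norm (gradJ 0))\<^sup>2 \<le> 0" using L by (simp add: field_simps)
  then show ?thesis by simp
qed

section \<open>Projection onto the admissible controls\<close>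

abbreviation boxp :: "real^'m \<Rightarrow> real^'m" where "boxp \<equiv> closest_point (cbox lo hi)"

abbreviation PF :: "(real^'m) L2 \<Rightarrow> (real^'m) L2" where "PF \<equiv> orth_proj (admissible_controls tf lo hi)"

lemma zero_in_box: "0 \<in> cbox lo hi"
  using box by (auto simp: mem_box_cart intro: less_imp_le)

lemma box_proj_lip: "norm (boxp x - boxp y) \<le> norm (x - y)"
  using closest_point_lipschitz[of "cbox lo hi" x y] zero_in_box by (auto simp: dist_norm)

lemma box_proj_zero: "boxp 0 = 0" by (rule closest_point_self[OF zero_in_box])

lemma box_proj_in: "boxp x \<in> cbox lo hi"
  using zero_in_box by (intro closest_point_in_set) auto

lemma continuous_box_proj: "continuous_on S boxp"
  by (rule lipschitz_on_continuous_on[of 1]) (auto intro!: lipschitz_onI simp: dist_norm box_proj_lip)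

text \<open>The candidate is the pointwise box projection: it is square integrable because the box
  contains 0, and the pointwise variational inequality of the box integrates to the one in
  \<open>L2\<close>.\<close>

lemma PF_exists:
  "\<exists>c. c \<in> admissible_controls tf lo hi \<and>
     (AE t in lborel. L2_fun c t = indicator {0..tf} t *\<^sub>R boxp (L2_fun v t)) \<and>
     (\<forall>y\<in>admissible_controls tf lo hi. (v - c) \<bullet> (y - c) \<le> 0)"
proof -
  have [measurable]: "boxp \<in> borel_measurable borel"
    by (rule borel_measurable_continuous_onI[OF continuous_box_proj])
  have le: "norm (boxp x) \<le> norm x" for x using box_proj_lip[of x 0] by (simp add: box_proj_zero)
  have "integrable lborel (\<lambda>t. (norm (indicator {0..tf} t *\<^sub>R boxp (L2_fun v t)))\<^sup>2)"
  proof (rule Bochner_Integration.integrable_bound[OF integrable_norm_L2_fun[of v]])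
    show "AE t in lborel. norm ((norm (indicator {0..tf} t *\<^sub>R boxp (L2_fun v t)))\<^sup>2) \<le> norm ((norm (L2_fun v t))\<^sup>2)"
      using le by (intro always_eventually allI) (auto simp: indicator_def intro!: power_mono)
  qed measurable
  then have si: "square_integrable (\<lambda>t. indicator {0..tf} t *\<^sub>R boxp (L2_fun v t))"
    by (simp add: square_integrable_def)
  define c where "c = abs_L2 (\<lambda>t. indicator {0..tf} t *\<^sub>R boxp (L2_fun v t))"
  have ae: "AE t in lborel. L2_fun c t = indicator {0..tf} t *\<^sub>R boxp (L2_fun v t)"
    unfolding c_def by (rule L2_fun_abs[OF si])
  have adm: "c \<in> admissible_controls tf lo hi"
    unfolding admissible_controls_def L2_on_def
  proof (intro CollectI conjI)
    show "AE t in lborel. t \<notin> {0..tf} \<longrightarrow> L2_fun c t = 0"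
      using ae by (auto elim!: eventually_mono)
    show "AE t in lborel. t \<in> {0..tf} \<longrightarrow> (\<forall>i. lo $ i \<le> L2_fun c t $ i \<and> L2_fun c t $ i \<le> hi $ i)"
      using ae by eventually_elim (use box_proj_in in \<open>auto simp: mem_box_cart\<close>)
  qed
  have "(v - c) \<bullet> (y - c) \<le> 0" if y: "y \<in> admissible_controls tf lo hi" for y
  proof -
    have "0 \<le> (\<integral>t. - (L2_fun (v - c) t \<bullet> L2_fun (y - c) t) \<partial>lborel)"
    proof (rule integral_nonneg_AE)
      have "AE t in lborel. t \<notin> {0..tf} \<longrightarrow> L2_fun y t = 0"
        "AE t in lborel. t \<in> {0..tf} \<longrightarrow> (\<forall>i. lo $ i \<le> L2_fun y t $ i \<and> L2_fun y t $ i \<le> hi $ i)"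
        using y by (auto simp: admissible_controls_def L2_on_def)
      with ae L2_fun_diff[of v c] L2_fun_diff[of y c]
      show "AE t in lborel. 0 \<le> - (L2_fun (v - c) t \<bullet> L2_fun (y - c) t)"
      proof eventually_elim
        case (elim t)
        show ?case
        proof (cases "t \<in> {0..tf}")
          case True
          then have "L2_fun y t \<in> cbox lo hi" using elim by (simp add: mem_box_cart)
          then have "(L2_fun v t - boxp (L2_fun v t)) \<bullet> (L2_fun y t - boxp (L2_fun v t)) \<le> 0"
            by (intro closest_point_dot) auto
          then show ?thesis using elim True by simp
        next
          case False
          then show ?thesis using elim by simp
        qed
      qed
    qed
    then show ?thesis by (simp add: inner_L2_eq)
  qed
  then show ?thesis using ae adm by blast
qed

lemma PF_fun: "AE t in lborel. L2_fun (PF v) t = indicator {0..tf} t *\<^sub>R boxp (L2_fun v t)"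
  and PF_in: "PF v \<in> admissible_controls tf lo hi"
  and PF_vi: "y \<in> admissible_controls tf lo hi \<Longrightarrow> (v - PF v) \<bullet> (y - PF v) \<le> 0"
proof -
  obtain c where c: "c \<in> admissible_controls tf lo hi"
    "AE t in lborel. L2_fun c t = indicator {0..tf} t *\<^sub>R boxp (L2_fun v t)"
    "\<And>y. y \<in> admissible_controls tf lo hi \<Longrightarrow> (v - c) \<bullet> (y - c) \<le> 0"
    using PF_exists[of v] by blast
  have eq: "PF v = c" using c(1,3) by (rule orth_proj_eqI)
  show "AE t in lborel. L2_fun (PF v) t = indicator {0..tf} t *\<^sub>R boxp (L2_fun v t)"
    "PF v \<in> admissible_controls tf lo hi"
    "y \<in> admissible_controls tf lo hi \<Longrightarrow> (v - PF v) \<bullet> (y - PF v) \<le> 0"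
    unfolding eq using c by auto
qed

lemma PF_L2_on: "PF v \<in> L2_on tf"
  using PF_in by (simp add: admissible_controls_def)

text \<open>Adding the variational inequalities of the two projections. This stronger form of
  nonexpansiveness is what makes the second block of \<open>opR\<close> dissipate the control
  difference.\<close>

lemma PF_firm: "(norm (PF v - PF w))\<^sup>2 \<le> (PF v - PF w) \<bullet> (v - w)"
proof -
  have "(v - PF v) \<bullet> (PF w - PF v) \<le> 0" "(w - PF w) \<bullet> (PF v - PF w) \<le> 0"
    by (intro PF_vi PF_in)+
  then show ?thesis
    by (simp add: power2_norm_eq_inner inner_diff_left inner_diff_right inner_commute)
qed

lemma PF_lip: "norm (PF v - PF w) \<le> norm (v - w)"
proof -
  let ?d = "norm (PF v - PF w)"
  have "?d * ?d \<le> ?d * norm (v - w)"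
    using PF_firm[of v w] norm_cauchy_schwarz[of "PF v - PF w" "v - w"] by (simp add: power2_eq_square)
  then show ?thesis by (cases "?d = 0") (auto simp: mult_le_cancel_left)
qed

lemma PF_zero: "PF 0 = 0"
proof (rule L2_eqI)
  show "AE t in lborel. L2_fun (PF 0) t = L2_fun 0 t"
    using PF_fun[of 0] L2_fun_zero[where 'a="real^'m"] by eventually_elim (simp add: box_proj_zero)
qed

end

lemma half_power2_norm_diff:
  fixes u v :: "'a::real_inner"
  shows "u \<bullet> (v - u) = ((norm v)\<^sup>2 - (norm u)\<^sup>2 - (norm (v - u))\<^sup>2) / 2"
  by (simp add: power2_norm_eq_inner inner_diff_left inner_diff_right inner_commute)

lemma abs_diff_power2_norm:
  fixes u v :: "'a::real_normed_vector"
  shows "\<bar>(norm u)\<^sup>2 - (norm v)\<^sup>2\<bar> \<le> norm (u - v) * (norm u + norm v)"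
proof -
  have "(norm u)\<^sup>2 - (norm v)\<^sup>2 = (norm u - norm v) * (norm u + norm v)"
    by (simp add: power2_eq_square algebra_simps)
  then have "\<bar>(norm u)\<^sup>2 - (norm v)\<^sup>2\<bar> = \<bar>norm u - norm v\<bar> * (norm u + norm v)" by (simp add: abs_mult)
  then show ?thesis using norm_triangle_ineq3[of u v] by (simp add: mult_right_mono)
qed

section \<open>Optimality system, feedback and verification of the fast-slow hypotheses\<close>

context ocp_problem
begin

abbreviation state :: "(real^'m) L2 \<Rightarrow> real^'n \<Rightarrow> (real^'n) L2" where
  "state u x0 \<equiv> state_map tf A (L2_mat Bp u, x0)"

interpretation K: bounded_linear "state_map tf A" by (rule bounded_linear_state_map[OF tf])
interpretation E: bounded_linear "adjoint_map tf A" by (rule bounded_linear_adjoint_map[OF tf])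
interpretation mB: bounded_linear "L2_mat Bp" by (rule bounded_linear_L2_mat)
interpretation mBt: bounded_linear "L2_mat (transpose Bp)" by (rule bounded_linear_L2_mat)

lemma state_diff: "state u x0 - state v x0 = state_map tf A (L2_mat Bp (u - v), 0)"
proof -
  have "(L2_mat Bp u, x0) - (L2_mat Bp v, x0) = (L2_mat Bp (u - v), 0)" by (simp add: mB.diff)
  then show ?thesis using K.diff by metis
qed

text \<open>The gradient of the cost as a function of the control alone, with the state eliminated;
  the adjoint equation evaluates the transpose of the control-to-state map.\<close>

definition cost_grad :: "real^'n \<Rightarrow> (real^'m) L2 \<Rightarrow> (real^'m) L2" where
  "cost_grad x0 u = \<alpha> *\<^sub>R u + L2_mat (transpose Bp) (fst (adjoint_map tf A (gradJ (state u x0))))"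

lemma adjoint_state_inner: "L2_mat (transpose Bp) (fst (adjoint_map tf A g)) \<bullet> u = g \<bullet> state_map tf A (L2_mat Bp u, 0)"
proof -
  have "L2_mat (transpose Bp) (fst (adjoint_map tf A g)) \<bullet> u = adjoint_map tf A g \<bullet> (L2_mat Bp u, 0)"
    by (simp add: L2_mat_adjoint inner_prod_def inner_commute)
  then show ?thesis by (simp add: adjoint_map_inner[OF tf])
qed

lemma cost_grad_diff: "cost_grad x0 u - cost_grad x0 v =
    \<alpha> *\<^sub>R (u - v) + L2_mat (transpose Bp) (fst (adjoint_map tf A (gradJ (state u x0) - gradJ (state v x0))))"
  by (simp add: cost_grad_def E.diff mBt.diff scaleR_diff_right)

lemma cost_grad_monotone: "(cost_grad x0 u - cost_grad x0 v) \<bullet> (u - v) \<ge> \<alpha> * (norm (u - v))\<^sup>2"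
proof -
  have "0 \<le> \<mu> * (norm (state u x0 - state v x0))\<^sup>2" using \<mu> by simp
  also have "\<dots> \<le> (gradJ (state u x0) - gradJ (state v x0)) \<bullet> (state u x0 - state v x0)"
    by (rule J_lower[OF state_map_in state_map_in])
  finally show ?thesis
    unfolding cost_grad_diff inner_add_left adjoint_state_inner state_diff[of u x0 v, symmetric]
    by (simp add: power2_norm_eq_inner)
qed

lemma cost_grad_lipschitz:
  obtains G where "G \<ge> \<alpha>" "\<And>u v. norm (cost_grad x0 u - cost_grad x0 v) \<le> G * norm (u - v)"
proof -
  obtain k where k: "k \<ge> 0" "\<And>z. norm (state_map tf A z) \<le> norm z * k" using K.nonneg_bounded by blast
  obtain e where e: "e \<ge> 0" "\<And>z. norm (adjoint_map tf A z) \<le> norm z * e" using E.nonneg_bounded by blast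
  obtain p where p: "p \<ge> 0" "\<And>z. norm (L2_mat Bp z) \<le> norm z * p" using mB.nonneg_bounded by blast
  obtain r where r: "r \<ge> 0" "\<And>z. norm (L2_mat (transpose Bp) z) \<le> norm z * r" using mBt.nonneg_bounded by blast
  have "norm (cost_grad x0 u - cost_grad x0 v) \<le> (\<alpha> + p * k * (2 * L) * e * r) * norm (u - v)" for u v
  proof -
    let ?g = "gradJ (state u x0) - gradJ (state v x0)"
    have 1: "norm (state u x0 - state v x0) \<le> norm (u - v) * p * k"
    proof -
      have "norm (state u x0 - state v x0) \<le> norm (L2_mat Bp (u - v)) * k"
        unfolding state_diff using k(2)[of "(L2_mat Bp (u - v), 0)"] by simp
      also have "\<dots> \<le> norm (u - v) * p * k" by (intro mult_right_mono p k)
      finally show ?thesis .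
    qed
    have "norm ?g \<le> 2 * L * norm (state u x0 - state v x0)" by (rule gradJ_lip[OF state_map_in state_map_in])
    also have "\<dots> \<le> 2 * L * (norm (u - v) * p * k)" using 1 L by (intro mult_left_mono) auto
    finally have 2: "norm ?g \<le> 2 * L * (norm (u - v) * p * k)" .
    have "norm (L2_mat (transpose Bp) (fst (adjoint_map tf A ?g))) \<le> norm (fst (adjoint_map tf A ?g)) * r" by (rule r)
    also have "\<dots> \<le> norm ?g * e * r"
      using norm_fst_le[of "fst (adjoint_map tf A ?g)" "snd (adjoint_map tf A ?g)"] e(2)[of ?g] r(1)
      by (intro mult_right_mono) auto
    also have "\<dots> \<le> 2 * L * (norm (u - v) * p * k) * e * r" by (intro mult_right_mono 2 e r)
    finally have "norm (L2_mat (transpose Bp) (fst (adjoint_map tf A ?g))) \<le> p * k * (2 * L) * e * r * norm (u - v)"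
      by (simp add: mult_ac)
    moreover have "norm (\<alpha> *\<^sub>R (u - v)) = \<alpha> * norm (u - v)" using \<alpha> by simp
    moreover have "norm (cost_grad x0 u - cost_grad x0 v) \<le>
        norm (\<alpha> *\<^sub>R (u - v)) + norm (L2_mat (transpose Bp) (fst (adjoint_map tf A ?g)))"
      unfolding cost_grad_diff by (rule norm_triangle_ineq)
    ultimately show ?thesis by (simp only: distrib_right)
  qed
  then show thesis using k(1) e(1) p(1) r(1) L by (intro that[of "\<alpha> + p * k * (2 * L) * e * r"]) auto
qed

text \<open>The projected gradient step is a contraction for a small step size.\<close>

lemma optimal_control_exists:
  "\<exists>u. u \<in> admissible_controls tf lo hi \<and>
     (\<forall>v\<in>admissible_controls tf lo hi. cost_grad x0 u \<bullet> (v - u) \<ge> 0)"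
proof -
  obtain G where G: "G \<ge> \<alpha>" "\<And>u v. norm (cost_grad x0 u - cost_grad x0 v) \<le> G * norm (u - v)"
    by (rule cost_grad_lipschitz[of x0]) (rule that)
  have G0: "G > 0" using G(1) \<alpha> by linarith
  \<comment> \<open>The step size minimises \<open>1 - 2 s \<alpha> + s^2 G^2\<close>, and the
    minimum is \<open>1 - s \<alpha>\<close>; the condition \<open>G \<ge> \<alpha>\<close> keeps it
    nonnegative.\<close>
  define s where "s = \<alpha> / G\<^sup>2"
  have s: "s > 0" "s * G\<^sup>2 = \<alpha>" using \<alpha> G0 by (auto simp: s_def)
  have sa: "s * \<alpha> \<le> 1"
  proof -
    have "\<alpha> * \<alpha> \<le> G * G" using G(1) \<alpha> by (intro mult_mono) auto
    then show ?thesis using G0 by (simp add: s_def power2_eq_square divide_le_eq)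
  qed
  define \<Phi> where "\<Phi> u = PF (u - s *\<^sub>R cost_grad x0 u)" for u
  have contr: "norm (\<Phi> u - \<Phi> v) \<le> sqrt (1 - s * \<alpha>) * norm (u - v)" for u v
  proof (rule power2_le_imp_le)
    let ?d = "u - v" and ?g = "cost_grad x0 u - cost_grad x0 v"
    have "norm (\<Phi> u - \<Phi> v) \<le> norm (?d - s *\<^sub>R ?g)"
      unfolding \<Phi>_def by (rule order_trans[OF PF_lip]) (simp add: scaleR_diff_right algebra_simps)
    then have "(norm (\<Phi> u - \<Phi> v))\<^sup>2 \<le> (norm (?d - s *\<^sub>R ?g))\<^sup>2" by (intro power_mono) auto
    also have "\<dots> = (norm ?d)\<^sup>2 - 2 * s * (?g \<bullet> ?d) + s\<^sup>2 * (norm ?g)\<^sup>2"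
      unfolding power2_norm_eq_inner inner_diff_left[of ?d "s *\<^sub>R ?g"] inner_diff_right[of _ ?d "s *\<^sub>R ?g"]
      by (simp add: inner_commute power2_eq_square)
    also have "\<dots> \<le> (norm ?d)\<^sup>2 - 2 * s * (\<alpha> * (norm ?d)\<^sup>2) + s\<^sup>2 * (G * norm ?d)\<^sup>2"
    proof -
      have "2 * s * (\<alpha> * (norm ?d)\<^sup>2) \<le> 2 * s * (?g \<bullet> ?d)"
        using s(1) cost_grad_monotone[of u v x0] by (intro mult_left_mono) auto
      moreover have "s\<^sup>2 * (norm ?g)\<^sup>2 \<le> s\<^sup>2 * (G * norm ?d)\<^sup>2"
        using G(2)[of u v] by (intro mult_left_mono power_mono) auto
      ultimately show ?thesis by linarith
    qed
    also have "\<dots> = (1 - 2 * (s * \<alpha>) + s * (s * G\<^sup>2)) * (norm ?d)\<^sup>2" by (simp add: power2_eq_square algebra_simps)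
    also have "\<dots> = (sqrt (1 - s * \<alpha>) * norm ?d)\<^sup>2" using sa s(2) by (simp add: power_mult_distrib)
    finally show "(norm (\<Phi> u - \<Phi> v))\<^sup>2 \<le> (sqrt (1 - s * \<alpha>) * norm ?d)\<^sup>2" .
    show "0 \<le> sqrt (1 - s * \<alpha>) * norm ?d" using sa by simp
  qed
  have "\<exists>!u. \<Phi> u = u"
  proof (rule banach_fix_type[of "sqrt (1 - s * \<alpha>)"])
    show "0 \<le> sqrt (1 - s * \<alpha>)" using sa by simp
    show "sqrt (1 - s * \<alpha>) < 1" using s \<alpha> by simp
    show "\<forall>u v. dist (\<Phi> u) (\<Phi> v) \<le> sqrt (1 - s * \<alpha>) * dist u v" using contr by (simp add: dist_norm)
  qed
  then obtain u where u: "\<Phi> u = u" by blast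
  have adm: "u \<in> admissible_controls tf lo hi" using PF_in u unfolding \<Phi>_def by metis
  have "0 \<le> cost_grad x0 u \<bullet> (v - u)" if "v \<in> admissible_controls tf lo hi" for v
  proof -
    have "(u - s *\<^sub>R cost_grad x0 u - u) \<bullet> (v - u) \<le> 0"
      using PF_vi[OF that, of "u - s *\<^sub>R cost_grad x0 u"] u unfolding \<Phi>_def by simp
    then have "0 \<le> s * (cost_grad x0 u \<bullet> (v - u))" by simp
    then show ?thesis using s(1) by (simp add: zero_le_mult_iff)
  qed
  with adm show ?thesis by blast
qed

definition opt_control :: "real^'n \<Rightarrow> (real^'m) L2" where
  "opt_control x0 = (SOME u. u \<in> admissible_controls tf lo hi \<and>
     (\<forall>v\<in>admissible_controls tf lo hi. cost_grad x0 u \<bullet> (v - u) \<ge> 0))"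

abbreviation opt_state :: "real^'n \<Rightarrow> (real^'n) L2" where "opt_state x0 \<equiv> state (opt_control x0) x0"

lemma opt_control: "opt_control x0 \<in> admissible_controls tf lo hi"
  "v \<in> admissible_controls tf lo hi \<Longrightarrow> cost_grad x0 (opt_control x0) \<bullet> (v - opt_control x0) \<ge> 0"
  using someI_ex[OF optimal_control_exists[of x0]] unfolding opt_control_def by auto

text \<open>The sign solves the first row \<open>- opA_adj p = gradJ x\<close> of the stationary
  optimizer equation.\<close>

definition costate :: "real^'n \<Rightarrow> 'n adjoint_space" where
  "costate x0 = - adjoint_map tf A (gradJ (opt_state x0))"

text \<open>Divided by \<open>\<alpha>\<close>, the first-order condition is the variational
  inequality that characterises the projection.\<close>

lemma opt_control_eq_PF: "opt_control x0 = PF ((1 / \<alpha>) *\<^sub>R opB_adj Bp (costate x0))"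
proof (rule orth_proj_eqI[symmetric])
  let ?u = "opt_control x0" and ?v = "(1 / \<alpha>) *\<^sub>R opB_adj Bp (costate x0)"
  fix y assume y: "y \<in> admissible_controls tf lo hi"
  have "cost_grad x0 ?u = - (\<alpha> *\<^sub>R (?v - ?u))"
    using \<alpha> by (simp add: cost_grad_def costate_def opB_adj_def case_prod_beta mBt.neg scaleR_diff_right)
  then have "0 \<le> - (\<alpha> * ((?v - ?u) \<bullet> (y - ?u)))" using opt_control(2)[OF y, of x0] by simp
  then show "(?v - ?u) \<bullet> (y - ?u) \<le> 0" using \<alpha> by (simp add: mult_le_0_iff)
qed (rule opt_control)

lemma ocp_feasible_iff:
  "(x, u) \<in> ocp_feasible tf A Bp lo hi x0 \<longleftrightarrow> u \<in> admissible_controls tf lo hi \<and> x = state u x0"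
proof (cases "u \<in> admissible_controls tf lo hi")
  case adm: True
  then have "u \<in> L2_on tf" by (simp add: admissible_controls_def)
  then have Bu: "L2_restrict tf (L2_mat Bp u) = L2_mat Bp u" using L2_mat_in by (simp add: L2_on_iff)
  have "(x, u) \<in> ocp_feasible tf A Bp lo hi x0 \<longleftrightarrow> x = state u x0"
  proof
    assume "(x, u) \<in> ocp_feasible tf A Bp lo hi x0"
    then have x: "x \<in> H1_on tf" "H1_deriv tf x = L2_mat A x + L2_mat Bp u" "L2_at tf x 0 = x0"
      by (auto simp: ocp_feasible_def)
    obtain v where v: "H1_rep tf x (H1_deriv tf x) v" using H1_onE[OF tf x(1)] .
    have "v 0 = x0" using H1_rep_at[OF tf v, of 0] x(3) tf by simp
    then have "state u x0 = x" using v x(2) Bu by (intro state_map_eqI[where v=v]) auto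
    then show "x = state u x0" ..
  next
    assume x: "x = state u x0"
    obtain v where "H1_rep tf x (L2_mat A x + L2_restrict tf (fst (L2_mat Bp u, x0))) v" "v 0 = snd (L2_mat Bp u, x0)"
      unfolding x by (rule state_map_rep)
    then have v: "H1_rep tf x (L2_mat A x + L2_mat Bp u) v" "v 0 = x0" using Bu by simp_all
    have "x \<in> H1_on tf" using v(1) by (auto simp: H1_on_def has_H1_deriv_iff)
    then show "(x, u) \<in> ocp_feasible tf A Bp lo hi x0"
      using adm H1_deriv_eq[OF tf v(1)] H1_rep_at[OF tf v(1), of 0] v(2) tf by (simp add: ocp_feasible_def)
  qed
  then show ?thesis using adm by simp
qed (simp add: ocp_feasible_def)

text \<open>Convexity bounds \<open>J\<close> below by its linearisation, the control term expands
  exactly, and the first-order condition removes the linear part. The quadratic remainder makes the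
  minimiser unique, as the definite description in \<open>ocp_solution\<close> demands.\<close>

lemma ocp_cost_gap:
  assumes v: "v \<in> admissible_controls tf lo hi"
  shows "ocp_cost tf l \<alpha> (opt_state x0, opt_control x0) + \<alpha> / 2 * (norm (v - opt_control x0))\<^sup>2
    \<le> ocp_cost tf l \<alpha> (state v x0, v)"
proof -
  let ?u = "opt_control x0" and ?x = "opt_state x0"
  let ?p = "L2_mat (transpose Bp) (fst (adjoint_map tf A (gradJ ?x)))"
  have "J ?x + gradJ ?x \<bullet> (state v x0 - ?x) \<le> J (state v x0)"
    by (rule J_bounds(1)[OF state_map_in state_map_in])
  moreover have "gradJ ?x \<bullet> (state v x0 - ?x) = ?p \<bullet> (v - ?u)"
    unfolding state_diff adjoint_state_inner ..
  moreover have "0 \<le> \<alpha> * (?u \<bullet> (v - ?u)) + ?p \<bullet> (v - ?u)"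
    using opt_control(2)[OF v, of x0] by (simp add: cost_grad_def inner_add_left)
  ultimately have "J ?x - \<alpha> * (?u \<bullet> (v - ?u)) \<le> J (state v x0)" by linarith
  then show ?thesis
    unfolding half_power2_norm_diff ocp_cost_def prod.case by (simp add: field_simps)
qed

lemma ocp_solution_eq: "ocp_solution tf A Bp l \<alpha> lo hi x0 = (opt_state x0, opt_control x0)"
  unfolding ocp_solution_def
proof (rule the_equality)
  let ?s = "(opt_state x0, opt_control x0)"
  have feas: "?s \<in> ocp_feasible tf A Bp lo hi x0" using opt_control(1) by (simp add: ocp_feasible_iff)
  have gap: "ocp_cost tf l \<alpha> ?s + \<alpha> / 2 * (norm (snd s - opt_control x0))\<^sup>2 \<le> ocp_cost tf l \<alpha> s"
    "fst s = state (snd s) x0" if "s \<in> ocp_feasible tf A Bp lo hi x0" for s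
    using that ocp_cost_gap[of "snd s" x0] by (cases s; simp add: ocp_feasible_iff)+
  have "ocp_cost tf l \<alpha> ?s \<le> ocp_cost tf l \<alpha> s" if "s \<in> ocp_feasible tf A Bp lo hi x0" for s
  proof -
    have "0 \<le> \<alpha> / 2 * (norm (snd s - opt_control x0))\<^sup>2" using \<alpha> by simp
    then show ?thesis using gap(1)[OF that] by linarith
  qed
  then show "is_arg_min (ocp_cost tf l \<alpha>) (\<lambda>s. s \<in> ocp_feasible tf A Bp lo hi x0) ?s"
    using feas by (simp add: is_arg_min_linorder)
  fix s assume "is_arg_min (ocp_cost tf l \<alpha>) (\<lambda>s. s \<in> ocp_feasible tf A Bp lo hi x0) s"
  then have s: "s \<in> ocp_feasible tf A Bp lo hi x0" "ocp_cost tf l \<alpha> s \<le> ocp_cost tf l \<alpha> ?s"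
    using feas by (auto simp: is_arg_min_linorder)
  have "\<alpha> / 2 * (norm (snd s - opt_control x0))\<^sup>2 \<le> 0" using gap(1)[OF s(1)] s(2) by linarith
  then have "snd s = opt_control x0" using \<alpha> by (simp add: mult_le_0_iff)
  then show "s = ?s" using gap(2)[OF s(1)] by (simp add: prod_eq_iff)
qed

definition out :: "'n optimizer_space \<Rightarrow> real^'m" where
  "out w = boxp ((1 / \<alpha>) *\<^sub>R (transpose Bp *v snd (snd w)))"

text \<open>The image under \<open>opJ\<close> of the optimal state and costate, written out by
  means of the state equation and the adjoint equation.\<close>

definition js :: "real^'n \<Rightarrow> 'n optimizer_space" where
  "js x0 = (gradJ (opt_state x0), (L2_mat Bp (opt_control x0), x0))"

lemma opJ_inv_js: "opJ_inv tf A (js x0) = (opt_state x0, costate x0)"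
  by (simp add: opJ_inv_def js_def costate_def)

lemma js_eq: "js x0 = opR tf Bp \<alpha> lo hi gradJ (opJ_inv tf A (js x0)) + iota3 x0"
  unfolding opJ_inv_js opR_def prod.case opt_control_eq_PF[symmetric]
  by (simp add: js_def opB_def iota3_def)

lemma js_in: "restrict_opt tf (js x0) = js x0"
  using opt_control(1)[of x0]
  by (simp add: restrict_opt_iff js_def gradJ_in state_map_in L2_mat_in admissible_controls_def)

text \<open>Projecting the continuous representative of the costate pointwise onto the box gives a
  continuous representative of the optimal control; at time 0 it sees exactly the boundary component
  of the costate.\<close>

lemma ocp_feedback_eq: "ocp_feedback tf A Bp l \<alpha> lo hi x0 = out (opJ_inv tf A (js x0))"
proof -
  let ?g = "gradJ (opt_state x0)"
  let ?v = "(1 / \<alpha>) *\<^sub>R opB_adj Bp (costate x0)"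
  obtain w where w: "H1_rep tf (fst (adjoint_map tf A ?g))
      (- L2_mat (transpose A) (fst (adjoint_map tf A ?g)) - L2_restrict tf ?g) w" "w 0 = snd (adjoint_map tf A ?g)"
    by (rule adjoint_map_rep[OF tf]) (rule that)
  define c where "c t = boxp ((1 / \<alpha>) *\<^sub>R (transpose Bp *v (- w t)))" for t
  have "continuous_on {0..tf} (\<lambda>t. (1 / \<alpha>) *\<^sub>R (transpose Bp *v (- w t)))"
    by (intro continuous_intros continuous_on_matrix_vector H1_rep_continuous[OF w(1)])
  then have cont: "continuous_on {0..tf} c"
    unfolding c_def by (rule continuous_on_compose2[OF continuous_box_proj[of UNIV]]) simp
  have "is_rep_on tf (opt_control x0) c"
    unfolding is_rep_on_def
  proof -
    have "AE t in lborel. t \<in> {0..tf} \<longrightarrow> L2_fun (fst (adjoint_map tf A ?g)) t = w t"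
      using H1_repD(3)[OF w(1)] by (simp add: is_rep_on_def)
    moreover have "AE t in lborel. L2_fun (opt_control x0) t = indicator {0..tf} t *\<^sub>R boxp (L2_fun ?v t)"
      using PF_fun[of ?v] unfolding opt_control_eq_PF[symmetric] .
    moreover note L2_fun_scaleR[of "1 / \<alpha>" "opB_adj Bp (costate x0)"]
      L2_fun_mat[of "transpose Bp" "fst (costate x0)"] L2_fun_uminus[of "fst (adjoint_map tf A ?g)"]
    ultimately show "AE t in lborel. t \<in> {0..tf} \<longrightarrow> L2_fun (opt_control x0) t = c t"
      by eventually_elim (simp add: c_def opB_adj_def case_prod_beta costate_def)
  qed
  then have "L2_at tf (opt_control x0) 0 = c 0" by (intro L2_at_eq[OF tf cont]) (use tf in auto)
  then show ?thesis
    by (simp add: ocp_feedback_def ocp_solution_eq opJ_inv_js out_def c_def w(2) costate_def)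
qed

lemma R_cross_bound:
  fixes a c x p P :: real
  shows "a * (x * P) + c * (x * p) \<le> (a\<^sup>2 / 2 + c\<^sup>2 / 2) * x\<^sup>2 + P\<^sup>2 / 2 + p\<^sup>2 / 2"
  using zero_le_power2[of "a * x - P"] zero_le_power2[of "c * x - p"]
  by (simp add: power2_diff power_mult_distrib algebra_simps)

lemma restrict_optD: "restrict_opt tf w = w \<Longrightarrow> fst w \<in> L2_on tf"
  by (simp add: restrict_opt_iff)

text \<open>The cross term \<open>\<eta> \<langle>x, K p\<rangle>\<close> turns the skew part into \<open>\<eta> (\<parallel>x\<parallel>\<^sup>2 - \<parallel>p\<parallel>\<^sup>2)\<close> and so
  supplies the damping of the costate that \<open>\<R>\<close> lacks.\<close>

lemma fast_slow_ocp:
  obtains b q c0 LR Cq Lh where "fast_slow (restrict_opt tf) (opJ_inv tf A) (opR tf Bp \<alpha> lo hi gradJ) iota3 b q js out ((*v) Bp) c0 LR Cq Lh"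
proof -
  let ?K = "state_map tf A" and ?R = "opR tf Bp \<alpha> lo hi gradJ :: 'n optimizer_space \<Rightarrow> _"
  obtain k where k: "k > 0" "\<And>z. norm (?K z) \<le> norm z * k" using K.pos_bounded by blast
  obtain p where p: "p \<ge> 0" "\<And>z. norm (L2_mat Bp z) \<le> norm z * p" using mB.nonneg_bounded by blast
  obtain r where r: "r \<ge> 0" "\<And>z. norm (L2_mat (transpose Bp) z) \<le> norm z * r" using mBt.nonneg_bounded by blast
  obtain a where a: "a \<ge> 0" "\<And>x. norm (transpose Bp *v x) \<le> a * norm x"
    by (rule matrix_vector_bound[of "transpose Bp"]) (rule that)
  \<comment> \<open>The total coefficient of \<open>\<eta>\<close> times the squared state error: 1
    from \<open>q\<close>, the rest from Young's inequality for the two cross terms of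
    \<open>b\<close> with \<open>opR\<close>.\<close>
  define Q where "Q = 1 + (k * p)\<^sup>2 / 2 + (k * (2 * L))\<^sup>2 / 2"
  have Q: "Q > 0" unfolding Q_def by (intro add_pos_nonneg) auto
  \<comment> \<open>The three bounds keep half of the strong convexity \<open>\<mu>\<close> for the
    state error, let \<open>\<alpha>\<close> absorb the control difference, and make the cross term
    in \<open>b\<close> at most a quarter of the squared norm, so that \<open>b\<close> stays
    equivalent to it.\<close>
  define \<eta> where "\<eta> = Min {\<mu> / (2 * Q), 2 * \<alpha>, 1 / (2 * k)}"
  have \<eta>: "\<eta> > 0" "\<eta> * Q \<le> \<mu> / 2" "\<eta> / 2 \<le> \<alpha>" "\<eta> * k \<le> 1 / 2"
  proof -
    show "\<eta> > 0" using \<mu> \<alpha> k Q by (simp add: \<eta>_def)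
    have "\<eta> \<le> \<mu> / (2 * Q)" "\<eta> \<le> 2 * \<alpha>" "\<eta> \<le> 1 / (2 * k)" by (simp_all add: \<eta>_def)
    then show "\<eta> * Q \<le> \<mu> / 2" "\<eta> / 2 \<le> \<alpha>" "\<eta> * k \<le> 1 / 2" using Q k by (simp_all add: field_simps)
  qed
  \<comment> \<open>The polarisation of the quadratic form in the overview, so that \<open>b\<close>
    is symmetric.\<close>
  define b where "b w w' = (1 / 2) * (w \<bullet> w') + (\<eta> / 2) * (fst w \<bullet> ?K (snd w') + fst w' \<bullet> ?K (snd w))"
    for w w' :: "'n optimizer_space"
  define q where "q w = \<eta> * ((norm (fst w))\<^sup>2 - (norm (snd w))\<^sup>2)" for w :: "'n optimizer_space"
  have bww: "b w w = (norm w)\<^sup>2 / 2 + \<eta> * (fst w \<bullet> ?K (snd w))" for w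
    by (simp add: b_def power2_norm_eq_inner)
  have cross: "\<bar>\<eta> * (fst w \<bullet> ?K (snd w))\<bar> \<le> (norm w)\<^sup>2 / 4" for w :: "'n optimizer_space"
  proof -
    have "\<bar>fst w \<bullet> ?K (snd w)\<bar> \<le> norm (fst w) * norm (?K (snd w))" by (rule Cauchy_Schwarz_ineq2)
    also have "\<dots> \<le> norm (fst w) * (norm (snd w) * k)" by (intro mult_left_mono k) auto
    finally have "\<eta> * \<bar>fst w \<bullet> ?K (snd w)\<bar> \<le> \<eta> * (norm (fst w) * (norm (snd w) * k))"
      using \<eta>(1) by (intro mult_left_mono) auto
    also have "\<dots> = (\<eta> * k) * (norm (fst w) * norm (snd w))" by simp
    also have "\<dots> \<le> 1 / 2 * (norm (fst w) * norm (snd w))" using \<eta>(4) by (intro mult_right_mono) auto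
    also have "\<dots> \<le> (norm w)\<^sup>2 / 4"
    proof -
      have "2 * (norm (fst w) * norm (snd w)) \<le> (norm (fst w))\<^sup>2 + (norm (snd w))\<^sup>2"
        using sum_squares_bound[of "norm (fst w)" "norm (snd w)"] by simp
      then show ?thesis by (simp add: norm_prod_def real_sqrt_pow2)
    qed
    finally show ?thesis using \<eta>(1) by (simp add: abs_mult)
  qed
  define PFo where "PFo w = PF ((1 / \<alpha>) *\<^sub>R opB_adj Bp (snd w))" for w :: "'n optimizer_space"
  have R_diff: "?R v - ?R w = (gradJ (fst v) - gradJ (fst w), (L2_mat Bp (PFo v - PFo w), 0))" for v w
    unfolding PFo_def by (cases v; cases w) (simp add: opR_def opB_def mB.diff)
  have adj_diff: "(1 / \<alpha>) *\<^sub>R opB_adj Bp (snd v) - (1 / \<alpha>) *\<^sub>R opB_adj Bp (snd w)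
      = (1 / \<alpha>) *\<^sub>R L2_mat (transpose Bp) (fst (snd (v - w)))" for v w :: "'n optimizer_space"
    by (simp add: opB_adj_def case_prod_beta mBt.diff scaleR_diff_right)
  have norm_fst: "norm (fst w) \<le> norm w" and norm_snd: "norm (snd w) \<le> norm w" for w :: "'n optimizer_space"
    using norm_fst_le[of "fst w" "snd w"] norm_snd_le[of "snd w" "fst w"] by simp_all
  have norm_snd2: "norm (fst (snd w)) \<le> norm w" "norm (snd (snd w)) \<le> norm w" for w :: "'n optimizer_space"
    using norm_snd[of w] norm_fst_le[of "fst (snd w)" "snd (snd w)"] norm_snd_le[of "snd (snd w)" "fst (snd w)"] by simp_all
  have "fast_slow (restrict_opt tf) (opJ_inv tf A) ?R iota3 b q js out ((*v) Bp) (min (\<mu> / 2) (\<eta> / 2))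
    (2 * L + r / \<alpha> * p) (2 * \<eta>) (a / \<alpha>)"
  proof (rule fast_slow.intro[OF skew_operator_opJ_inv[OF tf] fast_slow_axioms.intro])
    fix v w u :: "'n optimizer_space" and x :: "real^'n"
    show "restrict_opt tf w = w \<Longrightarrow> restrict_opt tf (?R w) = ?R w"
      by (cases w) (auto simp: restrict_opt_iff opR_def opB_def gradJ_in L2_mat_in PF_L2_on)
    show "?R 0 = 0"
      by (simp add: opR_def opB_def opB_adj_def gradJ_zero mBt.zero mB.zero PF_zero zero_prod_def)
    show "bounded_linear (iota3 :: _ \<Rightarrow> 'n optimizer_space)"
      unfolding iota3_def by (intro bounded_linear_Pair bounded_linear_zero bounded_linear_ident)
    show "restrict_opt tf (iota3 x) = iota3 x"
      by (simp add: restrict_opt_iff iota3_def subspace_0[OF L2_on_subspace])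
    show "bounded_bilinear b"
    proof -
      \<comment> \<open>Moving \<open>state_map\<close> to the other side by its adjoint writes
        \<open>b\<close> as an inner product with a bounded linear image of the second
        argument.\<close>
      have "bounded_linear (\<lambda>w :: 'n optimizer_space. (1 / 2) *\<^sub>R w + (\<eta> / 2) *\<^sub>R (?K (snd w), adjoint_map tf A (fst w)))"
        by (intro bounded_linear_add bounded_linear_compose[OF bounded_linear_scaleR_right] bounded_linear_ident
            bounded_linear_Pair bounded_linear_compose[OF K.bounded_linear_axioms bounded_linear_snd]
            bounded_linear_compose[OF E.bounded_linear_axioms bounded_linear_fst])
      moreover have "b = (\<lambda>w w'. w \<bullet> ((1 / 2) *\<^sub>R w' + (\<eta> / 2) *\<^sub>R (?K (snd w'), adjoint_map tf A (fst w'))))"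
        by (simp add: fun_eq_iff b_def inner_add_right inner_prod_def[of _ "(_, _)"] inner_commute[of "snd _"] adjoint_map_inner[OF tf] distrib_left)
      ultimately show ?thesis using bounded_bilinear.comp[OF bounded_bilinear_inner bounded_linear_ident] by simp
    qed
    show "b v w = b w v" by (simp add: b_def inner_commute)
    show "(norm w)\<^sup>2 \<le> 4 * b w w" "b w w \<le> (norm w)\<^sup>2" using cross[of w] unfolding bww by (simp_all add: abs_le_iff)
    show "2 * b u (opJ_inv tf A u) = q (opJ_inv tf A u)"
    proof -
      obtain f z where u: "u = (f, z)" by (cases u)
      have "z \<bullet> adjoint_map tf A f = f \<bullet> ?K z" "f \<bullet> ?K (adjoint_map tf A f) = (norm (adjoint_map tf A f))\<^sup>2"
        using adjoint_map_inner[OF tf, of A f] by (simp_all add: inner_commute[of z] power2_norm_eq_inner)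
      then show ?thesis
        by (simp add: u b_def q_def opJ_inv_def K.neg power2_norm_eq_inner[symmetric] right_diff_distrib)
    qed
    show "\<bar>q v - q w\<bar> \<le> 2 * \<eta> * norm (v - w) * (norm v + norm w)"
    proof -
      have *: "\<bar>(norm (g v))\<^sup>2 - (norm (g w))\<^sup>2\<bar> \<le> norm (v - w) * (norm v + norm w)"
        if "\<And>w. norm (g w) \<le> norm w" "g v - g w = g (v - w)" for g :: "'n optimizer_space \<Rightarrow> 'c::real_normed_vector"
      proof -
        have "norm (g v - g w) * (norm (g v) + norm (g w)) \<le> norm (v - w) * (norm v + norm w)"
          unfolding that(2) by (intro mult_mono add_mono that(1)) auto
        then show ?thesis using abs_diff_power2_norm[of "g v" "g w"] by linarith
      qed
      have "q v - q w = \<eta> * (((norm (fst v))\<^sup>2 - (norm (fst w))\<^sup>2) - ((norm (snd v))\<^sup>2 - (norm (snd w))\<^sup>2))"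
        by (simp add: q_def algebra_simps)
      then have "\<bar>q v - q w\<bar> = \<eta> * \<bar>((norm (fst v))\<^sup>2 - (norm (fst w))\<^sup>2) - ((norm (snd v))\<^sup>2 - (norm (snd w))\<^sup>2)\<bar>"
        using \<eta>(1) by (simp add: abs_mult)
      also have "\<dots> \<le> \<eta> * (2 * (norm (v - w) * (norm v + norm w)))"
        using *[of fst, OF norm_fst] *[of snd, OF norm_snd] \<eta>(1) by (intro mult_left_mono) auto
      finally show ?thesis by simp
    qed
    have fst_R: "norm (gradJ (fst v) - gradJ (fst w)) \<le> 2 * L * norm (fst (v - w))"
      if "restrict_opt tf v = v" "restrict_opt tf w = w"
      using gradJ_lip[OF restrict_optD restrict_optD, of w v] that by simp
    have PFo_lip: "norm (PFo v - PFo w) \<le> r / \<alpha> * norm (v - w)"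
    proof -
      have "norm (PFo v - PFo w) \<le> norm ((1 / \<alpha>) *\<^sub>R L2_mat (transpose Bp) (fst (snd (v - w))))"
        unfolding PFo_def adj_diff[symmetric] by (rule PF_lip)
      also have "\<dots> = norm (L2_mat (transpose Bp) (fst (snd (v - w)))) / \<alpha>" using \<alpha> by simp
      also have "\<dots> \<le> norm (fst (snd (v - w))) * r / \<alpha>" using \<alpha> by (intro divide_right_mono r) auto
      also have "\<dots> \<le> norm (v - w) * r / \<alpha>"
        using \<alpha> by (intro divide_right_mono mult_right_mono norm_snd2 r) auto
      finally show ?thesis by (simp add: mult_ac)
    qed
    show "norm (?R v - ?R w) \<le> (2 * L + r / \<alpha> * p) * norm (v - w)"
      if "restrict_opt tf v = v" "restrict_opt tf w = w"
    proof -
      have "norm (?R v - ?R w) \<le> norm (gradJ (fst v) - gradJ (fst w)) + norm (L2_mat Bp (PFo v - PFo w))"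
        unfolding R_diff using norm_Pair_le[of "gradJ (fst v) - gradJ (fst w)" "(L2_mat Bp (PFo v - PFo w), 0 :: real^'n)"] by simp
      also have "norm (gradJ (fst v) - gradJ (fst w)) \<le> 2 * L * norm (v - w)"
        using order_trans[OF fst_R[OF that] mult_left_mono[OF norm_fst]] L by simp
      also have "norm (L2_mat Bp (PFo v - PFo w)) \<le> r / \<alpha> * norm (v - w) * p"
        by (rule order_trans[OF p(2) mult_right_mono[OF PFo_lip p(1)]])
      finally show ?thesis by (simp add: algebra_simps)
    qed
    show "q (v - w) - 2 * b (v - w) (?R v - ?R w) \<le> - min (\<mu> / 2) (\<eta> / 2) * (norm (v - w))\<^sup>2"
      if "restrict_opt tf v = v" "restrict_opt tf w = w"
    proof -
      let ?e = "v - w" and ?g = "gradJ (fst v) - gradJ (fst w)" and ?d = "PFo v - PFo w"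
      let ?x = "norm (fst ?e)" and ?p = "norm (snd ?e)"
      have "\<mu> * ?x\<^sup>2 \<le> fst ?e \<bullet> ?g"
        using J_lower[OF restrict_optD restrict_optD, OF that] by (simp add: inner_commute)
      \<comment> \<open>Firm nonexpansiveness yields damping by the control difference
        \<open>?d\<close>; it has to pay for the cross term between the state error and the image of
        \<open>?d\<close> under \<open>state_map\<close>.\<close>
      moreover have "\<alpha> * (norm ?d)\<^sup>2 \<le> fst (snd ?e) \<bullet> L2_mat Bp ?d"
      proof -
        have "(norm ?d)\<^sup>2 \<le> ?d \<bullet> ((1 / \<alpha>) *\<^sub>R L2_mat (transpose Bp) (fst (snd ?e)))"
          unfolding PFo_def adj_diff[symmetric] by (rule PF_firm)
        also have "\<dots> = (fst (snd ?e) \<bullet> L2_mat Bp ?d) / \<alpha>"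
          by (simp add: L2_mat_adjoint[symmetric] inner_commute)
        finally show ?thesis using \<alpha> by (simp add: pos_le_divide_eq mult.commute)
      qed
      ultimately have inner: "\<mu> * ?x\<^sup>2 + \<alpha> * (norm ?d)\<^sup>2 \<le> ?e \<bullet> (?R v - ?R w)"
        unfolding R_diff inner_prod_def[of ?e] inner_prod_def[of "snd ?e"] fst_conv snd_conv by simp
      have "\<bar>fst ?e \<bullet> ?K (L2_mat Bp ?d, 0)\<bar> \<le> ?x * (norm ?d * p * k)"
      proof -
        have "norm (?K (L2_mat Bp ?d, 0)) \<le> norm (L2_mat Bp ?d) * k" using k(2)[of "(L2_mat Bp ?d, 0)"] by simp
        also have "\<dots> \<le> norm ?d * p * k" using k by (intro mult_right_mono p) auto
        finally show ?thesis
          by (intro order_trans[OF Cauchy_Schwarz_ineq2] mult_left_mono) auto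
      qed
      moreover have "\<bar>?g \<bullet> ?K (snd ?e)\<bar> \<le> 2 * L * ?x * (?p * k)"
        using L by (intro order_trans[OF Cauchy_Schwarz_ineq2] mult_mono fst_R[OF that] k) auto
      ultimately have "- (fst ?e \<bullet> ?K (L2_mat Bp ?d, 0) + ?g \<bullet> ?K (snd ?e))
          \<le> (k * p) * (?x * norm ?d) + (k * (2 * L)) * (?x * ?p)" by (simp add: mult_ac abs_le_iff)
      also have "\<dots> \<le> (Q - 1) * ?x\<^sup>2 + (norm ?d)\<^sup>2 / 2 + ?p\<^sup>2 / 2"
        using R_cross_bound[of "k * p" ?x "norm ?d" "k * (2 * L)" ?p] by (simp add: Q_def)
      finally have "\<eta> * - (fst ?e \<bullet> ?K (L2_mat Bp ?d, 0) + ?g \<bullet> ?K (snd ?e))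
          \<le> \<eta> * ((Q - 1) * ?x\<^sup>2 + (norm ?d)\<^sup>2 / 2 + ?p\<^sup>2 / 2)"
        by (rule mult_left_mono) (use \<eta> in simp)
      moreover have "2 * b ?e (?R v - ?R w) = ?e \<bullet> (?R v - ?R w)
          + \<eta> * (fst ?e \<bullet> ?K (L2_mat Bp ?d, 0) + ?g \<bullet> ?K (snd ?e))"
        unfolding b_def R_diff fst_conv snd_conv by (simp add: distrib_left)
      ultimately have "q ?e - 2 * b ?e (?R v - ?R w) \<le> \<eta> * (?x\<^sup>2 - ?p\<^sup>2) - (\<mu> * ?x\<^sup>2 + \<alpha> * (norm ?d)\<^sup>2)
          + \<eta> * ((Q - 1) * ?x\<^sup>2 + (norm ?d)\<^sup>2 / 2 + ?p\<^sup>2 / 2)"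
        using inner unfolding q_def by linarith
      also have "\<dots> = (\<eta> * Q - \<mu>) * ?x\<^sup>2 + (\<eta> / 2 - \<alpha>) * (norm ?d)\<^sup>2 - \<eta> / 2 * ?p\<^sup>2"
        by (simp add: algebra_simps)
      also have "\<dots> \<le> - (\<mu> / 2) * ?x\<^sup>2 + 0 - \<eta> / 2 * ?p\<^sup>2"
      proof (intro add_mono diff_mono order_refl)
        show "(\<eta> * Q - \<mu>) * ?x\<^sup>2 \<le> - (\<mu> / 2) * ?x\<^sup>2" using \<eta>(2) by (intro mult_right_mono) auto
        show "(\<eta> / 2 - \<alpha>) * (norm ?d)\<^sup>2 \<le> 0" using \<eta>(3) by (intro mult_nonpos_nonneg) auto
      qed
      also have "\<dots> \<le> - min (\<mu> / 2) (\<eta> / 2) * (?x\<^sup>2 + ?p\<^sup>2)"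
      proof -
        have "min (\<mu> / 2) (\<eta> / 2) * ?x\<^sup>2 \<le> \<mu> / 2 * ?x\<^sup>2" "min (\<mu> / 2) (\<eta> / 2) * ?p\<^sup>2 \<le> \<eta> / 2 * ?p\<^sup>2"
          by (intro mult_right_mono; simp)+
        then show ?thesis by (simp only: distrib_left minus_mult_left[symmetric])
      qed
      also have "?x\<^sup>2 + ?p\<^sup>2 = (norm ?e)\<^sup>2" by (simp add: norm_prod_def real_sqrt_pow2)
      finally show ?thesis .
    qed
    show "min (\<mu> / 2) (\<eta> / 2) > 0" using \<mu> \<eta> by simp
    show "restrict_opt tf (js x) = js x" by (rule js_in)
    show "js x = ?R (opJ_inv tf A (js x)) + iota3 x" by (rule js_eq)
    show "norm (out v - out w) \<le> a / \<alpha> * norm (v - w)"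
    proof -
      have "norm (out v - out w) \<le> norm ((1 / \<alpha>) *\<^sub>R (transpose Bp *v snd (snd (v - w))))"
        unfolding out_def by (rule order_trans[OF box_proj_lip]) (simp add: matrix_vector_mult_diff_distrib scaleR_diff_right)
      also have "\<dots> = norm (transpose Bp *v snd (snd (v - w))) / \<alpha>" using \<alpha> by simp
      also have "\<dots> \<le> a * norm (snd (snd (v - w))) / \<alpha>" using \<alpha> by (intro divide_right_mono a) auto
      also have "\<dots> \<le> a * norm (v - w) / \<alpha>"
        using \<alpha> by (intro divide_right_mono mult_left_mono norm_snd2 a) auto
      finally show ?thesis by simp
    qed
    show "a / \<alpha> \<ge> 0" "2 * L + r / \<alpha> * p \<ge> 0" using a r p \<alpha> L by simp_all
    show "bounded_linear ((*v) Bp)" by (rule matrix_vector_mul_bounded_linear)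
  qed
  then show thesis by (rule that)
qed

end

section \<open>The plant-optimizer system\<close>

lemma locally_lipschitz_on_compact:
  fixes f :: "'a::metric_space \<Rightarrow> 'b::metric_space"
  assumes f: "locally_lipschitz f" and S: "compact S"
  obtains K where "K-lipschitz_on S f"
proof -
  have ll: "local_lipschitz {0::real} S (\<lambda>_. f)"
  proof (rule local_lipschitzI)
    fix x
    obtain r K where "r > 0" "K-lipschitz_on (cball x r) f" using f unfolding locally_lipschitz_def by blast
    then show "\<exists>u>0. \<exists>L. \<forall>t\<in>cball t u \<inter> {0}. L-lipschitz_on (cball x u \<inter> S) f" for t :: real
      by (intro exI[of _ r] conjI exI[of _ K] ballI) (auto intro: lipschitz_on_subset)
  qed
  obtain K where "\<And>t. t \<in> {0::real} \<Longrightarrow> K-lipschitz_on S f"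
    by (rule local_lipschitz_compact_implies_lipschitz[OF ll S, of thesis]) auto
  then show thesis by (intro that[of K]) simp
qed

lemma lipschitz_on_cball_trunc:
  fixes f :: "'a::euclidean_space \<Rightarrow> 'b::metric_space"
  assumes f: "K-lipschitz_on (cball 0 \<rho>) f" and \<rho>: "\<rho> \<ge> 0"
  shows "K-lipschitz_on UNIV (\<lambda>x. f (closest_point (cball 0 \<rho>) x))"
proof -
  have "1-lipschitz_on UNIV (closest_point (cball (0::'a) \<rho>))"
    using closest_point_lipschitz[of "cball (0::'a) \<rho>"] \<rho> by (intro lipschitz_onI) auto
  moreover have "K-lipschitz_on (closest_point (cball 0 \<rho>) ` UNIV) f"
    by (rule lipschitz_on_subset[OF f]) (use closest_point_in_set[of "cball (0::'a) \<rho>"] \<rho> in auto)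
  ultimately show ?thesis using lipschitz_on_compose2 by fastforce
qed

text \<open>An integral curve of the truncated field starting at \<open>0\<close> stays in \<open>{V \<le> 0} = {0}\<close>.\<close>

lemma equilibrium_of_lyapunov:
  fixes F g :: "'a::euclidean_space \<Rightarrow> 'a" and V :: "'a \<Rightarrow> real"
  assumes F: "K-lipschitz_on (cball 0 \<rho>) F" and \<rho>: "\<rho> > 0"
    and V: "\<And>x. norm x < \<rho> \<Longrightarrow> (V has_derivative (\<lambda>k. g x \<bullet> k)) (at x)"
    and decr: "\<And>x. norm x < \<rho> \<Longrightarrow> g x \<bullet> F x \<le> 0"
    and V0: "V 0 = 0" and pos: "\<And>x. norm x < \<rho> \<Longrightarrow> x \<noteq> 0 \<Longrightarrow> V x > 0"
  shows "F 0 = 0"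
proof -
  define G where "G x = F (closest_point (cball 0 \<rho>) x)" for x
  have lip: "K-lipschitz_on UNIV G" unfolding G_def using F \<rho> by (intro lipschitz_on_cball_trunc) auto
  have GF: "G x = F x" if "norm x < \<rho>" for x
    unfolding G_def using that by (subst closest_point_self) auto
  have Gc: "continuous_on S (\<lambda>s. G (u s))" if "continuous_on S u" for S and u :: "real \<Rightarrow> 'a"
    using continuous_on_compose2[OF lipschitz_on_continuous_on[OF lip] that] by simp
  have "\<exists>u :: real \<Rightarrow> 'a. continuous_on {0..} u \<and> (\<forall>t\<ge>0. integral {0..t} (\<lambda>s. G (u s)) = u t)"
  proof (rule volterra_fixed_point[of "\<lambda>u t. integral {0..t} (\<lambda>s. G (u s))" K])
    show "K \<ge> 0" using lip by (rule lipschitz_on_nonneg)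
    show "continuous_on {0..} (\<lambda>t. integral {0..t} (\<lambda>s. G (u s)))" if u: "continuous_on {0..} u" for u :: "real \<Rightarrow> 'a"
    proof (rule continuous_on_atLeast)
      fix b :: real
      show "continuous_on {0..b} (\<lambda>t. integral {0..t} (\<lambda>s. G (u s)))"
        by (intro indefinite_integral_continuous_1 integrable_continuous_interval Gc continuous_on_subset[OF u]) auto
    qed
    fix u v :: "real \<Rightarrow> 'a" and t :: real
    assume uv: "continuous_on {0..} u" "continuous_on {0..} v" "t \<ge> 0"
    have c: "continuous_on {0..t} u" "continuous_on {0..t} v" by (auto intro: continuous_on_subset[OF uv(1)] continuous_on_subset[OF uv(2)])
    have "norm (integral {0..t} (\<lambda>s. G (u s)) - integral {0..t} (\<lambda>s. G (v s)))
        = norm (integral {0..t} (\<lambda>s. G (u s) - G (v s)))"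
      by (subst integral_diff) (auto intro!: integrable_continuous_interval Gc c)
    also have "\<dots> \<le> integral {0..t} (\<lambda>s. K * norm (u s - v s))"
      by (rule integral_norm_bound_integral)
        (use lipschitz_onD[OF lip] in \<open>auto simp: dist_norm intro!: integrable_continuous_interval continuous_intros Gc c\<close>)
    finally show "norm (integral {0..t} (\<lambda>s. G (u s)) - integral {0..t} (\<lambda>s. G (v s)))
        \<le> K * integral {0..t} (\<lambda>s. norm (u s - v s))" by simp
  next
    fix u :: "real \<Rightarrow> 'a" assume u1: "continuous_on {0..} u" and u2: "\<And>t. 0 \<le> t \<Longrightarrow> integral {0..t} (\<lambda>s. G (u s)) = u t"
    show "\<exists>u :: real \<Rightarrow> 'a. continuous_on {0..} u \<and> (\<forall>t\<ge>0. integral {0..t} (\<lambda>s. G (u s)) = u t)"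
      by (intro exI[of _ u] conjI allI impI u1 u2)
  qed
  then obtain u :: "real \<Rightarrow> 'a"
    where u': "continuous_on {0..} u \<and> (\<forall>t\<ge>0. integral {0..t} (\<lambda>s. G (u s)) = u t)" ..
  have uc: "continuous_on {0..} u" by (rule conjunct1[OF u'])
  have u: "integral {0..t} (\<lambda>s. G (u s)) = u t" if "t \<ge> 0" for t using conjunct2[OF u'] that by simp
  have u0: "u 0 = 0" using u[of 0] by simp
  have "((\<lambda>t. norm (u t)) \<longlongrightarrow> norm (u 0)) (at 0 within {0..})"
    using uc by (intro tendsto_norm) (auto simp: continuous_on)
  then have "\<forall>\<^sub>F t in at 0 within {0..}. norm (u t) < \<rho>"
    using \<rho> u0 by (intro order_tendstoD(2)) auto
  then obtain d where d: "d > 0" "\<And>t. t \<ge> 0 \<Longrightarrow> t \<noteq> 0 \<Longrightarrow> dist t 0 < d \<Longrightarrow> norm (u t) < \<rho>"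
    unfolding eventually_at by auto
  define \<tau> where "\<tau> = d / 2"
  have \<tau>: "\<tau> > 0" using d by (simp add: \<tau>_def)
  have small: "norm (u t) < \<rho>" if "t \<in> {0..\<tau>}" for t
    using that d u0 \<rho> by (cases "t = 0") (auto simp: \<tau>_def)
  have uc': "continuous_on {0..t} u" for t by (rule continuous_on_subset[OF uc]) auto
  have zero: "u t = 0" if t: "t \<in> {0..\<tau>}" for t
  proof (rule ccontr)
    assume "u t \<noteq> 0"
    then have "V (u t) > 0" using small[OF t] by (intro pos)
    moreover have "V (u t) \<le> V (u 0)"
    proof (rule DERIV_nonpos_imp_decreasing_open[of 0 t])
      show "0 \<le> t" using t by simp
      have "continuous_on (ball 0 \<rho>) V"
        by (rule continuous_at_imp_continuous_on) (auto intro: has_derivative_continuous[OF V])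
      then show "continuous_on {0..t} (\<lambda>t. V (u t))"
        by (rule continuous_on_compose2[OF _ uc']) (use small t in auto)
      fix s assume s: "0 < s" "s < t"
      have "((\<lambda>t. integral {0..t} (\<lambda>s. G (u s))) has_vector_derivative G (u s)) (at s within {0..t})"
        using s by (intro integral_has_vector_derivative Gc uc') auto
      then have "(u has_vector_derivative G (u s)) (at s within {0..t})"
        by (rule has_vector_derivative_transform[rotated 2]) (use s u in auto)
      then have "(u has_vector_derivative G (u s)) (at s)"
        using at_within_interior[of s "{0..t}"] s by simp
      then have "(u has_derivative (\<lambda>h. h *\<^sub>R G (u s))) (at s)" by (simp add: has_vector_derivative_def)
      from has_derivative_compose[OF this V[of "u s"]]
      have "((\<lambda>t. V (u t)) has_derivative (\<lambda>h. g (u s) \<bullet> (h *\<^sub>R G (u s)))) (at s)"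
        using small[of s] s t by simp
      then have "((\<lambda>t. V (u t)) has_real_derivative g (u s) \<bullet> F (u s)) (at s)"
        using GF[of "u s"] small[of s] s t
        by (simp add: has_field_derivative_def mult.commute[of _ "g (u s) \<bullet> F (u s)"])
      moreover have "g (u s) \<bullet> F (u s) \<le> 0" using small[of s] s t by (intro decr) auto
      ultimately show "\<exists>y. ((\<lambda>t. V (u t)) has_real_derivative y) (at s) \<and> y \<le> 0" by blast
    qed
    ultimately show False using u0 V0 by simp
  qed
  \<comment> \<open>The curve being constantly zero on \<open>{0..\<tau>}\<close>, its integral
    equation reads \<open>\<tau> *\<^sub>R F 0 = 0\<close>.\<close>
  have "integral {0..\<tau>} (\<lambda>s. G (u s)) = integral {0..\<tau>} (\<lambda>s. F 0)"
    by (rule integral_cong) (use zero GF[of 0] \<rho> in auto)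
  then have "\<tau> *\<^sub>R F 0 = 0" using u[of \<tau>] zero[of \<tau>] \<tau> by simp
  then show ?thesis using \<tau> by simp
qed

section \<open>Local stability by truncation of the plant field\<close>

context fast_slow
begin

lemma mild_cong:
  assumes \<epsilon>: "\<epsilon> > 0" and z: "mild \<epsilon> f I z0 z" and I: "\<And>t. t \<in> I \<Longrightarrow> {0..t} \<subseteq> I"
    and eq: "\<And>t. t \<in> I \<Longrightarrow> f (fst (z t)) = f' (fst (z t))"
  shows "mild \<epsilon> f' I z0 z"
proof -
  interpret SP: contraction_semigroup Psp "Tsp \<epsilon>" by (rule contraction_semigroup_Tsp[OF \<epsilon>])
  have fsp: "fsp f \<epsilon> (z s) = fsp f' \<epsilon> (z s)" if "s \<in> I" for s
    using eq[OF that] by (simp add: fsp_def case_prod_beta)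
  have "((\<lambda>s. Tsp \<epsilon> (t - s) (fsp f' \<epsilon> (z s))) has_integral (z t - Tsp \<epsilon> t z0)) {0..t}" if t: "t \<in> I" for t
  proof (rule has_integral_eq)
    show "((\<lambda>s. Tsp \<epsilon> (t - s) (fsp f \<epsilon> (z s))) has_integral (z t - Tsp \<epsilon> t z0)) {0..t}"
      using z t unfolding SP.mild_on_def by blast
  qed (use I[OF t] fsp in auto)
  then show ?thesis using z unfolding SP.mild_on_def by blast
qed

lemma mild_atLeast_lessThan: "\<epsilon> > 0 \<Longrightarrow> mild \<epsilon> f {0..} z0 z \<Longrightarrow> mild \<epsilon> f {0..<\<tau>} z0 z"
  by (erule mild_subset) auto

text \<open>Truncation to the ball of radius \<open>\<rho>\<close> makes the plant field globally
  Lipschitz, so a global solution exists. Stability keeps its plant component inside the ball, where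
  the fields coincide; it thus solves the original system, and uniqueness is proved for the original
  field directly.\<close>

lemma local_stability:
  assumes lyap: "plant_lyapunov (ereal \<rho>) f V g r1 rp c \<zeta> LF" and \<epsilon>: "0 < \<epsilon>" "\<epsilon> < eps_bound c \<zeta> LF"
    and \<rho>: "\<rho> > 0" and f: "\<And>r. \<exists>K. K-lipschitz_on (cball 0 r) f"
  obtains d where "d > 0" "\<And>z0. Psp z0 = z0 \<Longrightarrow> norm z0 < d \<Longrightarrow>
      \<exists>z. mild \<epsilon> f {0..} z0 z \<and> bounded (z ` {0..}) \<and> (z \<longlongrightarrow> 0) at_top \<and>
        (\<forall>z'. mild \<epsilon> f {0..} z0 z' \<longrightarrow> (\<forall>t\<ge>0. z' t = z t))"
proof -
  obtain K where K: "K-lipschitz_on (cball 0 \<rho>) f" using f by blast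
  define f' where "f' x = f (closest_point (cball 0 \<rho>) x)" for x
  have f'f: "f' x = f x" if "norm x < \<rho>" for x
    unfolding f'_def using that by (subst closest_point_self) auto
  have lip: "K-lipschitz_on UNIV f'" unfolding f'_def using K \<rho> by (intro lipschitz_on_cball_trunc) auto
  have lyap': "plant_lyapunov (ereal \<rho>) f' V g r1 rp c \<zeta> LF"
    using lyap lipschitz_on_continuous_on[OF lip] f'f unfolding plant_lyapunov_def by simp
  have \<rho>': "ereal \<rho> > 0" using \<rho> by simp
  obtain d where d: "d > 0" "\<And>z0 \<tau> z t. Psp z0 = z0 \<Longrightarrow> norm z0 < d \<Longrightarrow> mild \<epsilon> f' {0..<\<tau>} z0 z \<Longrightarrow>
      t \<in> {0..<\<tau>} \<Longrightarrow> norm (z t) < 1 \<and> ereal (norm (fst (z t))) < ereal \<rho>"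
    by (rule stable[OF lyap' \<epsilon> \<rho>' zero_less_one]) (rule that)
  show thesis
  proof (rule that[OF d(1)])
    fix z0 assume z0: "Psp z0 = z0" "norm z0 < d"
    obtain z where z: "mild \<epsilon> f' {0..} z0 z" by (rule mild_exists[OF \<epsilon>(1) lip])
    have b: "norm (z t) < 1 \<and> ereal (norm (fst (z t))) < ereal \<rho>" if "t \<ge> 0" for t
      by (rule d(2)[OF z0 mild_atLeast_lessThan[OF \<epsilon>(1) z, of "t + 1"]]) (use that in auto)
    have zf: "mild \<epsilon> f {0..} z0 z"
      by (rule mild_cong[OF \<epsilon>(1) z]) (use b f'f in auto)
    have "(z \<longlongrightarrow> 0) at_top" by (rule convergent[OF lyap' \<epsilon> \<rho>' z]) (use b in auto)
    moreover have "bounded (z ` {0..})"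
      unfolding bounded_iff using b by (intro exI[of _ 1]) (auto intro: less_imp_le)
    ultimately show "\<exists>z. mild \<epsilon> f {0..} z0 z \<and> bounded (z ` {0..}) \<and> (z \<longlongrightarrow> 0) at_top \<and>
        (\<forall>z'. mild \<epsilon> f {0..} z0 z' \<longrightarrow> (\<forall>t\<ge>0. z' t = z t))"
      using zf mild_unique[OF \<epsilon>(1) f _ zf] by blast
  qed
qed

end

lemma stabilizing_controllerE:
  fixes Bp :: "real^'m^'n"
  assumes "stabilizing_controller f Bp \<kappa> \<delta> r1"
  obtains V g rp c \<zeta> where "c > 0" "\<zeta> > 0" "V 0 = 0" "r1 0 = 0" "strict_mono_on {s. 0 \<le> s \<and> ereal s < \<delta>} r1"
    "\<And>x. ereal (norm x) < \<delta> \<Longrightarrow> (V has_derivative (\<lambda>k. g x \<bullet> k)) (at x)"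
    "\<And>x. ereal (norm x) < \<delta> \<Longrightarrow> r1 (norm x) \<le> V x"
    "\<And>x :: real^'n. ereal (norm x) < \<delta> \<Longrightarrow> c * (norm x)\<^sup>2 \<le> rp (norm x)"
    "\<And>x. ereal (norm x) < \<delta> \<Longrightarrow> g x \<bullet> (f x + Bp *v \<kappa> x) \<le> - rp (norm x)"
    "\<And>x y. ereal (norm x) < \<delta> \<Longrightarrow> \<bar>g x \<bullet> (Bp *v y)\<bar> \<le> sqrt (\<zeta> * rp (norm x)) * norm y"
proof -
  obtain V g rp c \<zeta> where sc: "class_K \<delta> r1" "c > 0" "\<zeta> > 0" "V 0 = 0"
    "\<forall>s\<ge>0. ereal s < \<delta> \<longrightarrow> rp s \<ge> c * s\<^sup>2" "\<forall>x\<in>eball0 \<delta>. GDERIV V x :> g x"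
    "\<forall>x\<in>eball0 \<delta>. V x \<ge> r1 (norm x) \<and> g x \<bullet> (f x + Bp *v \<kappa> x) \<le> - rp (norm x) \<and>
       (norm (transpose Bp *v g x))\<^sup>2 \<le> \<zeta> * rp (norm x)"
    using assms unfolding stabilizing_controller_def by blast
  have eball0: "x \<in> eball0 \<delta>" if "ereal (norm x) < \<delta>" for x :: "real^'n" using that by (simp add: eball0_def)
  show thesis
  proof (rule that[where c = c and \<zeta> = \<zeta> and V = V and g = g and rp = rp])
    show "r1 0 = 0" "strict_mono_on {s. 0 \<le> s \<and> ereal s < \<delta>} r1" using sc(1) by (auto simp: class_K_def)
    fix x :: "real^'n" assume x: "ereal (norm x) < \<delta>"
    show "(V has_derivative (\<lambda>k. g x \<bullet> k)) (at x)"
      using sc(6) eball0[OF x] by (simp add: gderiv_def inner_commute)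
    show "c * (norm x)\<^sup>2 \<le> rp (norm x)" using sc(5) x by simp
    show "r1 (norm x) \<le> V x" "g x \<bullet> (f x + Bp *v \<kappa> x) \<le> - rp (norm x)" using sc(7) eball0[OF x] by blast+
    show "\<bar>g x \<bullet> (Bp *v y)\<bar> \<le> sqrt (\<zeta> * rp (norm x)) * norm y" for y
    proof -
      have "\<bar>g x \<bullet> (Bp *v y)\<bar> = \<bar>y \<bullet> (transpose Bp *v g x)\<bar>"
        using matrix_vector_inner_transpose[of Bp y "g x"] by (simp only: inner_commute[of "g x"])
      also have "\<dots> \<le> norm y * norm (transpose Bp *v g x)" by (rule Cauchy_Schwarz_ineq2)
      also have "\<dots> \<le> norm y * sqrt (\<zeta> * rp (norm x))"
        using sc(7) eball0[OF x] by (intro mult_left_mono real_le_rsqrt) auto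
      finally show ?thesis by (simp only: mult.commute)
    qed
  qed (use sc in auto)
qed

theorem theorem5p4:
  fixes tf \<alpha> \<mu> L :: real
    and A :: "real^'n^'n" and Bp :: "real^'m^'n"
    and lo hi :: "real^'m"
    and Hp :: "real^'n \<Rightarrow> real" and gradHp Jp Rp fp :: "real^'n \<Rightarrow> real^'n"
    and l :: "real^'n \<Rightarrow> real" and gradJ :: "(real^'n) L2 \<Rightarrow> (real^'n) L2"
    and \<kappa> :: "real^'n \<Rightarrow> real^'m"
    and \<delta> :: ereal
  assumes tf: "tf > 0"
    (* plant *)
    and Hp_grad: "\<And>x. GDERIV Hp x :> gradHp x"
    and Hp_convex: "strongly_convex Hp"
    and Jp_skew: "\<And>z. Jp z \<bullet> z = 0"
    and Rp_cont: "continuous_on UNIV Rp"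
    and Rp_diss: "\<And>z. Rp z \<bullet> z \<ge> 0"
    and fp: "fp = (\<lambda>x. Jp (gradHp x) - Rp (gradHp x))"
    and lip: "locally_lipschitz Jp" "locally_lipschitz Rp" "locally_lipschitz gradHp"
    (* optimal control problem *)
    and \<alpha>: "\<alpha> > 0"
    and box: "\<And>i. lo $ i < 0 \<and> 0 < hi $ i"
    and l_cont: "continuous_on UNIV l"
    and l_convex: "convex_on UNIV l"
    and l_nonneg: "\<And>x. l x \<ge> 0"
    and l_zero: "l 0 = 0"
    and J_finite: "\<And>x. x \<in> L2_on tf \<Longrightarrow> set_integrable lborel {0..tf} (\<lambda>t. l (L2_fun x t))"
    and gradJ_in: "\<And>x. x \<in> L2_on tf \<Longrightarrow> gradJ x \<in> L2_on tf"
    and J_grad: "\<And>x. x \<in> L2_on tf \<Longrightarrow>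
          (running_cost tf l has_derivative (\<lambda>h. gradJ x \<bullet> h)) (at x within L2_on tf)"
    and \<mu>L: "\<mu> > 0" "L > 0"
    and J_lower: "\<And>x y. x \<in> L2_on tf \<Longrightarrow> y \<in> L2_on tf \<Longrightarrow>
          \<mu> * (norm (x - y))\<^sup>2 \<le> (gradJ x - gradJ y) \<bullet> (x - y)"
    and J_upper: "\<And>x y. x \<in> L2_on tf \<Longrightarrow> y \<in> L2_on tf \<Longrightarrow>
          (gradJ x - gradJ y) \<bullet> (x - y) \<le> L * (norm (x - y))\<^sup>2"
    (* feedback and assumption (SC) *)
    and \<kappa>: "\<kappa> = ocp_feedback tf A Bp l \<alpha> lo hi"
    and \<kappa>_lip: "locally_lipschitz \<kappa>"
    and \<delta>: "\<delta> > 0"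
    and SC: "\<exists>r1. stabilizing_controller fp Bp \<kappa> \<delta> r1"
  shows "\<exists>\<epsilon>star>0.
     (\<forall>\<epsilon>. 0 < \<epsilon> \<and> \<epsilon> < \<epsilon>star \<longrightarrow>
        (\<exists>\<delta>'>0. \<forall>z0\<in>sp_carrier tf. norm z0 < \<delta>' \<longrightarrow>
           (\<exists>z. mild_solution (sp_carrier tf) (sp_generator tf A \<epsilon>)
                   (sp_nonlinearity tf fp Bp \<alpha> lo hi gradJ \<epsilon>) {0..} z0 z \<and>
                bounded (z ` {0..}) \<and>
                (\<forall>z'. mild_solution (sp_carrier tf) (sp_generator tf A \<epsilon>)
                        (sp_nonlinearity tf fp Bp \<alpha> lo hi gradJ \<epsilon>) {0..} z0 z' \<and>
                      bounded (z' ` {0..}) \<longrightarrow> (\<forall>t\<ge>0. z' t = z t)) \<and>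
                (z \<longlongrightarrow> 0) at_top)) \<and>
        locally_asymptotically_stable (sp_carrier tf) (sp_generator tf A \<epsilon>)
          (sp_nonlinearity tf fp Bp \<alpha> lo hi gradJ \<epsilon>)) \<and>
     ((\<exists>C. C-lipschitz_on UNIV fp) \<and>
      (\<exists>r1. stabilizing_controller fp Bp \<kappa> \<infinity> r1 \<and> class_K_inf r1) \<longrightarrow>
        (\<forall>\<epsilon>. 0 < \<epsilon> \<and> \<epsilon> < \<epsilon>star \<longrightarrow>
           globally_asymptotically_stable (sp_carrier tf) (sp_generator tf A \<epsilon>)
             (sp_nonlinearity tf fp Bp \<alpha> lo hi gradJ \<epsilon>)))"
proof -
  interpret ocp_problem tf \<alpha> \<mu> L A Bp lo hi l gradJ
    by unfold_locales (fact assms)+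
  obtain b q c0 LR Cq Lh where fs: "fast_slow (restrict_opt tf) (opJ_inv tf A) (opR tf Bp \<alpha> lo hi gradJ)
      iota3 b q js out ((*v) Bp) c0 LR Cq Lh" by (rule fast_slow_ocp)
  interpret fs: fast_slow "restrict_opt tf" "opJ_inv tf A" "opR tf Bp \<alpha> lo hi gradJ" iota3 b q js out "(*v) Bp" c0 LR Cq Lh
    by (rule fs)
  let ?V = "sp_carrier tf :: 'n sp_space set" and ?G = "sp_generator tf A" and ?N = "sp_nonlinearity tf fp Bp \<alpha> lo hi gradJ"
  define F where "F x = fp x + Bp *v \<kappa> x" for x
  have \<kappa>_eq: "\<kappa> x = out (fs.ws x)" for x
    unfolding \<kappa> fs.ws_def by (rule ocp_feedback_eq)

  have carrier: "z \<in> ?V \<longleftrightarrow> fs.Psp z = z" for z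
    by (cases z rule: prod_cases4) (simp add: fs.Psp_iff sp_carrier_def restrict_opt_iff)
  have nonlin: "?N \<epsilon> = fs.fsp fp \<epsilon>" for \<epsilon>
    by (auto simp: fun_eq_iff sp_nonlinearity_def fs.fsp_def out_def)
  \<comment> \<open>All statements are transferred to the abstract system here: carrier, generator
    and nonlinearity are identified with \<open>range fs.Psp\<close>, the generator of
    \<open>fs.Tsp\<close> and \<open>fs.fsp\<close>.\<close>
  have mild_iff: "mild_solution ?V (?G \<epsilon>) (?N \<epsilon>) I z0 z \<longleftrightarrow> fs.mild \<epsilon> fp I z0 z"
    if \<epsilon>: "\<epsilon> > 0" and z0: "fs.Psp z0 = z0" and I: "\<And>t. t \<in> I \<Longrightarrow> t \<ge> 0 \<and> {0..t} \<subseteq> I" for \<epsilon> I z0 z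
  proof -
    interpret SP: contraction_semigroup fs.Psp "fs.Tsp \<epsilon>" by (rule fs.contraction_semigroup_Tsp[OF \<epsilon>])
    have V: "?V = range fs.Psp" using carrier SP.range_iff by blast
    have "?G \<epsilon> = {((x, w), (0, (1 / \<epsilon>) *\<^sub>R v)) | x w v. (w, v) \<in> {(w, opJ tf A w) | w. w \<in> dom_opJ tf}}"
      unfolding sp_generator_def by blast
    also have "\<dots> = generator_on (range fs.Psp) (fs.Tsp \<epsilon>)"
      unfolding opJ_graph[OF tf] fs.generator_Tsp[OF \<epsilon>] by blast
    finally have G: "?G \<epsilon> = generator_on (range fs.Psp) (fs.Tsp \<epsilon>)" .
    show ?thesis
      unfolding V G nonlin
      by (rule SP.mild_solution_iff_mild_on[OF refl fs.dense_generator_Tsp[OF \<epsilon>] fs.fsp_range z0 I])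
  qed
  have mild_atLeast: "mild_solution ?V (?G \<epsilon>) (?N \<epsilon>) {0..} z0 z \<longleftrightarrow> fs.mild \<epsilon> fp {0..} z0 z"
    if "\<epsilon> > 0" "fs.Psp z0 = z0" for \<epsilon> z0 z
    by (rule mild_iff[OF that]) auto

  have fp_lip: "\<exists>K. K-lipschitz_on (cball 0 r) fp" for r
  proof -
    obtain Kg where Kg: "Kg-lipschitz_on (cball 0 r) gradHp" by (rule locally_lipschitz_on_compact[OF lip(3) compact_cball])
    have cpt: "compact (gradHp ` cball 0 r)"
      by (intro compact_continuous_image lipschitz_on_continuous_on[OF Kg] compact_cball)
    obtain KJ where KJ: "KJ-lipschitz_on (gradHp ` cball 0 r) Jp" by (rule locally_lipschitz_on_compact[OF lip(1) cpt])
    obtain KR where KR: "KR-lipschitz_on (gradHp ` cball 0 r) Rp" by (rule locally_lipschitz_on_compact[OF lip(2) cpt])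
    show ?thesis unfolding fp
      using lipschitz_on_diff[OF lipschitz_on_compose2[OF Kg KJ] lipschitz_on_compose2[OF Kg KR]] by blast
  qed
  have fp_cont: "continuous_on UNIV fp"
  proof (rule continuous_at_imp_continuous_on, rule ballI)
    fix x :: "real^'n"
    obtain K where "K-lipschitz_on (cball 0 (norm x + 1)) fp" using fp_lip by blast
    then have "continuous_on (ball 0 (norm x + 1)) fp"
      by (rule continuous_on_subset[OF lipschitz_on_continuous_on]) auto
    then show "isCont fp x" by (simp add: continuous_on_eq_continuous_at)
  qed
  \<comment> \<open>As \<open>out\<close> composed with the stationary map, the feedback has an
    explicit global Lipschitz constant; it serves both the local and the global case.\<close>
  have \<kappa>_bound: "norm (\<kappa> x - \<kappa> y) \<le> Lh * fs.\<l> * norm (x - y)" for x y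
  proof -
    have "norm (\<kappa> x - \<kappa> y) \<le> Lh * norm (fs.ws x - fs.ws y)" unfolding \<kappa>_eq by (rule fs.out_lip)
    also have "\<dots> \<le> Lh * (fs.\<l> * norm (x - y))" by (intro mult_left_mono fs.ws_lip fs.Lh)
    finally show ?thesis by (simp only: mult.assoc)
  qed
  have F_lip: "(K + fs.nB * (Lh * fs.\<l>))-lipschitz_on S F" if K: "K-lipschitz_on S fp" for K S
  proof -
    have "(Lh * fs.\<l>)-lipschitz_on S \<kappa>"
      by (rule lipschitz_onI) (use \<kappa>_bound fs.Lh fs.\<l>_nonneg in \<open>auto simp: dist_norm\<close>)
    moreover have "fs.nB-lipschitz_on (\<kappa> ` S) ((*v) Bp)"
      using fs.nB by (intro lipschitz_onI) (auto simp: dist_norm mult.commute[of fs.nB] simp flip: matrix_vector_mult_diff_distrib)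
    ultimately have "(fs.nB * (Lh * fs.\<l>))-lipschitz_on S (\<lambda>x. Bp *v \<kappa> x)" by (rule lipschitz_on_compose2)
    from lipschitz_on_add[OF K this] show ?thesis unfolding F_def .
  qed

  have plant: "\<exists>V g rp c \<zeta>. fs.plant_lyapunov \<rho> fp V g r1 rp c \<zeta> LF"
    if sc: "stabilizing_controller fp Bp \<kappa> \<delta> r1" and \<rho>: "0 < \<rho>" "\<rho> \<le> \<delta>" and K: "LF-lipschitz_on {x. ereal (norm x) < \<rho>} F"
    for \<rho> \<delta> :: ereal and r1 LF
  proof -
    obtain V g rp c \<zeta> where V: "c > 0" "\<zeta> > 0" "V 0 = 0" "r1 0 = 0" "strict_mono_on {s. 0 \<le> s \<and> ereal s < \<delta>} r1"
      "\<And>x. ereal (norm x) < \<delta> \<Longrightarrow> (V has_derivative (\<lambda>k. g x \<bullet> k)) (at x)"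
      "\<And>x. ereal (norm x) < \<delta> \<Longrightarrow> r1 (norm x) \<le> V x"
      "\<And>x :: real^'n. ereal (norm x) < \<delta> \<Longrightarrow> c * (norm x)\<^sup>2 \<le> rp (norm x)"
      "\<And>x. ereal (norm x) < \<delta> \<Longrightarrow> g x \<bullet> (fp x + Bp *v \<kappa> x) \<le> - rp (norm x)"
      "\<And>x y. ereal (norm x) < \<delta> \<Longrightarrow> \<bar>g x \<bullet> (Bp *v y)\<bar> \<le> sqrt (\<zeta> * rp (norm x)) * norm y"
      by (rule stabilizing_controllerE[OF sc]) (rule that)
    have in\<delta>: "ereal (norm x) < \<delta>" if "ereal (norm x) < \<rho>" for x :: "real^'n"
      using that \<rho>(2) by (rule less_le_trans)
    \<comment> \<open>A finite radius, also for infinite \<open>\<delta>\<close>, gives a compact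
      ball on which the closed-loop field is Lipschitz.\<close>
    obtain s where s: "0 < ereal s" "ereal s < \<delta>" using ereal_dense2[OF less_le_trans[OF \<rho>]] by blast
    have s\<delta>: "ereal (norm x) < \<delta>" if "norm x < s" for x :: "real^'n"
      using that s(2) by (meson ereal_less_le less_imp_le less_le_trans less_ereal.simps(1) less_trans)
    obtain K' where K': "K'-lipschitz_on (cball 0 s) F" using fp_lip F_lip by blast
    \<comment> \<open>The origin is an equilibrium, so that the Lipschitz constant of
      \<open>F\<close> becomes the linear bound \<open>LF * norm x\<close> required by
      \<open>plant_lyapunov\<close>.\<close>
    have F0: "F 0 = 0"
    proof (rule equilibrium_of_lyapunov[OF K', of V g])
      show "s > 0" using s by simp
      fix x :: "real^'n" assume x: "norm x < s"
      show "(V has_derivative (\<lambda>k. g x \<bullet> k)) (at x)" by (rule V(6)[OF s\<delta>[OF x]])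
      have "0 \<le> c * (norm x)\<^sup>2" using V(1) by simp
      then show "g x \<bullet> F x \<le> 0" using V(8,9)[OF s\<delta>[OF x]] unfolding F_def by linarith
      show "V x > 0" if "x \<noteq> 0"
      proof -
        have "r1 0 < r1 (norm x)"
          using that s\<delta>[OF x] s\<delta>[of 0] s by (intro strict_mono_onD[OF V(5)]) auto
        then show ?thesis using V(4) V(7)[OF s\<delta>[OF x]] by simp
      qed
    qed (rule V(3))
    have "fs.plant_lyapunov \<rho> fp V g r1 rp c \<zeta> LF"
      unfolding fs.plant_lyapunov_def \<kappa>_eq[symmetric]
    proof (intro conjI allI impI)
      show "LF \<ge> 0" using K by (rule lipschitz_on_nonneg)
      show "strict_mono_on {s. 0 \<le> s \<and> ereal s < \<rho>} r1"
        by (rule monotone_on_subset[OF V(5)]) (use \<rho>(2) in auto)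
      fix x :: "real^'n" assume x: "ereal (norm x) < \<rho>"
      show "norm (fp x + Bp *v \<kappa> x) \<le> LF * norm x"
        using lipschitz_onD[OF K, of x 0] x \<rho>(1) F0 by (simp add: dist_norm F_def zero_ereal_def)
    qed (use fp_cont V in\<delta> in auto)
    then show ?thesis by blast
  qed

  have stable: "lyapunov_stable ?V (?G \<epsilon>) (?N \<epsilon>)"
    if lyap: "fs.plant_lyapunov \<rho> fp V g r1 rp c \<zeta> LF" and \<epsilon>: "0 < \<epsilon>" "\<epsilon> < fs.eps_bound c \<zeta> LF" and \<rho>: "\<rho> > 0"
    for \<rho> V g r1 rp c \<zeta> LF \<epsilon>
    unfolding lyapunov_stable_def
  proof (intro allI impI)
    fix \<eta> :: real assume \<eta>: "\<eta> > 0"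
    obtain d where d: "d > 0" "\<And>z0 \<tau> z t. fs.Psp z0 = z0 \<Longrightarrow> norm z0 < d \<Longrightarrow> fs.mild \<epsilon> fp {0..<\<tau>} z0 z \<Longrightarrow>
      t \<in> {0..<\<tau>} \<Longrightarrow> norm (z t) < \<eta> \<and> ereal (norm (fst (z t))) < \<rho>"
      by (rule fs.stable[OF lyap \<epsilon> \<rho> \<eta>]) (rule that)
    show "\<exists>d>0. \<forall>z0\<in>?V. norm z0 < d \<longrightarrow>
        (\<forall>\<tau>>0. \<forall>z. mild_solution ?V (?G \<epsilon>) (?N \<epsilon>) {0..<\<tau>} z0 z \<longrightarrow> (\<forall>t\<in>{0..<\<tau>}. norm (z t) < \<eta>))"
    proof (intro exI[of _ d] conjI d(1) ballI impI allI)
      fix z0 \<tau> z t assume z0: "z0 \<in> ?V" "norm z0 < d" and z: "mild_solution ?V (?G \<epsilon>) (?N \<epsilon>) {0..<\<tau>} z0 z"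
        and t: "t \<in> {0..<\<tau>}"
      have P: "fs.Psp z0 = z0" using z0(1) by (simp only: carrier)
      have "fs.mild \<epsilon> fp {0..<\<tau>} z0 z" using z by (subst (asm) mild_iff[OF \<epsilon>(1) P]) auto
      then show "norm (z t) < \<eta>" using d(2)[OF P z0(2) _ t] by blast
    qed
  qed

  let ?loc = "\<lambda>\<epsilon>. (\<exists>\<delta>'>0. \<forall>z0\<in>?V. norm z0 < \<delta>' \<longrightarrow>
           (\<exists>z. mild_solution ?V (?G \<epsilon>) (?N \<epsilon>) {0..} z0 z \<and>
                bounded (z ` {0..}) \<and>
                (\<forall>z'. mild_solution ?V (?G \<epsilon>) (?N \<epsilon>) {0..} z0 z' \<and>
                      bounded (z' ` {0..}) \<longrightarrow> (\<forall>t\<ge>0. z' t = z t)) \<and>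
                (z \<longlongrightarrow> 0) at_top)) \<and>
        locally_asymptotically_stable ?V (?G \<epsilon>) (?N \<epsilon>)"
  let ?glob = "\<lambda>\<epsilon>. globally_asymptotically_stable ?V (?G \<epsilon>) (?N \<epsilon>)"
  have loc: "\<exists>e>0. \<forall>\<epsilon>. 0 < \<epsilon> \<and> \<epsilon> < e \<longrightarrow> ?loc \<epsilon>"
  proof -
    obtain r1 where r1: "stabilizing_controller fp Bp \<kappa> \<delta> r1" using SC by blast
    \<comment> \<open>Shrinking to a real radius below \<open>\<delta>\<close> gives a compact ball
      on which \<open>F\<close> has one Lipschitz constant, at the price of a radius unrelated to
      the region of attraction.\<close>
    obtain \<rho> where \<rho>: "0 < ereal \<rho>" "ereal \<rho> < \<delta>" using ereal_dense2[OF \<delta>] by blast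
    obtain K where "K-lipschitz_on (cball 0 \<rho>) F" using fp_lip F_lip by blast
    then have K: "K-lipschitz_on {x. ereal (norm x) < ereal \<rho>} F" by (rule lipschitz_on_subset) auto
    obtain V g rp c \<zeta> where lyap: "fs.plant_lyapunov (ereal \<rho>) fp V g r1 rp c \<zeta> K"
      using plant[OF r1 \<rho>(1) less_imp_le[OF \<rho>(2)] K] by blast
    have "?loc \<epsilon>" if \<epsilon>: "0 < \<epsilon>" "\<epsilon> < fs.eps_bound c \<zeta> K" for \<epsilon>
    proof -
      have \<rho>0: "\<rho> > 0" using \<rho> by simp
      obtain d where d: "d > 0" "\<And>z0. fs.Psp z0 = z0 \<Longrightarrow> norm z0 < d \<Longrightarrow>
        \<exists>z. fs.mild \<epsilon> fp {0..} z0 z \<and> bounded (z ` {0..}) \<and> (z \<longlongrightarrow> 0) at_top \<and>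
          (\<forall>z'. fs.mild \<epsilon> fp {0..} z0 z' \<longrightarrow> (\<forall>t\<ge>0. z' t = z t))"
        by (rule fs.local_stability[OF lyap \<epsilon> \<rho>0 fp_lip]) (rule that)
      have sol: "\<exists>z. mild_solution ?V (?G \<epsilon>) (?N \<epsilon>) {0..} z0 z \<and> bounded (z ` {0..}) \<and> (z \<longlongrightarrow> 0) at_top \<and>
          (\<forall>z'. mild_solution ?V (?G \<epsilon>) (?N \<epsilon>) {0..} z0 z' \<longrightarrow> (\<forall>t\<ge>0. z' t = z t))"
        if "z0 \<in> ?V" "norm z0 < d" for z0
        using d(2)[of z0] that mild_atLeast[OF \<epsilon>(1)] by (simp only: carrier)
      \<comment> \<open>Uniqueness passes the convergence of the constructed solution on to every
        mild solution with the same initial value.\<close>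
      have "(z \<longlongrightarrow> 0) at_top" if z0: "z0 \<in> ?V" "norm z0 < d" and z: "mild_solution ?V (?G \<epsilon>) (?N \<epsilon>) {0..} z0 z" for z0 z
      proof -
        obtain y where "(y \<longlongrightarrow> 0) at_top" "\<forall>t\<ge>0. z t = y t" using sol[OF z0] z by blast
        then show ?thesis
          by (elim Lim_transform_eventually) (auto intro: eventually_mono[OF eventually_ge_at_top[of 0]])
      qed
      then have "locally_asymptotically_stable ?V (?G \<epsilon>) (?N \<epsilon>)"
        unfolding locally_asymptotically_stable_def using stable[OF lyap \<epsilon> \<rho>(1)] d(1) by blast
      moreover have "\<exists>\<delta>'>0. \<forall>z0\<in>?V. norm z0 < \<delta>' \<longrightarrow>
           (\<exists>z. mild_solution ?V (?G \<epsilon>) (?N \<epsilon>) {0..} z0 z \<and> bounded (z ` {0..}) \<and>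
                (\<forall>z'. mild_solution ?V (?G \<epsilon>) (?N \<epsilon>) {0..} z0 z' \<and>
                      bounded (z' ` {0..}) \<longrightarrow> (\<forall>t\<ge>0. z' t = z t)) \<and> (z \<longlongrightarrow> 0) at_top)"
        using d(1) sol by blast
      ultimately show ?thesis by blast
    qed
    then show ?thesis using fs.eps_bound_pos by blast
  qed
  have glob: "\<exists>e>0. \<forall>\<epsilon>. 0 < \<epsilon> \<and> \<epsilon> < e \<longrightarrow> ?glob \<epsilon>"
    if C: "C-lipschitz_on UNIV fp" and sc: "stabilizing_controller fp Bp \<kappa> \<infinity> r1" for C r1
  proof -
    have K: "(C + fs.nB * (Lh * fs.\<l>))-lipschitz_on {x. ereal (norm x) < \<infinity>} F" (is "?K-lipschitz_on _ F")
      using F_lip[OF C] by simp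
    obtain V g rp c \<zeta> where lyap: "fs.plant_lyapunov \<infinity> fp V g r1 rp c \<zeta> ?K"
      using plant[OF sc _ order_refl K] by auto
    have "?glob \<epsilon>" if \<epsilon>: "0 < \<epsilon>" "\<epsilon> < fs.eps_bound c \<zeta> ?K" for \<epsilon>
      unfolding globally_asymptotically_stable_def
    proof (intro conjI ballI allI impI)
      show "lyapunov_stable ?V (?G \<epsilon>) (?N \<epsilon>)" by (rule stable[OF lyap \<epsilon>]) simp
      fix z0 assume "z0 \<in> ?V"
      then have P: "fs.Psp z0 = z0" by (simp only: carrier)
      obtain z where "fs.mild \<epsilon> fp {0..} z0 z" by (rule fs.mild_exists[OF \<epsilon>(1) C])
      then show "\<exists>z. mild_solution ?V (?G \<epsilon>) (?N \<epsilon>) {0..} z0 z" using mild_atLeast[OF \<epsilon>(1) P] by blast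
      fix z assume "mild_solution ?V (?G \<epsilon>) (?N \<epsilon>) {0..} z0 z"
      then have "fs.mild \<epsilon> fp {0..} z0 z" using mild_atLeast[OF \<epsilon>(1) P] by blast
      then show "(z \<longlongrightarrow> 0) at_top" by (rule fs.convergent[OF lyap \<epsilon>, rotated]) simp_all
    qed
    then show ?thesis using fs.eps_bound_pos by blast
  qed
  obtain e1 where e1: "e1 > 0" "\<And>\<epsilon>. 0 < \<epsilon> \<Longrightarrow> \<epsilon> < e1 \<Longrightarrow> ?loc \<epsilon>" using loc by blast
  \<comment> \<open>One \<open>\<epsilon>star\<close> has to serve both claims, while the bound for
    the global claim exists only under its additional hypotheses; hence the case distinction and the
    minimum.\<close>
  show ?thesis
  proof (cases "(\<exists>C. C-lipschitz_on UNIV fp) \<and> (\<exists>r1. stabilizing_controller fp Bp \<kappa> \<infinity> r1 \<and> class_K_inf r1)")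
    case True
    then obtain e2 where e2: "e2 > 0" "\<And>\<epsilon>. 0 < \<epsilon> \<Longrightarrow> \<epsilon> < e2 \<Longrightarrow> ?glob \<epsilon>" using glob by blast
    show ?thesis
      by (rule exI[of _ "min e1 e2"]) (use e1 e2 in simp)
  next
    case False
    show ?thesis
    proof (intro exI[of _ e1] conjI)
      show "\<forall>\<epsilon>. 0 < \<epsilon> \<and> \<epsilon> < e1 \<longrightarrow> ?loc \<epsilon>" using e1(2) by blast
    qed (use e1(1) False in blast)+
  qed
qed

end
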